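(* Let $0<p\le 1$, $\alpha>-1$, and $\lambda=\frac{\alpha+n}{p}$. For $f\in A^\infty_{\lambda}(\mathbb B)$ set $$s_1(f)=\mathrm{dist}_{A^\infty_{\lambda}}(f,A^p_\alpha)=\inf_{g\in A^p_\alpha}\|f-g\|_{A^\infty_\lambda},$$ $$s_2(f)=\inf\left\{\epsilon>0:\int_{\mathbb B}\left(\int_{U_{\epsilon,\lambda}(f)}|Q_\beta(x,y)|\,(1-|y|)^{\beta-\lambda}\,dy\right)^p(1-|x|)^\alpha\,dx<\infty\right\}.$$ Then there is a number $m_0$ depending only on $\alpha,p,n$ such that for every real $\beta>m_0$ one has $s_1(f)\asymp s_2(f)$; that is, there is a constant $C\ge 1$, independent of $f$, such that $C^{-1}s_1(f)\le s_2(f)\le C s_1(f)$ for all $f\in A^\infty_\lambda(\mathbb B)$.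
   Context: $\mathbb B$ is the open unit ball of $\mathbb R^n$, $\mathbb S=\partial\mathbb B$, $dx$ is (normalized) Lebesgue measure on $\mathbb B$, and $h(\mathbb B)$ is the space of harmonic functions on $\mathbb B$. For $0<p<\infty$ and $\alpha>-1$, $A^p_\alpha=A^p_\alpha(\mathbb B)$ is the set of $f\in h(\mathbb B)$ with $\|f\|_{A^p_\alpha}^p=\int_{\mathbb B}|f(x)|^p(1-|x|^2)^\alpha\,dx<\infty$. For $\alpha>0$, $A^\infty_\alpha=A^\infty_\alpha(\mathbb B)$ is the set of $f\in h(\mathbb B)$ with $\|f\|_{A^\infty_\alpha}=\sup_{x\in\mathbb B}|f(x)|(1-|x|^2)^\alpha<\infty$. One has $A^p_\alpha\subset A^\infty_{(\alpha+n)/p}$. For $\epsilon>0$, $t>0$ and $f\in h(\mathbb B)$, $U_{\epsilon,t}(f)=\{x\in\mathbb B:|f(x)|(1-|x|)^t\ge\epsilon\}$. Let $Y^{(k)}_j$, $1\le j\le d_k$, be spherical harmonics of order $k$ on $\mathbb S$, chosen so that all $Y^{(k)}_j$ ($k\ge0$, $1\le j\le d_k$) together form an orthonormal basis of $L^2(\mathbb S,dx')$ ($dx'$ is surface measure), and let $Z^{(k)}_{x'}(y')=\sum_{j=1}^{d_k}Y^{(k)}_j(x')\overline{Y^{(k)}_j(y')}$ be the zonal harmonics. The Bergman kernel is $$Q_\beta(x,y)=2\sum_{k=0}^\infty\frac{\Gamma(\beta+1+k+n/2)}{\Gamma(\beta+1)\Gamma(k+n/2)}\,r^k\rho^k Z^{(k)}_{x'}(y'),\qquad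 x=rx',\ y=\rho y'\in\mathbb B,\ r=|x|,\ \rho=|y|,\ x',y'\in\mathbb S.$$ *)

theory Defs
  imports "HOL-Analysis.Analysis"
begin

text \<open>
  The space \<open>\<real>\<^sup>n\<close> is a type \<open>'a\<close> of class \<^class>\<open>euclidean_space\<close> with \<open>n = DIM('a)\<close>, the unit ball
  is \<open>ball 0 1\<close> and the unit sphere is \<open>sphere 0 1\<close>. Functions on the ball or on the sphere are
  total functions whose values elsewhere are never used. Harmonic functions are complex-valued.
\<close>

subsection \<open>Harmonic functions and the spaces \<open>A\<^sup>p\<^sub>\<alpha>\<close>\<close>

text \<open>
  Twice continuously differentiable with vanishing Laplacian: \<open>D1 x\<close> is the derivative of \<open>f\<close> at \<open>x\<close>,
  and \<open>D2 x i j\<close> is the derivative in direction \<open>j\<close> of the \<open>i\<close>-th partial derivative.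
\<close>

definition harmonic_on :: "('a::euclidean_space \<Rightarrow> 'b::real_normed_vector) \<Rightarrow> 'a set \<Rightarrow> bool" where
  "harmonic_on f S \<longleftrightarrow> open S \<and>
     (\<exists>D1 D2. (\<forall>x\<in>S. (f has_derivative D1 x) (at x)) \<and>
        (\<forall>i\<in>Basis. \<forall>x\<in>S. ((\<lambda>y. D1 y i) has_derivative D2 x i) (at x)) \<and>
        (\<forall>i\<in>Basis. \<forall>j\<in>Basis. continuous_on S (\<lambda>x. D2 x i j)) \<and>
        (\<forall>x\<in>S. (\<Sum>i\<in>Basis. D2 x i i) = 0))"

definition ball_measure :: "'a::euclidean_space measure" where
  "ball_measure = uniform_measure lborel (ball 0 1)"

definition A_p :: "real \<Rightarrow> real \<Rightarrow> ('a::euclidean_space \<Rightarrow> complex) set" where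
  "A_p p \<alpha> = {f. harmonic_on f (ball 0 1) \<and>
     (\<integral>\<^sup>+x. ennreal (cmod (f x) powr p * (1 - (norm x)\<^sup>2) powr \<alpha>) \<partial>ball_measure) < \<infinity>}"

definition A_infty_norm :: "real \<Rightarrow> ('a::euclidean_space \<Rightarrow> complex) \<Rightarrow> ennreal" where
  "A_infty_norm \<alpha> f = (SUP x\<in>ball 0 1. ennreal (cmod (f x) * (1 - (norm x)\<^sup>2) powr \<alpha>))"

definition A_infty :: "real \<Rightarrow> ('a::euclidean_space \<Rightarrow> complex) set" where
  "A_infty \<alpha> = {f. harmonic_on f (ball 0 1) \<and> A_infty_norm \<alpha> f < \<infinity>}"

subsection \<open>Spherical harmonics and the Bergman kernel\<close>

text \<open>
  Surface measure on the unit sphere as the cone measure: the measure of a Borel set \<open>A\<close> of unit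
  vectors is \<open>n\<close> times the Lebesgue measure of \<open>{r x | 0 < r < 1, x \<in> A}\<close>, so that
  \<open>dx = r\<^sup>n\<^sup>-\<^sup>1 dr dx'\<close> in polar coordinates. It is not normalized.
\<close>

definition surface_measure :: "'a::euclidean_space measure" where
  "surface_measure = scale_measure (of_nat DIM('a))
     (distr (restrict_space lborel (ball 0 1 - {0})) (restrict_space borel (sphere 0 1)) sgn)"

definition spherical_harmonic :: "nat \<Rightarrow> ('a::euclidean_space \<Rightarrow> complex) \<Rightarrow> bool" where
  "spherical_harmonic k Y \<longleftrightarrow>
     (\<exists>P. polynomial_function P \<and> (\<forall>c x. P (c *\<^sub>R x) = c ^ k *\<^sub>R P x) \<and>
          harmonic_on P UNIV \<and> (\<forall>x\<in>sphere 0 1. Y x = P x))"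

definition square_integrable :: "'b measure \<Rightarrow> ('b \<Rightarrow> complex) \<Rightarrow> bool" where
  "square_integrable M f \<longleftrightarrow> f \<in> borel_measurable M \<and> integrable M (\<lambda>x. (cmod (f x))\<^sup>2)"

text \<open>An orthonormal family in \<open>L\<^sup>2(M)\<close> whose linear span is dense.\<close>

definition orthonormal_basis_L2 :: "'b measure \<Rightarrow> 'i set \<Rightarrow> ('i \<Rightarrow> 'b \<Rightarrow> complex) \<Rightarrow> bool" where
  "orthonormal_basis_L2 M I e \<longleftrightarrow>
     (\<forall>i\<in>I. square_integrable M (e i)) \<and>
     (\<forall>i\<in>I. \<forall>j\<in>I. (LINT x|M. e i x * cnj (e j x)) = (if i = j then 1 else 0)) \<and>
     (\<forall>f. square_integrable M f \<longrightarrow> (\<forall>\<epsilon>>0. \<exists>F c. finite F \<and> F \<subseteq> I \<and>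
        (LINT x|M. (cmod (f x - (\<Sum>i\<in>F. c i * e i x)))\<^sup>2) < \<epsilon>))"

definition spherical_harmonic_basis ::
    "(nat \<Rightarrow> nat) \<Rightarrow> (nat \<Rightarrow> nat \<Rightarrow> 'a::euclidean_space \<Rightarrow> complex) \<Rightarrow> bool" where
  "spherical_harmonic_basis d Y \<longleftrightarrow>
     (\<forall>k. \<forall>j\<in>{1..d k}. spherical_harmonic k (Y k j)) \<and>
     orthonormal_basis_L2 surface_measure (SIGMA k:UNIV. {1..d k}) (\<lambda>(k, j). Y k j)"

definition zonal ::
    "(nat \<Rightarrow> nat) \<Rightarrow> (nat \<Rightarrow> nat \<Rightarrow> 'a \<Rightarrow> complex) \<Rightarrow> nat \<Rightarrow> 'a::euclidean_space \<Rightarrow> 'a \<Rightarrow> complex" where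
  "zonal d Y k x y = (\<Sum>j=1..d k. Y k j x * cnj (Y k j y))"

text \<open>
  A unit vector \<open>x'\<close> with \<open>x = r x'\<close>, where \<open>r = norm x\<close>. It is \<open>sgn x\<close> for \<open>x \<noteq> 0\<close> and an arbitrary
  unit vector for \<open>x = 0\<close>, where \<open>sgn\<close> would leave the sphere.
\<close>

definition direction :: "'a::euclidean_space \<Rightarrow> 'a" where
  "direction x = (SOME u. u \<in> sphere 0 1 \<and> x = norm x *\<^sub>R u)"

definition bergman_kernel ::
    "(nat \<Rightarrow> nat) \<Rightarrow> (nat \<Rightarrow> nat \<Rightarrow> 'a \<Rightarrow> complex) \<Rightarrow> real \<Rightarrow> 'a::euclidean_space \<Rightarrow> 'a \<Rightarrow> complex" where
  "bergman_kernel d Y \<beta> x y = 2 * (\<Sum>k.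
     of_real (Gamma (\<beta> + 1 + real k + real DIM('a) / 2) /
              (Gamma (\<beta> + 1) * Gamma (real k + real DIM('a) / 2)) *
              norm x ^ k * norm y ^ k) *
     zonal d Y k (direction x) (direction y))"

subsection \<open>The two distance quantities\<close>

definition U_set :: "real \<Rightarrow> real \<Rightarrow> ('a::euclidean_space \<Rightarrow> complex) \<Rightarrow> 'a set" where
  "U_set \<epsilon> t f = {x \<in> ball 0 1. cmod (f x) * (1 - norm x) powr t \<ge> \<epsilon>}"

definition ennreal_powr :: "ennreal \<Rightarrow> real \<Rightarrow> ennreal" where
  "ennreal_powr x p = (if x = \<infinity> then \<infinity> else ennreal (enn2real x powr p))"

definition s1 :: "real \<Rightarrow> real \<Rightarrow> real \<Rightarrow> ('a::euclidean_space \<Rightarrow> complex) \<Rightarrow> ennreal" where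
  "s1 lam p \<alpha> f = (INF g\<in>A_p p \<alpha>. A_infty_norm lam (\<lambda>x. f x - g x))"

definition s2 ::
    "(nat \<Rightarrow> nat) \<Rightarrow> (nat \<Rightarrow> nat \<Rightarrow> 'a \<Rightarrow> complex) \<Rightarrow> real \<Rightarrow> real \<Rightarrow> real \<Rightarrow> real \<Rightarrow>
     ('a::euclidean_space \<Rightarrow> complex) \<Rightarrow> ennreal" where
  "s2 d Y \<beta> lam p \<alpha> f = Inf (ennreal ` {\<epsilon>. \<epsilon> > 0 \<and>
     (\<integral>\<^sup>+x. ennreal_powr
        (\<integral>\<^sup>+y\<in>U_set \<epsilon> lam f. ennreal (cmod (bergman_kernel d Y \<beta> x y) * (1 - norm y) powr (\<beta> - lam)) \<partial>ball_measure) p *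
        ennreal ((1 - norm x) powr \<alpha>) \<partial>ball_measure) < \<infinity>})"

end

theory Submission
  imports Defs "HOL-Complex_Analysis.Complex_Analysis"
begin

text \<open>
  One may take \<open>m\<^sub>0 = \<lambda>\<close>. The kernel \<open>Q\<^sub>\<beta>(x, y)\<close> is a fractional radial derivative of order \<open>\<beta> + 1\<close> of the
  Poisson kernel, which extends holomorphically in the radius; Cauchy's inequality for the integer orders
  and a Beta integral for the remaining ones give \<open>|Q\<^sub>\<beta>(x, y)| \<le> C K(x, y)\<^bsup>-(n+\<beta>)\<^esup>\<close> with
  \<open>K(x, y) = |x - y| + (1 - |x|) + (1 - |y|)\<close>. Integration of \<open>f(y) (1 - |y|\<^sup>2)\<^bsup>\<beta>\<^esup>\<close> against \<open>Q\<^sub>\<beta>\<close> reproduces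
  every \<open>f \<in> A\<^bsup>\<infinity>\<^esup>\<^sub>\<lambda>\<close>.

  If \<open>\<epsilon>\<close> is admissible in \<open>s\<^sub>2(f)\<close>, split this integral at \<open>U\<^bsub>\<epsilon>,\<lambda>\<^esub>(f)\<close>. The part over the level set lies in
  \<open>A\<^bsup>p\<^esup>\<^sub>\<alpha>\<close>; the other part is at most a constant times \<open>\<epsilon> \<integral> K(x, y)\<^bsup>-(n+\<beta>)\<^esup> (1 - |y|)\<^bsup>\<beta>-\<lambda>\<^esup> dy\<close>, which is
  of order \<open>\<epsilon> (1 - |x|)\<^bsup>-\<lambda>\<^esup>\<close>.

  Conversely, if \<open>g \<in> A\<^bsup>p\<^esup>\<^sub>\<alpha>\<close> and \<open>\<epsilon> > 2 \<parallel>f - g\<parallel>\<close>, then \<open>|g| (1 - |y|)\<^bsup>\<lambda>\<^esup> \<ge> \<epsilon>/2\<close> on \<open>U\<^bsub>\<epsilon>,\<lambda>\<^esub>(f)\<close>, so that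
  the inner integral in \<open>s\<^sub>2(f)\<close> is dominated by \<open>\<integral> |g| K\<^bsup>-(n+\<beta>)\<^esup> (1 - |y|)\<^bsup>\<beta>\<^esup> dy\<close>. As \<open>p \<le> 1\<close>, the sub-mean
  value property of \<open>|g|\<^bsup>p\<^esup>\<close> moves the power \<open>p\<close> inside, and Fubini's theorem bounds the outer integral by
  the norm of \<open>g\<close> in \<open>A\<^bsup>p\<^esup>\<^sub>\<alpha>\<close>.
\<close>

section \<open>Polar coordinates\<close>

text \<open>The threshold \<lambda> serves both halves. In \<open>s1_le\<close> it keeps (1 -
  |y|^2)^(\<beta> - \<lambda>) bounded; in \<open>s2_le\<close> it yields p (n + \<beta>) > n +
  \<alpha>, because p \<lambda> = \<alpha> + n, and the outer integral needs this to converge. The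
  orthonormal basis is arbitrary, so the generating function of its zonal sums is derived here.
  Green's formula with the weights \<open>bump\<close>, which vanish before the boundary is reached,
  shows that the spherical coefficients of any harmonic function are homogeneous in the radius;
  Parseval's formula and a sub-mean value bound turn this into pointwise convergence. The Poisson
  kernel is the case whose coefficients are known explicitly. The kernel bound has exponent n +
  \<beta> and not n + \<beta> + 1 since the numerator 1 - w^2 is at most of the order |1 - t z| on
  the disc used for Cauchy's inequality. The radius of that disc is proportional to |1 - t z|, not
  to 1 - t, so it may leave the unit disc; this is why the extension is studied near each t.\<close>

lemma nn_integral_powr_from_0:
  fixes s d :: real
  assumes "s > -1" "d \<ge> 0"
  shows "(\<integral>\<^sup>+u. ennreal (u powr s) * indicator {0..d} u \<partial>lborel) = ennreal (d powr (s + 1) / (s + 1))"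
  by (rule nn_integral_has_integral_lebesgue'[OF _ has_integral_powr_from_0[OF assms]]) simp

lemma nn_integral_powr_to_inf:
  fixes s d :: real
  assumes "s < -1" "d > 0"
  shows "(\<integral>\<^sup>+u. ennreal (u powr s) * indicator {d..} u \<partial>lborel) = ennreal (- (d powr (s + 1)) / (s + 1))"
  by (rule nn_integral_has_integral_lebesgue'[OF _ has_integral_powr_to_inf[OF assms]]) simp

lemma nn_integral_lborel_affine:
  fixes f :: "'a::euclidean_space \<Rightarrow> ennreal" and t :: 'a
  assumes [measurable]: "f \<in> borel_measurable borel" and c: "c \<noteq> 0"
  shows "(\<integral>\<^sup>+x. f x \<partial>lborel) = ennreal (\<bar>c\<bar> ^ DIM('a)) * (\<integral>\<^sup>+x. f (t + c *\<^sub>R x) \<partial>lborel)"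
proof -
  have "(\<integral>\<^sup>+x. f x \<partial>lborel) = (\<integral>\<^sup>+x. f x \<partial>density (distr lborel borel (\<lambda>x. t + c *\<^sub>R x)) (\<lambda>_. ennreal (\<bar>c\<bar>^DIM('a))))"
    using lborel_affine[OF c, of t] by (simp add: ennreal_power)
  also have "... = ennreal (\<bar>c\<bar> ^ DIM('a)) * (\<integral>\<^sup>+x. f (t + c *\<^sub>R x) \<partial>lborel)"
    by (subst nn_integral_density) (auto simp: nn_integral_distr nn_integral_cmult)
  finally show ?thesis .
qed

text \<open>The factor n normalizes the radial part to a probability measure, so that all the volume
  of the ball sits in \<open>cone_measure\<close>; surface measure is n times the latter.\<close>

definition radial_measure :: "nat \<Rightarrow> real measure" where
  "radial_measure n = density lborel (\<lambda>r. ennreal (real n * r ^ (n - 1)) * indicator {0<..<1} r)"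

text \<open>The measure of a set of directions is the volume of the cone over it. Unlike
  \<open>surface_measure\<close> it is a Borel measure on the whole space, so integrands need no
  restriction to the sphere; the value \<open>sgn 0 = 0\<close> concerns a null set only.\<close>

definition cone_measure :: "'a::euclidean_space measure" where
  "cone_measure = distr (restrict_space lborel (ball 0 1)) borel sgn"

lemma sets_radial_measure [simp, measurable_cong]: "sets (radial_measure n) = sets borel"
  by (simp add: radial_measure_def)

lemma sets_cone_measure [simp, measurable_cong]: "sets cone_measure = sets borel"
  by (simp add: cone_measure_def)

lemma space_radial_measure [simp]: "space (radial_measure n) = UNIV"
  by (simp add: radial_measure_def)

lemma space_cone_measure [simp]: "space cone_measure = UNIV"
  by (simp add: cone_measure_def)

lemma measurable_ball_restrict: "f \<in> borel \<rightarrow>\<^sub>M N \<Longrightarrow> f \<in> restrict_space lborel (ball 0 1) \<rightarrow>\<^sub>M N"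
  by (rule measurable_restrict_space1) simp

lemma emeasure_cone_measure:
  assumes [measurable]: "E \<in> sets borel"
  shows "emeasure cone_measure E = emeasure lborel (ball (0::'a::euclidean_space) 1 \<inter> sgn -` E)"
proof -
  have m: "sgn -` E \<in> sets (borel :: 'a measure)"
    using measurable_sets[of sgn borel borel E] by simp
  show ?thesis
    unfolding cone_measure_def
    by (subst emeasure_distr) (auto simp: measurable_ball_restrict emeasure_restrict_space space_restrict_space m Int_commute)
qed

lemma finite_cone: "emeasure lborel (ball (0::'a::euclidean_space) 1 \<inter> A) < \<infinity>"
proof -
  have "emeasure lborel (ball (0::'a) 1 \<inter> A) \<le> emeasure lborel (ball (0::'a) 1)"
    by (rule emeasure_mono) auto
  also have "... < \<infinity>" by (simp add: emeasure_ball)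
  finally show ?thesis .
qed

lemma emeasure_cone_scale:
  assumes [measurable]: "E \<in> sets borel" and a: "a > 0"
  shows "emeasure lborel (ball (0::'a::euclidean_space) a \<inter> sgn -` E)
     = ennreal (a ^ DIM('a)) * emeasure lborel (ball (0::'a) 1 \<inter> sgn -` E)"
proof -
  have m: "sgn -` E \<in> sets (borel :: 'a measure)"
    using measurable_sets[of sgn borel borel E] by simp
  have "emeasure lborel (ball (0::'a) a \<inter> sgn -` E) = (\<integral>\<^sup>+x. indicator (ball (0::'a) a \<inter> sgn -` E) x \<partial>lborel)"
    using m by simp
  also have "... = ennreal (\<bar>a\<bar> ^ DIM('a)) * (\<integral>\<^sup>+x. indicator (ball (0::'a) a \<inter> sgn -` E) (0 + a *\<^sub>R x) \<partial>lborel)"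
    by (rule nn_integral_lborel_affine) (use a m in \<open>auto intro!: borel_measurable_indicator\<close>)
  also have "(\<lambda>x. indicator (ball (0::'a) a \<inter> sgn -` E) (0 + a *\<^sub>R x) :: ennreal) = indicator (ball 0 1 \<inter> sgn -` E)"
    using a by (auto simp: fun_eq_iff indicator_def sgn_scaleR)
  finally show ?thesis using m a by simp
qed

lemma emeasure_radial_greaterThan:
  assumes n: "n \<ge> 1" and x: "0 \<le> x" "x < 1"
  shows "emeasure (radial_measure n) {x<..} = ennreal (1 - x ^ n)"
proof -
  have "emeasure (radial_measure n) {x<..} = (\<integral>\<^sup>+r. ennreal (real n * r ^ (n - 1)) * indicator {0<..<1} r * indicator {x<..} r \<partial>lborel)"
    unfolding radial_measure_def by (subst emeasure_density) auto
  also have "... = (\<integral>\<^sup>+r. ennreal (real n * r ^ (n - 1)) * indicator {x..1} r \<partial>lborel)"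
  proof (rule nn_integral_cong_AE)
    have "AE r::real in lborel. r \<noteq> x" "AE r::real in lborel. r \<noteq> 1" by (rule AE_lborel_singleton)+
    then show "AE r in lborel. ennreal (real n * r ^ (n - 1)) * indicator {0<..<1} r * indicator {x<..} r
        = ennreal (real n * r ^ (n - 1)) * indicator {x..1} r"
      by eventually_elim (use x in \<open>auto simp: indicator_def\<close>)
  qed
  also have "... = ennreal (1 ^ n - x ^ n)"
    by (rule nn_integral_FTC_Icc) (use x n in \<open>auto intro!: derivative_eq_intros DERIV_subset[OF DERIV_power]\<close>)
  finally show ?thesis by simp
qed

lemma radial_measure_prob: "n \<ge> 1 \<Longrightarrow> emeasure (radial_measure n) UNIV = 1"
proof -
  assume n: "n \<ge> 1"
  have "emeasure (radial_measure n) UNIV = emeasure (radial_measure n) {0<..}"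
    unfolding radial_measure_def
    by (subst emeasure_density, simp, simp, subst emeasure_density, simp, simp)
      (auto intro!: nn_integral_cong simp: indicator_def)
  then show ?thesis using emeasure_radial_greaterThan[OF n, of 0] n by (simp add: power_0_left)
qed

lemma finite_measure_radial: "n \<ge> 1 \<Longrightarrow> finite_measure (radial_measure n)"
  by (rule finite_measureI) (simp add: radial_measure_prob)

lemma finite_measure_cone: "finite_measure (cone_measure :: 'a::euclidean_space measure)"
  by (rule finite_measureI) (use finite_cone[of UNIV] in \<open>simp add: emeasure_cone_measure less_top\<close>)

text \<open>For a fixed \<open>E\<close> the distribution of the norm on the cone over
  \<open>E\<close> is compared with a multiple of the radial measure. Both are finite on the
  half-lines \<open>{x<..}\<close>, where they agree because the cone scales like r^n; half-lines
  determine the measure.\<close>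

lemma emeasure_radial_cone:
  assumes [measurable]: "A \<in> sets borel" "E \<in> sets borel"
  shows "emeasure (radial_measure DIM('a)) A * emeasure (cone_measure :: 'a::euclidean_space measure) E
    = emeasure lborel {x \<in> ball (0::'a) 1. norm x \<in> A \<and> sgn x \<in> E}"
proof -
  define S where "S = ball (0::'a) 1 \<inter> sgn -` E"
  have m: "sgn -` E \<in> sets (borel :: 'a measure)"
    using measurable_sets[of sgn borel borel E] by simp
  then have S[measurable]: "S \<in> sets borel" by (simp add: S_def)
  define T where "T = emeasure lborel S"
  have T: "T = emeasure cone_measure E" "T < \<infinity>"
    by (auto simp: T_def S_def emeasure_cone_measure finite_cone[simplified])
  define M where "M = distr (restrict_space lborel S) borel norm"
  have eM: "emeasure M B = emeasure lborel {x \<in> S. norm x \<in> B}" if [measurable]: "B \<in> sets borel" for B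
  proof -
    have nm: "norm \<in> restrict_space lborel S \<rightarrow>\<^sub>M borel" by (rule measurable_restrict_space1) simp
    have "emeasure M B = emeasure (restrict_space lborel S) (norm -` B \<inter> space (restrict_space lborel S))"
      unfolding M_def by (rule emeasure_distr[OF nm that])
    also have "... = emeasure lborel (norm -` B \<inter> S)"
      by (subst emeasure_restrict_space) (auto simp: space_restrict_space)
    also have "norm -` B \<inter> S = {x \<in> S. norm x \<in> B}" by auto
    finally show ?thesis .
  qed
  have eq: "M = scale_measure T (radial_measure DIM('a))"
  proof (rule measure_eqI_lessThan)
    show "emeasure M {x<..} < \<infinity>" for x
    proof -
      have "{y \<in> S. norm y \<in> {x<..}} = ball 0 1 \<inter> (sgn -` E \<inter> {y. norm y > x})" by (auto simp: S_def)
      then show ?thesis using finite_cone[of "sgn -` E \<inter> {y. norm y > x}"] by (simp only: eM borel_open open_greaterThan)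
    qed
    show "emeasure M {x<..} = emeasure (scale_measure T (radial_measure DIM('a))) {x<..}" for x
    proof -
      consider "x < 0" | "0 \<le> x" "x < 1" | "x \<ge> 1" by linarith
      then show ?thesis
      proof cases
        case 1
        have "{y \<in> S. norm y > x} = S" using 1 by (auto intro: less_le_trans)
        moreover have "emeasure (radial_measure DIM('a)) {x<..} = 1"
        proof -
          have "emeasure (radial_measure DIM('a)) {0<..} \<le> emeasure (radial_measure DIM('a)) {x<..}"
            using 1 by (intro emeasure_mono) auto
          moreover have "emeasure (radial_measure DIM('a)) {x<..} \<le> emeasure (radial_measure DIM('a)) UNIV"
            by (intro emeasure_mono) auto
          ultimately show ?thesis
            using emeasure_radial_greaterThan[of "DIM('a)" 0] radial_measure_prob[of "DIM('a)"]
            by (simp add: power_0_left antisym)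
        qed
        ultimately show ?thesis by (simp add: eM T_def)
      next
        case 2
        \<comment> \<open>Removing the open ball of radius x leaves the sphere of radius x, which
          \<open>{x<..}\<close> excludes.\<close>
        have null: "AE y::'a in lborel. norm y \<noteq> x"
        proof -
          have "sphere (0::'a) x \<in> null_sets lborel"
            using negligible_sphere[of "0::'a" x]
            by (auto simp: null_sets_completion_iff negligible_iff_null_sets negligible_convex_frontier)
          then show ?thesis by (auto dest: AE_not_in)
        qed
        have "emeasure M {x<..} = emeasure lborel (S - (ball 0 x \<inter> sgn -` E))"
          unfolding eM[OF borel_open[OF open_greaterThan]]
        proof (rule emeasure_eq_AE)
          show "AE y in lborel. (y \<in> {y \<in> S. norm y \<in> {x<..}}) = (y \<in> S - (ball 0 x \<inter> sgn -` E))"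
            using null by eventually_elim (auto simp: S_def)
        qed (use m in auto)
        also have "... = emeasure lborel S - emeasure lborel (ball 0 x \<inter> sgn -` E)"
          by (rule emeasure_Diff) (use m 2 finite_cone[of "ball 0 x \<inter> sgn -` E"] in \<open>auto simp: S_def Int_absorb1 Int_assoc[symmetric] subset_ball\<close>)
        also have "emeasure lborel (ball 0 x \<inter> sgn -` E) = ennreal (x ^ DIM('a)) * T"
          using 2 emeasure_cone_scale[of E x] by (cases "x = 0") (auto simp: T_def S_def)
        also have "emeasure lborel S - ennreal (x ^ DIM('a)) * T = T * ennreal (1 - x ^ DIM('a))"
        proof -
          obtain t where t: "T = ennreal t" "t \<ge> 0" using T(2) by (cases T) auto
          have "x ^ DIM('a) \<le> 1" using 2 by (simp add: power_le_one)
          then show ?thesis using t 2 unfolding T_def[symmetric]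
            by (simp add: ennreal_mult[symmetric] ennreal_minus algebra_simps)
        qed
        finally show ?thesis using 2 by (simp add: emeasure_radial_greaterThan)
      next
        case 3
        have "{y \<in> S. norm y > x} = {}" using 3 by (auto simp: S_def)
        moreover have "emeasure (radial_measure DIM('a)) {x<..} = 0"
        proof -
          have "emeasure (radial_measure DIM('a)) {x<..} = (\<integral>\<^sup>+r. ennreal (real DIM('a) * r ^ (DIM('a) - 1)) * indicator {0<..<1} r * indicator {x<..} r \<partial>lborel)"
            unfolding radial_measure_def by (subst emeasure_density) auto
          also have "... = (\<integral>\<^sup>+r. 0 \<partial>(lborel :: real measure))"
            by (rule nn_integral_cong) (use 3 in \<open>auto simp: indicator_def\<close>)
          finally show ?thesis by simp
        qed
        ultimately have "emeasure M {x<..} = 0" by (simp only: eM borel_open open_greaterThan greaterThan_iff emeasure_empty)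
        then show ?thesis using \<open>emeasure (radial_measure DIM('a)) {x<..} = 0\<close> by simp
      qed
    qed
  qed (simp_all add: M_def)
  have "emeasure (radial_measure DIM('a)) A * emeasure (cone_measure :: 'a measure) E = emeasure M A"
    unfolding eq T(1)[symmetric] by (simp add: mult.commute)
  also have "... = emeasure lborel {x \<in> ball (0::'a) 1. norm x \<in> A \<and> sgn x \<in> E}"
    by (simp add: eM S_def Int_def conj_ac)
  finally show ?thesis .
qed

lemma polar_measure:
  "radial_measure DIM('a) \<Otimes>\<^sub>M (cone_measure :: 'a::euclidean_space measure)
    = distr (restrict_space lborel (ball 0 1)) (borel \<Otimes>\<^sub>M borel) (\<lambda>x. (norm x, sgn x))"
proof (rule pair_measure_eqI)
  show "sigma_finite_measure (radial_measure DIM('a))"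
    using finite_measure_radial finite_measure.axioms(1) by (metis DIM_ge_Suc0 One_nat_def)
  show "sigma_finite_measure (cone_measure :: 'a measure)"
    using finite_measure_cone finite_measure.axioms(1) by blast
  show "sets (radial_measure DIM('a) \<Otimes>\<^sub>M (cone_measure :: 'a measure)) =
    sets (distr (restrict_space lborel (ball 0 1)) (borel \<Otimes>\<^sub>M borel) (\<lambda>x::'a. (norm x, sgn x)))"
    unfolding sets_distr by (rule sets_pair_measure_cong) simp_all
  fix A E assume AE: "A \<in> sets (radial_measure DIM('a))" "E \<in> sets (cone_measure :: 'a measure)"
  then have AE: "A \<in> sets borel" "E \<in> sets borel" by simp_all
  have m: "(\<lambda>x::'a. (norm x, sgn x)) \<in> restrict_space lborel (ball 0 1) \<rightarrow>\<^sub>M borel \<Otimes>\<^sub>M borel"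
    by (rule measurable_ball_restrict) measurable
  have "emeasure (distr (restrict_space lborel (ball 0 1)) (borel \<Otimes>\<^sub>M borel) (\<lambda>x::'a. (norm x, sgn x))) (A \<times> E)
     = emeasure (restrict_space lborel (ball 0 1)) ((\<lambda>x::'a. (norm x, sgn x)) -` (A \<times> E) \<inter> space (restrict_space lborel (ball 0 1)))"
    by (rule emeasure_distr[OF m]) (use AE in auto)
  also have "... = emeasure lborel ((\<lambda>x::'a. (norm x, sgn x)) -` (A \<times> E) \<inter> ball 0 1)"
    by (subst emeasure_restrict_space) (auto simp: space_restrict_space)
  also have "(\<lambda>x::'a. (norm x, sgn x)) -` (A \<times> E) \<inter> ball 0 1 = {x \<in> ball (0::'a) 1. norm x \<in> A \<and> sgn x \<in> E}" by auto
  finally show "emeasure (radial_measure DIM('a)) A * emeasure (cone_measure :: 'a measure) E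
      = emeasure (distr (restrict_space lborel (ball 0 1)) (borel \<Otimes>\<^sub>M borel) (\<lambda>x::'a. (norm x, sgn x))) (A \<times> E)"
    using emeasure_radial_cone[OF AE] by simp
qed

lemma nn_integral_polar:
  fixes F :: "real \<Rightarrow> 'a::euclidean_space \<Rightarrow> ennreal"
  assumes [measurable]: "(\<lambda>(r, u). F r u) \<in> borel_measurable (borel \<Otimes>\<^sub>M borel)"
  shows "(\<integral>\<^sup>+x\<in>ball 0 1. F (norm x) (sgn x) \<partial>lborel)
    = (\<integral>\<^sup>+r. (\<integral>\<^sup>+u. F r u \<partial>cone_measure) \<partial>radial_measure DIM('a))"
proof -
  interpret C: finite_measure "cone_measure :: 'a measure" by (rule finite_measure_cone)
  have m: "(\<lambda>x::'a. (norm x, sgn x)) \<in> restrict_space lborel (ball 0 1) \<rightarrow>\<^sub>M borel \<Otimes>\<^sub>M borel"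
    by (rule measurable_ball_restrict) measurable
  have m2: "(\<lambda>(r, u). F r u) \<in> borel_measurable (radial_measure DIM('a) \<Otimes>\<^sub>M (cone_measure :: 'a measure))"
    using assms by (simp cong: measurable_cong_sets sets_pair_measure_cong)
  have "(\<integral>\<^sup>+r. (\<integral>\<^sup>+u. F r u \<partial>cone_measure) \<partial>radial_measure DIM('a))
     = (\<integral>\<^sup>+z. (case z of (r, u) \<Rightarrow> F r u) \<partial>(radial_measure DIM('a) \<Otimes>\<^sub>M (cone_measure :: 'a measure)))"
    by (subst C.nn_integral_fst[OF m2, symmetric]) simp
  also have "... = (\<integral>\<^sup>+x. F (norm x) (sgn x) \<partial>restrict_space lborel (ball (0::'a) 1))"
    unfolding polar_measure by (subst nn_integral_distr[OF m]) auto
  also have "... = (\<integral>\<^sup>+x\<in>ball 0 1. F (norm x) (sgn x) \<partial>lborel)"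
    by (subst nn_integral_restrict_space) auto
  finally show ?thesis by simp
qed

lemma integral_polar:
  fixes F :: "real \<Rightarrow> 'a::euclidean_space \<Rightarrow> complex"
  assumes [measurable]: "(\<lambda>(r, u). F r u) \<in> borel_measurable (borel \<Otimes>\<^sub>M borel)"
    and int: "set_integrable lborel (ball 0 1) (\<lambda>x. F (norm x) (sgn x))"
  shows "(LINT x:ball 0 1|lborel. F (norm x) (sgn x))
    = (LINT r|radial_measure DIM('a). (LINT u|cone_measure. F r u))"
proof -
  interpret C: finite_measure "cone_measure :: 'a measure" by (rule finite_measure_cone)
  interpret R: finite_measure "radial_measure DIM('a)" by (rule finite_measure_radial) (simp add: DIM_positive Suc_leI)
  interpret P: pair_sigma_finite "radial_measure DIM('a)" "cone_measure :: 'a measure" ..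
  have m: "(\<lambda>x::'a. (norm x, sgn x)) \<in> restrict_space lborel (ball 0 1) \<rightarrow>\<^sub>M borel \<Otimes>\<^sub>M borel"
    by (rule measurable_ball_restrict) measurable
  have i: "integrable (radial_measure DIM('a) \<Otimes>\<^sub>M (cone_measure :: 'a measure)) (\<lambda>(r, u). F r u)"
    unfolding polar_measure
    by (subst integrable_distr_eq[OF m])
      (use int in \<open>auto simp: integrable_restrict_space set_integrable_def\<close>)
  have "(LINT r|radial_measure DIM('a). (LINT u|cone_measure. F r u))
    = (LINT z|(radial_measure DIM('a) \<Otimes>\<^sub>M (cone_measure :: 'a measure)). (case z of (r, u) \<Rightarrow> F r u))"
    using P.integral_fst'[OF i] by simp
  also have "... = (LINT x|restrict_space lborel (ball (0::'a) 1). F (norm x) (sgn x))"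
    unfolding polar_measure by (subst integral_distr[OF m]) auto
  also have "... = (LINT x:ball 0 1|lborel. F (norm x) (sgn x))"
    by (subst integral_restrict_space) (auto simp: set_lebesgue_integral_def)
  finally show ?thesis by simp
qed

lemma AE_radial: "AE r in radial_measure n. 0 < r \<and> r < 1"
  unfolding radial_measure_def by (subst AE_density) (auto simp: indicator_def)

lemma AE_cone: "AE u in (cone_measure :: 'a::euclidean_space measure). norm u = 1"
proof -
  have "AE x::'a in lborel. x \<noteq> 0" by (rule AE_lborel_singleton)
  then have "AE x in restrict_space lborel (ball (0::'a) 1). norm (sgn x) = 1"
    by (subst AE_restrict_space_iff) (auto elim!: eventually_mono simp: norm_sgn)
  then show ?thesis
    unfolding cone_measure_def by (subst AE_distr_iff) (auto simp: measurable_ball_restrict)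
qed

lemma nn_integral_radial:
  assumes [measurable]: "f \<in> borel_measurable borel"
  shows "(\<integral>\<^sup>+r. f r \<partial>radial_measure n) = (\<integral>\<^sup>+r. ennreal (real n * r ^ (n - 1)) * indicator {0<..<1} r * f r \<partial>lborel)"
  unfolding radial_measure_def by (rule nn_integral_density) auto

text \<open>This removes the weight (1 - r)^s. Where 1 - r > A the two integrands coincide. Where 1
  - r \<le> A the left side contributes at most n A^(1-n-t) / (s+1), and the right side already has
  that order on the interval 1 - A/4 < r < 1. There A \<le> 2 gives r > 1/2, so r^(n-1) is bounded
  below.\<close>

lemma radial_weight_comparison:
  fixes s t :: real and n :: nat
  assumes s: "s > -1" and t: "t > 0" and n: "n \<ge> 1"
  shows "\<exists>C>0. \<forall>A. 0 < A \<and> A \<le> 2 \<longrightarrow>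
    (\<integral>\<^sup>+r. ennreal ((1 - r) powr s * max A (1 - r) powr (- (real n + s + t))) \<partial>radial_measure n)
    \<le> ennreal C * (\<integral>\<^sup>+r. ennreal (max A (1 - r) powr (- (real n + t))) \<partial>radial_measure n)"
\<comment> \<open>The summand 1 accounts for 1 - r > A; the factor 2^(n-1) 4 undoes the loss in the
  lower bound \<open>lower\<close>.\<close>
proof (intro exI[of _ "1 + 2 ^ (n - 1) * 4 / (s + 1)"] conjI allI impI)
  show "1 + 2 ^ (n - 1) * 4 / (s + 1) > 0" using s by (intro add_pos_nonneg) auto
  fix A :: real assume A: "0 < A \<and> A \<le> 2"
  define I where "I = (\<integral>\<^sup>+r. ennreal (max A (1 - r) powr (- (real n + t))) \<partial>radial_measure n)"
  define a where "a = A powr (1 - real n - t)"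
  have I: "I = (\<integral>\<^sup>+r. ennreal (real n * r ^ (n - 1)) * indicator {0<..<1} r * ennreal (max A (1 - r) powr (- (real n + t))) \<partial>lborel)"
    unfolding I_def by (rule nn_integral_radial) measurable
  have lower: "ennreal (real n * (1 / 2) ^ (n - 1) * a / 4) \<le> I"
  proof -
    have "ennreal (real n * (1 / 2) ^ (n - 1) * a / 4) = ennreal (real n * (1 / 2) ^ (n - 1) * A powr (- (real n + t))) * ennreal (A / 4)"
    proof -
      have "a = A * A powr (- (real n + t))" using A unfolding a_def by (simp add: powr_add powr_diff powr_minus divide_simps)
      then show ?thesis using A by (subst ennreal_mult[symmetric]) (auto simp: field_simps)
    qed
    also have "... = (\<integral>\<^sup>+r. ennreal (real n * (1 / 2) ^ (n - 1) * A powr (- (real n + t))) * indicator {1 - A / 4<..<1} r \<partial>lborel)"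
      using A by (subst nn_integral_cmult_indicator) auto
    also have "... \<le> I" unfolding I
    proof (rule nn_integral_mono)
      fix r :: real
      show "ennreal (real n * (1 / 2) ^ (n - 1) * A powr (- (real n + t))) * indicator {1 - A / 4<..<1} r
        \<le> ennreal (real n * r ^ (n - 1)) * indicator {0<..<1} r * ennreal (max A (1 - r) powr (- (real n + t)))"
      proof (cases "r \<in> {1 - A / 4<..<1}")
        case True
        then have r: "r > 1 / 2" "r < 1" "max A (1 - r) = A" using A by (auto simp: max_def)
        have "(1 / 2) ^ (n - 1) \<le> r ^ (n - 1)" using r by (intro power_mono) auto
        then have "real n * (1 / 2) ^ (n - 1) * A powr (- (real n + t)) \<le> real n * r ^ (n - 1) * A powr (- (real n + t))"
          by (intro mult_right_mono mult_left_mono) auto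
        then show ?thesis using True r by (simp add: ennreal_mult[symmetric] ennreal_leI)
      qed simp
    qed
    finally show ?thesis .
  qed
  have "(\<integral>\<^sup>+r. ennreal ((1 - r) powr s * max A (1 - r) powr (- (real n + s + t))) \<partial>radial_measure n)
     = (\<integral>\<^sup>+r. ennreal (real n * r ^ (n - 1)) * indicator {0<..<1} r * ennreal ((1 - r) powr s * max A (1 - r) powr (- (real n + s + t))) \<partial>lborel)"
    by (rule nn_integral_radial) measurable
  also have "... \<le> (\<integral>\<^sup>+r. ennreal (real n * A powr (- (real n + s + t))) * (ennreal ((1 - r) powr s) * indicator {0..A} (1 - r))
     + ennreal (real n * r ^ (n - 1)) * indicator {0<..<1} r * ennreal (max A (1 - r) powr (- (real n + t))) \<partial>lborel)"
  proof (rule nn_integral_mono)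
    fix r :: real
    show "ennreal (real n * r ^ (n - 1)) * indicator {0<..<1} r * ennreal ((1 - r) powr s * max A (1 - r) powr (- (real n + s + t)))
      \<le> ennreal (real n * A powr (- (real n + s + t))) * (ennreal ((1 - r) powr s) * indicator {0..A} (1 - r))
       + ennreal (real n * r ^ (n - 1)) * indicator {0<..<1} r * ennreal (max A (1 - r) powr (- (real n + t)))"
    proof (cases "r \<in> {0<..<1}")
      case True
      show ?thesis
      proof (cases "1 - r \<le> A")
        case le: True
        have "real n * r ^ (n - 1) * ((1 - r) powr s * A powr (- (real n + s + t))) \<le> real n * 1 * ((1 - r) powr s * A powr (- (real n + s + t)))"
          using True by (intro mult_right_mono mult_left_mono power_le_one) auto
        then have "ennreal (real n * r ^ (n - 1)) * indicator {0<..<1} r * ennreal ((1 - r) powr s * max A (1 - r) powr (- (real n + s + t)))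
          \<le> ennreal (real n * A powr (- (real n + s + t))) * (ennreal ((1 - r) powr s) * indicator {0..A} (1 - r))"
          using True le by (simp add: max_def ennreal_mult[symmetric] mult_ac ennreal_leI)
        then show ?thesis by (rule order_trans) simp
      next
        case False
        then have "(1 - r) powr s * max A (1 - r) powr (- (real n + s + t)) = max A (1 - r) powr (- (real n + t))"
          using A by (simp add: max_def powr_add[symmetric])
        then show ?thesis by simp
      qed
    qed simp
  qed
  also have "... = ennreal (real n * A powr (- (real n + s + t))) * (\<integral>\<^sup>+r. ennreal ((1 - r) powr s) * indicator {0..A} (1 - r) \<partial>lborel) + I"
    unfolding I by (subst nn_integral_add) (auto simp: nn_integral_cmult)
  also have "(\<integral>\<^sup>+r. ennreal ((1 - r) powr s) * indicator {0..A} (1 - r) \<partial>lborel) = ennreal (A powr (s + 1) / (s + 1))"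
  proof -
    have m: "(\<lambda>u::real. ennreal (u powr s) * indicator {0..A} u) \<in> borel_measurable borel" by measurable
    show ?thesis using nn_integral_lborel_affine[OF m, of "-1" 1] nn_integral_powr_from_0[OF s, of A] A by simp
  qed
  also have "ennreal (real n * A powr (- (real n + s + t))) * ennreal (A powr (s + 1) / (s + 1)) = ennreal (real n * a / (s + 1))"
  proof -
    have e: "- (real n + s + t) + (s + 1) = 1 - real n - t" by simp
    have "A powr (- (real n + s + t)) * A powr (s + 1) = a" unfolding a_def powr_add[symmetric] e ..
    then show ?thesis using s by (subst ennreal_mult[symmetric]) auto
  qed
  also have "ennreal (real n * a / (s + 1)) = ennreal (2 ^ (n - 1) * 4 / (s + 1)) * ennreal (real n * (1 / 2) ^ (n - 1) * a / 4)"
    using s by (subst ennreal_mult[symmetric]) (auto simp: power_divide a_def)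
  also have "... + I \<le> ennreal (2 ^ (n - 1) * 4 / (s + 1)) * I + I"
    by (intro add_right_mono mult_left_mono lower) auto
  also have "... = ennreal (1 + 2 ^ (n - 1) * 4 / (s + 1)) * I"
    using s by (simp add: ennreal_plus distrib_right add.commute)
  finally show "(\<integral>\<^sup>+r. ennreal ((1 - r) powr s * max A (1 - r) powr (- (real n + s + t))) \<partial>radial_measure n)
    \<le> ennreal (1 + 2 ^ (n - 1) * 4 / (s + 1)) * (\<integral>\<^sup>+r. ennreal (max A (1 - r) powr (- (real n + t))) \<partial>radial_measure n)"
    unfolding I_def .
qed

lemma nn_integral_polar_swap:
  fixes F :: "real \<Rightarrow> 'a::euclidean_space \<Rightarrow> ennreal"
  assumes m[measurable]: "(\<lambda>(r, u). F r u) \<in> borel_measurable (borel \<Otimes>\<^sub>M borel)"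
  shows "(\<integral>\<^sup>+x\<in>ball 0 1. F (norm x) (sgn x) \<partial>lborel)
    = (\<integral>\<^sup>+u. (\<integral>\<^sup>+r. F r u \<partial>radial_measure DIM('a)) \<partial>cone_measure)"
proof -
  interpret C: finite_measure "cone_measure :: 'a measure" by (rule finite_measure_cone)
  interpret R: finite_measure "radial_measure DIM('a)" by (rule finite_measure_radial) (simp add: DIM_positive Suc_leI)
  interpret P: pair_sigma_finite "radial_measure DIM('a)" "cone_measure :: 'a measure" ..
  have m2: "(\<lambda>(r, u). F r u) \<in> borel_measurable (radial_measure DIM('a) \<Otimes>\<^sub>M (cone_measure :: 'a measure))"
    using m by (simp cong: measurable_cong_sets sets_pair_measure_cong)
  show ?thesis unfolding nn_integral_polar[OF m]
    using P.Fubini'[OF m2] by simp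
qed

text \<open>Layer cake: m^(-e) is the integral of e r^(-e-1) over r \<ge> m. After the order of
  integration is exchanged, the inner integral is the volume of the ball of radius r.\<close>

lemma nn_integral_max_norm_powr:
  fixes t d :: real
  assumes t: "t > 0" and d: "d > 0"
  shows "(\<integral>\<^sup>+w. ennreal (max (norm w) d powr (- (real DIM('a) + t))) \<partial>(lborel :: 'a::euclidean_space measure))
    = ennreal ((real DIM('a) + t) * unit_ball_vol DIM('a) / t * d powr (- t))"
proof -
  define e where "e = real DIM('a) + t"
  have e: "e > 0" using t by (simp add: e_def add_nonneg_pos)
  have layer: "ennreal (m powr (- e)) = (\<integral>\<^sup>+r. ennreal e * (ennreal (r powr (- e - 1)) * indicator {m..} r) \<partial>lborel)" if "m > 0" for m :: real
    using e that by (simp add: nn_integral_cmult nn_integral_powr_to_inf ennreal_mult[symmetric])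
  have m: "(\<lambda>(w::'a, r::real). ennreal e * (ennreal (r powr (- e - 1)) * indicator {d..} r * indicator {x::'a\<times>real. norm (fst x) \<le> snd x} (w, r))) \<in> borel_measurable (lborel \<Otimes>\<^sub>M lborel)"
  proof -
    have "{x::'a\<times>real. norm (fst x) \<le> snd x} \<in> sets (lborel \<Otimes>\<^sub>M lborel)"
    proof -
      have "closed {x::'a\<times>real. norm (fst x) \<le> snd x}" by (intro closed_Collect_le continuous_intros)
      then have "{x::'a\<times>real. norm (fst x) \<le> snd x} \<in> sets borel" by (rule borel_closed)
      moreover have "sets (lborel \<Otimes>\<^sub>M lborel :: ('a \<times> real) measure) = sets borel" by (metis lborel_prod sets_lborel)
      ultimately show ?thesis by (simp only:)
    qed
    then show ?thesis by measurable
  qed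
  have "(\<integral>\<^sup>+w. ennreal (max (norm w) d powr (- e)) \<partial>(lborel :: 'a measure)) =
     (\<integral>\<^sup>+w. (\<integral>\<^sup>+r. ennreal e * (ennreal (r powr (- e - 1)) * indicator {d..} r * indicator {x::'a\<times>real. norm (fst x) \<le> snd x} (w, r)) \<partial>lborel) \<partial>(lborel :: 'a measure))"
  proof (intro nn_integral_cong)
    fix w :: 'a
    have "ennreal (max (norm w) d powr (- e)) = (\<integral>\<^sup>+r. ennreal e * (ennreal (r powr (- e - 1)) * indicator {max (norm w) d..} r) \<partial>lborel)"
      by (rule layer) (use d in auto)
    also have "... = (\<integral>\<^sup>+r. ennreal e * (ennreal (r powr (- e - 1)) * indicator {d..} r * indicator {x::'a\<times>real. norm (fst x) \<le> snd x} (w, r)) \<partial>lborel)"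
      by (intro nn_integral_cong) (auto simp: indicator_def)
    finally show "ennreal (max (norm w) d powr (- e)) = (\<integral>\<^sup>+r. ennreal e * (ennreal (r powr (- e - 1)) * indicator {d..} r * indicator {x::'a\<times>real. norm (fst x) \<le> snd x} (w, r)) \<partial>lborel)" .
  qed
  also have "... = (\<integral>\<^sup>+r. (\<integral>\<^sup>+w. ennreal e * (ennreal (r powr (- e - 1)) * indicator {d..} r * indicator {x::'a\<times>real. norm (fst x) \<le> snd x} (w, r)) \<partial>lborel) \<partial>lborel)"
    by (rule lborel_pair.Fubini'[symmetric]) (use m in simp)
  also have "... = (\<integral>\<^sup>+r. ennreal (e * unit_ball_vol DIM('a)) * (ennreal (r powr (- t - 1)) * indicator {d..} r) \<partial>lborel)"
  proof (intro nn_integral_cong)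
    fix r :: real
    have "(\<integral>\<^sup>+w. ennreal e * (ennreal (r powr (- e - 1)) * indicator {d..} r * indicator {x::'a\<times>real. norm (fst x) \<le> snd x} (w, r)) \<partial>lborel)
      = (\<integral>\<^sup>+w. ennreal e * (ennreal (r powr (- e - 1)) * indicator {d..} r) * indicator (cball 0 r) (w::'a) \<partial>lborel)"
      by (intro nn_integral_cong) (auto simp: indicator_def)
    also have "... = ennreal e * (ennreal (r powr (- e - 1)) * indicator {d..} r) * emeasure lborel (cball (0::'a) r)"
      by (rule nn_integral_cmult_indicator) simp
    also have "... = ennreal (e * unit_ball_vol DIM('a)) * (ennreal (r powr (- t - 1)) * indicator {d..} r)"
    proof (cases "r \<ge> d")
      case True
      then have r: "r > 0" using d by simp
      have "r powr (- e - 1) * r ^ DIM('a) = r powr (- t - 1)"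
        using r by (simp add: powr_realpow[symmetric] powr_add[symmetric] e_def)
      then have "e * (r powr (- e - 1) * (unit_ball_vol DIM('a) * r ^ DIM('a))) = e * unit_ball_vol DIM('a) * r powr (- t - 1)"
        by (metis mult.assoc mult.commute)
      then show ?thesis using True r e
        by (simp add: emeasure_cball ennreal_mult[symmetric] mult.assoc)
    qed simp
    finally show "(\<integral>\<^sup>+w. ennreal e * (ennreal (r powr (- e - 1)) * indicator {d..} r * indicator {x::'a\<times>real. norm (fst x) \<le> snd x} (w, r)) \<partial>lborel)
       = ennreal (e * unit_ball_vol DIM('a)) * (ennreal (r powr (- t - 1)) * indicator {d..} r)" .
  qed
  also have "... = ennreal (e * unit_ball_vol DIM('a)) * ennreal (d powr (- t) / t)"
    using t d by (simp add: nn_integral_cmult nn_integral_powr_to_inf)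
  also have "... = ennreal (e * unit_ball_vol DIM('a) / t * d powr (- t))"
    using t e by (subst ennreal_mult[symmetric]) auto
  finally show ?thesis by (simp add: e_def)
qed

section \<open>A size function for the kernel\<close>

text \<open>Comparable, for points of the ball, with \<open>|\<rho> x - y'|\<close>, where \<open>y = \<rho> y'\<close>.\<close>

definition kap :: "'a::real_normed_vector \<Rightarrow> 'a \<Rightarrow> real" where
  "kap x y = norm (x - y) + (1 - norm x) + (1 - norm y)"

lemma kap_pos: "norm x < 1 \<Longrightarrow> norm y < 1 \<Longrightarrow> kap x y > 0"
  using norm_ge_zero[of "x - y"] unfolding kap_def by linarith

lemma kap_commute: "kap x y = kap y x"
  by (simp add: kap_def norm_minus_commute)

lemma norm_diff_sgn: "norm x \<le> 1 \<Longrightarrow> norm (x - sgn x) \<le> 1 - norm (x::'a::real_normed_vector)"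
proof (cases "x = 0")
  case False
  assume "norm x \<le> 1"
  have "x - sgn x = (norm x - 1) *\<^sub>R sgn x" using False by (simp add: sgn_div_norm algebra_simps)
  then show ?thesis using \<open>norm x \<le> 1\<close> False by (simp add: norm_sgn)
qed simp

lemma norm_triangle3: "norm (a + b + c) \<le> norm a + norm b + norm (c::'a::real_normed_vector)"
  by (rule order_trans[OF norm_triangle_ineq add_right_mono[OF norm_triangle_ineq]])

text \<open>Triangle inequalities through the boundary points \<open>sgn x\<close> and
  \<open>v\<close> make \<open>kap\<close> comparable to an expression in which the radius and the
  direction of x are separated. The direction of y is a parameter because \<open>sgn y\<close> is
  not a unit vector for y = 0.\<close>

lemma kap_polar:
  fixes x y v :: "'a::real_normed_vector"
  assumes x: "norm x < 1" and y: "norm y < 1" and v: "norm v = 1" "y = norm y *\<^sub>R v"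
  defines "m \<equiv> max (max (norm (sgn x - v)) (1 - norm y)) (1 - norm x)"
  shows "m \<le> kap x y" and "kap x y \<le> 5 * m"
proof -
  have vy: "norm (y - v) = 1 - norm y"
  proof -
    have "y - v = (norm y - 1) *\<^sub>R v" using v(2) by (simp add: algebra_simps)
    then have "norm (y - v) = \<bar>norm y - 1\<bar> * norm v" by (simp only: norm_scaleR)
    then show ?thesis using v y by simp
  qed
  have xs: "norm (x - sgn x) \<le> 1 - norm x" by (rule norm_diff_sgn) (use x in simp)
  have eq: "(sgn x - x) + (x - y) + (y - v) = sgn x - v" by simp
  have "norm (sgn x - v) \<le> norm (sgn x - x) + norm (x - y) + norm (y - v)"
    using norm_triangle3[of "sgn x - x" "x - y" "y - v"] unfolding eq .
  then have "norm (sgn x - v) \<le> kap x y"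
    using xs vy unfolding kap_def norm_minus_commute[of "sgn x" x] by linarith
  then show "m \<le> kap x y" unfolding m_def
    by (intro max.boundedI) (insert x y norm_ge_zero[of "x - y"], unfold kap_def, linarith+)
  have eq: "(x - sgn x) + (sgn x - v) + (v - y) = x - y" by simp
  have "norm (x - y) \<le> norm (x - sgn x) + norm (sgn x - v) + norm (v - y)"
    using norm_triangle3[of "x - sgn x" "sgn x - v" "v - y"] unfolding eq .
  then have "norm (x - y) \<le> (1 - norm x) + norm (sgn x - v) + (1 - norm y)"
    using xs vy unfolding norm_minus_commute[of v y] by linarith
  moreover have "norm (sgn x - v) \<le> m" "1 - norm y \<le> m" "1 - norm x \<le> m" by (auto simp: m_def)
  ultimately show "kap x y \<le> 5 * m" unfolding kap_def by linarith
qed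

lemma exists_unit_direction: "\<exists>v::'a::euclidean_space. norm v = 1 \<and> y = norm y *\<^sub>R v"
proof (cases "y = 0")
  case True
  then show ?thesis by (intro exI[of _ "SOME i. i \<in> Basis"]) (simp add: norm_Basis SOME_Basis)
next
  case False
  then show ?thesis by (intro exI[of _ "sgn y"]) (simp add: norm_sgn sgn_div_norm)
qed

text \<open>In polar coordinates the weight (1 - |x|)^s is traded for s in the exponent by
  \<open>radial_weight_comparison\<close>, with A the maximum of |u - v| and 1 - |y|. The remaining
  unweighted integral is read in Cartesian coordinates again and enlarged to the whole space, where
  it is explicit.\<close>

lemma kap_integral_estimate:
  fixes s t :: real
  assumes s: "s > -1" and t: "t > 0"
  shows "\<exists>C>0. \<forall>y\<in>ball (0::'a::euclidean_space) 1.
    (\<integral>\<^sup>+x\<in>ball 0 1. ennreal ((1 - norm x) powr s * kap x y powr (- (real DIM('a) + s + t))) \<partial>lborel)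
      \<le> ennreal (C * (1 - norm y) powr (- t))"
proof -
  let ?n = "DIM('a)"
  obtain C1 where C1: "C1 > 0" "\<And>A. 0 < A \<Longrightarrow> A \<le> 2 \<Longrightarrow>
    (\<integral>\<^sup>+r. ennreal ((1 - r) powr s * max A (1 - r) powr (- (real ?n + s + t))) \<partial>radial_measure ?n)
    \<le> ennreal C1 * (\<integral>\<^sup>+r. ennreal (max A (1 - r) powr (- (real ?n + t))) \<partial>radial_measure ?n)"
    using radial_weight_comparison[OF s t, of ?n] by (auto simp: DIM_positive Suc_leI)
  define C2 where "C2 = (real ?n + t) * unit_ball_vol ?n / t"
  have C2: "C2 > 0" unfolding C2_def using t by (intro divide_pos_pos mult_pos_pos add_nonneg_pos) auto
  define C where "C = C1 * (5 powr (real ?n + t) * C2)"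
  have "C > 0" unfolding C_def using C1 C2 by simp
  moreover have "(\<integral>\<^sup>+x\<in>ball 0 1. ennreal ((1 - norm x) powr s * kap x y powr (- (real ?n + s + t))) \<partial>lborel)
      \<le> ennreal (C * (1 - norm y) powr (- t))" if y: "y \<in> ball (0::'a) 1" for y
  proof -
    obtain v where v: "norm v = 1" "y = norm y *\<^sub>R v" using exists_unit_direction by blast
    define d where "d = 1 - norm y"
    have d: "d > 0" "d \<le> 1" using y by (auto simp: d_def)
    have pos: "real ?n + s + t > 0" "real ?n + t > 0" using s t DIM_positive[where 'a='a] by linarith+
    have "(\<integral>\<^sup>+x\<in>ball 0 1. ennreal ((1 - norm x) powr s * kap x y powr (- (real ?n + s + t))) \<partial>lborel)
      \<le> (\<integral>\<^sup>+x\<in>ball (0::'a) 1. ennreal ((1 - norm x) powr s * max (max (norm (sgn x - v)) d) (1 - norm x) powr (- (real ?n + s + t))) \<partial>lborel)"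
    proof (rule nn_integral_mono)
      fix x :: 'a
      show "ennreal ((1 - norm x) powr s * kap x y powr (- (real ?n + s + t))) * indicator (ball 0 1) x
        \<le> ennreal ((1 - norm x) powr s * max (max (norm (sgn x - v)) d) (1 - norm x) powr (- (real ?n + s + t))) * indicator (ball 0 1) x"
      proof (cases "x \<in> ball 0 1")
        case True
        have "kap x y powr (- (real ?n + s + t)) \<le> max (max (norm (sgn x - v)) d) (1 - norm x) powr (- (real ?n + s + t))"
          by (rule powr_mono2') (use kap_polar(1)[OF _ _ v, of x] True y d pos in \<open>auto simp: d_def\<close>)
        then show ?thesis using True by (auto intro!: ennreal_leI mult_left_mono)
      qed simp
    qed
    also have "... = (\<integral>\<^sup>+u. (\<integral>\<^sup>+r. ennreal ((1 - r) powr s * max (max (norm (u - v)) d) (1 - r) powr (- (real ?n + s + t))) \<partial>radial_measure ?n) \<partial>cone_measure)"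
      by (rule nn_integral_polar_swap) measurable
    also have "... \<le> (\<integral>\<^sup>+u. ennreal C1 * (\<integral>\<^sup>+r. ennreal (max (max (norm (u - v)) d) (1 - r) powr (- (real ?n + t))) \<partial>radial_measure ?n) \<partial>cone_measure)"
    proof (rule nn_integral_mono_AE)
      show "AE u in cone_measure. (\<integral>\<^sup>+r. ennreal ((1 - r) powr s * max (max (norm (u - v)) d) (1 - r) powr (- (real ?n + s + t))) \<partial>radial_measure ?n)
         \<le> ennreal C1 * (\<integral>\<^sup>+r. ennreal (max (max (norm (u - v)) d) (1 - r) powr (- (real ?n + t))) \<partial>radial_measure ?n)"
        using AE_cone
      proof eventually_elim
        case (elim u)
        have "norm (u - v) \<le> 2" using norm_triangle_ineq4[of u v] elim v by simp
        then show ?case using d by (intro C1) auto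
      qed
    qed
    also have "... = ennreal C1 * (\<integral>\<^sup>+u. (\<integral>\<^sup>+r. ennreal (max (max (norm (u - v)) d) (1 - r) powr (- (real ?n + t))) \<partial>radial_measure ?n) \<partial>cone_measure)"
    proof (rule nn_integral_cmult)
      interpret R: finite_measure "radial_measure ?n" by (rule finite_measure_radial) (simp add: DIM_positive Suc_leI)
      show "(\<lambda>u. \<integral>\<^sup>+r. ennreal (max (max (norm (u - v)) d) (1 - r) powr (- (real ?n + t))) \<partial>radial_measure ?n) \<in> borel_measurable cone_measure"
        by measurable
    qed
    also have "(\<integral>\<^sup>+u. (\<integral>\<^sup>+r. ennreal (max (max (norm (u - v)) d) (1 - r) powr (- (real ?n + t))) \<partial>radial_measure ?n) \<partial>cone_measure)
      = (\<integral>\<^sup>+x\<in>ball (0::'a) 1. ennreal (max (max (norm (sgn x - v)) d) (1 - norm x) powr (- (real ?n + t))) \<partial>lborel)"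
      by (rule nn_integral_polar_swap[symmetric]) measurable
    also have "... \<le> (\<integral>\<^sup>+x. ennreal (5 powr (real ?n + t)) * ennreal (max (norm (x - y)) d powr (- (real ?n + t))) \<partial>(lborel :: 'a measure))"
    proof (rule nn_integral_mono)
      fix x :: 'a
      show "ennreal (max (max (norm (sgn x - v)) d) (1 - norm x) powr (- (real ?n + t))) * indicator (ball 0 1) x
        \<le> ennreal (5 powr (real ?n + t)) * ennreal (max (norm (x - y)) d powr (- (real ?n + t)))"
      proof (cases "x \<in> ball 0 1")
        case True
        define m where "m = max (max (norm (sgn x - v)) d) (1 - norm x)"
        \<comment> \<open>Return from the polar expression m to Cartesian coordinates:
          \<open>kap\<close> lies above the new maximum and below 5 m.\<close>
        have "max (norm (x - y)) d \<le> kap x y" 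
          using True y norm_ge_zero[of "x - y"] unfolding kap_def d_def max.bounded_iff mem_ball_0 by linarith
        also have "... \<le> 5 * m" using kap_polar(2)[OF _ _ v, of x] True y by (simp add: m_def d_def)
        finally have le: "max (norm (x - y)) d / 5 \<le> m" by simp
        have "m powr (- (real ?n + t)) \<le> (max (norm (x - y)) d / 5) powr (- (real ?n + t))"
          by (rule powr_mono2'[OF _ _ le]) (use d pos in auto)
        also have "... = 5 powr (real ?n + t) * max (norm (x - y)) d powr (- (real ?n + t))"
        proof -
          have "(max (norm (x - y)) d / 5) powr (- (real ?n + t)) = max (norm (x - y)) d powr (- (real ?n + t)) / 5 powr (- (real ?n + t))"
            by (rule powr_divide)
          also have "5 powr (- (real ?n + t)) = inverse (5 powr (real ?n + t) :: real)" by (rule powr_minus)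
          finally show ?thesis by (simp only: divide_inverse inverse_inverse_eq mult.commute)
        qed
        finally show ?thesis using True by (simp add: m_def ennreal_mult[symmetric] ennreal_leI)
      qed simp
    qed
    also have "... = ennreal (5 powr (real ?n + t)) * (\<integral>\<^sup>+x. ennreal (max (norm (x - y)) d powr (- (real ?n + t))) \<partial>(lborel :: 'a measure))"
      by (rule nn_integral_cmult) measurable
    also have "(\<integral>\<^sup>+x. ennreal (max (norm (x - y)) d powr (- (real ?n + t))) \<partial>(lborel :: 'a measure)) = (\<integral>\<^sup>+w. ennreal (max (norm w) d powr (- (real ?n + t))) \<partial>(lborel :: 'a measure))"
    proof -
      have m: "(\<lambda>x::'a. ennreal (max (norm (x - y)) d powr (- (real ?n + t)))) \<in> borel_measurable borel" by measurable
      show ?thesis using nn_integral_lborel_affine[OF m, of 1 y] by simp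
    qed
    also have "... = ennreal (C2 * d powr (- t))" unfolding C2_def by (rule nn_integral_max_norm_powr[OF t d(1)])
    also have "ennreal C1 * (ennreal (5 powr (real ?n + t)) * ennreal (C2 * d powr (- t))) = ennreal (C * (1 - norm y) powr (- t))"
      using C1(1) C2 by (simp add: ennreal_mult[symmetric] C_def d_def mult_ac)
    finally show ?thesis by (simp add: mult_left_mono)
  qed
  ultimately show ?thesis by blast
qed

section \<open>Fractional derivatives of the Poisson kernel\<close>

text \<open>The Pochhammer symbol is the eigenvalue on w^k of the product of the operators w d/dw +
  a + i for i < m. Expanding the product in terms of w^i (d/dw)^i gives the coefficients
  \<open>e\<close>. They are chosen before \<open>F\<close>, which makes the later bounds uniform in
  the kernel variable.\<close>

lemma euler_operator_power_series:
  fixes F :: "complex \<Rightarrow> complex" and a :: complex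
  shows "\<exists>e :: nat \<Rightarrow> complex. \<forall>F q. F holomorphic_on ball 0 1 \<longrightarrow>
     (\<forall>w\<in>ball 0 1. (\<lambda>k. q k * w ^ k) sums F w) \<longrightarrow>
     (\<forall>w\<in>ball 0 1. (\<lambda>k. pochhammer (of_nat k + a) m * q k * w ^ k) sums (\<Sum>i\<le>m. e i * w ^ i * (deriv ^^ i) F w))"
proof (induction m)
  case 0
  show ?case by (rule exI[of _ "\<lambda>_. 1"]) auto
next
  case (Suc m)
  then obtain e where e: "\<And>F q w. F holomorphic_on ball 0 1 \<Longrightarrow>
     (\<And>w. w\<in>ball 0 1 \<Longrightarrow> (\<lambda>k. q k * w ^ k) sums F w) \<Longrightarrow> w\<in>ball 0 1 \<Longrightarrow>
     (\<lambda>k. pochhammer (of_nat k + a) m * q k * w ^ k) sums (\<Sum>i\<le>m. e i * w ^ i * (deriv ^^ i) F w)"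
    by (elim exE) blast
  \<comment> \<open>Applying w d/dw + a + m to e_i w^i F^(i) produces (i + a + m) e_i w^i F^(i) and
    e_i w^(i+1) F^(i+1).\<close>
  define e' where "e' i = (if i \<le> m then e i * (of_nat i + a + of_nat m) else 0) + (if i \<ge> 1 then e (i - 1) else 0)" for i
  show ?case
  proof (intro exI[of _ e'] allI impI ballI)
    fix F q w assume F: "F holomorphic_on ball 0 1" and q: "\<forall>w\<in>ball 0 1. (\<lambda>k. q k * w ^ k) sums F w"
      and w: "w \<in> ball (0::complex) 1"
    define G where "G w = (\<Sum>i\<le>m. e i * w ^ i * (deriv ^^ i) F w)" for w
    define c where "c k = pochhammer (of_nat k + a) m * q k" for k
    have cs: "(\<lambda>k. c k * w ^ k) sums G w" if "norm w < 1" for w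
      unfolding c_def G_def by (rule e) (use F q that in auto)
    have dF: "((deriv ^^ i) F has_field_derivative (deriv ^^ Suc i) F w) (at w)" for i
      using holomorphic_higher_deriv[OF F open_ball, of i] holomorphic_derivI[OF _ open_ball w] by simp
    have dG: "(G has_field_derivative (\<Sum>i\<le>m. e i * (of_nat i * w ^ (i - 1) * (deriv ^^ i) F w + w ^ i * (deriv ^^ Suc i) F w))) (at w)"
      unfolding G_def by (auto intro!: derivative_eq_intros dF sum.cong simp del: funpow.simps simp: algebra_simps)
    define G' where "G' = (\<Sum>i\<le>m. e i * (of_nat i * w ^ (i - 1) * (deriv ^^ i) F w + w ^ i * (deriv ^^ Suc i) F w))"
    have "(\<lambda>k. diffs c k * w ^ k) sums G'"
      by (rule termdiffs_sums_strong[OF cs dG[folded G'_def]]) (use w in auto)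
    then have "(\<lambda>k. w * (diffs c k * w ^ k)) sums (w * G')" by (rule sums_mult)
    then have "(\<lambda>k. of_nat (Suc k) * c (Suc k) * w ^ Suc k) sums (w * G')"
      by (simp add: diffs_def algebra_simps)
    then have "(\<lambda>k. of_nat k * c k * w ^ k) sums (w * G' + of_nat 0 * c 0 * w ^ 0)"
      by (rule sums_Suc)
    then have "(\<lambda>k. of_nat k * c k * w ^ k + (a + of_nat m) * (c k * w ^ k)) sums (w * G' + (a + of_nat m) * G w)"
      using sums_add[OF _ sums_mult[OF cs[of w], of "a + of_nat m"]] w by force
    moreover have "of_nat k * c k * w ^ k + (a + of_nat m) * (c k * w ^ k) = pochhammer (of_nat k + a) (Suc m) * q k * w ^ k" for k
      by (simp add: c_def pochhammer_Suc algebra_simps)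
    moreover have "w * G' + (a + of_nat m) * G w = (\<Sum>i\<le>Suc m. e' i * w ^ i * (deriv ^^ i) F w)"
    proof -
      have "w * G' = (\<Sum>i\<le>m. e i * of_nat i * w ^ i * (deriv ^^ i) F w) + (\<Sum>i\<le>m. e i * w ^ Suc i * (deriv ^^ Suc i) F w)"
        unfolding G'_def sum_distrib_left sum.distrib[symmetric]
      proof (rule sum.cong[OF refl])
        fix i show "w * (e i * (of_nat i * w ^ (i - 1) * (deriv ^^ i) F w + w ^ i * (deriv ^^ Suc i) F w)) =
          e i * of_nat i * w ^ i * (deriv ^^ i) F w + e i * w ^ Suc i * (deriv ^^ Suc i) F w"
          by (cases i) (simp_all add: algebra_simps del: funpow.simps)
      qed
      moreover have "(\<Sum>i\<le>m. e i * w ^ Suc i * (deriv ^^ Suc i) F w) = (\<Sum>i\<le>Suc m. (if i \<ge> 1 then e (i - 1) else 0) * w ^ i * (deriv ^^ i) F w)"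
        by (subst sum.atMost_Suc_shift) simp
      moreover have "(\<Sum>i\<le>m. e i * of_nat i * w ^ i * (deriv ^^ i) F w) + (a + of_nat m) * G w
         = (\<Sum>i\<le>Suc m. (if i \<le> m then e i * (of_nat i + a + of_nat m) else 0) * w ^ i * (deriv ^^ i) F w)"
        unfolding G_def sum_distrib_left sum.distrib[symmetric]
        by (simp, rule sum.cong) (auto simp: algebra_simps)
      ultimately show ?thesis
        unfolding e'_def by (simp add: distrib_right sum.distrib del: sum.atMost_Suc funpow.simps)
    qed
    ultimately show "(\<lambda>k. pochhammer (of_nat k + a) (Suc m) * q k * w ^ k) sums (\<Sum>i\<le>Suc m. e' i * w ^ i * (deriv ^^ i) F w)"
      by simp
  qed
qed

text \<open>The holomorphic extension of the Poisson kernel \<open>(1 - t\<^sup>2) / |1 - t z|\<^sup>n\<close>, \<open>|z| = 1\<close>, in the radius \<open>t\<close>.\<close>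

definition poisson_ext :: "nat \<Rightarrow> complex \<Rightarrow> complex \<Rightarrow> complex" where
  "poisson_ext n z w = (1 - w\<^sup>2) * exp (- (of_nat n / 2) * (Ln (1 - w * z) + Ln (1 - w * cnj z)))"

text \<open>A real number u \<le> 0 differs from v by at least Re v in the real part and by |Im v|
  in the imaginary part, hence by at least |v|. The disc around v through the origin therefore
  avoids the branch cut of the logarithm.\<close>

lemma half_plane_ball_nonpos_Reals:
  assumes "Re v > 0" "norm (u - v) < norm v"
  shows "u \<notin> \<real>\<^sub>\<le>\<^sub>0"
proof
  assume "u \<in> \<real>\<^sub>\<le>\<^sub>0"
  then have u: "Im u = 0" "Re u \<le> 0" by (auto simp: complex_nonpos_Reals_iff)
  have "(Re v)\<^sup>2 \<le> (Re u - Re v)\<^sup>2"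
    using u(2) assms(1) by (simp add: abs_le_square_iff[symmetric])
  then have "(norm v)\<^sup>2 \<le> (norm (u - v))\<^sup>2"
    using u(1) by (simp add: cmod_power2)
  then show False using assms(2) by (simp add: power2_le_imp_le not_less[symmetric] power_strict_mono)
qed

lemma norm_cnj_factor: "norm (1 - complex_of_real t * cnj z) = norm (1 - complex_of_real t * z)"
proof -
  have "1 - complex_of_real t * cnj z = cnj (1 - complex_of_real t * z)" by simp
  then show ?thesis by (metis complex_mod_cnj)
qed

lemma Re_factor_pos:
  assumes "norm z = 1" "norm w < 1"
  shows "Re (1 - w * z) > 0"
proof -
  have "Re (w * z) \<le> norm (w * z)" by (rule complex_Re_le_cmod)
  then show ?thesis using assms by (simp add: norm_mult)
qed

lemma norm_factor_pos:
  fixes z :: complex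
  assumes "norm z = 1" "0 \<le> t" "t < 1"
  shows "norm (1 - of_real t * z) > 0"
proof -
  have "Re (1 - of_real t * z) > 0" by (rule Re_factor_pos) (use assms in auto)
  then show ?thesis by (metis less_irrefl zero_complex.simps(1) zero_less_norm_iff)
qed

text \<open>Both factors 1 - w z and 1 - w \<open>cnj z\<close> stay in the discs of
  \<open>half_plane_ball_nonpos_Reals\<close> as long as |w - t| < |1 - t z|. This radius, larger
  than 1 - t when z is away from 1, makes Cauchy's inequality give powers of |1 - t z|.\<close>

lemma holomorphic_poisson_ext:
  assumes "norm z = 1" "0 \<le> t" "t < 1"
  shows "poisson_ext n z holomorphic_on ball (of_real t) (norm (1 - of_real t * z))"
proof -
  have *: "1 - w * v \<notin> \<real>\<^sub>\<le>\<^sub>0"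
    if "w \<in> ball (of_real t) (norm (1 - of_real t * z))" "v = z \<or> v = cnj z" for w v
  proof (rule half_plane_ball_nonpos_Reals)
    show "0 < Re (1 - of_real t * v)" by (rule Re_factor_pos) (use assms that in auto)
    have "norm ((1 - w * v) - (1 - of_real t * v)) = norm ((of_real t - w) * v)" by (simp add: algebra_simps)
    also have "... = norm (of_real t - w)" using assms that by (auto simp: norm_mult)
    also have "... < norm (1 - of_real t * v)" using that norm_cnj_factor[of t z] by (auto simp: dist_norm)
    finally show "norm ((1 - w * v) - (1 - of_real t * v)) < norm (1 - of_real t * v)" .
  qed
  show ?thesis unfolding poisson_ext_def
    by (intro holomorphic_intros) (use * in auto)
qed

lemma holomorphic_poisson_ext_disc:
  assumes "norm z = 1"
  shows "poisson_ext n z holomorphic_on ball 0 1"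
  using holomorphic_poisson_ext[OF assms, of 0 n] by simp

text \<open>For real t the two logarithms are conjugate, so their sum is 2 ln |1 - t z|.\<close>

lemma poisson_ext_of_real:
  assumes z: "norm z = 1" and t: "0 \<le> t" "t < 1"
  shows "poisson_ext n z (of_real t) = of_real ((1 - t\<^sup>2) / norm (1 - of_real t * z) ^ n)"
proof -
  define v where "v = 1 - of_real t * z"
  have v: "Re v > 0" unfolding v_def by (rule Re_factor_pos) (use z t in auto)
  then have v0: "v \<noteq> 0" "v \<notin> \<real>\<^sub>\<le>\<^sub>0" by (auto simp: complex_nonpos_Reals_iff)
  have "1 - of_real t * cnj z = cnj v" by (simp add: v_def)
  then have "Ln (1 - of_real t * z) + Ln (1 - of_real t * cnj z) = Ln v + cnj (Ln v)"
    using cnj_Ln[OF v0(2)] v_def by simp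
  also have "... = of_real (2 * ln (norm v))"
    using v0 by (simp add: complex_add_cnj)
  finally have "poisson_ext n z (of_real t) = of_real ((1 - t\<^sup>2) * exp (- (real n * ln (norm v))))"
    unfolding poisson_ext_def by (simp add: exp_of_real[symmetric])
  also have "exp (- (real n * ln (norm v))) = 1 / norm v ^ n"
    using v0 by (simp add: exp_minus exp_of_nat_mult divide_inverse)
  finally show ?thesis by (simp add: v_def)
qed

text \<open>On the disc of half the radius both linear factors keep modulus at least d/2. The
  numerator gains one power of d: 1 - t \<le> d at the centre, and |w - t| \<le> d/2.\<close>

lemma norm_poisson_ext_le:
  assumes z: "norm z = 1" and t: "0 \<le> t" "t < 1"
    and d: "d = norm (1 - of_real t * z)" and w: "norm (w - of_real t) \<le> d / 2"
  shows "norm (poisson_ext n z w) \<le> 4 * d * (d / 2) powr (- real n)"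
proof -
  have d0: "d > 0" using norm_factor_pos[OF z t] unfolding d .
  have d2: "d \<le> 2" unfolding d using norm_triangle_ineq4[of 1 "of_real t * z"] z t by (simp add: norm_mult)
  have dt: "1 - t \<le> d"
    unfolding d using norm_triangle_ineq2[of 1 "of_real t * z"] z t by (simp add: norm_mult)
  have lower: "d / 2 \<le> norm (1 - w * v)" if v: "v = z \<or> v = cnj z" for v
  proof -
    have "norm (1 - of_real t * v) = d" using v norm_cnj_factor[of t z] d by auto
    moreover have "norm ((1 - of_real t * v) - (1 - w * v)) = norm ((w - of_real t) * v)" by (simp add: algebra_simps)
    moreover have "... \<le> d / 2" using v z w by (auto simp: norm_mult)
    moreover have "norm (1 - of_real t * v) - norm (1 - w * v) \<le> norm ((1 - of_real t * v) - (1 - w * v))"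
      by (rule norm_triangle_ineq2)
    ultimately show ?thesis by linarith
  qed
  have *: "exp (- (real n / 2) * ln (norm (1 - w * v))) \<le> (d / 2) powr (- (real n / 2))" if "v = z \<or> v = cnj z" for v
  proof -
    have "ln (d / 2) \<le> ln (norm (1 - w * v))" using lower[OF that] d0 by (intro ln_mono) auto
    then have "- (real n / 2) * ln (norm (1 - w * v)) \<le> - (real n / 2) * ln (d / 2)"
      by (intro mult_left_mono_neg) auto
    then show ?thesis using d0 by (simp add: powr_def)
  qed
  have nz: "1 - w * z \<noteq> 0" "1 - w * cnj z \<noteq> 0"
    using lower[of z] lower[of "cnj z"] d0 by auto
  have "norm (exp (- (of_nat n / 2) * (Ln (1 - w * z) + Ln (1 - w * cnj z))))
     = exp (- (real n / 2) * ln (norm (1 - w * z))) * exp (- (real n / 2) * ln (norm (1 - w * cnj z)))"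
    using nz by (simp add: exp_add[symmetric] algebra_simps)
  also have "... \<le> (d / 2) powr (- (real n / 2)) * (d / 2) powr (- (real n / 2))"
    by (intro mult_mono *) auto
  also have "... = (d / 2) powr (- real n)" by (simp add: powr_add[symmetric])
  finally have 1: "norm (exp (- (of_nat n / 2) * (Ln (1 - w * z) + Ln (1 - w * cnj z)))) \<le> (d / 2) powr (- real n)" .
  have "norm (1 - w\<^sup>2) \<le> norm (1 - (of_real t)\<^sup>2 :: complex) + norm ((of_real t)\<^sup>2 - w\<^sup>2)"
    using norm_triangle_ineq[of "1 - (of_real t)\<^sup>2 :: complex" "(of_real t)\<^sup>2 - w\<^sup>2"] by simp
  moreover have "norm (1 - (of_real t)\<^sup>2 :: complex) \<le> 2 * d"
  proof -
    have "(1 - (of_real t)\<^sup>2 :: complex) = of_real ((1 - t) * (1 + t))" by (simp add: algebra_simps power2_eq_square)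
    also have "norm ... = (1 - t) * (1 + t)" using t by (simp only: norm_of_real) (simp add: abs_mult)
    also have "... \<le> d * 2" using t dt d0 by (intro mult_mono) auto
    finally show ?thesis by simp
  qed
  moreover have "norm ((of_real t)\<^sup>2 - w\<^sup>2) \<le> 2 * d"
  proof -
    have "(of_real t)\<^sup>2 - w\<^sup>2 = - ((w - of_real t) * (2 * of_real t + (w - of_real t)))" by (simp add: algebra_simps power2_eq_square)
    then have "norm ((of_real t)\<^sup>2 - w\<^sup>2) = norm (w - of_real t) * norm (2 * of_real t + (w - of_real t))"
      by (simp only: norm_minus_cancel norm_mult)
    also have "norm (2 * of_real t + (w - of_real t)) \<le> norm (2 * of_real t :: complex) + norm (w - of_real t)" by (rule norm_triangle_ineq)
    also have "norm (2 * of_real t :: complex) + norm (w - of_real t) \<le> 3" using t w d2 by (simp add: norm_mult)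
    finally have "norm ((of_real t)\<^sup>2 - w\<^sup>2) \<le> norm (w - of_real t) * 3" by (simp add: mult_left_mono)
    then show ?thesis using w d0 by linarith
  qed
  ultimately have 2: "norm (1 - w\<^sup>2) \<le> 4 * d" by linarith
  show ?thesis unfolding poisson_ext_def norm_mult
    by (rule mult_mono[OF 2 1]) (use d0 in auto)
qed

lemma higher_deriv_poisson_ext_bound:
  assumes z: "norm z = 1" and t: "0 \<le> t" "t < 1" and d: "d = norm (1 - of_real t * z)"
  shows "norm ((deriv ^^ i) (poisson_ext n z) (of_real t)) \<le> fact i * (4 * 2 ^ n * 2 ^ i) * d powr (1 - real n - real i)"
proof -
  have d0: "d > 0" using norm_factor_pos[OF z t] unfolding d .
  have "poisson_ext n z holomorphic_on ball (of_real t) d"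
    unfolding d by (rule holomorphic_poisson_ext[OF z t])
  then have h: "poisson_ext n z holomorphic_on cball (of_real t) (d / 2)"
    by (rule holomorphic_on_subset) (use d0 in auto)
  have "norm ((deriv ^^ i) (poisson_ext n z) (of_real t)) \<le> fact i * (4 * d * (d / 2) powr (- real n)) / (d / 2) ^ i"
    by (rule Cauchy_inequality)
      (use h d0 norm_poisson_ext_le[OF z t d] in \<open>auto intro: holomorphic_on_subset holomorphic_on_imp_continuous_on simp: norm_minus_commute\<close>)
  also have "... = fact i * (4 * 2 ^ n * 2 ^ i) * d powr (1 - real n - real i)"
    using d0 by (simp add: powr_diff powr_minus powr_realpow divide_simps power_divide)
  finally show ?thesis .
qed

text \<open>The i-th term of the expanded operator is of order d^(1-n-i) with d = |1 - t z|. Since d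
  \<le> 2, every term is absorbed by the worst one, i = m, at the price of a factor 2^m.\<close>

lemma pochhammer_kernel_bound:
  "\<exists>C>0. \<forall>z q t. norm z = 1 \<longrightarrow> (\<forall>w\<in>ball 0 1. (\<lambda>k. q k * w ^ k) sums poisson_ext n z w) \<longrightarrow> 0 \<le> t \<longrightarrow> t < 1 \<longrightarrow>
     norm (\<Sum>k. pochhammer (of_nat k + of_nat n / 2) m * q k * of_real t ^ k) \<le> C * norm (1 - of_real t * z) powr (1 - real n - real m)"
proof -
  obtain e where e: "\<And>F q w. F holomorphic_on ball 0 1 \<Longrightarrow>
     (\<And>w. w\<in>ball 0 1 \<Longrightarrow> (\<lambda>k. q k * w ^ k) sums F w) \<Longrightarrow> w\<in>ball 0 1 \<Longrightarrow>
     (\<lambda>k. pochhammer (of_nat k + of_nat n / 2) m * q k * w ^ k) sums (\<Sum>i\<le>m. e i * w ^ i * (deriv ^^ i) F w)"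
    using euler_operator_power_series[of "of_nat n / 2" m] by (elim exE) blast
  define C where "C = 1 + (\<Sum>i\<le>m. norm (e i) * (fact i * (4 * 2 ^ n * 2 ^ i) * 2 ^ m))"
  have "C > 0" unfolding C_def by (intro add_pos_nonneg sum_nonneg) auto
  moreover have "norm (\<Sum>k. pochhammer (of_nat k + of_nat n / 2) m * q k * of_real t ^ k) \<le> C * norm (1 - of_real t * z) powr (1 - real n - real m)"
    if z: "norm z = 1" and q: "\<forall>w\<in>ball 0 1. (\<lambda>k. q k * w ^ k) sums poisson_ext n z w" and t: "0 \<le> t" "t < 1" for z q t
  proof -
    define d where "d = norm (1 - of_real t * z)"
    have d0: "d > 0" using norm_factor_pos[OF z t] unfolding d_def .
    have d2: "d \<le> 2" unfolding d_def using norm_triangle_ineq4[of 1 "of_real t * z"] z t by (simp add: norm_mult)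
    have "(\<Sum>k. pochhammer (of_nat k + of_nat n / 2) m * q k * of_real t ^ k)
        = (\<Sum>i\<le>m. e i * of_real t ^ i * (deriv ^^ i) (poisson_ext n z) (of_real t))"
      by (rule sums_unique[symmetric], rule e) (use q t holomorphic_poisson_ext_disc[OF z] in auto)
    also have "norm ... \<le> (\<Sum>i\<le>m. norm (e i * of_real t ^ i * (deriv ^^ i) (poisson_ext n z) (of_real t)))"
      by (rule norm_sum)
    also have "... \<le> (\<Sum>i\<le>m. norm (e i) * (fact i * (4 * 2 ^ n * 2 ^ i) * 2 ^ m) * d powr (1 - real n - real m))"
    proof (rule sum_mono)
      fix i assume i: "i \<in> {..m}"
      have "d powr (1 - real n - real i) = d powr real (m - i) * d powr (1 - real n - real m)"
        using i by (simp add: powr_add[symmetric] of_nat_diff)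
      also have "d powr real (m - i) \<le> 2 ^ m"
      proof -
        have "d powr real (m - i) \<le> 2 powr real (m - i)" using d0 d2 by (intro powr_mono2) auto
        also have "... \<le> 2 powr real m" by (intro powr_mono) auto
        finally show ?thesis by (simp add: powr_realpow)
      qed
      finally have dd: "d powr (1 - real n - real i) \<le> 2 ^ m * d powr (1 - real n - real m)" by (simp add: mult_right_mono)
      have "norm (e i * of_real t ^ i * (deriv ^^ i) (poisson_ext n z) (of_real t))
         = norm (e i) * (t ^ i * norm ((deriv ^^ i) (poisson_ext n z) (of_real t)))"
        using t by (simp add: norm_mult norm_power)
      also have "... \<le> norm (e i) * (1 * (fact i * (4 * 2 ^ n * 2 ^ i) * d powr (1 - real n - real i)))"
        using t d0 by (intro mult_left_mono mult_mono higher_deriv_poisson_ext_bound[OF z t d_def] power_le_one) auto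
      also have "... \<le> norm (e i) * (1 * (fact i * (4 * 2 ^ n * 2 ^ i) * (2 ^ m * d powr (1 - real n - real m))))"
        by (intro mult_left_mono dd) auto
      finally show "norm (e i * of_real t ^ i * (deriv ^^ i) (poisson_ext n z) (of_real t))
        \<le> norm (e i) * (fact i * (4 * 2 ^ n * 2 ^ i) * 2 ^ m) * d powr (1 - real n - real m)" by (simp add: mult_ac)
    qed
    also have "... \<le> C * d powr (1 - real n - real m)"
      unfolding sum_distrib_right[symmetric] C_def by (intro mult_right_mono) auto
    finally show ?thesis by (simp add: d_def)
  qed
  ultimately show ?thesis by blast
qed

text \<open>The quotient of Gamma values of order b is the Pochhammer symbol of an integer order M >
  b times Beta(b + n/2 + k, M - b) / Gamma(M - b). Writing the Beta value as an integral over s in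
  [0, 1] turns the series of order b at t into an average of the series of order M at t s, to which
  \<open>pochhammer_kernel_bound\<close> applies.\<close>

lemma fractional_kernel_bound:
  fixes b :: real and n :: nat
  assumes b: "b \<ge> 1" and n: "n \<ge> 1"
  shows "\<exists>C>0. \<forall>z q t. norm z = 1 \<longrightarrow> (\<forall>w\<in>ball 0 1. (\<lambda>k. q k * w ^ k) sums poisson_ext n z w) \<longrightarrow> 0 \<le> t \<longrightarrow> t < 1 \<longrightarrow>
     summable (\<lambda>k. norm (of_real (Gamma (b + real k + real n / 2) / Gamma (real k + real n / 2)) * q k * of_real t ^ k)) \<and>
     norm (\<Sum>k. of_real (Gamma (b + real k + real n / 2) / Gamma (real k + real n / 2)) * q k * of_real t ^ k)
        \<le> C * norm (1 - of_real t * z) powr (1 - real n - b)"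
proof -
  \<comment> \<open>M exceeds b strictly, so that the second Beta parameter M - b is
    positive.\<close>
  define M where "M = nat \<lceil>b\<rceil> + 1"
  have M: "real M > b" unfolding M_def using b by linarith
  obtain C where C: "C > 0" "\<And>z q t. norm z = 1 \<Longrightarrow> (\<forall>w\<in>ball 0 1. (\<lambda>k. q k * w ^ k) sums poisson_ext n z w) \<Longrightarrow> 0 \<le> t \<Longrightarrow> t < 1 \<Longrightarrow>
     norm (\<Sum>k. pochhammer (of_nat k + of_nat n / 2) M * q k * of_real t ^ k) \<le> C * norm (1 - of_real t * z) powr (1 - real n - real M)"
    using pochhammer_kernel_bound[of n M] by blast
  obtain e where e: "\<And>F q w. F holomorphic_on ball 0 1 \<Longrightarrow>
     (\<And>w. w\<in>ball 0 1 \<Longrightarrow> (\<lambda>k. q k * w ^ k) sums F w) \<Longrightarrow> w\<in>ball 0 1 \<Longrightarrow>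
     (\<lambda>k. pochhammer (of_nat k + of_nat n / 2) M * q k * w ^ k) sums (\<Sum>i\<le>M. e i * w ^ i * (deriv ^^ i) F w)"
    using euler_operator_power_series[of "of_nat n / 2" M] by (elim exE) blast
  \<comment> \<open>The Beta density without its factor s^k, which is carried by the power
    series.\<close>
  define w where "w s = indicator {0..1} s * (s powr (b + real n / 2 - 1) * (1 - s) powr (real M - b - 1))" for s :: real
  define B where "B k = Beta (b + real n / 2 + real k) (real M - b)" for k
  have pos: "b + real n / 2 + real k > 0" "real M - b > 0" "real k + real n / 2 > 0" for k
    using b n M by (auto intro: add_pos_pos add_pos_nonneg add_nonneg_pos)
  have w0: "w s \<ge> 0" for s by (simp add: w_def)
  have wk: "w s * s ^ k = indicator {0..1} s * (s powr (b + real n / 2 + real k - 1) * (1 - s) powr (real M - b - 1))" for s k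
  proof (cases "s > 0")
    case True
    then show ?thesis by (simp add: w_def powr_add[symmetric] powr_realpow[symmetric] algebra_simps)
  next
    case False
    then show ?thesis by (auto simp: w_def indicator_def)
  qed
  have wint: "integrable lborel (\<lambda>s. w s * s ^ k)" "(\<integral>s. w s * s ^ k \<partial>lborel) = B k" for k
  proof -
    have si: "set_integrable lborel {0..1} (\<lambda>s. s powr (b + real n / 2 + real k - 1) * (1 - s) powr (real M - b - 1))"
      by (rule integrable_Beta) (use pos in auto)
    then show "integrable lborel (\<lambda>s. w s * s ^ k)"
      unfolding set_integrable_def wk by simp
    have "((\<lambda>s. s powr (b + real n / 2 + real k - 1) * (1 - s) powr (real M - b - 1)) has_integral B k) {0..1}"
      unfolding B_def by (rule has_integral_Beta_real) (use pos in auto)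
    then show "(\<integral>s. w s * s ^ k \<partial>lborel) = B k"
      using set_borel_integral_eq_integral(2)[OF si] unfolding set_lebesgue_integral_def wk
      by (simp add: integral_unique)
  qed
  have gam: "Gamma (b + real k + real n / 2) / Gamma (real k + real n / 2) = pochhammer (real k + real n / 2) M * B k / Gamma (real M - b)" for k
  proof -
    have nn: "real k + real n / 2 \<notin> \<int>\<^sub>\<le>\<^sub>0" using pos(3)[of k] by (auto dest: nonpos_Ints_nonpos)
    have "pochhammer (real k + real n / 2) M = Gamma (real k + real n / 2 + real M) / Gamma (real k + real n / 2)"
      by (rule pochhammer_Gamma[OF nn])
    moreover have "B k = Gamma (b + real k + real n / 2) * Gamma (real M - b) / Gamma (real k + real n / 2 + real M)"
      unfolding B_def Beta_def by (simp add: algebra_simps)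
    moreover have "Gamma (real k + real n / 2 + real M) > 0" by (rule Gamma_real_pos) (use pos(3)[of k] in linarith)
    moreover have "Gamma (real M - b) > 0" by (rule Gamma_real_pos) (use pos in auto)
    ultimately show ?thesis by simp
  qed
  have Bk: "0 \<le> B k" "B k \<le> B 0" for k
  proof -
    show "0 \<le> B k" unfolding wint(2)[symmetric] by (rule integral_nonneg_AE) (auto simp: wk)
    have "(\<integral>s. w s * s ^ k \<partial>lborel) \<le> (\<integral>s. w s * s ^ 0 \<partial>lborel)"
    proof (rule Bochner_Integration.integral_mono[OF wint(1) wint(1)])
      show "w s * s ^ k \<le> w s * s ^ 0" for s
        by (cases "s \<in> {0..1}") (auto simp: w_def power_le_one intro!: mult_left_le)
    qed
    then show "B k \<le> B 0" unfolding wint(2) .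
  qed
  have GM: "Gamma (real M - b) > 0" by (rule Gamma_real_pos) (use pos in auto)
  define K where "K = C * (2 powr (real n + b - 1) * (1 / (real M - b) + 1 / (real n + b - 1))) / Gamma (real M - b)"
  have K: "K > 0" unfolding K_def
    using C(1) GM pos(2) b n by (intro divide_pos_pos mult_pos_pos add_pos_pos) auto
  have main: "summable (\<lambda>k. norm (of_real (Gamma (b + real k + real n / 2) / Gamma (real k + real n / 2)) * q k * of_real t ^ k)) \<and>
     norm (\<Sum>k. of_real (Gamma (b + real k + real n / 2) / Gamma (real k + real n / 2)) * q k * of_real t ^ k)
        \<le> K * norm (1 - of_real t * z) powr (1 - real n - b)"
    if z: "norm z = 1" and q: "\<forall>w\<in>ball 0 1. (\<lambda>k. q k * w ^ k) sums poisson_ext n z w" and t: "0 \<le> t" "t < 1" for z q t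
  proof -
    define p where "p k = pochhammer (of_nat k + of_nat n / 2) M * q k" for k
    have n1: "cmod (1 + complex_of_real t) = 1 + t"
      using t norm_of_real[of "1 + t", where 'a = complex] by simp
    have ps: "summable (\<lambda>k. norm (p k * of_real t ^ k))"
    proof (rule powser_insidea)
      show "summable (\<lambda>k. p k * of_real ((1 + t) / 2) ^ k)"
        unfolding p_def
        by (rule sums_summable, rule e[OF holomorphic_poisson_ext_disc[OF z]]) (use q t n1 in \<open>auto simp: norm_divide\<close>)
      show "norm (of_real t :: complex) < norm (of_real ((1 + t) / 2) :: complex)"
        using t by (simp only: norm_of_real) auto
    qed
    have coeff: "of_real (Gamma (b + real k + real n / 2) / Gamma (real k + real n / 2)) * q k * of_real t ^ k
       = of_real (B k) * (p k * of_real t ^ k) / of_real (Gamma (real M - b))" for k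
      unfolding gam p_def by (simp add: pochhammer_of_real[symmetric])
    have sB: "summable (\<lambda>k. norm (of_real (B k) * (p k * of_real t ^ k)))"
    proof (rule summable_comparison_test'[OF summable_mult[OF ps, of "B 0"]])
      show "norm (norm (of_real (B k) * (p k * of_real t ^ k))) \<le> B 0 * norm (p k * of_real t ^ k)" for k
using mult_right_mono[OF Bk(2)[of k], of "norm (p k * of_real t ^ k)"] Bk(1)[of k] by (simp add: norm_mult)
    qed
    have sum1: "summable (\<lambda>k. norm (of_real (Gamma (b + real k + real n / 2) / Gamma (real k + real n / 2)) * q k * of_real t ^ k))"
      unfolding coeff norm_divide by (rule summable_divide[OF sB])
    define f where "f k s = of_real (w s * s ^ k) * (p k * of_real t ^ k)" for k s
    have fi: "integrable lborel (f k)" for k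
      unfolding f_def by (intro integrable_mult_left integrable_of_real wint)
    have fs: "AE s in lborel. summable (\<lambda>k. norm (f k s))"
    proof (rule AE_I2)
      fix s :: real
      show "summable (\<lambda>k. norm (f k s))"
      proof (rule summable_comparison_test'[OF summable_mult[OF ps, of "w s"]])
        fix k
        have "\<bar>w s * s ^ k\<bar> \<le> w s"
          by (cases "s \<in> {0..1}") (auto simp: w_def power_le_one abs_mult intro!: mult_left_le)
        from mult_right_mono[OF this, of "norm (p k * of_real t ^ k)"]
        show "norm (norm (f k s)) \<le> w s * norm (p k * of_real t ^ k)"
          by (simp add: f_def norm_mult abs_mult norm_power power_abs)
      qed
    qed
    have nf: "norm (f k s) = (w s * s ^ k) * norm (p k * of_real t ^ k)" for k s
    proof -
      have "w s * s ^ k \<ge> 0" by (simp add: wk)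
      then show ?thesis unfolding f_def norm_mult[of "of_real (w s * s ^ k)"] norm_of_real by simp
    qed
    have fis: "summable (\<lambda>k. \<integral>s. norm (f k s) \<partial>lborel)"
      unfolding nf using sB Bk by (simp add: wint norm_mult)
    have "(\<integral>s. (\<Sum>k. f k s) \<partial>lborel) = (\<Sum>k. integral\<^sup>L lborel (f k))"
      by (rule integral_suminf[OF fi fs fis])
    also have "... = (\<Sum>k. of_real (B k) * (p k * of_real t ^ k))"
    proof -
      have "integral\<^sup>L lborel (f k) = of_real (B k) * (p k * of_real t ^ k)" for k
        unfolding f_def by (simp only: integral_mult_left_zero integral_complex_of_real wint)
      then show ?thesis by simp
    qed
    finally have eq: "(\<Sum>k. of_real (B k) * (p k * of_real t ^ k)) = (\<integral>s. (\<Sum>k. f k s) \<partial>lborel)" by simp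
    have si: "integrable lborel (\<lambda>s. \<Sum>k. f k s)" by (rule integrable_suminf[OF fi fs fis])
    \<comment> \<open>Half of |1 - t z|, because |1 - t z| \<le> |1 - t s z| + t (1 - s) \<le> 2 |1
      - t s z|. Thus |1 - t s z| dominates the maximum of 1 - s and d.\<close>
    define d where "d = norm (1 - of_real t * z) / 2"
    have d: "d > 0" unfolding d_def using norm_factor_pos[OF z t] by simp
    define h where "h u = u powr (real M - b - 1) * max u d powr (1 - real n - real M)" for u :: real
    have pt: "norm (\<Sum>k. f k s) \<le> C * (indicator {0..1} s * h (1 - s))" for s
    proof (cases "s \<in> {0..1}")
      case True
      have ts: "0 \<le> t * s" "t * s < 1" using True t mult_left_le[of s t] by auto
      have "(\<Sum>k. f k s) = (\<Sum>k. of_real (w s) * (p k * of_real (t * s) ^ k))"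
        by (intro suminf_cong) (simp add: f_def power_mult_distrib mult_ac)
      also have "... = of_real (w s) * (\<Sum>k. p k * of_real (t * s) ^ k)"
      proof (rule suminf_mult)
        show "summable (\<lambda>k. p k * of_real (t * s) ^ k)" unfolding p_def
          by (rule sums_summable, rule e[OF holomorphic_poisson_ext_disc[OF z]]) (use q ts in \<open>auto simp: norm_mult[symmetric] simp del: of_real_mult\<close>)
      qed
      finally have "norm (\<Sum>k. f k s) = w s * norm (\<Sum>k. p k * of_real (t * s) ^ k)"
        using w0[of s] by (simp add: norm_mult)
      also have "... \<le> w s * (C * norm (1 - of_real (t * s) * z) powr (1 - real n - real M))"
        unfolding p_def by (intro mult_left_mono C(2)[OF z q ts] w0)
      also have "... \<le> w s * (C * max (1 - s) d powr (1 - real n - real M))"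
      proof (intro mult_left_mono w0 powr_mono2')
        have "1 - s \<le> norm (1 - of_real (t * s) * z)"
        proof -
          have "norm (of_real (t * s) * z) = t * s"
            by (simp only: norm_mult norm_of_real z mult_1_right abs_of_nonneg[OF ts(1)])
          moreover have "t * s \<le> s" using True t by (simp add: mult_left_le_one_le)
          ultimately show ?thesis using norm_triangle_ineq2[of 1 "of_real (t * s) * z"] by simp
        qed
        moreover have "d \<le> norm (1 - of_real (t * s) * z)"
        proof -
          have "1 - of_real t * z = (1 - of_real (t * s) * z) - of_real (t * (1 - s)) * z" by (simp add: algebra_simps)
          then have "norm (1 - of_real t * z) \<le> norm (1 - of_real (t * s) * z) + norm (of_real (t * (1 - s)) * z)"
            using norm_triangle_ineq4 by metis
          moreover have "norm (of_real (t * (1 - s)) * z) = t * (1 - s)" unfolding norm_mult norm_of_real using z t True by (simp add: abs_mult)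
          moreover have "t * (1 - s) \<le> 1 - s" using True t by (simp add: mult_left_le_one_le)
          ultimately show ?thesis using \<open>1 - s \<le> norm (1 - of_real (t * s) * z)\<close> by (simp add: d_def)
        qed
        ultimately show "max (1 - s) d \<le> norm (1 - of_real (t * s) * z)" by simp
      qed (use C(1) d n in auto)
      also have "... \<le> C * (indicator {0..1} s * h (1 - s))"
      proof -
        have "s powr (b + real n / 2 - 1) \<le> 1" using True b n by (intro powr_le1) auto
        then have "w s \<le> (1 - s) powr (real M - b - 1)" using True by (simp add: w_def mult_left_le_one_le)
        then have "w s * (C * max (1 - s) d powr (1 - real n - real M)) \<le> (1 - s) powr (real M - b - 1) * (C * max (1 - s) d powr (1 - real n - real M))"
          using C(1) by (intro mult_right_mono) auto
        then show ?thesis using True by (simp add: h_def mult_ac)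
      qed
      finally show ?thesis .
    next
      case False
      then have "(\<lambda>k. f k s) = (\<lambda>k. 0)" by (auto simp: f_def w_def)
      then show ?thesis using False by simp
    qed
    \<comment> \<open>Split at u = d: the integrand is d^(1-n-M) u^(M-b-1) below and u^(-b-n) above,
      and both parts are multiples of d^(1-n-b).\<close>
    have hi: "(\<integral>\<^sup>+u. ennreal (indicator {0..1} u * h u) \<partial>lborel) \<le> ennreal (d powr (1 - real n - b) * (1 / (real M - b) + 1 / (real n + b - 1)))"
    proof -
      have "(\<integral>\<^sup>+u. ennreal (indicator {0..1} u * h u) \<partial>lborel) \<le>
         (\<integral>\<^sup>+u. ennreal (d powr (1 - real n - real M)) * (ennreal (u powr (real M - b - 1)) * indicator {0..d} u) +
            ennreal (u powr (- b - real n)) * indicator {d..} u \<partial>lborel)"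
      proof (rule nn_integral_mono)
        fix u :: real
        show "ennreal (indicator {0..1} u * h u) \<le> ennreal (d powr (1 - real n - real M)) * (ennreal (u powr (real M - b - 1)) * indicator {0..d} u) +
            ennreal (u powr (- b - real n)) * indicator {d..} u"
        proof (cases "u \<le> d")
          case True
          then show ?thesis by (auto simp: indicator_def h_def max_def ennreal_mult[symmetric] mult.commute)
        next
          case False
          then have "h u = u powr (- b - real n)" using d by (simp add: h_def powr_add[symmetric] algebra_simps max_def)
          then show ?thesis using False by (auto simp: indicator_def)
        qed
      qed
      also have "... = ennreal (d powr (1 - real n - real M)) * ennreal (d powr (real M - b - 1 + 1) / (real M - b - 1 + 1))
          + ennreal (- (d powr (- b - real n + 1)) / (- b - real n + 1))"
        using d pos b n
        by (subst nn_integral_add) (auto simp: nn_integral_cmult nn_integral_powr_from_0 nn_integral_powr_to_inf)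
      also have "... = ennreal (d powr (1 - real n - b) * (1 / (real M - b) + 1 / (real n + b - 1)))"
      proof -
        have 1: "d powr (1 - real n - real M) * (d powr (real M - b - 1 + 1) / (real M - b - 1 + 1)) = d powr (1 - real n - b) * (1 / (real M - b))"
        proof -
          have e: "1 - real n - real M + (real M - b - 1 + 1) = 1 - real n - b" by simp
          show ?thesis by (simp only: times_divide_eq_right powr_add[symmetric] e) simp
        qed
        have 2: "- (d powr (- b - real n + 1)) / (- b - real n + 1) = d powr (1 - real n - b) * (1 / (real n + b - 1))"
        proof -
          have e1: "- b - real n + 1 = 1 - real n - b" and e2: "1 - real n - b = - (real n + b - 1)" by simp_all
          have "- (d powr (- b - real n + 1)) / (- b - real n + 1) = - (d powr (1 - real n - b)) / (- (real n + b - 1))"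
            unfolding e1 by (simp only: e2)
          then show ?thesis by (simp only: minus_divide_divide times_divide_eq_right mult_1_right)
        qed
        have 3: "ennreal (d powr (1 - real n - real M)) * ennreal (d powr (real M - b - 1 + 1) / (real M - b - 1 + 1))
            = ennreal (d powr (1 - real n - b) * (1 / (real M - b)))"
          unfolding 1[symmetric] by (rule ennreal_mult[symmetric]) (use pos in auto)
        show ?thesis unfolding 2 3 distrib_left
          by (rule ennreal_plus[symmetric]) (use pos(2) b n in auto)
      qed
      finally show ?thesis .
    qed
    have hm: "(\<lambda>u. ennreal (indicator {0..1} u * h u)) \<in> borel_measurable borel" unfolding h_def by measurable
    have "ennreal (norm (\<integral>s. (\<Sum>k. f k s) \<partial>lborel)) \<le> (\<integral>\<^sup>+s. ennreal (norm (\<Sum>k. f k s)) \<partial>lborel)"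
      by (rule integral_norm_bound_ennreal[OF si])
    also have "... \<le> (\<integral>\<^sup>+s. ennreal C * ennreal (indicator {0..1} (1 - s) * h (1 - s)) \<partial>lborel)"
    proof (rule nn_integral_mono)
      fix s :: real
      have "ennreal (norm (\<Sum>k. f k s)) \<le> ennreal (C * (indicator {0..1} s * h (1 - s)))"
        by (rule ennreal_leI[OF pt])
      also have "... = ennreal C * ennreal (indicator {0..1} (1 - s) * h (1 - s))"
        using C(1) by (subst ennreal_mult) (auto simp: h_def indicator_def)
      finally show "ennreal (norm (\<Sum>k. f k s)) \<le> ennreal C * ennreal (indicator {0..1} (1 - s) * h (1 - s))" .
    qed
    also have "... = ennreal C * (\<integral>\<^sup>+s. ennreal (indicator {0..1} (1 - s) * h (1 - s)) \<partial>lborel)"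
      by (rule nn_integral_cmult) (unfold h_def, measurable)
    also have "(\<integral>\<^sup>+s. ennreal (indicator {0..1} (1 - s) * h (1 - s)) \<partial>lborel) = (\<integral>\<^sup>+u. ennreal (indicator {0..1} u * h u) \<partial>lborel)"
      using nn_integral_lborel_affine[OF hm, of "-1" 1] by simp
    also have "ennreal C * ... \<le> ennreal C * ennreal (d powr (1 - real n - b) * (1 / (real M - b) + 1 / (real n + b - 1)))"
      by (rule mult_left_mono[OF hi]) simp
    also have "... = ennreal (C * (d powr (1 - real n - b) * (1 / (real M - b) + 1 / (real n + b - 1))))"
      using C(1) pos b n by (subst ennreal_mult[symmetric]) auto
    finally have fin: "norm (\<integral>s. (\<Sum>k. f k s) \<partial>lborel) \<le> C * (d powr (1 - real n - b) * (1 / (real M - b) + 1 / (real n + b - 1)))"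
      using C(1) pos b n by (subst (asm) ennreal_le_iff) auto
    have dp: "d powr (1 - real n - b) = 2 powr (real n + b - 1) * norm (1 - of_real t * z) powr (1 - real n - b)"
    proof -
      have "d powr (1 - real n - b) = norm (1 - of_real t * z) powr (1 - real n - b) / 2 powr (1 - real n - b)"
        unfolding d_def by (rule powr_divide)
      also have "2 powr (1 - real n - b) = inverse (2 powr (real n + b - 1) :: real)"
      proof -
        have e: "1 - real n - b = - (real n + b - 1)" by simp
        show ?thesis unfolding e by (rule powr_minus)
      qed
      finally show ?thesis by (simp only: divide_inverse inverse_inverse_eq mult.commute)
    qed
    have "(\<Sum>k. of_real (Gamma (b + real k + real n / 2) / Gamma (real k + real n / 2)) * q k * of_real t ^ k)
       = (\<Sum>k. of_real (B k) * (p k * of_real t ^ k)) / of_real (Gamma (real M - b))"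
      unfolding coeff by (rule suminf_divide) (rule summable_norm_cancel[OF sB])
    then have "norm (\<Sum>k. of_real (Gamma (b + real k + real n / 2) / Gamma (real k + real n / 2)) * q k * of_real t ^ k)
      = norm (\<integral>s. (\<Sum>k. f k s) \<partial>lborel) / Gamma (real M - b)"
      unfolding eq using GM by (simp add: norm_divide)
    also have "... \<le> C * (d powr (1 - real n - b) * (1 / (real M - b) + 1 / (real n + b - 1))) / Gamma (real M - b)"
      by (rule divide_right_mono[OF fin]) (use GM in simp)
    also have "... = K * norm (1 - of_real t * z) powr (1 - real n - b)"
      unfolding K_def dp by simp
    finally show ?thesis using sum1 by simp
  qed
  show ?thesis using K main by blast
qed

text \<open>The bound on the derivatives gives, by the mean value inequality, a Lipschitz bound
  \<open>B y\<close> for the integrand. The remainder quotient is then dominated by 2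
  \<open>B y\<close>, and dominated convergence along sequences applies.\<close>

lemma has_derivative_integral_dominated:
  fixes k :: "'a::{real_normed_vector,perfect_space} \<Rightarrow> 'b \<Rightarrow> 'c::{banach,second_countable_topology}"
  assumes e: "e > 0"
    and deriv: "\<And>x y. x \<in> ball x0 e \<Longrightarrow> y \<in> space M \<Longrightarrow> ((\<lambda>x. k x y) has_derivative k' x y) (at x)"
    and int: "\<And>x. x \<in> ball x0 e \<Longrightarrow> integrable M (k x)"
    and meas: "\<And>v. (\<lambda>y. k' x0 y v) \<in> borel_measurable M"
    and bound: "\<And>x y v. x \<in> ball x0 e \<Longrightarrow> y \<in> space M \<Longrightarrow> norm (k' x y v) \<le> B y * norm v"
    and B: "integrable M B"
  shows "((\<lambda>x. \<integral>y. k x y \<partial>M) has_derivative (\<lambda>v. \<integral>y. k' x0 y v \<partial>M)) (at x0)"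
proof -
  have x0: "x0 \<in> ball x0 e" using e by simp
  have intk': "integrable M (\<lambda>y. k' x0 y v)" for v
    by (rule Bochner_Integration.integrable_bound[of _ "\<lambda>y. B y * norm v"])
      (use B meas bound[OF x0] in \<open>auto intro!: AE_I2 integrable_mult_left intro: order_trans[OF _ abs_ge_self]\<close>)
  have lin: "bounded_linear (k' x0 y)" if "y \<in> space M" for y
    using deriv[OF x0 that] has_derivative_bounded_linear by blast
  have lip: "norm (k (x0 + h) y - k x0 y) \<le> B y * norm h" if "y \<in> space M" "norm h < e" for y h
  proof -
    have "norm (k (x0 + h) y - k x0 y) \<le> B y * norm (x0 + h - x0)"
    proof (rule differentiable_bound[where S = "ball x0 e" and f = "\<lambda>x. k x y" and f' = "\<lambda>x. k' x y"])
      show "((\<lambda>x. k x y) has_derivative k' x y) (at x within ball x0 e)" if "x \<in> ball x0 e" for x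
        using deriv[OF that \<open>y \<in> space M\<close>] has_derivative_at_withinI by blast
      show "onorm (k' x y) \<le> B y" if "x \<in> ball x0 e" for x
        by (rule onorm_le) (rule bound[OF that \<open>y \<in> space M\<close>])
    qed (use that e in \<open>auto simp: dist_norm\<close>)
    then show ?thesis by simp
  qed
  show ?thesis unfolding has_derivative_at
  proof (intro conjI)
    show "bounded_linear (\<lambda>v. \<integral>y. k' x0 y v \<partial>M)"
    proof (rule bounded_linear_intro[where K="\<integral>y. B y \<partial>M"])
      show "(\<integral>y. k' x0 y (u + v) \<partial>M) = (\<integral>y. k' x0 y u \<partial>M) + (\<integral>y. k' x0 y v \<partial>M)" for u v
      proof -
        have "(\<integral>y. k' x0 y (u + v) \<partial>M) = (\<integral>y. k' x0 y u + k' x0 y v \<partial>M)"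
          by (intro Bochner_Integration.integral_cong) (use lin in \<open>auto intro!: linear_add bounded_linear.linear\<close>)
        then show ?thesis using intk' by simp
      qed
      show "(\<integral>y. k' x0 y (r *\<^sub>R v) \<partial>M) = r *\<^sub>R (\<integral>y. k' x0 y v \<partial>M)" for r v
      proof -
        have "(\<integral>y. k' x0 y (r *\<^sub>R v) \<partial>M) = (\<integral>y. r *\<^sub>R k' x0 y v \<partial>M)"
          by (intro Bochner_Integration.integral_cong) (use lin in \<open>auto intro!: linear_scale bounded_linear.linear\<close>)
        then show ?thesis by simp
      qed
      show "norm (\<integral>y. k' x0 y v \<partial>M) \<le> norm v * (\<integral>y. B y \<partial>M)" for v
      proof -
        have "norm (\<integral>y. k' x0 y v \<partial>M) \<le> (\<integral>y. norm (k' x0 y v) \<partial>M)"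
          by (rule Bochner_Integration.integral_norm_bound)
        also have "... \<le> (\<integral>y. B y * norm v \<partial>M)"
          by (rule Bochner_Integration.integral_mono) (use intk' B bound[OF x0] in auto)
        finally show ?thesis by (simp add: mult.commute)
      qed
    qed
    show "(\<lambda>h. norm ((\<integral>y. k (x0 + h) y \<partial>M) - (\<integral>y. k x0 y \<partial>M) - (\<integral>y. k' x0 y h \<partial>M)) / norm h) \<midarrow>0\<rightarrow> 0"
      unfolding tendsto_at_iff_sequentially o_def
    proof (intro allI impI)
      fix X :: "nat \<Rightarrow> 'a" assume X: "\<forall>i. X i \<in> UNIV - {0}" "X \<longlonglongrightarrow> 0"
      \<comment> \<open>The default 0 covers those i for which x0 + X i has not yet entered the ball
        where the bounds hold.\<close>
      define s where "s i y = (if norm (X i) < e then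
         norm (k (x0 + X i) y - k x0 y - k' x0 y (X i)) / norm (X i) else 0)" for i y
      have small: "\<forall>\<^sub>F i in sequentially. norm (X i) < e"
        using X(2) e by (simp add: LIMSEQ_def eventually_sequentially)
      have "(\<lambda>i. \<integral>y. s i y \<partial>M) \<longlonglongrightarrow> (\<integral>y. 0 \<partial>M)"
      proof (rule integral_dominated_convergence[where w = "\<lambda>y. 2 * B y"])
        show "s i \<in> borel_measurable M" for i
        proof (cases "norm (X i) < e")
          case True
          have "integrable M (k (x0 + X i))" "integrable M (k x0)" using int e True by (auto simp: dist_norm)
          then show ?thesis using meas True unfolding s_def by measurable
        qed (simp add: s_def[abs_def])
        show "integrable M (\<lambda>y. 2 * B y)" using B by simp
        show "AE y in M. norm (s i y) \<le> 2 * B y" for i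
        proof (rule AE_I2)
          fix y assume y: "y \<in> space M"
          have Xn: "norm (X i) > 0" using X by auto
          have "0 \<le> norm (k' x0 y (X i))" by simp
          also have "... \<le> B y * norm (X i)" using bound[OF x0 y] .
          finally have B0: "B y \<ge> 0" using Xn by (simp add: zero_le_mult_iff)
          show "norm (s i y) \<le> 2 * B y"
          proof (cases "norm (X i) < e")
            case True
            have "norm (k (x0 + X i) y - k x0 y - k' x0 y (X i)) \<le> norm (k (x0 + X i) y - k x0 y) + norm (k' x0 y (X i))"
              by (rule norm_triangle_ineq4)
            also have "... \<le> B y * norm (X i) + B y * norm (X i)"
              by (intro add_mono lip bound x0 y True)
            finally show ?thesis using True Xn by (simp add: s_def divide_simps)
          qed (use B0 in \<open>simp add: s_def\<close>)
        qed
        show "AE y in M. (\<lambda>i. s i y) \<longlonglongrightarrow> 0"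
        proof (rule AE_I2)
          fix y assume y: "y \<in> space M"
          have "(\<lambda>h. norm (k (x0 + h) y - k x0 y - k' x0 y h) / norm h) \<midarrow>0\<rightarrow> 0"
            using deriv[OF x0 y] unfolding has_derivative_at by simp
          then have "(\<lambda>i. norm (k (x0 + X i) y - k x0 y - k' x0 y (X i)) / norm (X i)) \<longlonglongrightarrow> 0"
            using X unfolding tendsto_at_iff_sequentially o_def by blast
          then show "(\<lambda>i. s i y) \<longlonglongrightarrow> 0"
            by (rule Lim_transform_eventually) (use small in \<open>auto elim!: eventually_mono simp: s_def\<close>)
        qed
      qed simp
      then have "(\<lambda>i. \<integral>y. s i y \<partial>M) \<longlonglongrightarrow> 0" by simp
      then show "(\<lambda>i. norm ((\<integral>y. k (x0 + X i) y \<partial>M) - (\<integral>y. k x0 y \<partial>M) - (\<integral>y. k' x0 y (X i) \<partial>M)) / norm (X i)) \<longlonglongrightarrow> 0"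
      proof (rule Lim_null_comparison[rotated])
        show "\<forall>\<^sub>F i in sequentially. norm (norm ((\<integral>y. k (x0 + X i) y \<partial>M) - (\<integral>y. k x0 y \<partial>M) - (\<integral>y. k' x0 y (X i) \<partial>M)) / norm (X i)) \<le> (\<integral>y. s i y \<partial>M)"
          using small
        proof eventually_elim
          case (elim i)
          have ints: "integrable M (k (x0 + X i))" "integrable M (k x0)" using int e elim by (auto simp: dist_norm)
          have "(\<integral>y. k (x0 + X i) y \<partial>M) - (\<integral>y. k x0 y \<partial>M) - (\<integral>y. k' x0 y (X i) \<partial>M)
              = (\<integral>y. k (x0 + X i) y - k x0 y - k' x0 y (X i) \<partial>M)"
            using ints intk' by simp
          also have "norm ... \<le> (\<integral>y. norm (k (x0 + X i) y - k x0 y - k' x0 y (X i)) \<partial>M)"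
            by (rule integral_norm_bound)
          finally show ?case using elim by (simp add: s_def divide_right_mono)
        qed
      qed
    qed
  qed
qed

section \<open>Harmonic functions\<close>

text \<open>Translation invariance of Lebesgue measure makes the integral of \<open>x \<mapsto> g (x + t e)\<close> constant in \<open>t\<close>.\<close>

lemma integral_directional_derivative_zero:
  fixes g :: "'a::euclidean_space \<Rightarrow> 'c::{banach,second_countable_topology}"
  assumes deriv: "\<And>x. (g has_derivative g' x) (at x)"
    and cont: "continuous_on UNIV (\<lambda>x. g' x e)"
    and supp: "\<And>x. norm x \<ge> r \<Longrightarrow> g x = 0"
  shows "(\<integral>x. g' x e \<partial>lborel) = 0"
proof -
  have contg: "continuous_on UNIV g"
    using deriv has_derivative_continuous continuous_at_imp_continuous_on by blast
  have supp': "g' x e = 0" if "norm x > r" for x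
  proof -
    have "((\<lambda>_. 0) has_derivative g' x) (at x)"
      by (rule has_derivative_transform_within_open[OF deriv, where s = "{x. norm x > r}"])
        (use that supp in \<open>auto intro!: open_Collect_less continuous_intros\<close>)
    then have "g' x = (\<lambda>_. 0)" using has_derivative_unique has_derivative_const by blast
    then show ?thesis by simp
  qed
  have "compact ((\<lambda>x. g' x e) ` cball 0 r)"
    by (intro compact_continuous_image continuous_on_subset[OF cont]) auto
  then obtain C where C: "\<And>x. norm x \<le> r \<Longrightarrow> norm (g' x e) \<le> C" "C > 0"
    using compact_imp_bounded bounded_pos by (metis (no_types, lifting) imageI mem_cball_0)
  have C': "norm (g' x e) \<le> C" for x
    using C supp'[of x] by (cases "norm x \<le> r") auto
  \<comment> \<open>Large enough to contain every translate of the support by t e with |t| <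
    1.\<close>
  define r' where "r' = r + norm e"
  have intg: "integrable lborel g"
  proof -
    have "integrable lborel (\<lambda>x. indicator (cball 0 r) x *\<^sub>R g x)"
      by (rule borel_integrable_compact) (auto intro: continuous_on_subset[OF contg])
    moreover have "indicator (cball 0 r) x *\<^sub>R g x = g x" for x
      using supp[of x] by (auto simp: indicator_def)
    ultimately show ?thesis by simp
  qed
  have "((\<lambda>t. \<integral>x. g (x + t *\<^sub>R e) \<partial>lborel) has_derivative (\<lambda>t. \<integral>x. g' (x + 0 *\<^sub>R e) (t *\<^sub>R e) \<partial>lborel)) (at 0)"
  proof (rule has_derivative_integral_dominated[where e = 1 and B = "\<lambda>x. C * indicator (cball 0 r') x" and k' = "\<lambda>t x s. g' (x + t *\<^sub>R e) (s *\<^sub>R e)"])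
    show "((\<lambda>t. g (x + t *\<^sub>R e)) has_derivative (\<lambda>s. g' (x + t *\<^sub>R e) (s *\<^sub>R e))) (at t)" for x t
      by (rule has_derivative_compose[of "\<lambda>t. x + t *\<^sub>R e" "\<lambda>s. s *\<^sub>R e" _ UNIV g, OF _ deriv])
        (auto intro!: derivative_eq_intros)
    show "integrable lborel (\<lambda>x. g (x + t *\<^sub>R e))" for t
    proof -
      have "integrable (distr lborel borel ((+) (t *\<^sub>R e))) g" using intg by (simp add: lborel_distr_plus)
      then show ?thesis
        by (subst (asm) integrable_distr_eq) (use borel_measurable_continuous_onI[OF contg] in \<open>auto simp: add.commute\<close>)
    qed
    have lin: "g' x (s *\<^sub>R e) = s *\<^sub>R g' x e" for s x
      using deriv[of x] has_derivative_bounded_linear linear_scale bounded_linear.linear by blast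
    show "(\<lambda>y. g' (y + 0 *\<^sub>R e) (v *\<^sub>R e)) \<in> borel_measurable lborel" for v
      using borel_measurable_continuous_onI[OF cont] unfolding lin by simp
    show "norm (g' (y + x *\<^sub>R e) (v *\<^sub>R e)) \<le> C * indicator (cball 0 r') y * norm v" if "x \<in> ball 0 1" for x y v
    proof (cases "norm y \<le> r'")
      case True
      then show ?thesis using C'[of "y + x *\<^sub>R e"] by (simp add: lin mult.commute[of C] mult_left_mono)
    next
      case False
      have "norm (x *\<^sub>R e) \<le> norm e" using that by (simp add: mult_left_le_one_le)
      then have "norm (y + x *\<^sub>R e) > r" using False norm_diff_ineq[of y "x *\<^sub>R e"] unfolding r'_def by linarith
      then show ?thesis using C(2) by (simp add: lin supp')
    qed
    show "integrable lborel (\<lambda>x. C * indicator (cball 0 r') x :: real)"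
      by (intro integrable_mult_right integrable_real_indicator emeasure_bounded_finite) auto
  qed auto
  moreover have "(\<integral>x. g (x + t *\<^sub>R e) \<partial>lborel) = (\<integral>x. g x \<partial>lborel)" for t
  proof -
    have "(\<integral>x. g x \<partial>lborel) = (\<integral>x. g x \<partial>distr lborel borel ((+) (t *\<^sub>R e)))" by (simp add: lborel_distr_plus)
    also have "... = (\<integral>x. g (t *\<^sub>R e + x) \<partial>lborel)"
      by (rule integral_distr) (use borel_measurable_continuous_onI[OF contg] in auto)
    finally show ?thesis by (simp add: add.commute)
  qed
  ultimately have "((\<lambda>t::real. \<integral>x. g x \<partial>lborel) has_derivative (\<lambda>t. \<integral>x. g' x (t *\<^sub>R e) \<partial>lborel)) (at 0)" by simp
  then have "(\<lambda>t::real. \<integral>x. g' x (t *\<^sub>R e) \<partial>lborel) = (\<lambda>_. 0)" using has_derivative_unique has_derivative_const by blast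
  from fun_cong[OF this, of 1] show ?thesis by simp
qed

text \<open>A radial weight of finite smoothness with support in the closed ball. Its gradient is a
  multiple of y times the weight with exponent one lower, so Green's formula against it involves
  radial derivatives only, and no boundary integral arises.\<close>

definition bump :: "real \<Rightarrow> nat \<Rightarrow> 'a::euclidean_space \<Rightarrow> real" where
  "bump R N y = (max 0 (R\<^sup>2 - (norm y)\<^sup>2)) ^ N"

lemma has_field_derivative_positive_part_power:
  fixes t :: real
  assumes "N \<ge> 1"
  shows "((\<lambda>t. (max 0 t) ^ Suc N) has_field_derivative (of_nat (Suc N) * (max 0 t) ^ N)) (at t)"
proof -
  consider "t > 0" | "t < 0" | "t = 0" by linarith
  then show ?thesis
  proof cases
    case 1
    have "((\<lambda>t. t ^ Suc N) has_field_derivative (of_nat (Suc N) * (max 0 t) ^ N)) (at t)"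
      using DERIV_pow[of "Suc N" t UNIV] 1 by simp
    then show ?thesis
      by (rule has_field_derivative_transform_within_open[of _ _ _ "{0<..}"]) (use 1 in auto)
  next
    case 2
    have "((\<lambda>t. 0) has_field_derivative (of_nat (Suc N) * (max 0 t) ^ N)) (at t)"
      using 2 assms by (auto intro!: derivative_eq_intros simp: power_0_left)
    then show ?thesis
      by (rule has_field_derivative_transform_within_open[of _ _ _ "{..<0}"]) (use 2 in auto)
  next
    case 3
    have "(\<lambda>h. (max 0 h) ^ Suc N / h) \<midarrow>0\<rightarrow> (0::real)"
    proof (rule Lim_null_comparison)
      show "\<forall>\<^sub>F h in at 0. norm ((max 0 h) ^ Suc N / h) \<le> \<bar>h::real\<bar> ^ N"
      proof (rule always_eventually, rule allI)
        fix h :: real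
        have "\<bar>max 0 h\<bar> ^ Suc N \<le> \<bar>h\<bar> ^ Suc N" by (intro power_mono) auto
        then show "norm ((max 0 h) ^ Suc N / h) \<le> \<bar>h\<bar> ^ N"
          by (cases "h = 0") (auto simp: power_abs divide_simps abs_mult mult.commute)
      qed
      have "(\<lambda>h::real. \<bar>h\<bar> ^ N) \<midarrow>0\<rightarrow> \<bar>0\<bar> ^ N" by (intro tendsto_intros)
      then show "(\<lambda>h::real. \<bar>h\<bar> ^ N) \<midarrow>0\<rightarrow> 0" using assms by (simp add: power_0_left)
    qed
    then show ?thesis using 3 assms by (simp add: DERIV_def power_0_left)
  qed
qed

lemma has_derivative_bump [derivative_intros]:
  fixes y :: "'a::euclidean_space"
  assumes "N \<ge> 1"
  shows "(bump R (Suc N) has_derivative (\<lambda>v. - (2 * of_nat (Suc N) * bump R N y * (y \<bullet> v)))) (at y)"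
proof -
  have "((\<lambda>y::'a. R\<^sup>2 - (norm y)\<^sup>2) has_derivative (\<lambda>v. - (2 * (y \<bullet> v)))) (at y)"
    unfolding power2_norm_eq_inner by (auto intro!: derivative_eq_intros simp: inner_commute)
  from has_derivative_compose[OF this has_field_derivative_positive_part_power[OF assms, unfolded has_field_derivative_def]]
  show ?thesis unfolding bump_def by (simp add: algebra_simps)
qed

lemma continuous_on_bump [continuous_intros]: "continuous_on S (bump R N)"
  unfolding bump_def by (intro continuous_intros)

lemma bump_eq_0: "0 \<le> R \<Longrightarrow> R \<le> norm y \<Longrightarrow> 1 \<le> N \<Longrightarrow> bump R N y = 0"
  by (simp add: bump_def power_0_left max_def power_mono)

lemma bump_nonneg [simp]: "bump R N y \<ge> 0"
  by (simp add: bump_def)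

lemma bump_pos: "norm y < R \<Longrightarrow> bump R N y > 0"
  using power_strict_mono[of "norm y" R 2] by (auto simp: bump_def)

lemma harmonic_on_subset: "harmonic_on f S \<Longrightarrow> open T \<Longrightarrow> T \<subseteq> S \<Longrightarrow> harmonic_on f T"
proof -
  assume f: "harmonic_on f S" and T: "open T" "T \<subseteq> S"
  from f obtain D1 D2 where D: "\<forall>x\<in>S. (f has_derivative D1 x) (at x)"
      "\<forall>i\<in>Basis. \<forall>x\<in>S. ((\<lambda>y. D1 y i) has_derivative D2 x i) (at x)"
      "\<forall>i\<in>Basis. \<forall>j\<in>Basis. continuous_on S (\<lambda>x. D2 x i j)"
      "\<forall>x\<in>S. (\<Sum>i\<in>Basis. D2 x i i) = 0" unfolding harmonic_on_def by blast
  have c: "continuous_on T (\<lambda>x. D2 x i j)" if "i \<in> Basis" "j \<in> Basis" for i j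
    by (rule continuous_on_subset[of S]) (use D(3) that T in auto)
  show "harmonic_on f T"
    unfolding harmonic_on_def
    by (intro conjI exI[of _ D1] exI[of _ D2] T(1)) (use D(1,2,4) T(2) c in auto)
qed

lemma harmonic_on_imp_continuous_on: "harmonic_on f S \<Longrightarrow> continuous_on S f"
  unfolding harmonic_on_def
  by (elim conjE exE, rule continuous_at_imp_continuous_on, blast intro: has_derivative_continuous)

text \<open>The field bump_(N+1) (f grad h - h grad f) has compact support, so its divergence
  integrates to zero. The Laplacians drop out of the divergence, and the gradient of the weight
  leaves -2 (N+1) bump_N times the radial expression in the conclusion.\<close>

lemma green_bump:
  fixes f h :: "'a::euclidean_space \<Rightarrow> complex"
  assumes R: "0 \<le> R" "R < 1" and N: "N \<ge> 1"
    and f: "harmonic_on f (ball 0 1)" and h: "harmonic_on h (ball 0 1)"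
    and df: "\<And>x. x \<in> ball 0 1 \<Longrightarrow> (f has_derivative f' x) (at x)"
    and dh: "\<And>x. x \<in> ball 0 1 \<Longrightarrow> (h has_derivative h' x) (at x)"
  shows "(\<integral>y. bump R N y *\<^sub>R (f y * h' y y - h y * f' y y) \<partial>lborel) = 0"
proof -
  \<comment> \<open>The second derivatives in \<open>harmonic_on\<close> belong to an existentially
    bound first derivative; uniqueness of derivatives transfers them to the given \<open>f'\<close>
    and \<open>h'\<close>.\<close>
  have *: "\<exists>D2. (\<forall>i\<in>Basis. \<forall>x\<in>ball 0 1. ((\<lambda>y. u' y i) has_derivative D2 x i) (at x)) \<and>
        (\<forall>i\<in>Basis. \<forall>j\<in>Basis. continuous_on (ball 0 1) (\<lambda>x. D2 x i j)) \<and>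
        (\<forall>x\<in>ball 0 1. (\<Sum>i\<in>Basis. D2 x i i) = 0)"
    if "harmonic_on u (ball 0 1)" "\<And>x. x \<in> ball 0 1 \<Longrightarrow> (u has_derivative u' x) (at x)"
    for u :: "'a \<Rightarrow> complex" and u'
  proof -
    from that(1) obtain D1 D2 where D: "\<forall>x\<in>ball 0 1. (u has_derivative D1 x) (at x)"
      "\<forall>i\<in>Basis. \<forall>x\<in>ball 0 1. ((\<lambda>y. D1 y i) has_derivative D2 x i) (at x)"
      "\<forall>i\<in>Basis. \<forall>j\<in>Basis. continuous_on (ball 0 1) (\<lambda>x. D2 x i j)"
      "\<forall>x\<in>ball 0 1. (\<Sum>i\<in>Basis. D2 x i i) = 0" unfolding harmonic_on_def by blast
    have eq: "D1 x = u' x" if "x \<in> ball 0 1" for x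
      using D(1) \<open>\<And>x. x \<in> ball 0 1 \<Longrightarrow> (u has_derivative u' x) (at x)\<close> that has_derivative_unique by blast
    have "((\<lambda>y. u' y i) has_derivative D2 x i) (at x)" if "i \<in> Basis" "x \<in> ball 0 1" for i x
      by (rule has_derivative_transform_within_open[of "\<lambda>y. D1 y i" _ _ _ "ball 0 1"]) (use D(2) that eq in auto)
    then show ?thesis using D by blast
  qed
  obtain f2 where f2: "\<And>i x. i \<in> Basis \<Longrightarrow> x \<in> ball 0 1 \<Longrightarrow> ((\<lambda>y. f' y i) has_derivative f2 x i) (at x)"
      "\<And>i j. i \<in> Basis \<Longrightarrow> j \<in> Basis \<Longrightarrow> continuous_on (ball 0 1) (\<lambda>x. f2 x i j)"
      "\<And>x. x \<in> ball 0 1 \<Longrightarrow> (\<Sum>i\<in>Basis. f2 x i i) = 0" using *[OF f df] by blast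
  obtain h2 where h2: "\<And>i x. i \<in> Basis \<Longrightarrow> x \<in> ball 0 1 \<Longrightarrow> ((\<lambda>y. h' y i) has_derivative h2 x i) (at x)"
      "\<And>i j. i \<in> Basis \<Longrightarrow> j \<in> Basis \<Longrightarrow> continuous_on (ball 0 1) (\<lambda>x. h2 x i j)"
      "\<And>x. x \<in> ball 0 1 \<Longrightarrow> (\<Sum>i\<in>Basis. h2 x i i) = 0" using *[OF h dh] by blast
  have cf: "continuous_on (ball 0 1) f" "continuous_on (ball 0 1) h"
    using f h harmonic_on_imp_continuous_on by auto
  have cf': "continuous_on (ball 0 1) (\<lambda>y. f' y i)" "continuous_on (ball 0 1) (\<lambda>y. h' y i)" if "i \<in> Basis" for i
    by (rule continuous_at_imp_continuous_on, rule ballI, rule has_derivative_continuous, rule f2(1)[OF that], assumption)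
      (rule continuous_at_imp_continuous_on, rule ballI, rule has_derivative_continuous, rule h2(1)[OF that], assumption)
  \<comment> \<open>Components of the field, extended by zero. The extension is differentiable
    everywhere because the weight already vanishes for |y| \<ge> R, and R < 1.\<close>
  define g where "g i y = (if norm y < 1 then bump R (Suc N) y *\<^sub>R (f y * h' y i - h y * f' y i) else 0)" for i y
  define g' where "g' i y v = (if norm y < 1 then
      bump R (Suc N) y *\<^sub>R ((f y * h2 y i v + f' y v * h' y i) - (h y * f2 y i v + h' y v * f' y i))
      + (- (2 * of_nat (Suc N) * bump R N y * (y \<bullet> v))) *\<^sub>R (f y * h' y i - h y * f' y i) else 0)" for i y v
  have zero: "g' i y v = 0" "g i y = 0" if "R < norm y" for i y v
    using that R N by (simp_all add: g'_def g_def bump_eq_0)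
  have g': "(g i has_derivative g' i y) (at y)" if i: "i \<in> Basis" for i y
  proof (cases "norm y < 1")
    case True
    have "((\<lambda>y. bump R (Suc N) y *\<^sub>R (f y * h' y i - h y * f' y i)) has_derivative g' i y) (at y)"
      using True by (auto intro!: derivative_eq_intros df dh f2(1) h2(1) i N simp: g'_def fun_eq_iff)
    then show ?thesis
      by (rule has_derivative_transform_within_open[of _ _ _ _ "ball 0 1"]) (use True in \<open>auto simp: g_def\<close>)
  next
    case False
    then have "R < norm y" using R by simp
    moreover from this have "g' i y = (\<lambda>_. 0)" using zero(1)[of y i] by blast
    then have "((\<lambda>_. 0) has_derivative g' i y) (at y)" by simp
    moreover have "open {y::'a. norm y > R}" by (intro open_Collect_less continuous_intros)
    ultimately show ?thesis
      by (rule_tac has_derivative_transform_within_open[where f = "\<lambda>_. 0" and s = "{y. norm y > R}"])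
        (auto simp: zero(2))
  qed
  have contg': "continuous_on UNIV (\<lambda>y. g' i y i)" if i: "i \<in> Basis" for i
  proof -
    have "continuous_on (ball 0 1) (\<lambda>y. g' i y i) \<longleftrightarrow> continuous_on (ball 0 1) (\<lambda>y. bump R (Suc N) y *\<^sub>R ((f y * h2 y i i + f' y i * h' y i) - (h y * f2 y i i + h' y i * f' y i))
      + (- (2 * of_nat (Suc N) * bump R N y * (y \<bullet> i))) *\<^sub>R (f y * h' y i - h y * f' y i))"
      by (rule continuous_on_cong) (auto simp: g'_def)
    then have 1: "continuous_on (ball 0 1) (\<lambda>y. g' i y i)"
      by (auto intro!: continuous_intros cf cf' f2(2) h2(2) i)
    have "continuous_on {y. norm y > R} (\<lambda>y. g' i y i) \<longleftrightarrow> continuous_on {y. norm y > R} (\<lambda>y::'a. 0::complex)"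
      by (rule continuous_on_cong) (auto simp: zero)
    then have 2: "continuous_on {y. norm y > R} (\<lambda>y. g' i y i)" by simp
    have "continuous_on (ball 0 1 \<union> {y. norm y > R}) (\<lambda>y. g' i y i)"
      by (rule continuous_on_open_Un[OF _ _ 1 2]) (auto intro!: open_Collect_less continuous_intros)
    moreover have "ball 0 1 \<union> {y::'a. norm y > R} = UNIV" using R by auto
    ultimately show ?thesis by simp
  qed
  have int0: "(\<integral>y. g' i y i \<partial>lborel) = 0" if "i \<in> Basis" for i
    by (rule integral_directional_derivative_zero[of "g i" "g' i" _ 1]) (use g' contg' zero R that in auto)
  have ig: "integrable lborel (\<lambda>y. g' i y i)" if "i \<in> Basis" for i
  proof -
    have "integrable lborel (\<lambda>y. indicator (cball 0 1) y *\<^sub>R g' i y i)"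
      by (rule borel_integrable_compact) (auto intro: continuous_on_subset[OF contg'[OF that]])
    moreover have "indicator (cball 0 1) y *\<^sub>R g' i y i = g' i y i" for y
      using zero[of y] R by (auto simp: indicator_def)
    ultimately show ?thesis by simp
  qed
  have eq: "(\<Sum>i\<in>Basis. g' i y i) = - (2 * of_nat (Suc N)) * (bump R N y *\<^sub>R (f y * h' y y - h y * f' y y))" for y
  proof (cases "norm y < 1")
    case True
    have lin: "(\<Sum>i\<in>Basis. (y \<bullet> i) *\<^sub>R u i) = u y" if "linear u" for u :: "'a \<Rightarrow> complex"
    proof -
      have "u y = u (\<Sum>i\<in>Basis. (y \<bullet> i) *\<^sub>R i)" by (simp add: euclidean_representation)
      also have "... = (\<Sum>i\<in>Basis. (y \<bullet> i) *\<^sub>R u i)" using that by (simp add: linear_sum linear_scale)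
      finally show ?thesis by simp
    qed
    have "linear (f' y)" "linear (h' y)"
      using df[of y] dh[of y] True by (auto dest: has_derivative_bounded_linear bounded_linear.linear)
    note L = lin[OF this(1)] lin[OF this(2)]
    have "(\<Sum>i\<in>Basis. g' i y i) = (\<Sum>i\<in>Basis. bump R (Suc N) y *\<^sub>R (f y * h2 y i i - h y * f2 y i i)
       + (- (2 * of_nat (Suc N) * bump R N y)) *\<^sub>R (f y * ((y \<bullet> i) *\<^sub>R h' y i) - h y * ((y \<bullet> i) *\<^sub>R f' y i)))"
      using True by (intro sum.cong) (auto simp: g'_def algebra_simps scaleR_conv_of_real)
    also have "... = bump R (Suc N) y *\<^sub>R (f y * (\<Sum>i\<in>Basis. h2 y i i) - h y * (\<Sum>i\<in>Basis. f2 y i i))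
       + (- (2 * of_nat (Suc N) * bump R N y)) *\<^sub>R (f y * (\<Sum>i\<in>Basis. (y \<bullet> i) *\<^sub>R h' y i) - h y * (\<Sum>i\<in>Basis. (y \<bullet> i) *\<^sub>R f' y i))"
      by (simp only: sum.distrib sum_subtractf scaleR_sum_right sum_distrib_left scaleR_diff_right mult_scaleR_right)
    also have "... = - (2 * of_nat (Suc N)) * (bump R N y *\<^sub>R (f y * h' y y - h y * f' y y))"
    proof -
      have "y \<in> ball 0 1" using True by simp
      then show ?thesis
        by (simp only: L f2(3) h2(3)) (simp add: scaleR_conv_of_real algebra_simps)
    qed
    finally show ?thesis .
  next
    case False
    then have "R < norm y" using R by simp
    then show ?thesis using zero R N by (simp add: bump_eq_0)
  qed
  have "(\<integral>y. (\<Sum>i\<in>Basis. g' i y i) \<partial>lborel) = 0"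
    using int0 ig by (simp add: Bochner_Integration.integral_sum)
  then have "- (2 * of_nat (Suc N)) * (\<integral>y. bump R N y *\<^sub>R (f y * h' y y - h y * f' y y) \<partial>lborel) = 0"
    unfolding eq by (simp only: integral_mult_right_zero)
  then show ?thesis by (simp del: of_nat_Suc)
qed

section \<open>Closure properties of harmonic functions\<close>

lemma harmonic_onE:
  assumes "harmonic_on f S"
  obtains D1 D2 where "open S" "\<And>x. x \<in> S \<Longrightarrow> (f has_derivative D1 x) (at x)"
    "\<And>i x. i \<in> Basis \<Longrightarrow> x \<in> S \<Longrightarrow> ((\<lambda>y. D1 y i) has_derivative D2 x i) (at x)"
    "\<And>i j. i \<in> Basis \<Longrightarrow> j \<in> Basis \<Longrightarrow> continuous_on S (\<lambda>x. D2 x i j)"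
    "\<And>x. x \<in> S \<Longrightarrow> (\<Sum>i\<in>Basis. D2 x i i) = 0"
  using assms unfolding harmonic_on_def by blast

lemma harmonic_onI:
  assumes "open S" "\<And>x. x \<in> S \<Longrightarrow> (f has_derivative D1 x) (at x)"
    "\<And>i x. i \<in> Basis \<Longrightarrow> x \<in> S \<Longrightarrow> ((\<lambda>y. D1 y i) has_derivative D2 x i) (at x)"
    "\<And>i j. i \<in> Basis \<Longrightarrow> j \<in> Basis \<Longrightarrow> continuous_on S (\<lambda>x. D2 x i j)"
    "\<And>x. x \<in> S \<Longrightarrow> (\<Sum>i\<in>Basis. D2 x i i) = 0"
  shows "harmonic_on f S"
  unfolding harmonic_on_def by (intro conjI exI[of _ D1] exI[of _ D2]) (use assms in auto)

lemma harmonic_on_const: "open S \<Longrightarrow> harmonic_on (\<lambda>_. c) S"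
  by (rule harmonic_onI[where ?D1.0 = "\<lambda>_ _. 0" and ?D2.0 = "\<lambda>_ _ _. 0"]) auto

lemma harmonic_on_add:
  assumes "harmonic_on f S" "harmonic_on g S"
  shows "harmonic_on (\<lambda>x. f x + g x) S"
proof -
  obtain D1 D2 where D: "open S" "\<And>x. x \<in> S \<Longrightarrow> (f has_derivative D1 x) (at x)"
    "\<And>i x. i \<in> Basis \<Longrightarrow> x \<in> S \<Longrightarrow> ((\<lambda>y. D1 y i) has_derivative D2 x i) (at x)"
    "\<And>i j. i \<in> Basis \<Longrightarrow> j \<in> Basis \<Longrightarrow> continuous_on S (\<lambda>x. D2 x i j)"
    "\<And>x. x \<in> S \<Longrightarrow> (\<Sum>i\<in>Basis. D2 x i i) = 0" by (rule harmonic_onE[OF assms(1)]) (rule that)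
  obtain E1 E2 where E: "\<And>x. x \<in> S \<Longrightarrow> (g has_derivative E1 x) (at x)"
    "\<And>i x. i \<in> Basis \<Longrightarrow> x \<in> S \<Longrightarrow> ((\<lambda>y. E1 y i) has_derivative E2 x i) (at x)"
    "\<And>i j. i \<in> Basis \<Longrightarrow> j \<in> Basis \<Longrightarrow> continuous_on S (\<lambda>x. E2 x i j)"
    "\<And>x. x \<in> S \<Longrightarrow> (\<Sum>i\<in>Basis. E2 x i i) = 0" by (rule harmonic_onE[OF assms(2)]) (rule that)
  show ?thesis
    by (rule harmonic_onI[where ?D1.0 = "\<lambda>x v. D1 x v + E1 x v" and ?D2.0 = "\<lambda>x i v. D2 x i v + E2 x i v"])
      (auto intro!: D E has_derivative_add continuous_intros simp: sum.distrib D(5) E(4))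
qed

lemma harmonic_on_cmult:
  fixes f :: "'a::euclidean_space \<Rightarrow> complex"
  assumes "harmonic_on f S"
  shows "harmonic_on (\<lambda>x. c * f x) S"
proof -
  obtain D1 D2 where D: "open S" "\<And>x. x \<in> S \<Longrightarrow> (f has_derivative D1 x) (at x)"
    "\<And>i x. i \<in> Basis \<Longrightarrow> x \<in> S \<Longrightarrow> ((\<lambda>y. D1 y i) has_derivative D2 x i) (at x)"
    "\<And>i j. i \<in> Basis \<Longrightarrow> j \<in> Basis \<Longrightarrow> continuous_on S (\<lambda>x. D2 x i j)"
    "\<And>x. x \<in> S \<Longrightarrow> (\<Sum>i\<in>Basis. D2 x i i) = 0" by (rule harmonic_onE[OF assms(1)]) (rule that)
  show ?thesis
    by (rule harmonic_onI[where ?D1.0 = "\<lambda>x v. c * D1 x v" and ?D2.0 = "\<lambda>x i v. c * D2 x i v"])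
      (auto intro!: D has_derivative_mult_right continuous_intros simp: sum_distrib_left[symmetric])
qed

lemma harmonic_on_diff:
  fixes f g :: "'a::euclidean_space \<Rightarrow> complex"
  assumes "harmonic_on f S" "harmonic_on g S"
  shows "harmonic_on (\<lambda>x. f x - g x) S"
  using harmonic_on_add[OF assms(1) harmonic_on_cmult[OF assms(2), of "-1"]] by simp

lemma harmonic_on_sum:
  assumes "open S" "\<And>i. i \<in> I \<Longrightarrow> harmonic_on (f i) S"
  shows "harmonic_on (\<lambda>x. \<Sum>i\<in>I. f i x) S"
  using assms(2)
proof (induction I rule: infinite_finite_induct)
  case (insert i I)
  then show ?case using harmonic_on_add[of "f i" S "\<lambda>x. \<Sum>i\<in>I. f i x"] by simp
qed (auto intro: harmonic_on_const assms(1))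

lemma harmonic_on_cnj:
  fixes f :: "'a::euclidean_space \<Rightarrow> complex"
  assumes "harmonic_on f S"
  shows "harmonic_on (\<lambda>x. cnj (f x)) S"
proof -
  obtain D1 D2 where D: "open S" "\<And>x. x \<in> S \<Longrightarrow> (f has_derivative D1 x) (at x)"
    "\<And>i x. i \<in> Basis \<Longrightarrow> x \<in> S \<Longrightarrow> ((\<lambda>y. D1 y i) has_derivative D2 x i) (at x)"
    "\<And>i j. i \<in> Basis \<Longrightarrow> j \<in> Basis \<Longrightarrow> continuous_on S (\<lambda>x. D2 x i j)"
    "\<And>x. x \<in> S \<Longrightarrow> (\<Sum>i\<in>Basis. D2 x i i) = 0" by (rule harmonic_onE[OF assms(1)]) (rule that)
  show ?thesis
    by (rule harmonic_onI[where ?D1.0 = "\<lambda>x v. cnj (D1 x v)" and ?D2.0 = "\<lambda>x i v. cnj (D2 x i v)"])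
      (auto intro!: D has_derivative_cnj continuous_intros simp: cnj_sum[symmetric] simp del: cnj_sum)
qed

lemma harmonic_on_affine:
  fixes f :: "'a::euclidean_space \<Rightarrow> complex" and s :: real
  assumes f: "harmonic_on f S" and T: "open T" "\<And>y. y \<in> T \<Longrightarrow> x + s *\<^sub>R y \<in> S"
  shows "harmonic_on (\<lambda>y. f (x + s *\<^sub>R y)) T"
proof -
  obtain D1 D2 where D: "\<And>x. x \<in> S \<Longrightarrow> (f has_derivative D1 x) (at x)"
    "\<And>i x. i \<in> Basis \<Longrightarrow> x \<in> S \<Longrightarrow> ((\<lambda>y. D1 y i) has_derivative D2 x i) (at x)"
    "\<And>i j. i \<in> Basis \<Longrightarrow> j \<in> Basis \<Longrightarrow> continuous_on S (\<lambda>x. D2 x i j)"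
    "\<And>x. x \<in> S \<Longrightarrow> (\<Sum>i\<in>Basis. D2 x i i) = 0" by (rule harmonic_onE[OF f]) (rule that)
  have comp: "((\<lambda>y. g (x + s *\<^sub>R y)) has_derivative (\<lambda>v. s *\<^sub>R g' v)) (at y)"
    if g: "(g has_derivative g') (at (x + s *\<^sub>R y))" for g :: "'a \<Rightarrow> complex" and g' y
  proof -
    have "((\<lambda>y. x + s *\<^sub>R y) has_derivative (\<lambda>v. s *\<^sub>R v)) (at y)" by (auto intro!: derivative_eq_intros)
    from has_derivative_compose[OF this g] show ?thesis
      by (simp add: linear_scale[OF bounded_linear.linear[OF has_derivative_bounded_linear[OF g]]])
  qed
  show ?thesis
  proof (rule harmonic_onI[where ?D1.0 = "\<lambda>y v. s *\<^sub>R D1 (x + s *\<^sub>R y) v" and ?D2.0 = "\<lambda>y i v. s *\<^sub>R s *\<^sub>R D2 (x + s *\<^sub>R y) i v"])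
    show "((\<lambda>y. f (x + s *\<^sub>R y)) has_derivative (\<lambda>v. s *\<^sub>R D1 (x + s *\<^sub>R y) v)) (at y)" if "y \<in> T" for y
      by (rule comp, rule D(1), rule T(2)[OF that])
    show "((\<lambda>y. s *\<^sub>R D1 (x + s *\<^sub>R y) i) has_derivative (\<lambda>v. s *\<^sub>R s *\<^sub>R D2 (x + s *\<^sub>R y) i v)) (at y)"
      if "i \<in> Basis" "y \<in> T" for i y
      by (rule has_derivative_scaleR_right, rule comp, rule D(2), rule that, rule T(2)[OF that(2)])
    show "continuous_on T (\<lambda>y. s *\<^sub>R s *\<^sub>R D2 (x + s *\<^sub>R y) i j)" if "i \<in> Basis" "j \<in> Basis" for i j
      by (intro continuous_intros continuous_on_compose2[OF D(3)[OF that]]) (use T(2) in auto)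
    show "(\<Sum>i\<in>Basis. s *\<^sub>R s *\<^sub>R D2 (x + s *\<^sub>R y) i i) = 0" if "y \<in> T" for y
      using D(4)[OF T(2)[OF that]] by (simp add: scaleR_sum_right[symmetric])
  qed (rule T(1))
qed

section \<open>Dilations, mean values and sub-mean values\<close>

lemma integral_bump_restrict:
  fixes g :: "'a::euclidean_space \<Rightarrow> complex"
  assumes "0 \<le> R" "1 \<le> N"
  shows "(\<integral>y. bump R N y *\<^sub>R g y \<partial>lborel) = (\<integral>y. bump R N y *\<^sub>R g y \<partial>restrict_space lborel (cball 0 R))"
proof -
  have "(\<integral>y. bump R N y *\<^sub>R g y \<partial>restrict_space lborel (cball 0 R)) = (\<integral>y. indicator (cball 0 R) y *\<^sub>R (bump R N y *\<^sub>R g y) \<partial>lborel)"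
    by (rule integral_restrict_space) simp
  also have "(\<lambda>y. indicator (cball 0 R) y *\<^sub>R (bump R N y *\<^sub>R g y)) = (\<lambda>y. bump R N y *\<^sub>R g y)"
  proof
    fix y show "indicator (cball 0 R) y *\<^sub>R (bump R N y *\<^sub>R g y) = bump R N y *\<^sub>R g y"
      by (cases "norm y \<le> R") (use assms in \<open>simp_all add: bump_eq_0\<close>)
  qed
  finally show ?thesis by simp
qed

lemma integrable_continuous_cball:
  fixes g :: "'a::euclidean_space \<Rightarrow> 'b::{banach, second_countable_topology}"
  assumes "continuous_on (cball 0 R) g"
  shows "integrable (restrict_space lborel (cball 0 R)) g"
  by (subst integrable_restrict_space) (use assms in \<open>auto intro!: borel_integrable_compact\<close>)

lemma linear_Basis_bound:
  fixes L :: "'a::euclidean_space \<Rightarrow> 'b::real_normed_vector"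
  assumes "linear L" "\<And>i. i \<in> Basis \<Longrightarrow> norm (L i) \<le> C"
  shows "norm (L v) \<le> C * DIM('a) * norm v"
proof -
  have "L v = L (\<Sum>i\<in>Basis. (v \<bullet> i) *\<^sub>R i)" by (simp add: euclidean_representation)
  also have "... = (\<Sum>i\<in>Basis. (v \<bullet> i) *\<^sub>R L i)" using assms(1) by (simp add: linear_sum linear_scale)
  also have "norm ... \<le> (\<Sum>i\<in>(Basis::'a set). C * norm v)"
  proof (rule sum_norm_le)
    fix i :: 'a assume i: "i \<in> Basis"
    have "norm ((v \<bullet> i) *\<^sub>R L i) = \<bar>v \<bullet> i\<bar> * norm (L i)" by simp
    also have "... \<le> norm v * C" using i by (intro mult_mono assms Basis_le_norm) auto
    finally show "norm ((v \<bullet> i) *\<^sub>R L i) \<le> C * norm v" by (simp add: mult.commute)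
  qed
  finally show ?thesis by (simp add: mult_ac)
qed

text \<open>Green's formula for y \<mapsto> f (s y) and h, together with Euler's identity for the
  homogeneous h, gives s \<Phi>'(s) = k \<Phi>(s). Hence s^(-k) \<Phi>(s) is constant on (0, 1].
  Continuity at 0 is recorded for the case k = 0, where it identifies the constant.\<close>

lemma integral_bump_dilation:
  fixes f h :: "'a::euclidean_space \<Rightarrow> complex"
  assumes R: "0 \<le> R" "R < 1" and N: "N \<ge> 1"
    and f: "harmonic_on f (ball 0 1)" and h: "harmonic_on h UNIV"
    and hom: "\<And>c x. h (c *\<^sub>R x) = c ^ k *\<^sub>R h x"
  defines "\<Phi> \<equiv> (\<lambda>s. \<integral>y. bump R N y *\<^sub>R (f (s *\<^sub>R y) * h y) \<partial>lborel)"
  shows "s \<in> {0<..1} \<Longrightarrow> \<Phi> s = of_real s ^ k * \<Phi> 1" and "isCont \<Phi> 0"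
proof -
  define M where "M = restrict_space lborel (cball (0::'a) R)"
  obtain D1 D2 where "open (ball 0 1 :: 'a set)" and D: "\<And>x. x \<in> ball 0 1 \<Longrightarrow> (f has_derivative D1 x) (at x)"
    "\<And>i x. i \<in> Basis \<Longrightarrow> x \<in> ball 0 1 \<Longrightarrow> ((\<lambda>y. D1 y i) has_derivative D2 x i) (at x)"
    "\<And>i j. i \<in> Basis \<Longrightarrow> j \<in> Basis \<Longrightarrow> continuous_on (ball 0 1) (\<lambda>x. D2 x i j)"
    "\<And>x. x \<in> ball 0 1 \<Longrightarrow> (\<Sum>i\<in>Basis. D2 x i i) = 0" by (rule harmonic_onE[OF f]) (rule that)
  obtain h1 h2 where "open (UNIV :: 'a set)" and h1': "\<And>x. x \<in> UNIV \<Longrightarrow> (h has_derivative h1 x) (at x)"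
    "\<And>i x. i \<in> Basis \<Longrightarrow> x \<in> UNIV \<Longrightarrow> ((\<lambda>y. h1 y i) has_derivative h2 x i) (at x)"
    "\<And>i j. i \<in> Basis \<Longrightarrow> j \<in> Basis \<Longrightarrow> continuous_on UNIV (\<lambda>x. h2 x i j)"
    "\<And>x. x \<in> UNIV \<Longrightarrow> (\<Sum>i\<in>Basis. h2 x i i) = 0" by (rule harmonic_onE[OF h]) (rule that)
  have h1: "\<And>x. (h has_derivative h1 x) (at x)" using h1' by simp
  have cf: "continuous_on (ball 0 1) f" using f by (rule harmonic_on_imp_continuous_on)
  have ch: "continuous_on T h" for T
    using harmonic_on_imp_continuous_on[OF h] continuous_on_subset by blast
  have cD: "continuous_on (ball 0 1) (\<lambda>y. D1 y i)" if "i \<in> Basis" for i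
    by (rule continuous_at_imp_continuous_on) (use D(2)[OF that] has_derivative_continuous in blast)
  have linD: "linear (D1 x)" if "x \<in> ball 0 1" for x
    using D(1)[OF that] by (auto dest: has_derivative_bounded_linear bounded_linear.linear)
  \<comment> \<open>With this margin around [0, 1] the points s y stay within (2 - R) R = 1 - (1 -
    R)^2 < 1, so differentiation in s is legitimate also at the endpoints.\<close>
  define e where "e = 1 - R"
  have e: "e > 0" using R by (simp add: e_def)
  define R' where "R' = (1 + e) * R"
  have "R' < 1" 
  proof -
    have "1 - R' = (1 - R) * (1 - R)" by (simp add: R'_def e_def algebra_simps)
    moreover have "(1 - R) * (1 - R) > 0" using R by simp
    ultimately show ?thesis by linarith
  qed
  have sy: "norm (s *\<^sub>R y) \<le> R'" if "s0 \<in> {0..1}" "s \<in> ball s0 e" "norm y \<le> R" for s s0 and y :: 'a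
  proof -
    have "\<bar>s\<bar> \<le> 1 + e" using that by (auto simp: dist_real_def)
    then have "\<bar>s\<bar> * norm y \<le> (1 + e) * R" using that e by (intro mult_mono) auto
    then show ?thesis by (simp add: R'_def)
  qed
  have syb: "s *\<^sub>R y \<in> ball 0 1" if "s0 \<in> {0..1}" "s \<in> ball s0 e" "norm y \<le> R" for s s0 and y :: 'a
    using sy[OF that] \<open>R' < 1\<close> by simp
  have "\<exists>C. \<forall>i\<in>Basis. \<forall>z\<in>cball 0 R'. norm (D1 z i) \<le> C"
  proof -
    have "\<forall>i\<in>(Basis::'a set). \<exists>C. \<forall>z\<in>cball 0 R'. norm (D1 z i) \<le> C"
    proof
      fix i :: 'a assume i: "i \<in> Basis"
      have "compact ((\<lambda>z. D1 z i) ` cball 0 R')"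
        by (intro compact_continuous_image continuous_on_subset[OF cD[OF i]]) (use \<open>R' < 1\<close> in auto)
      then show "\<exists>C. \<forall>z\<in>cball 0 R'. norm (D1 z i) \<le> C"
        using compact_imp_bounded bounded_iff by (metis imageI)
    qed
    then obtain C where C: "\<And>i z. i \<in> (Basis::'a set) \<Longrightarrow> z \<in> cball 0 R' \<Longrightarrow> norm (D1 z i) \<le> C i" by metis
    show ?thesis
    proof (intro exI ballI)
      fix i z :: 'a assume "i \<in> Basis" "z \<in> cball 0 R'"
      then have "norm (D1 z i) \<le> C i" using C by blast
      also have "... \<le> (\<Sum>i\<in>Basis. \<bar>C i\<bar>)"
        using member_le_sum[of i Basis "\<lambda>i. \<bar>C i\<bar>"] \<open>i \<in> Basis\<close> abs_ge_self[of "C i"] by fastforce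
      finally show "norm (D1 z i) \<le> (\<Sum>i\<in>Basis. \<bar>C i\<bar>)" .
    qed
  qed
  then obtain C where C: "\<And>i z. i \<in> Basis \<Longrightarrow> z \<in> cball 0 R' \<Longrightarrow> norm (D1 z i) \<le> C" by blast
  have Phi: "\<Phi> s = (\<integral>y. bump R N y *\<^sub>R (f (s *\<^sub>R y) * h y) \<partial>M)" for s
    unfolding \<Phi>_def M_def by (rule integral_bump_restrict) (use R N in auto)
  have intM: "integrable M g" if "continuous_on (cball 0 R) g" for g :: "'a \<Rightarrow> complex"
    unfolding M_def using that by (rule integrable_continuous_cball)
  have intM': "integrable M g" if "continuous_on (cball 0 R) g" for g :: "'a \<Rightarrow> real"
    unfolding M_def using that by (rule integrable_continuous_cball)
  have der: "(\<Phi> has_derivative (\<lambda>v. \<integral>y. bump R N y *\<^sub>R (v *\<^sub>R D1 (s0 *\<^sub>R y) y * h y) \<partial>M)) (at s0)" if s0: "s0 \<in> {0..1}" for s0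
    unfolding Phi[abs_def]
  proof (rule has_derivative_integral_dominated[where e = e and B = "\<lambda>y. bump R N y * (C * DIM('a) * norm y * norm (h y))" and k' = "\<lambda>s y v. bump R N y *\<^sub>R (v *\<^sub>R D1 (s *\<^sub>R y) y * h y)"])
    fix s assume s: "s \<in> ball s0 e"
    show "integrable M (\<lambda>y. bump R N y *\<^sub>R (f (s *\<^sub>R y) * h y))"
      by (intro intM continuous_intros continuous_on_compose2[OF cf] ch) (use syb[OF s0 s] in auto)
    fix y assume "y \<in> space M"
    then have y: "norm y \<le> R" by (simp add: M_def space_restrict_space)
    have b: "s *\<^sub>R y \<in> ball 0 1" by (rule syb[OF s0 s y])
    have "((\<lambda>s. s *\<^sub>R y) has_derivative (\<lambda>v. v *\<^sub>R y)) (at s)" by (auto intro!: derivative_eq_intros)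
    from has_derivative_compose[OF this D(1)[OF b]]
    have "((\<lambda>s. f (s *\<^sub>R y)) has_derivative (\<lambda>v. v *\<^sub>R D1 (s *\<^sub>R y) y)) (at s)"
      using linD[OF b] by (simp add: linear_scale)
    from has_derivative_scaleR_right[OF has_derivative_mult_left[OF this, of "h y"], of "bump R N y"]
    show "((\<lambda>s. bump R N y *\<^sub>R (f (s *\<^sub>R y) * h y)) has_derivative (\<lambda>v. bump R N y *\<^sub>R (v *\<^sub>R D1 (s *\<^sub>R y) y * h y))) (at s)" .
    fix v :: real
    have "norm (D1 (s *\<^sub>R y) y) \<le> C * DIM('a) * norm y"
      by (rule linear_Basis_bound[OF linD[OF b]]) (use C sy[OF s0 s y] in auto)
    then have "\<bar>v\<bar> * (bump R N y * (norm (D1 (s *\<^sub>R y) y) * norm (h y))) \<le> \<bar>v\<bar> * (bump R N y * (C * DIM('a) * norm y * norm (h y)))"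
      by (intro mult_left_mono mult_right_mono) auto
    then show "norm (bump R N y *\<^sub>R (v *\<^sub>R D1 (s *\<^sub>R y) y * h y)) \<le> bump R N y * (C * DIM('a) * norm y * norm (h y)) * norm v"
      by (simp add: norm_mult abs_mult mult_ac)
  next
    fix v :: real
    have "continuous_on (cball 0 R) (\<lambda>y. D1 (s0 *\<^sub>R y) y)"
    proof -
      have "continuous_on (cball 0 R) (\<lambda>y. \<Sum>i\<in>Basis. (y \<bullet> i) *\<^sub>R D1 (s0 *\<^sub>R y) i)"
        by (intro continuous_intros continuous_on_compose2[OF cD]) (use syb[OF s0 centre_in_ball[THEN iffD2, OF e]] in auto)
      then show ?thesis
      proof (rule continuous_on_eq)
        fix y :: 'a assume y: "y \<in> cball 0 R"
        have l: "linear (D1 (s0 *\<^sub>R y))" using linD syb[OF s0 centre_in_ball[THEN iffD2, OF e]] y by auto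
        have "D1 (s0 *\<^sub>R y) y = D1 (s0 *\<^sub>R y) (\<Sum>i\<in>Basis. (y \<bullet> i) *\<^sub>R i)" by (simp add: euclidean_representation)
        then show "(\<Sum>i\<in>Basis. (y \<bullet> i) *\<^sub>R D1 (s0 *\<^sub>R y) i) = D1 (s0 *\<^sub>R y) y" by (simp add: linear_sum[OF l] linear_scale[OF l])
      qed
    qed
    then have "integrable M (\<lambda>y. bump R N y *\<^sub>R (v *\<^sub>R D1 (s0 *\<^sub>R y) y * h y))"
      by (intro intM continuous_intros ch)
    then show "(\<lambda>y. bump R N y *\<^sub>R (v *\<^sub>R D1 (s0 *\<^sub>R y) y * h y)) \<in> borel_measurable M" by simp
  next
    show "integrable M (\<lambda>y. bump R N y * (C * DIM('a) * norm y * norm (h y)))"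
      by (intro intM' continuous_intros ch)
  qed (rule e)
  show "isCont \<Phi> 0" using der[of 0] has_derivative_continuous by auto
  define \<Psi> where "\<Psi> s = (\<integral>y. bump R N y *\<^sub>R (D1 (s *\<^sub>R y) y * h y) \<partial>M)" for s
  have derf: "(\<Phi> has_vector_derivative \<Psi> s) (at s)" if "s \<in> {0..1}" for s
  proof -
    have "(\<lambda>v. \<integral>y. bump R N y *\<^sub>R (v *\<^sub>R D1 (s *\<^sub>R y) y * h y) \<partial>M) = (\<lambda>v. v *\<^sub>R \<Psi> s)"
    proof
      fix v :: real
      have "(\<integral>y. bump R N y *\<^sub>R (v *\<^sub>R D1 (s *\<^sub>R y) y * h y) \<partial>M) = (\<integral>y. v *\<^sub>R (bump R N y *\<^sub>R (D1 (s *\<^sub>R y) y * h y)) \<partial>M)"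
        by (rule Bochner_Integration.integral_cong) (auto simp: mult.commute)
      then show "(\<integral>y. bump R N y *\<^sub>R (v *\<^sub>R D1 (s *\<^sub>R y) y * h y) \<partial>M) = v *\<^sub>R \<Psi> s"
        unfolding \<Psi>_def by (simp only: Bochner_Integration.integral_scaleR_right)
    qed
    then show ?thesis using der[OF that] unfolding has_vector_derivative_def by simp
  qed
  have euler: "h1 y y = of_nat k * h y" for y
  proof -
    have "((\<lambda>c. c *\<^sub>R y) has_derivative (\<lambda>v. v *\<^sub>R y)) (at 1)" by (auto intro!: derivative_eq_intros)
    from has_derivative_compose[OF this, of h "h1 y"] h1(1)[of y]
    have "((\<lambda>c. h (c *\<^sub>R y)) has_derivative (\<lambda>v. h1 y (v *\<^sub>R y))) (at 1)" by simp
    moreover have "((\<lambda>c. c ^ k *\<^sub>R h y) has_derivative (\<lambda>v. (real k * v) *\<^sub>R h y)) (at 1)"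
      by (auto intro!: derivative_eq_intros)
    ultimately have "(\<lambda>v. h1 y (v *\<^sub>R y)) = (\<lambda>v. (real k * v) *\<^sub>R h y)"
      unfolding hom by (rule has_derivative_unique)
    from fun_cong[OF this, of 1] show ?thesis by (simp add: scaleR_conv_of_real)
  qed
  \<comment> \<open>Green's formula expresses the radial derivative of y \<mapsto> f (s y), which is
    s times the derivative in s, through the radial derivative of h, which is k h.\<close>
  have rel: "s *\<^sub>R \<Psi> s = of_nat k * \<Phi> s" if s: "s \<in> {0<..1}" for s
  proof -
    have s': "s \<in> {0..1}" using s by auto
    note syb' = syb[OF s' centre_in_ball[THEN iffD2, OF e]]
    have b: "s *\<^sub>R y \<in> ball 0 1" if "y \<in> ball 0 1" for y :: 'a
    proof -
      have "s * norm y \<le> 1 * norm y" using s by (intro mult_right_mono) auto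
      then show ?thesis using that s by simp
    qed
    have fs: "harmonic_on (\<lambda>y. f (s *\<^sub>R y)) (ball 0 1)"
      using harmonic_on_affine[OF f open_ball, of 0 1 0 s] b by simp
    have dfs: "((\<lambda>y. f (s *\<^sub>R y)) has_derivative (\<lambda>v. s *\<^sub>R D1 (s *\<^sub>R y) v)) (at y)" if "y \<in> ball 0 1" for y
    proof -
      have "((\<lambda>y. s *\<^sub>R y) has_derivative (\<lambda>v. s *\<^sub>R v)) (at y)" by (auto intro!: derivative_eq_intros)
      from has_derivative_compose[OF this D(1)[OF b[OF that]]]
      show ?thesis using linear_scale[OF linD[OF b[OF that]]] by simp
    qed
    have "(\<integral>y. bump R N y *\<^sub>R (f (s *\<^sub>R y) * h1 y y - h y * (s *\<^sub>R D1 (s *\<^sub>R y) y)) \<partial>lborel) = 0"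
      by (rule green_bump[OF R N fs harmonic_on_subset[OF h] dfs h1(1)]) auto
    then have "0 = (\<integral>y. bump R N y *\<^sub>R (f (s *\<^sub>R y) * h1 y y - h y * (s *\<^sub>R D1 (s *\<^sub>R y) y)) \<partial>M)"
      unfolding M_def by (subst integral_bump_restrict[symmetric]) (use R N in simp_all)
    also have "... = (\<integral>y. of_nat k * (bump R N y *\<^sub>R (f (s *\<^sub>R y) * h y)) - s *\<^sub>R (bump R N y *\<^sub>R (D1 (s *\<^sub>R y) y * h y)) \<partial>M)"
      by (rule Bochner_Integration.integral_cong) (auto simp: euler scaleR_conv_of_real algebra_simps)
    also have "... = of_nat k * \<Phi> s - s *\<^sub>R \<Psi> s"
    proof -
      have "continuous_on (cball 0 R) (\<lambda>y. D1 (s *\<^sub>R y) y)"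
      proof -
        have "continuous_on (cball 0 R) (\<lambda>y. \<Sum>i\<in>Basis. (y \<bullet> i) *\<^sub>R D1 (s *\<^sub>R y) i)"
          by (intro continuous_intros continuous_on_compose2[OF cD]) (use syb' in auto)
        then show ?thesis
        proof (rule continuous_on_eq)
          fix y :: 'a assume y: "y \<in> cball 0 R"
          have l: "linear (D1 (s *\<^sub>R y))" using linD syb' y by auto
          have "D1 (s *\<^sub>R y) y = D1 (s *\<^sub>R y) (\<Sum>i\<in>Basis. (y \<bullet> i) *\<^sub>R i)" by (simp add: euclidean_representation)
          then show "(\<Sum>i\<in>Basis. (y \<bullet> i) *\<^sub>R D1 (s *\<^sub>R y) i) = D1 (s *\<^sub>R y) y" by (simp add: linear_sum[OF l] linear_scale[OF l])
        qed
      qed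
      then have "integrable M (\<lambda>y. bump R N y *\<^sub>R (D1 (s *\<^sub>R y) y * h y))"
        by (intro intM continuous_intros ch)
      then have i1: "integrable M (\<lambda>y. s *\<^sub>R (bump R N y *\<^sub>R (D1 (s *\<^sub>R y) y * h y)))"
        by (intro integrable_scaleR_right)
      have "integrable M (\<lambda>y. bump R N y *\<^sub>R (f (s *\<^sub>R y) * h y))"
        by (intro intM continuous_intros continuous_on_compose2[OF cf] ch) (use syb' in auto)
      then have i2: "integrable M (\<lambda>y. of_nat k * (bump R N y *\<^sub>R (f (s *\<^sub>R y) * h y)))"
        by (intro integrable_mult_right)
      show ?thesis unfolding Phi \<Psi>_def Bochner_Integration.integral_diff[OF i2 i1]
        by (simp only: integral_mult_right_zero Bochner_Integration.integral_scaleR_right)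
    qed
    finally show ?thesis by simp
  qed
  \<comment> \<open>The differential equation says that s^(-k) \<Phi>(s) has derivative zero on (0,
    1].\<close>
  have "\<exists>c. \<forall>s\<in>{0<..1}. inverse (of_real s ^ k) * \<Phi> s = c"
  proof (rule has_derivative_zero_constant)
    fix s :: real assume s: "s \<in> {0<..1}"
    then have s0: "s \<noteq> 0" "s \<in> {0..1}" by auto
    have "((\<lambda>s. inverse (s ^ k)) has_real_derivative - (real k * inverse (s ^ k) * inverse s)) (at s)"
    proof -
      have "((\<lambda>s. inverse (s ^ k)) has_real_derivative - (real k * s ^ (k - Suc 0) * inverse ((s ^ k) ^ Suc (Suc 0)))) (at s)"
        by (rule DERIV_inverse_fun[OF DERIV_pow]) (use s0 in simp)
      also have "real k * s ^ (k - Suc 0) * inverse ((s ^ k) ^ Suc (Suc 0)) = real k * inverse (s ^ k) * inverse s"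
        using s0 by (cases k) (auto simp: field_simps)
      finally show ?thesis .
    qed
    then have "((\<lambda>s. complex_of_real (inverse (s ^ k))) has_vector_derivative of_real (- (real k * inverse (s ^ k) * inverse s))) (at s)"
      by (rule has_vector_derivative_of_real)
    from has_vector_derivative_mult[OF this derf[OF s0(2)]]
    have "((\<lambda>s. complex_of_real (inverse (s ^ k)) * \<Phi> s) has_vector_derivative
       complex_of_real (inverse (s ^ k)) * \<Psi> s + of_real (- (real k * inverse (s ^ k) * inverse s)) * \<Phi> s) (at s)" .
    also have "complex_of_real (inverse (s ^ k)) * \<Psi> s + of_real (- (real k * inverse (s ^ k) * inverse s)) * \<Phi> s
      = of_real (inverse (s ^ k) * inverse s) * (s *\<^sub>R \<Psi> s - of_nat k * \<Phi> s)"
      using s0 by (simp add: scaleR_conv_of_real field_simps)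
    also have "... = 0" using rel[OF s] by simp
    finally show "((\<lambda>s. inverse (of_real s ^ k) * \<Phi> s) has_derivative (\<lambda>h. 0)) (at s within {0<..1})"
      unfolding has_vector_derivative_def by (auto intro: has_derivative_at_withinI)
  qed simp
  then obtain c where c: "\<And>s. s \<in> {0<..1} \<Longrightarrow> inverse (of_real s ^ k) * \<Phi> s = c" by blast
  show "\<Phi> s = of_real s ^ k * \<Phi> 1" if "s \<in> {0<..1}" for s
    using c[OF that] c[of 1] that by (simp add: field_simps)
qed

lemma integral_bump_pos:
  assumes "0 < R" "1 \<le> N"
  shows "(\<integral>y. bump R N (y::'a::euclidean_space) \<partial>lborel) > 0" and "integrable lborel (bump R N :: 'a \<Rightarrow> real)"
proof -
  have "integrable lborel (\<lambda>y. indicator (cball 0 R) y *\<^sub>R bump R N (y::'a))"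
    by (rule borel_integrable_compact) (auto intro: continuous_on_bump)
  moreover have "(\<lambda>y. indicator (cball 0 R) y *\<^sub>R bump R N (y::'a)) = bump R N"
  proof
    fix y :: 'a show "indicator (cball 0 R) y *\<^sub>R bump R N y = bump R N y"
      by (cases "norm y \<le> R") (use assms in \<open>simp_all add: bump_eq_0\<close>)
  qed
  ultimately show i: "integrable lborel (bump R N :: 'a \<Rightarrow> real)" by simp
  have "(\<integral>y. bump R N (y::'a) \<partial>lborel) \<noteq> 0"
  proof
    assume "(\<integral>y. bump R N (y::'a) \<partial>lborel) = 0"
    then have "AE y::'a in lborel. bump R N y = 0"
      using i by (subst (asm) integral_nonneg_eq_0_iff_AE) auto
    then have "AE y::'a in lborel. y \<notin> ball 0 R"
      by (rule eventually_mono) (use bump_pos[of _ R N] in fastforce)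
    then have "emeasure lborel {y::'a. \<not> y \<notin> ball 0 R} = 0" by (subst (asm) AE_iff_measurable[OF _ refl]) auto
    then have "emeasure lborel (ball (0::'a) R) = 0" by (simp only: not_not Collect_mem_eq)
    then have "measure lborel (ball (0::'a) R) = 0" by (simp only: measure_def enn2real_0)
    then show False using content_ball_pos[OF assms(1), of "0::'a"] by simp
  qed
  moreover have "(\<integral>y. bump R N (y::'a) \<partial>lborel) \<ge> 0" by (rule integral_nonneg_AE) auto
  ultimately show "(\<integral>y. bump R N (y::'a) \<partial>lborel) > 0" by linarith
qed

text \<open>The case h = 1, k = 0 of the dilation formula: the integral of bump times f (s y) does
  not depend on s in (0, 1], and s tending to 0 replaces f (s y) by f 0.\<close>

lemma mean_value_bump:
  fixes f :: "'a::euclidean_space \<Rightarrow> complex"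
  assumes R: "0 < R" "R < 1" and N: "N \<ge> 1" and f: "harmonic_on f (ball 0 1)"
  shows "(\<integral>y. bump R N y *\<^sub>R f y \<partial>lborel) = (\<integral>y. bump R N (y::'a) \<partial>lborel) *\<^sub>R f 0"
proof -
  define \<Phi> where "\<Phi> s = (\<integral>y. bump R N y *\<^sub>R (f (s *\<^sub>R y) * 1) \<partial>lborel)" for s
  have *: "\<Phi> s = of_real s ^ 0 * \<Phi> 1" if "s \<in> {0<..1}" for s
    unfolding \<Phi>_def by (rule integral_bump_dilation(1)[OF less_imp_le[OF R(1)] R(2) N f harmonic_on_const]) (use that in auto)
  have "isCont \<Phi> 0"
    unfolding \<Phi>_def by (rule integral_bump_dilation(2)[OF less_imp_le[OF R(1)] R(2) N f harmonic_on_const, of 1 0]) auto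
  moreover have "(\<lambda>n. inverse (real (Suc n))) \<longlonglongrightarrow> 0" by (rule LIMSEQ_inverse_real_of_nat)
  ultimately have "(\<lambda>n. \<Phi> (inverse (real (Suc n)))) \<longlonglongrightarrow> \<Phi> 0" by (rule isCont_tendsto_compose)
  moreover have "\<Phi> (inverse (real (Suc n))) = \<Phi> 1" for n
    using *[of "inverse (real (Suc n))"] by (simp add: field_simps)
  ultimately have "\<Phi> 1 = \<Phi> 0" by (simp add: LIMSEQ_const_iff)
  then show ?thesis using integral_bump_pos(2)[OF R(1) N, where 'a = 'a] by (simp add: \<Phi>_def)
qed

lemma borel_measurable_indicator_ball:
  fixes f :: "'a::euclidean_space \<Rightarrow> 'b::{second_countable_topology, real_normed_vector}"
  assumes "continuous_on (ball x r) f"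
  shows "(\<lambda>y. indicator (ball x r) y *\<^sub>R f y) \<in> borel_measurable borel"
  using assms by (rule borel_measurable_continuous_on_indicator[OF borel_open[OF open_ball]])

lemma borel_measurable_ennreal_indicator_ball:
  fixes f :: "'a::euclidean_space \<Rightarrow> complex"
  assumes "continuous_on (ball x r) f" and g: "g \<in> borel_measurable borel"
  shows "(\<lambda>y. ennreal (g (cmod (f y))) * indicator (ball x r) y) \<in> borel_measurable borel"
proof -
  have "(\<lambda>y. ennreal (g (cmod (f y))) * indicator (ball x r) y)
      = (\<lambda>y. ennreal (g (cmod (indicator (ball x r) y *\<^sub>R f y))) * indicator (ball x r) y)"
    by (auto simp: fun_eq_iff indicator_def)
  moreover have "... \<in> borel_measurable borel"
  proof (rule borel_measurable_times_ennreal)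
    show "(\<lambda>y. ennreal (g (cmod (indicator (ball x r) y *\<^sub>R f y)))) \<in> borel_measurable borel"
      using borel_measurable_indicator_ball[OF assms(1)] g by measurable
  qed (auto intro!: borel_measurable_indicator)
  ultimately show ?thesis by simp
qed

text \<open>The mean value formula on the unit ball, transported to \<open>ball x \<delta>\<close>.
  The weight \<open>bump (1/2) 1\<close> is at most 1 and supported in half the ball, so the
  constant is the reciprocal of its integral.\<close>

lemma submean_value:
  "\<exists>C>0. \<forall>(f :: 'a::euclidean_space \<Rightarrow> complex) x \<delta>. \<delta> > 0 \<longrightarrow> harmonic_on f (ball x \<delta>) \<longrightarrow>
    ennreal (cmod (f x)) \<le> ennreal (C / \<delta> ^ DIM('a)) * (\<integral>\<^sup>+y\<in>ball x \<delta>. ennreal (cmod (f y)) \<partial>lborel)"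
proof -
  define I where "I = (\<integral>y. bump (1/2) 1 (y::'a) \<partial>lborel)"
  have I: "I > 0" unfolding I_def by (rule integral_bump_pos) auto
  have "ennreal (cmod (f x)) \<le> ennreal ((1 / I) / \<delta> ^ DIM('a)) * (\<integral>\<^sup>+y\<in>ball x \<delta>. ennreal (cmod (f y)) \<partial>lborel)"
    if d: "\<delta> > 0" and f: "harmonic_on f (ball x \<delta>)" for f :: "'a \<Rightarrow> complex" and x \<delta>
  proof -
    define g where "g y = f (x + \<delta> *\<^sub>R y)" for y
    have g: "harmonic_on g (ball 0 1)" unfolding g_def
      by (rule harmonic_on_affine[OF f open_ball]) (use d in \<open>auto simp: dist_norm\<close>)
    have cg: "continuous_on (ball 0 1) g" using g by (rule harmonic_on_imp_continuous_on)
    have "I *\<^sub>R g 0 = (\<integral>y. bump (1/2) 1 y *\<^sub>R g y \<partial>lborel)"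
      unfolding I_def by (rule mean_value_bump[symmetric]) (use g in auto)
    also have "... = (\<integral>y. bump (1/2) 1 y *\<^sub>R g y \<partial>restrict_space lborel (cball 0 (1/2)))"
      by (rule integral_bump_restrict) auto
    finally have "ennreal (cmod (I *\<^sub>R g 0)) = ennreal (cmod (\<integral>y. bump (1/2) 1 y *\<^sub>R g y \<partial>restrict_space lborel (cball 0 (1/2))))" by simp
    also have "... \<le> (\<integral>\<^sup>+y. ennreal (cmod (bump (1/2) 1 y *\<^sub>R g y)) \<partial>restrict_space lborel (cball 0 (1/2)))"
      by (intro integral_norm_bound_ennreal integrable_continuous_cball continuous_intros continuous_on_subset[OF cg]) auto
    also have "... = (\<integral>\<^sup>+y. ennreal (cmod (bump (1/2) 1 y *\<^sub>R g y)) * indicator (cball 0 (1/2)) y \<partial>lborel)"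
      by (rule nn_integral_restrict_space) simp
    also have "... \<le> (\<integral>\<^sup>+y. ennreal (cmod (g y)) * indicator (ball 0 1) y \<partial>lborel)"
    proof (rule nn_integral_mono)
      fix y :: 'a
      have "(1 / 2)\<^sup>2 - (norm y)\<^sup>2 \<le> (1 / 2 :: real)\<^sup>2" by simp
      also have "... \<le> 1" by (simp add: power2_eq_square)
      finally have "(max 0 ((1 / 2)\<^sup>2 - (norm y)\<^sup>2)) \<le> (1::real)" by simp
      then have "bump (1/2) 1 y \<le> 1" by (simp add: bump_def)
      then have "bump (1/2) 1 y * cmod (g y) \<le> cmod (g y)" by (simp add: mult_left_le_one_le)
      then show "ennreal (cmod (bump (1/2) 1 y *\<^sub>R g y)) * indicator (cball 0 (1/2)) y \<le> ennreal (cmod (g y)) * indicator (ball 0 1) y"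
        by (auto simp: indicator_def intro!: ennreal_leI)
    qed
    also have "... = (\<integral>\<^sup>+y. ennreal (cmod (f (x + \<delta> *\<^sub>R y))) * indicator (ball x \<delta>) (x + \<delta> *\<^sub>R y) \<partial>lborel)"
      by (intro nn_integral_cong) (use d in \<open>auto simp: g_def indicator_def dist_norm\<close>)
    also have "... = ennreal (1 / \<delta> ^ DIM('a)) * (\<integral>\<^sup>+y\<in>ball x \<delta>. ennreal (cmod (f y)) \<partial>lborel)"
    proof -
      have m: "(\<lambda>y. ennreal (cmod (f y)) * indicator (ball x \<delta>) y) \<in> borel_measurable borel"
        using borel_measurable_ennreal_indicator_ball[OF harmonic_on_imp_continuous_on[OF f], of "\<lambda>t. t"] by simp
      have "(\<integral>\<^sup>+y\<in>ball x \<delta>. ennreal (cmod (f y)) \<partial>lborel) = ennreal (\<delta> ^ DIM('a)) *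
          (\<integral>\<^sup>+y. ennreal (cmod (f (x + \<delta> *\<^sub>R y))) * indicator (ball x \<delta>) (x + \<delta> *\<^sub>R y) \<partial>lborel)"
        using nn_integral_lborel_affine[OF m, of \<delta> x] d by simp
      then show ?thesis using d by (simp add: mult.assoc[symmetric] ennreal_mult[symmetric])
    qed
    finally have "ennreal (1 / I) * ennreal (cmod (I *\<^sub>R g 0)) \<le> ennreal (1 / I) * (ennreal (1 / \<delta> ^ DIM('a)) * (\<integral>\<^sup>+y\<in>ball x \<delta>. ennreal (cmod (f y)) \<partial>lborel))"
      by (rule mult_left_mono) simp
    moreover have "ennreal (1 / I) * ennreal (cmod (I *\<^sub>R g 0)) = ennreal (cmod (f x))"
      using I by (subst ennreal_mult[symmetric]) (auto simp: g_def)
    moreover have "ennreal (1 / I) * (ennreal (1 / \<delta> ^ DIM('a)) * X) = ennreal ((1 / I) / \<delta> ^ DIM('a)) * X" for X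
      using I d by (simp add: mult.assoc[symmetric] ennreal_mult[symmetric])
    ultimately show ?thesis by simp
  qed
  then show ?thesis using I by (intro exI[of _ "1 / I"]) auto
qed

text \<open>The constant is found by maximizing \<open>(\<rho> - |z - x|)\<^bsup>n/p\<^esup> |f z|\<close> over a smaller ball.\<close>

lemma submean_value_powr:
  fixes p :: real
  assumes p: "0 < p" "p \<le> 1"
  shows "\<exists>C>0. \<forall>(f :: 'a::euclidean_space \<Rightarrow> complex) x \<delta>. \<delta> > 0 \<longrightarrow> harmonic_on f (ball x \<delta>) \<longrightarrow>
    ennreal (cmod (f x) powr p) \<le> ennreal (C / \<delta> ^ DIM('a)) * (\<integral>\<^sup>+y\<in>ball x \<delta>. ennreal (cmod (f y) powr p) \<partial>lborel)"
proof -
  let ?n = "real DIM('a)"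
  obtain C where C: "C > 0" "\<And>(f :: 'a \<Rightarrow> complex) x \<delta>. \<delta> > 0 \<Longrightarrow> harmonic_on f (ball x \<delta>) \<Longrightarrow>
    ennreal (cmod (f x)) \<le> ennreal (C / \<delta> ^ DIM('a)) * (\<integral>\<^sup>+y\<in>ball x \<delta>. ennreal (cmod (f y)) \<partial>lborel)"
    using submean_value by blast
  define K where "K = C * 2 powr (?n / p) * 2 ^ DIM('a)"
  have K: "K > 0" using C(1) by (simp add: K_def)
  have "ennreal (cmod (f x) powr p) \<le> ennreal (K / \<delta> ^ DIM('a)) * (\<integral>\<^sup>+y\<in>ball x \<delta>. ennreal (cmod (f y) powr p) \<partial>lborel)"
    if d: "\<delta> > 0" and f: "harmonic_on f (ball x \<delta>)" for f :: "'a \<Rightarrow> complex" and x \<delta>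
  proof (cases "(\<integral>\<^sup>+y\<in>ball x \<delta>. ennreal (cmod (f y) powr p) \<partial>lborel)")
    case top
    then show ?thesis using K d by (simp add: ennreal_mult_top)
  next
    case (real J)
    \<comment> \<open>The closed ball of half the radius lies inside the domain, so
      \<open>\<phi>\<close> attains its maximum there.\<close>
    define \<rho> where "\<rho> = \<delta> / 2"
    have r: "\<rho> > 0" "\<rho> < \<delta>" using d by (auto simp: \<rho>_def)
    have cf: "continuous_on (cball x \<rho>) f"
      using harmonic_on_imp_continuous_on[OF f] r by (rule_tac continuous_on_subset) auto
    define \<phi> where "\<phi> z = (\<rho> - dist x z) powr (?n / p) * cmod (f z)" for z
    have "continuous_on (cball x \<rho>) \<phi>" unfolding \<phi>_def
      by (intro continuous_intros continuous_on_powr' cf) (use p DIM_positive[where 'a='a] in \<open>auto intro!: divide_pos_pos\<close>)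
    then obtain z0 where z0: "z0 \<in> cball x \<rho>" "\<And>z. z \<in> cball x \<rho> \<Longrightarrow> \<phi> z \<le> \<phi> z0"
      using continuous_attains_sup[OF compact_cball, of x \<rho> \<phi>] r by auto
    define M where "M = \<phi> z0"
    have M0: "M \<ge> 0" by (simp add: M_def \<phi>_def)
    have fx: "\<rho> powr (?n / p) * cmod (f x) \<le> M"
      using z0(2)[of x] r by (simp add: M_def \<phi>_def)
    have MJ: "M powr p \<le> C * 2 powr (?n / p) * J"
    proof (cases "M = 0")
      case True
      then show ?thesis using C(1) real p by simp
    next
      case False
      then have Mpos: "M > 0" using M0 by simp
      \<comment> \<open>Half the distance from the maximum point to the sphere of radius
        \<open>\<rho>\<close>. On \<open>ball z0 e\<close> the weight \<rho> - |z - x| is still at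
        least e, and maximality bounds |f| by \<open>B\<close>.\<close>
      define e where "e = (\<rho> - dist x z0) / 2"
      have e: "e > 0" using z0(1) False by (auto simp: e_def M_def \<phi>_def less_le)
      have sub: "ball z0 e \<subseteq> cball x \<rho>" "ball z0 e \<subseteq> ball x \<delta>"
      proof -
        have "dist x z \<le> \<rho>" if "z \<in> ball z0 e" for z
          using that dist_triangle[of x z z0] e unfolding e_def by simp
        then show "ball z0 e \<subseteq> cball x \<rho>" "ball z0 e \<subseteq> ball x \<delta>" using r by force+
      qed
      define B where "B = M * e powr (- ?n / p)"
      have B: "B > 0" using Mpos e by (simp add: B_def)
      \<comment> \<open>|f| = |f|^p |f|^(1-p), where the second factor is controlled by
        \<open>B\<close> since p \<le> 1.\<close>
      have bound: "cmod (f z) \<le> cmod (f z) powr p * B powr (1 - p)" if z: "z \<in> ball z0 e" for z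
      proof (cases "f z = 0")
        case False
        have "e \<le> \<rho> - dist x z" using z dist_triangle[of x z z0] unfolding e_def by simp
        then have "e powr (?n / p) \<le> (\<rho> - dist x z) powr (?n / p)" using e p by (intro powr_mono2) auto
        then have "e powr (?n / p) * cmod (f z) \<le> \<phi> z" unfolding \<phi>_def by (rule mult_right_mono) simp
        also have "... \<le> M" unfolding M_def using z0(2) z sub by blast
        finally have "cmod (f z) \<le> B" using e by (simp add: B_def powr_minus field_simps)
        then have "cmod (f z) powr (1 - p) \<le> B powr (1 - p)" using p by (intro powr_mono2) auto
        then have "cmod (f z) powr p * cmod (f z) powr (1 - p) \<le> cmod (f z) powr p * B powr (1 - p)"
          by (rule mult_left_mono) simp
        then show ?thesis using False by (simp add: powr_add[symmetric])
      qed simp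
      have "ennreal (cmod (f z0)) \<le> ennreal (C / e ^ DIM('a)) * (\<integral>\<^sup>+y\<in>ball z0 e. ennreal (cmod (f y)) \<partial>lborel)"
        by (rule C(2)[OF e harmonic_on_subset[OF f]]) (use sub in auto)
      also have "... \<le> ennreal (C / e ^ DIM('a)) * (\<integral>\<^sup>+y. ennreal (B powr (1 - p)) * (ennreal (cmod (f y) powr p) * indicator (ball x \<delta>) y) \<partial>lborel)"
      proof (intro mult_left_mono nn_integral_mono)
        fix y
        show "ennreal (cmod (f y)) * indicator (ball z0 e) y \<le> ennreal (B powr (1 - p)) * (ennreal (cmod (f y) powr p) * indicator (ball x \<delta>) y)"
        proof (cases "y \<in> ball z0 e")
          case True
          then have "y \<in> ball x \<delta>" using sub by blast
          then show ?thesis using bound[OF True] True by (simp add: ennreal_mult[symmetric] mult.commute ennreal_leI)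
        qed simp
      qed simp
      also have "... = ennreal (C / e ^ DIM('a)) * (ennreal (B powr (1 - p)) * ennreal J)"
      proof (subst nn_integral_cmult)
        show "(\<lambda>y. ennreal (cmod (f y) powr p) * indicator (ball x \<delta>) y) \<in> borel_measurable lborel"
          using borel_measurable_ennreal_indicator_ball[OF harmonic_on_imp_continuous_on[OF f], of "\<lambda>t. t powr p"] by simp
      qed (simp add: real)
      also have "... = ennreal (C / e ^ DIM('a) * (B powr (1 - p) * J))"
        using C(1) e real by (simp add: ennreal_mult[symmetric])
      finally have 1: "cmod (f z0) \<le> C / e ^ DIM('a) * (B powr (1 - p) * J)"
        using C(1) e real by (subst (asm) ennreal_le_iff) auto
      have e2: "\<rho> - dist x z0 = 2 * e" by (simp add: e_def)
      have "M = (2 * e) powr (?n / p) * cmod (f z0)" unfolding M_def \<phi>_def e2 ..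
      also have "... \<le> (2 * e) powr (?n / p) * (C / e ^ DIM('a) * (B powr (1 - p) * J))"
        by (rule mult_left_mono[OF 1]) simp
      also have "... = C * 2 powr (?n / p) * J * (e powr (?n / p) * e powr (- ?n) * B powr (1 - p))"
        using e by (simp add: powr_mult powr_minus powr_realpow divide_inverse mult_ac)
      also have "B powr (1 - p) = M powr (1 - p) * e powr (- ?n / p * (1 - p))"
        using Mpos e by (simp add: B_def powr_mult powr_powr)
      also have "e powr (?n / p) * e powr (- ?n) * (M powr (1 - p) * e powr (- ?n / p * (1 - p))) = M powr (1 - p) * e powr (?n / p - ?n + (- ?n / p * (1 - p)))"
        by (simp add: powr_add powr_diff powr_minus divide_inverse mult_ac)
      \<comment> \<open>All powers of e cancel, which is why \<open>\<phi>\<close> carries the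
        exponent n/p. What remains is M \<le> const J M^(1-p).\<close>
      also have "?n / p - ?n + (- ?n / p * (1 - p)) = 0" using p by (simp add: field_simps)
      finally have "M \<le> C * 2 powr (?n / p) * J * M powr (1 - p)" using e by simp
      then have "M powr p * M powr (1 - p) \<le> C * 2 powr (?n / p) * J * M powr (1 - p)"
        using Mpos by (simp add: powr_add[symmetric])
      then show ?thesis using Mpos by simp
    qed
    have "(\<rho> powr (?n / p) * cmod (f x)) powr p \<le> M powr p" using fx p by (intro powr_mono2) auto
    also have "(\<rho> powr (?n / p) * cmod (f x)) powr p = \<rho> ^ DIM('a) * cmod (f x) powr p"
      using r p by (simp add: powr_mult powr_powr powr_realpow)
    finally have "\<rho> ^ DIM('a) * cmod (f x) powr p \<le> C * 2 powr (?n / p) * J" using MJ by simp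
    then have "cmod (f x) powr p \<le> K / \<delta> ^ DIM('a) * J"
      using d unfolding \<rho>_def K_def by (simp add: power_divide field_simps)
    then have "ennreal (cmod (f x) powr p) \<le> ennreal (K / \<delta> ^ DIM('a) * J)" by (rule ennreal_leI)
    also have "... = ennreal (K / \<delta> ^ DIM('a)) * ennreal J" using K d real by (intro ennreal_mult) auto
    finally show ?thesis using real by simp
  qed
  then show ?thesis using K by blast
qed

text \<open>With Q and P the primitives of q and r^2 q, the hypothesis reads R^2 Q(R) = P(R).
  Differentiating gives 2 R Q(R) = 0, and differentiating Q = 0 gives q = 0.\<close>

lemma volterra_zero:
  fixes q :: "real \<Rightarrow> complex"
  assumes cont: "continuous_on {0..<1} q"
    and zero: "\<And>R. R \<in> {0<..<1} \<Longrightarrow> integral {0..R} (\<lambda>r. (R\<^sup>2 - r\<^sup>2) *\<^sub>R q r) = 0"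
    and r: "r \<in> {0<..<1}"
  shows "q r = 0"
proof -
  have der: "((\<lambda>u. integral {0..u} h) has_vector_derivative h x) (at x)"
    if h: "continuous_on {0..<1} h" and x: "x \<in> {0<..<1}" for h :: "real \<Rightarrow> complex" and x
  proof -
    define b where "b = (1 + x) / 2"
    have b: "x < b" "b < 1" using x by (auto simp: b_def)
    have "((\<lambda>u. integral {0..u} h) has_vector_derivative h x) (at x within {0..b})"
      by (rule integral_has_vector_derivative) (use x b h in \<open>auto intro: continuous_on_subset\<close>)
    moreover have "at x within {0..b} = at x" using x b by (intro at_within_interior) auto
    ultimately show ?thesis by simp
  qed
  have c2: "continuous_on {0..<1} (\<lambda>r. r\<^sup>2 *\<^sub>R q r)" by (intro continuous_intros cont)
  define Q where "Q u = integral {0..u} q" for u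
  define P where "P u = integral {0..u} (\<lambda>r. r\<^sup>2 *\<^sub>R q r)" for u
  have eq: "R\<^sup>2 *\<^sub>R Q R = P R" if R: "R \<in> {0<..<1}" for R
  proof -
    have i: "q integrable_on {0..R}" "(\<lambda>r. r\<^sup>2 *\<^sub>R q r) integrable_on {0..R}"
      using cont c2 R by (auto intro!: integrable_continuous_interval intro: continuous_on_subset)
    have "0 = integral {0..R} (\<lambda>r. R\<^sup>2 *\<^sub>R q r - r\<^sup>2 *\<^sub>R q r)"
      using zero[OF R] by (simp add: scaleR_diff_left)
    also have "... = R\<^sup>2 *\<^sub>R Q R - P R"
      unfolding Q_def P_def using i by (subst integral_diff) (auto simp: integrable_cmul)
    finally show ?thesis by simp
  qed
  have Q0: "Q R = 0" if R: "R \<in> {0<..<1}" for R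
  proof -
    have "((\<lambda>u. u\<^sup>2 *\<^sub>R Q u) has_vector_derivative (R\<^sup>2 *\<^sub>R q R + (2 * R) *\<^sub>R Q R)) (at R)"
      using has_vector_derivative_scaleR[of "\<lambda>u. u\<^sup>2" "2 * R" R UNIV Q "q R"] der[OF cont R]
      unfolding Q_def by (auto intro!: derivative_eq_intros)
    moreover have "((\<lambda>u. u\<^sup>2 *\<^sub>R Q u) has_vector_derivative R\<^sup>2 *\<^sub>R q R) (at R)"
      using has_vector_derivative_transform_within_open[OF der[OF c2 R] open_greaterThanLessThan R, of "\<lambda>u. u\<^sup>2 *\<^sub>R Q u"] eq
      unfolding P_def by simp
    ultimately have "R\<^sup>2 *\<^sub>R q R + (2 * R) *\<^sub>R Q R = R\<^sup>2 *\<^sub>R q R" by (rule vector_derivative_unique_at)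
    then show ?thesis using R by simp
  qed
  have "((\<lambda>u. 0) has_vector_derivative q r) (at r)"
    using has_vector_derivative_transform_within_open[OF der[OF cont r] open_greaterThanLessThan r, of "\<lambda>u. 0"] Q0
    unfolding Q_def by simp
  then show ?thesis using has_vector_derivative_const[of 0] vector_derivative_unique_at by blast
qed

section \<open>Spherical harmonic expansions\<close>

lemma integral_radial_bump:
  fixes m :: "real \<Rightarrow> complex"
  assumes mm[measurable]: "m \<in> borel_measurable borel" and cm: "continuous_on {0..<1} m" and R: "R \<in> {0<..<1}"
  shows "(LINT r|radial_measure n. (max 0 (R\<^sup>2 - r\<^sup>2) * r ^ k) *\<^sub>R m r)
    = integral {0..R} (\<lambda>r. (R\<^sup>2 - r\<^sup>2) *\<^sub>R ((real n * r ^ (n - 1) * r ^ k) *\<^sub>R m r))"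
proof -
  let ?q = "\<lambda>r. (R\<^sup>2 - r\<^sup>2) *\<^sub>R ((real n * r ^ (n - 1) * r ^ k) *\<^sub>R m r)"
  have rad: "radial_measure n = density lborel (\<lambda>r. ennreal (real n * r ^ (n - 1) * indicator {0<..<1} r))"
    unfolding radial_measure_def
    by (intro arg_cong[where f = "density lborel"] ext) (auto simp: indicator_def)
  have "(LINT r|radial_measure n. (max 0 (R\<^sup>2 - r\<^sup>2) * r ^ k) *\<^sub>R m r)
     = (LINT r|lborel. (real n * r ^ (n - 1) * indicator {0<..<1} r) *\<^sub>R ((max 0 (R\<^sup>2 - r\<^sup>2) * r ^ k) *\<^sub>R m r))"
    unfolding rad by (subst integral_density) (auto simp: indicator_def)
  also have "... = (LINT r|lborel. indicator {0..R} r *\<^sub>R ?q r)"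
  proof (rule integral_cong_AE)
    show "AE r in lborel. (real n * r ^ (n - 1) * indicator {0<..<1} r) *\<^sub>R ((max 0 (R\<^sup>2 - r\<^sup>2) * r ^ k) *\<^sub>R m r) = indicator {0..R} r *\<^sub>R ?q r"
      using AE_lborel_singleton[of "0::real"]
    proof eventually_elim
      case (elim r)
      show ?case
      proof (cases "0 < r \<and> r < 1")
        case True
        show ?thesis
        proof (cases "r \<le> R")
          case le: True
          then have "r\<^sup>2 \<le> R\<^sup>2" using True by (intro power_mono) auto
          then show ?thesis using True le by (simp add: mult_ac)
        next
          case False
          then have "R\<^sup>2 \<le> r\<^sup>2" using R by (intro power_mono) auto
          then show ?thesis using False by simp
        qed
      next
        case False
        then show ?thesis using elim R by auto
      qed
    qed
  qed measurable
  also have "... = integral {0..R} ?q"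
  proof -
    have "set_integrable lborel {0..R} ?q"
      unfolding set_integrable_def
      by (rule borel_integrable_compact) (use R in \<open>auto intro!: continuous_intros continuous_on_subset[OF cm]\<close>)
    from set_borel_integral_eq_integral(2)[OF this] show ?thesis
      unfolding set_lebesgue_integral_def .
  qed
  finally show ?thesis .
qed

lemma integrable_cone:
  fixes f h :: "'a::euclidean_space \<Rightarrow> complex"
  assumes [measurable]: "f \<in> borel_measurable borel" "h \<in> borel_measurable borel"
    and f: "continuous_on (ball 0 1) f" and h: "continuous_on (sphere 0 1) h" and r: "0 \<le> r" "r < 1"
  shows "integrable cone_measure (\<lambda>u. f (r *\<^sub>R u) * h u)"
proof -
  have sub: "cball 0 r \<subseteq> ball (0::'a) 1" using r by (simp add: cball_subset_ball_iff)
  obtain A where A: "A \<ge> 0" "\<And>y. y \<in> cball 0 r \<Longrightarrow> norm (f y) \<le> A"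
    using continuous_on_compact_bound[OF compact_cball continuous_on_subset[OF f sub]] by blast
  obtain B where B: "B \<ge> 0" "\<And>u. u \<in> sphere 0 1 \<Longrightarrow> norm (h u) \<le> B"
    using continuous_on_compact_bound[OF compact_sphere h] by blast
  note AB = A(2) B(2)
  have "AE u in cone_measure. norm (f (r *\<^sub>R u) * h u) \<le> A * B"
    using AE_cone
  proof eventually_elim
    case (elim u)
    have "norm (f (r *\<^sub>R u)) \<le> A" using elim r by (intro AB) auto
    moreover have "norm (h u) \<le> B" using elim by (intro AB) auto
    ultimately show ?case unfolding norm_mult by (intro mult_mono) (auto intro: order_trans[OF norm_ge_zero])
  qed
  then show ?thesis
    by (intro finite_measure.integrable_const_bound[OF finite_measure_cone, where B = "A * B"]) auto
qed

lemma continuous_on_cone_integral: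
  fixes f h :: "'a::euclidean_space \<Rightarrow> complex"
  assumes fm[measurable]: "f \<in> borel_measurable borel" and hm[measurable]: "h \<in> borel_measurable borel"
    and f: "continuous_on (ball 0 1) f" and h: "continuous_on (sphere 0 1) h"
  shows "continuous_on {0..<1} (\<lambda>r. LINT u|cone_measure. f (r *\<^sub>R u) * h u)"
proof (rule continuous_on_sequentiallyI)
  fix w :: "nat \<Rightarrow> real" and a assume w: "\<forall>n. w n \<in> {0..<1}" and a: "a \<in> {0..<1}" and lim: "w \<longlonglongrightarrow> a"
  have "compact (insert a (range w))" using lim by (rule compact_sequence_with_limit)
  then obtain R where R: "R \<in> insert a (range w)" "\<And>t. t \<in> insert a (range w) \<Longrightarrow> t \<le> R"
    using compact_attains_sup[of "insert a (range w)"] by auto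
  have R1: "0 \<le> R" "R < 1" using R(1) w a by auto
  have sub: "cball 0 R \<subseteq> ball (0::'a) 1" using R1 by (simp add: cball_subset_ball_iff)
  obtain A where A: "A \<ge> 0" "\<And>y. y \<in> cball 0 R \<Longrightarrow> norm (f y) \<le> A"
    using continuous_on_compact_bound[OF compact_cball continuous_on_subset[OF f sub]] by blast
  obtain B where B: "B \<ge> 0" "\<And>u. u \<in> sphere 0 1 \<Longrightarrow> norm (h u) \<le> B"
    using continuous_on_compact_bound[OF compact_sphere h] by blast
  note AB = A(2) B(2)
  show "(\<lambda>n. LINT u|cone_measure. f (w n *\<^sub>R u) * h u) \<longlonglongrightarrow> (LINT u|cone_measure. f (a *\<^sub>R u) * h u)"
  proof (rule integral_dominated_convergence[where w = "\<lambda>_. A * B"])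
    show "integrable cone_measure (\<lambda>_::'a. A * B)"
      by (rule finite_measure.integrable_const[OF finite_measure_cone])
    show "AE u in cone_measure. (\<lambda>n. f (w n *\<^sub>R u) * h u) \<longlonglongrightarrow> f (a *\<^sub>R u) * h u"
      using AE_cone
    proof eventually_elim
      case (elim u)
      have "(\<lambda>n. f (w n *\<^sub>R u)) \<longlonglongrightarrow> f (a *\<^sub>R u)"
        by (rule continuous_on_tendsto_compose[OF f]) (use elim a w lim in \<open>auto intro!: tendsto_intros\<close>)
      then show ?case by (intro tendsto_intros)
    qed
    show "AE u in cone_measure. norm (f (w n *\<^sub>R u) * h u) \<le> A * B" for n
      using AE_cone
    proof eventually_elim
      case (elim u)
      have "norm (f (w n *\<^sub>R u)) \<le> A" using elim w R(2)[of "w n"] by (intro AB) auto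
      moreover have "norm (h u) \<le> B" using elim by (intro AB) auto
      ultimately show ?case unfolding norm_mult by (intro mult_mono) (auto intro: order_trans[OF norm_ge_zero])
    qed
  qed measurable
qed

lemma homogeneous_polar:
  assumes "\<And>c x. h (c *\<^sub>R x) = c ^ k *\<^sub>R h x"
  shows "h y = norm y ^ k *\<^sub>R h (sgn (y::'a::real_normed_vector))"
proof -
  have "h (norm y *\<^sub>R sgn y) = norm y ^ k *\<^sub>R h (sgn y)" by (rule assms)
  then show ?thesis by (cases "y = 0") (simp_all add: sgn_div_norm)
qed

text \<open>Green's formula makes the spherical coefficients of a harmonic function homogeneous in the radius.\<close>

lemma cone_coefficient_homogeneous:
  fixes f h :: "'a::euclidean_space \<Rightarrow> complex"
  assumes fm[measurable]: "f \<in> borel_measurable borel" and f: "harmonic_on f (ball 0 1)" and h: "harmonic_on h UNIV"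
    and hom: "\<And>c x. h (c *\<^sub>R x) = c ^ k *\<^sub>R h x"
  shows "\<exists>c. \<forall>r\<in>{0<..<1}. (LINT u|cone_measure. f (r *\<^sub>R u) * h u) = of_real r ^ k * c"
proof -
  define g where "g r = (LINT u|cone_measure. f (r *\<^sub>R u) * h u)" for r
  have cf: "continuous_on (ball 0 1) f" using f by (rule harmonic_on_imp_continuous_on)
  have ch: "continuous_on T h" for T
    using harmonic_on_imp_continuous_on[OF h] continuous_on_subset by blast
  have hm[measurable]: "h \<in> borel_measurable borel" using borel_measurable_continuous_onI[OF ch] .
  interpret C: finite_measure "cone_measure :: 'a measure" by (rule finite_measure_cone)
  have gm[measurable]: "g \<in> borel_measurable borel" unfolding g_def by measurable
  have cg: "continuous_on {0..<1} g" unfolding g_def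
    by (rule continuous_on_cone_integral[OF fm hm cf ch])
  have eq: "g (s * r) = of_real s ^ k * g r" if s: "s \<in> {0<..1}" and r: "r \<in> {0<..<1}" for s r
  proof -
    \<comment> \<open>In polar coordinates the dilation formula with N = 1 says that the weighted
      radial integrals of \<open>m\<close> vanish for every R < 1; \<open>volterra_zero\<close> then
      removes the integration.\<close>
    define m where "m r = g (s * r) - of_real s ^ k * g r" for r
    have mm[measurable]: "m \<in> borel_measurable borel" unfolding m_def by measurable
    have sr: "s * r \<in> {0..<1}" if "r \<in> {0..<1}" for r
    proof -
      have "s * r \<le> 1 * r" using s that by (intro mult_right_mono) auto
      then show ?thesis using that s by auto
    qed
    have cm: "continuous_on {0..<1} m" unfolding m_def
      by (intro continuous_intros cg continuous_on_compose2[OF cg]) (use sr in auto)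
    have zero: "integral {0..R} (\<lambda>r. (R\<^sup>2 - r\<^sup>2) *\<^sub>R ((real DIM('a) * r ^ (DIM('a) - 1) * r ^ k) *\<^sub>R m r)) = 0" if R: "R \<in> {0<..<1}" for R
    proof -
      define F where "F r u = (max 0 (R\<^sup>2 - r\<^sup>2) * r ^ k) *\<^sub>R ((f ((s * r) *\<^sub>R u) - of_real s ^ k * f (r *\<^sub>R u)) * h u)" for r u
      have Fm: "(\<lambda>(r, u). F r u) \<in> borel_measurable (borel \<Otimes>\<^sub>M borel)" unfolding F_def by measurable
      have F: "F (norm y) (sgn y) = bump R 1 y *\<^sub>R (f (s *\<^sub>R y) * h y) - of_real s ^ k * (bump R 1 y *\<^sub>R (f y * h y))" for y
      proof -
        have y: "norm y *\<^sub>R sgn y = y" by (cases "y = 0") (simp_all add: sgn_div_norm)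
        then have sy: "(s * norm y) *\<^sub>R sgn y = s *\<^sub>R y" by (metis scaleR_scaleR)
        show ?thesis unfolding F_def y sy homogeneous_polar[of h k y, OF hom]
          by (simp add: bump_def scaleR_conv_of_real algebra_simps)
      qed
      have int: "integrable lborel (\<lambda>y. bump R 1 y *\<^sub>R (f (t *\<^sub>R y) * h y))" if t: "t \<in> {0<..1}" for t
      proof -
        have ty: "t *\<^sub>R y \<in> ball 0 1" if "y \<in> cball 0 R" for y :: 'a
        proof -
          have "t * norm y \<le> 1 * norm y" using t by (intro mult_right_mono) auto
          then show ?thesis using that t R by auto
        qed
        have "integrable lborel (\<lambda>y. indicator (cball 0 R) y *\<^sub>R (bump R 1 y *\<^sub>R (f (t *\<^sub>R y) * h y)))"
          by (rule borel_integrable_compact) (use ty in \<open>auto intro!: continuous_intros ch continuous_on_compose2[OF cf]\<close>)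
        moreover have "(\<lambda>y. indicator (cball 0 R) y *\<^sub>R (bump R 1 y *\<^sub>R (f (t *\<^sub>R y) * h y))) = (\<lambda>y. bump R 1 y *\<^sub>R (f (t *\<^sub>R y) * h y))"
        proof
          fix y :: 'a show "indicator (cball 0 R) y *\<^sub>R (bump R 1 y *\<^sub>R (f (t *\<^sub>R y) * h y)) = bump R 1 y *\<^sub>R (f (t *\<^sub>R y) * h y)"
            by (cases "norm y \<le> R") (use R in \<open>simp_all add: bump_eq_0\<close>)
        qed
        ultimately show ?thesis by simp
      qed
      have i1: "integrable lborel (\<lambda>y. bump R 1 y *\<^sub>R (f (s *\<^sub>R y) * h y))" by (rule int[OF s])
      have i2: "integrable lborel (\<lambda>y. of_real s ^ k * (bump R 1 y *\<^sub>R (f y * h y)))"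
        using int[of 1] by (intro integrable_mult_right) simp
      have iF: "integrable lborel (\<lambda>y. F (norm y) (sgn y))" unfolding F by (rule Bochner_Integration.integrable_diff[OF i1 i2])
      have "(LINT y|lborel. F (norm y) (sgn y)) = (LINT y|lborel. bump R 1 y *\<^sub>R (f (s *\<^sub>R y) * h y)) - of_real s ^ k * (LINT y|lborel. bump R 1 y *\<^sub>R (f y * h y))"
        unfolding F Bochner_Integration.integral_diff[OF i1 i2] by (simp only: integral_mult_right_zero)
      also have "... = 0"
        using integral_bump_dilation(1)[OF _ _ _ f h hom, of R 1 s] R s by simp
      finally have z: "(LINT y|lborel. F (norm y) (sgn y)) = 0" .
      have Fb: "indicator (ball 0 1) y *\<^sub>R F (norm y) (sgn y) = F (norm y) (sgn y)" for y
      proof (cases "norm y < 1")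
        case False
        then have "bump R 1 y = 0" using R by (intro bump_eq_0) auto
        then show ?thesis by (simp add: F)
      qed simp
      have "0 = (LINT y:ball 0 1|lborel. F (norm y) (sgn y))"
        unfolding set_lebesgue_integral_def Fb using z by simp
      also have "... = (LINT r|radial_measure DIM('a). LINT u|cone_measure. F r u)"
        by (rule integral_polar[OF Fm]) (use iF in \<open>simp add: set_integrable_def Fb\<close>)
      also have "... = (LINT r|radial_measure DIM('a). (max 0 (R\<^sup>2 - r\<^sup>2) * r ^ k) *\<^sub>R m r)"
      proof (rule integral_cong_AE)
        show "AE r in radial_measure DIM('a). (LINT u|cone_measure. F r u) = (max 0 (R\<^sup>2 - r\<^sup>2) * r ^ k) *\<^sub>R m r"
          using AE_radial
        proof eventually_elim
          case (elim r)
          have j1: "integrable cone_measure (\<lambda>u. f ((s * r) *\<^sub>R u) * h u)"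
            by (rule integrable_cone[OF fm hm cf ch]) (use sr[of r] elim in auto)
          have j2: "integrable cone_measure (\<lambda>u. of_real s ^ k * (f (r *\<^sub>R u) * h u))"
            by (intro integrable_mult_right integrable_cone[OF fm hm cf ch]) (use elim in auto)
          have "(LINT u|cone_measure. F r u) = (max 0 (R\<^sup>2 - r\<^sup>2) * r ^ k) *\<^sub>R (LINT u|cone_measure. f ((s * r) *\<^sub>R u) * h u - of_real s ^ k * (f (r *\<^sub>R u) * h u))"
            unfolding F_def Bochner_Integration.integral_scaleR_right[symmetric]
            by (simp only: left_diff_distrib mult.assoc)
          also have "(LINT u|cone_measure. f ((s * r) *\<^sub>R u) * h u - of_real s ^ k * (f (r *\<^sub>R u) * h u)) = m r"
            unfolding m_def g_def Bochner_Integration.integral_diff[OF j1 j2] by simp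
          finally show ?case .
        qed
        show "(\<lambda>r. LINT u|cone_measure. F r u) \<in> borel_measurable (radial_measure DIM('a))"
          using Fm by measurable
      qed measurable
      also have "... = integral {0..R} (\<lambda>r. (R\<^sup>2 - r\<^sup>2) *\<^sub>R ((real DIM('a) * r ^ (DIM('a) - 1) * r ^ k) *\<^sub>R m r))"
        by (rule integral_radial_bump[OF mm cm R])
      finally show ?thesis by simp
    qed
    have "(real DIM('a) * r ^ (DIM('a) - 1) * r ^ k) *\<^sub>R m r = 0"
      by (rule volterra_zero[OF _ zero r]) (intro continuous_intros cm)
    then show ?thesis using r by (simp add: m_def)
  qed
  \<comment> \<open>The constant is read off at radius 1/2. As \<open>eq\<close> only contracts, 1/2
    is contracted to r or r to 1/2, according to which is smaller.\<close>
  have "g r = of_real r ^ k * (g (1/2) / of_real (1/2) ^ k)" if r: "r \<in> {0<..<1}" for r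
  proof (cases "r \<le> 1 / 2")
    case True
    then have "g (2 * r * (1/2)) = of_real (2 * r) ^ k * g (1/2)" using r by (intro eq) auto
    then show ?thesis by (simp add: power_mult_distrib power_divide field_simps)
  next
    case False
    then have "g (1 / (2 * r) * r) = of_real (1 / (2 * r)) ^ k * g r" using r by (intro eq) auto
    then show ?thesis using r by (simp add: power_mult_distrib power_divide field_simps)
  qed
  then show ?thesis unfolding g_def by blast
qed

section \<open>Surface measure against cone measure\<close>

lemma surface_measure_eq:
  "(surface_measure :: 'a::euclidean_space measure) = density (distr (restrict_space lborel (ball 0 1 - {0})) (restrict_space borel (sphere 0 1)) sgn) (\<lambda>_. ennreal (real DIM('a)))"
  (is "_ = density ?D _")
proof (rule measure_eqI)
  show "sets surface_measure = sets (density ?D (\<lambda>_. ennreal (real DIM('a))))" by (simp add: surface_measure_def)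
  fix A assume "A \<in> sets (surface_measure :: 'a measure)"
  then have A: "A \<in> sets ?D" by (simp add: surface_measure_def)
  show "emeasure surface_measure A = emeasure (density ?D (\<lambda>_. ennreal (real DIM('a)))) A"
    unfolding surface_measure_def
    using A by (simp add: emeasure_density_const ennreal_of_nat_eq_real_of_nat)
qed

lemma measurable_sgn_surface: "(sgn :: 'a::euclidean_space \<Rightarrow> 'a) \<in> restrict_space lborel (ball 0 1 - {0}) \<rightarrow>\<^sub>M restrict_space borel (sphere 0 1)"
proof (rule measurable_restrict_space2)
  show "sgn \<in> space (restrict_space lborel (ball (0::'a) 1 - {0})) \<rightarrow> sphere 0 1"
    by (auto simp: space_restrict_space norm_sgn)
  show "(sgn :: 'a \<Rightarrow> 'a) \<in> restrict_space lborel (ball 0 1 - {0}) \<rightarrow>\<^sub>M borel"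
    by (rule measurable_restrict_space1) simp
qed

lemma sets_surface_measure [measurable_cong]:
  "sets (surface_measure :: 'a::euclidean_space measure) = sets (restrict_space borel (sphere 0 1))"
  by (simp add: surface_measure_def)

lemma space_surface_measure: "space (surface_measure :: 'a::euclidean_space measure) = sphere 0 1"
  by (simp add: sets_eq_imp_space_eq[OF sets_surface_measure] space_restrict_space)

lemma integrable_scaleR_right_iff':
  fixes h :: "'b \<Rightarrow> 'c::{banach, second_countable_topology}"
  assumes "c \<noteq> 0"
  shows "integrable M (\<lambda>x. c *\<^sub>R h x) \<longleftrightarrow> integrable M h"
  using integrable_scaleR_right[of c M h] integrable_scaleR_right[of "inverse c" M "\<lambda>x. c *\<^sub>R h x"] assms by auto

lemma integrable_surface_iff:
  fixes h :: "'a::euclidean_space \<Rightarrow> 'b::{banach, second_countable_topology}"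
  assumes [measurable]: "h \<in> borel_measurable borel"
  shows "integrable surface_measure h \<longleftrightarrow> integrable cone_measure h"
proof -
  have hm: "h \<in> borel_measurable (restrict_space borel (sphere 0 1))" by (rule measurable_restrict_space1) simp
  have "AE x::'a in lborel. x \<noteq> 0" by (rule AE_lborel_singleton)
  then have *: "integrable lborel (\<lambda>x. indicator (ball 0 1 - {0}) x *\<^sub>R h (sgn x)) \<longleftrightarrow> integrable lborel (\<lambda>x. indicator (ball 0 1) x *\<^sub>R h (sgn (x::'a)))"
    by (intro integrable_cong_AE) (auto simp: indicator_def elim!: eventually_mono)
  have "integrable surface_measure h \<longleftrightarrow> integrable (distr (restrict_space lborel (ball 0 1 - {0})) (restrict_space borel (sphere 0 1)) sgn) (\<lambda>x. real DIM('a) *\<^sub>R h x)"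
    unfolding surface_measure_eq by (subst integrable_density) (use hm in auto)
  also have "... \<longleftrightarrow> integrable (restrict_space lborel (ball 0 1 - {0})) (\<lambda>x. h (sgn x))"
    by (subst integrable_distr_eq[OF measurable_sgn_surface]) (use hm in \<open>auto simp: integrable_scaleR_right_iff'\<close>)
  also have "... \<longleftrightarrow> integrable lborel (\<lambda>x. indicator (ball 0 1) x *\<^sub>R h (sgn x))"
    by (subst integrable_restrict_space) (auto simp: *)
  also have "... \<longleftrightarrow> integrable cone_measure h"
    unfolding cone_measure_def
    by (subst integrable_distr_eq) (auto simp: measurable_ball_restrict integrable_restrict_space)
  finally show ?thesis .
qed

lemma integral_surface:
  fixes h :: "'a::euclidean_space \<Rightarrow> 'b::{banach, second_countable_topology}"
  assumes [measurable]: "h \<in> borel_measurable borel"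
  shows "(LINT u|surface_measure. h u) = real DIM('a) *\<^sub>R (LINT u|cone_measure. h u)"
proof -
  have hm: "h \<in> borel_measurable (restrict_space borel (sphere 0 1))" by (rule measurable_restrict_space1) simp
  have ae: "AE x::'a in lborel. x \<noteq> 0" by (rule AE_lborel_singleton)
  have "(LINT u|surface_measure. h u) = (LINT u|distr (restrict_space lborel (ball 0 1 - {0})) (restrict_space borel (sphere 0 1)) sgn. real DIM('a) *\<^sub>R h u)"
    unfolding surface_measure_eq by (subst integral_density) (use hm in auto)
  also have "... = (LINT x|restrict_space lborel (ball 0 1 - {0}). real DIM('a) *\<^sub>R h (sgn x))"
    by (subst integral_distr[OF measurable_sgn_surface]) (use hm in auto)
  also have "... = real DIM('a) *\<^sub>R (LINT x|lborel. indicator (ball 0 1 - {0}) x *\<^sub>R h (sgn x))"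
    by (simp add: integral_restrict_space)
  also have "(LINT x|lborel. indicator (ball 0 1 - {0}) x *\<^sub>R h (sgn x)) = (LINT x|lborel. indicator (ball 0 1) x *\<^sub>R h (sgn (x::'a)))"
    by (intro integral_cong_AE) (use ae in \<open>auto simp: indicator_def elim!: eventually_mono\<close>)
  also have "... = (LINT u|cone_measure. h u)"
    unfolding cone_measure_def
    by (subst integral_distr) (auto simp: measurable_ball_restrict integral_restrict_space)
  finally show ?thesis .
qed

lemma borel_measurable_cnj [measurable]:
  "g \<in> borel_measurable M \<Longrightarrow> (\<lambda>x. cnj (g x)) \<in> borel_measurable M"
  by (rule measurable_compose[OF _ borel_measurable_continuous_onI[OF continuous_on_cnj[OF continuous_on_id]]])

section \<open>Bessel's identity and Parseval's formula\<close>

lemma orthonormal_basis_L2_dense: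
  assumes "orthonormal_basis_L2 M I e" "square_integrable M f" "\<epsilon> > 0"
  obtains F c where "finite F" "F \<subseteq> I" "(LINT x|M. (cmod (f x - (\<Sum>i\<in>F. c i * e i x)))\<^sup>2) < \<epsilon>"
proof -
  have "\<forall>f. square_integrable M f \<longrightarrow> (\<forall>\<epsilon>>0. \<exists>F c. finite F \<and> F \<subseteq> I \<and>
        (LINT x|M. (cmod (f x - (\<Sum>i\<in>F. c i * e i x)))\<^sup>2) < \<epsilon>)"
    using assms(1) unfolding orthonormal_basis_L2_def by (elim conjE)
  from this[rule_format, OF assms(2,3)] show ?thesis using that by blast
qed

lemma square_integrable_mult_cnj:
  assumes f: "square_integrable M f" and g: "square_integrable M g"
  shows "integrable M (\<lambda>x. f x * cnj (g x))"
proof (rule Bochner_Integration.integrable_bound)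
  show "integrable M (\<lambda>x. (cmod (f x))\<^sup>2 + (cmod (g x))\<^sup>2)"
    using f g by (simp add: square_integrable_def)
  show "(\<lambda>x. f x * cnj (g x)) \<in> borel_measurable M"
    by (intro borel_measurable_times borel_measurable_cnj) (use f g in \<open>auto simp: square_integrable_def\<close>)
  have "a * b \<le> a\<^sup>2 + b\<^sup>2" if "a \<ge> 0" "b \<ge> 0" for a b :: real
    using sum_squares_bound[of a b] that mult_nonneg_nonneg[OF that] by linarith
  then show "AE x in M. norm (f x * cnj (g x)) \<le> norm ((cmod (f x))\<^sup>2 + (cmod (g x))\<^sup>2)"
    by (intro AE_I2) (simp add: norm_mult)
qed

text \<open>Expand the square and complete it in the coefficients. Leaving \<open>a\<close>
  arbitrary covers three uses: the Fourier coefficients themselves, the approximants supplied by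
  density, and, with h = 0, the norm of a finite combination.\<close>

lemma bessel_identity:
  assumes on: "orthonormal_basis_L2 M I e" and h: "square_integrable M h"
    and F: "finite F" "F \<subseteq> I"
  shows "(LINT x|M. (cmod (h x - (\<Sum>i\<in>F. a i * e i x)))\<^sup>2) =
    (LINT x|M. (cmod (h x))\<^sup>2) + (\<Sum>i\<in>F. (cmod (a i - (LINT x|M. h x * cnj (e i x))))\<^sup>2)
     - (\<Sum>i\<in>F. (cmod (LINT x|M. h x * cnj (e i x)))\<^sup>2)"
proof -
  define c where "c i = (LINT x|M. h x * cnj (e i x))" for i
  have e: "square_integrable M (e i)" if "i \<in> F" for i
    using on F(2) that unfolding orthonormal_basis_L2_def by blast
  have orth: "(LINT x|M. e i x * cnj (e j x)) = (if i = j then 1 else 0)" if "i \<in> F" "j \<in> F" for i j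
    using on F(2) that unfolding orthonormal_basis_L2_def by blast
  have I1: "integrable M (\<lambda>x. h x * cnj (h x))" by (rule square_integrable_mult_cnj[OF h h])
  have I2: "integrable M (\<lambda>x. h x * cnj (e i x))" if "i \<in> F" for i by (rule square_integrable_mult_cnj[OF h e[OF that]])
  have I3: "integrable M (\<lambda>x. e i x * cnj (h x))" if "i \<in> F" for i by (rule square_integrable_mult_cnj[OF e[OF that] h])
  have I4: "integrable M (\<lambda>x. e i x * cnj (e j x))" if "i \<in> F" "j \<in> F" for i j by (rule square_integrable_mult_cnj[OF e e]) (use that in auto)
  have c': "(LINT x|M. e i x * cnj (h x)) = cnj (c i)" for i
    unfolding c_def by (subst Bochner_Integration.integral_cnj[symmetric]) (simp add: mult.commute)
  have sq: "complex_of_real ((cmod z)\<^sup>2) = z * cnj z" for z by (rule complex_norm_square)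
  have "complex_of_real (LINT x|M. (cmod (h x - (\<Sum>i\<in>F. a i * e i x)))\<^sup>2)
     = (LINT x|M. (h x - (\<Sum>i\<in>F. a i * e i x)) * cnj (h x - (\<Sum>i\<in>F. a i * e i x)))"
    unfolding integral_complex_of_real[symmetric] sq ..
  also have "... = (LINT x|M. h x * cnj (h x) - (\<Sum>i\<in>F. cnj (a i) * (h x * cnj (e i x))) - (\<Sum>i\<in>F. a i * (e i x * cnj (h x)))
      + (\<Sum>i\<in>F. \<Sum>j\<in>F. a i * cnj (a j) * (e i x * cnj (e j x))))"
  proof (intro Bochner_Integration.integral_cong refl)
    fix x
    define S where "S = (\<Sum>i\<in>F. a i * e i x)"
    have "(h x - S) * cnj (h x - S) = h x * cnj (h x) - cnj S * h x - S * cnj (h x) + S * cnj S"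
      by (simp add: algebra_simps)
    moreover have "cnj S * h x = (\<Sum>i\<in>F. cnj (a i) * (h x * cnj (e i x)))"
      unfolding S_def cnj_sum sum_distrib_right by (intro sum.cong refl) simp
    moreover have "S * cnj (h x) = (\<Sum>i\<in>F. a i * (e i x * cnj (h x)))"
      unfolding S_def sum_distrib_right by (intro sum.cong refl) simp
    moreover have "S * cnj S = (\<Sum>i\<in>F. \<Sum>j\<in>F. a i * cnj (a j) * (e i x * cnj (e j x)))"
      unfolding S_def cnj_sum sum_product by (intro sum.cong refl) simp
    ultimately show "(h x - (\<Sum>i\<in>F. a i * e i x)) * cnj (h x - (\<Sum>i\<in>F. a i * e i x)) =
        h x * cnj (h x) - (\<Sum>i\<in>F. cnj (a i) * (h x * cnj (e i x))) - (\<Sum>i\<in>F. a i * (e i x * cnj (h x)))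
        + (\<Sum>i\<in>F. \<Sum>j\<in>F. a i * cnj (a j) * (e i x * cnj (e j x)))"
      unfolding S_def by simp
  qed
  also have "... = (LINT x|M. h x * cnj (h x)) - (\<Sum>i\<in>F. cnj (a i) * c i) - (\<Sum>i\<in>F. a i * cnj (c i))
      + (\<Sum>i\<in>F. \<Sum>j\<in>F. a i * cnj (a j) * (if i = j then 1 else 0))"
  proof -
    have J2: "integrable M (\<lambda>x. \<Sum>i\<in>F. cnj (a i) * (h x * cnj (e i x)))" by (intro Bochner_Integration.integrable_sum integrable_mult_right I2)
    have J3: "integrable M (\<lambda>x. \<Sum>i\<in>F. a i * (e i x * cnj (h x)))" by (intro Bochner_Integration.integrable_sum integrable_mult_right I3)
    have J4: "integrable M (\<lambda>x. \<Sum>i\<in>F. \<Sum>j\<in>F. a i * cnj (a j) * (e i x * cnj (e j x)))" by (intro Bochner_Integration.integrable_sum integrable_mult_right I4)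
    have E2: "(LINT x|M. (\<Sum>i\<in>F. cnj (a i) * (h x * cnj (e i x)))) = (\<Sum>i\<in>F. cnj (a i) * c i)"
      by (subst Bochner_Integration.integral_sum) (auto intro!: integrable_mult_right I2 simp: integral_mult_right_zero c_def)
    have E3: "(LINT x|M. (\<Sum>i\<in>F. a i * (e i x * cnj (h x)))) = (\<Sum>i\<in>F. a i * cnj (c i))"
      by (subst Bochner_Integration.integral_sum) (auto intro!: integrable_mult_right I3 simp: integral_mult_right_zero c')
    have E4: "(LINT x|M. (\<Sum>i\<in>F. \<Sum>j\<in>F. a i * cnj (a j) * (e i x * cnj (e j x)))) = (\<Sum>i\<in>F. \<Sum>j\<in>F. a i * cnj (a j) * (if i = j then 1 else 0))"
    proof -
      have "(LINT x|M. (\<Sum>i\<in>F. \<Sum>j\<in>F. a i * cnj (a j) * (e i x * cnj (e j x)))) = (\<Sum>i\<in>F. (LINT x|M. (\<Sum>j\<in>F. a i * cnj (a j) * (e i x * cnj (e j x)))))"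
        by (rule Bochner_Integration.integral_sum) (intro Bochner_Integration.integrable_sum integrable_mult_right I4)
      also have "... = (\<Sum>i\<in>F. \<Sum>j\<in>F. (LINT x|M. a i * cnj (a j) * (e i x * cnj (e j x))))"
        by (intro sum.cong refl Bochner_Integration.integral_sum integrable_mult_right I4)
      finally show ?thesis by (simp only: integral_mult_right_zero orth cong: sum.cong)
    qed
    show ?thesis
      unfolding E2[symmetric] E3[symmetric] E4[symmetric]
      by (subst Bochner_Integration.integral_diff[OF I1 J2, symmetric],
          subst Bochner_Integration.integral_diff[OF Bochner_Integration.integrable_diff[OF I1 J2] J3, symmetric],
          subst Bochner_Integration.integral_add[OF Bochner_Integration.integrable_diff[OF Bochner_Integration.integrable_diff[OF I1 J2] J3] J4, symmetric]) simp
  qed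
  also have "(\<Sum>i\<in>F. \<Sum>j\<in>F. a i * cnj (a j) * (if i = j then 1 else 0)) = (\<Sum>i\<in>F. a i * cnj (a i))"
    using F(1) by (simp add: sum.delta if_distrib[of "\<lambda>t. _ * t"] cong: if_cong)
  also have "(LINT x|M. h x * cnj (h x)) - (\<Sum>i\<in>F. cnj (a i) * c i) - (\<Sum>i\<in>F. a i * cnj (c i)) + (\<Sum>i\<in>F. a i * cnj (a i))
      = (LINT x|M. h x * cnj (h x)) + (\<Sum>i\<in>F. (a i - c i) * cnj (a i - c i)) - (\<Sum>i\<in>F. c i * cnj (c i))"
    by (simp add: algebra_simps sum.distrib sum_subtractf)
  also have "... = complex_of_real ((LINT x|M. (cmod (h x))\<^sup>2) + (\<Sum>i\<in>F. (cmod (a i - c i))\<^sup>2) - (\<Sum>i\<in>F. (cmod (c i))\<^sup>2))"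
    by (simp only: of_real_add of_real_diff of_real_sum integral_complex_of_real[symmetric] sq)
  finally show ?thesis unfolding c_def of_real_eq_iff .
qed

text \<open>Bessel's inequality bounds every finite sum by the full norm. Density supplies a finite
  combination close to h, and the Fourier coefficients on the same index set approximate at least as
  well, so the finite sums come arbitrarily close to the bound and increase with the index
  set.\<close>

lemma parseval_has_sum:
  assumes on: "orthonormal_basis_L2 M I e" and h: "square_integrable M h"
  shows "((\<lambda>i. (cmod (LINT x|M. h x * cnj (e i x)))\<^sup>2) has_sum (LINT x|M. (cmod (h x))\<^sup>2)) I"
proof -
  define c where "c i = (LINT x|M. h x * cnj (e i x))" for i
  define T where "T = (LINT x|M. (cmod (h x))\<^sup>2)"
  have le: "(\<Sum>i\<in>F. (cmod (c i))\<^sup>2) \<le> T" if "finite F" "F \<subseteq> I" for F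
  proof -
    have "0 \<le> (LINT x|M. (cmod (h x - (\<Sum>i\<in>F. c i * e i x)))\<^sup>2)" by (rule integral_nonneg_AE) auto
    also have "... = T - (\<Sum>i\<in>F. (cmod (c i))\<^sup>2)"
      unfolding bessel_identity[OF on h that, of c, folded c_def T_def] by simp
    finally show ?thesis by simp
  qed
  have "((\<lambda>i. (cmod (c i))\<^sup>2) has_sum T) I"
    unfolding has_sum_def
  proof (rule tendstoI)
    fix \<epsilon> :: real assume "\<epsilon> > 0"
    then obtain F0 a where F0: "finite F0" "F0 \<subseteq> I" "(LINT x|M. (cmod (h x - (\<Sum>i\<in>F0. a i * e i x)))\<^sup>2) < \<epsilon>"
      by (rule orthonormal_basis_L2_dense[OF on h])
    have "T - (\<Sum>i\<in>F0. (cmod (c i))\<^sup>2) \<le> (LINT x|M. (cmod (h x - (\<Sum>i\<in>F0. a i * e i x)))\<^sup>2)"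
      unfolding bessel_identity[OF on h F0(1,2), folded c_def T_def] by (simp add: sum_nonneg)
    then have F0': "T - (\<Sum>i\<in>F0. (cmod (c i))\<^sup>2) < \<epsilon>" using F0(3) by simp
    show "\<forall>\<^sub>F F in finite_subsets_at_top I. dist (\<Sum>i\<in>F. (cmod (c i))\<^sup>2) T < \<epsilon>"
      unfolding eventually_finite_subsets_at_top
    proof (intro exI[of _ F0] conjI allI impI)
      fix F assume F: "finite F \<and> F0 \<subseteq> F \<and> F \<subseteq> I"
      then have "(\<Sum>i\<in>F0. (cmod (c i))\<^sup>2) \<le> (\<Sum>i\<in>F. (cmod (c i))\<^sup>2)" by (intro sum_mono2) auto
      then show "dist (\<Sum>i\<in>F. (cmod (c i))\<^sup>2) T < \<epsilon>" using le[of F] F F0' by (simp add: dist_real_def)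
    qed (use F0 in auto)
  qed
  then show ?thesis unfolding c_def T_def .
qed

section \<open>From mean squares on spheres to pointwise expansions\<close>

definition cone_mass :: "'a::euclidean_space itself \<Rightarrow> real" where
  "cone_mass _ = measure (cone_measure :: 'a measure) UNIV"

lemma cone_mass_pos: "cone_mass TYPE('a::euclidean_space) > 0"
proof -
  have "emeasure (cone_measure :: 'a measure) UNIV = emeasure lborel (ball (0::'a) 1)"
    by (subst emeasure_cone_measure) auto
  then have "cone_mass TYPE('a) = measure lborel (ball (0::'a) 1)" by (simp add: cone_mass_def measure_def)
  then show ?thesis using content_ball_pos[of 1 "0::'a"] by simp
qed

lemma emeasure_cone_UNIV: "emeasure (cone_measure :: 'a::euclidean_space measure) UNIV = ennreal (cone_mass TYPE('a))"
  unfolding cone_mass_def using finite_measure.emeasure_eq_measure[OF finite_measure_cone] by blast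

text \<open>The sub-mean value inequality on \<open>ball x (R - norm x)\<close> is read in polar
  coordinates, and the inequality t \<le> \<eta> + t^2 / \<eta> passes from means of |f| to means of
  |f|^2. It replaces Cauchy-Schwarz and accounts for the factor \<kappa> + 1, with \<kappa> the mass
  of \<open>cone_measure\<close>.\<close>

lemma pointwise_L2_bound:
  "\<exists>C>0. \<forall>(f :: 'a::euclidean_space \<Rightarrow> complex) x R \<eta>. f \<in> borel_measurable borel \<longrightarrow> harmonic_on f (ball 0 1) \<longrightarrow> 0 < \<eta> \<longrightarrow>
     norm x < R \<longrightarrow> R \<le> 1 \<longrightarrow> (\<forall>r. 0 < r \<longrightarrow> r < R \<longrightarrow> (\<integral>\<^sup>+u. ennreal ((cmod (f (r *\<^sub>R u)))\<^sup>2) \<partial>cone_measure) \<le> ennreal (\<eta>\<^sup>2)) \<longrightarrow>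
     cmod (f x) \<le> C / (R - norm x) ^ DIM('a) * \<eta>"
proof -
  obtain C where C: "C > 0" "\<And>(f :: 'a \<Rightarrow> complex) x \<delta>. \<delta> > 0 \<Longrightarrow> harmonic_on f (ball x \<delta>) \<Longrightarrow>
    ennreal (cmod (f x)) \<le> ennreal (C / \<delta> ^ DIM('a)) * (\<integral>\<^sup>+y\<in>ball x \<delta>. ennreal (cmod (f y)) \<partial>lborel)"
    using submean_value by blast
  define \<kappa> where "\<kappa> = cone_mass TYPE('a)"
  have k: "\<kappa> > 0" unfolding \<kappa>_def by (rule cone_mass_pos)
  have "cmod (f x) \<le> (C * (\<kappa> + 1)) / (R - norm x) ^ DIM('a) * \<eta>"
    if fm[measurable]: "f \<in> borel_measurable borel" and f: "harmonic_on f (ball 0 1)" and e: "0 < \<eta>" and x: "norm x < R" and R: "R \<le> 1"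
      and b: "\<And>r. 0 < r \<Longrightarrow> r < R \<Longrightarrow> (\<integral>\<^sup>+u. ennreal ((cmod (f (r *\<^sub>R u)))\<^sup>2) \<partial>cone_measure) \<le> ennreal (\<eta>\<^sup>2)"
    for f :: "'a \<Rightarrow> complex" and x R \<eta>
  proof -
    have sub: "ball x (R - norm x) \<subseteq> ball 0 R"
      by (simp add: ball_subset_ball_iff)
    have "ennreal (cmod (f x)) \<le> ennreal (C / (R - norm x) ^ DIM('a)) * (\<integral>\<^sup>+y\<in>ball x (R - norm x). ennreal (cmod (f y)) \<partial>lborel)"
      by (rule C(2)) (use x R sub in \<open>auto intro!: harmonic_on_subset[OF f]\<close>)
    also have "(\<integral>\<^sup>+y\<in>ball x (R - norm x). ennreal (cmod (f y)) \<partial>lborel) \<le> (\<integral>\<^sup>+y\<in>ball 0 1. indicator {..<R} (norm y) * ennreal (cmod (f (norm y *\<^sub>R sgn y))) \<partial>lborel)"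
    proof (rule nn_integral_mono)
      fix y :: 'a
      have y: "norm y *\<^sub>R sgn y = y" by (cases "y = 0") (simp_all add: sgn_div_norm)
      show "ennreal (cmod (f y)) * indicator (ball x (R - norm x)) y \<le> indicator {..<R} (norm y) * ennreal (cmod (f (norm y *\<^sub>R sgn y))) * indicator (ball 0 1) y"
        unfolding y using sub R by (auto simp: indicator_def)
    qed
    also have "... = (\<integral>\<^sup>+r. (\<integral>\<^sup>+u. indicator {..<R} r * ennreal (cmod (f (r *\<^sub>R u))) \<partial>cone_measure) \<partial>radial_measure DIM('a))"
      by (rule nn_integral_polar) measurable
    also have "... \<le> (\<integral>\<^sup>+r. ennreal ((\<kappa> + 1) * \<eta>) \<partial>radial_measure DIM('a))"
    proof (rule nn_integral_mono_AE)
      show "AE r in radial_measure DIM('a). (\<integral>\<^sup>+u. indicator {..<R} r * ennreal (cmod (f (r *\<^sub>R u))) \<partial>cone_measure) \<le> ennreal ((\<kappa> + 1) * \<eta>)"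
        using AE_radial
      proof eventually_elim
        case (elim r)
        show ?case
        proof (cases "r < R")
          case True
          have "(\<integral>\<^sup>+u. indicator {..<R} r * ennreal (cmod (f (r *\<^sub>R u))) \<partial>cone_measure)
            \<le> (\<integral>\<^sup>+u. ennreal \<eta> + ennreal (1 / \<eta>) * ennreal ((cmod (f (r *\<^sub>R u)))\<^sup>2) \<partial>cone_measure)"
          proof (rule nn_integral_mono)
            fix u
            have "cmod (f (r *\<^sub>R u)) \<le> \<eta> + 1 / \<eta> * (cmod (f (r *\<^sub>R u)))\<^sup>2"
            proof (cases "cmod (f (r *\<^sub>R u)) \<le> \<eta>")
              case True
              then show ?thesis using e by (intro order_trans[OF True]) simp
            next
              case False
              then have "\<eta> * cmod (f (r *\<^sub>R u)) \<le> cmod (f (r *\<^sub>R u)) * cmod (f (r *\<^sub>R u))" by (intro mult_right_mono) auto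
              then have "cmod (f (r *\<^sub>R u)) \<le> 1 / \<eta> * (cmod (f (r *\<^sub>R u)))\<^sup>2" using e by (simp add: field_simps power2_eq_square)
              then show ?thesis using e by simp
            qed
            then show "indicator {..<R} r * ennreal (cmod (f (r *\<^sub>R u))) \<le> ennreal \<eta> + ennreal (1 / \<eta>) * ennreal ((cmod (f (r *\<^sub>R u)))\<^sup>2)"
              using e True by (simp add: ennreal_mult[symmetric] ennreal_plus[symmetric] ennreal_leI del: ennreal_plus)
          qed
          also have "... = ennreal \<eta> * ennreal \<kappa> + ennreal (1 / \<eta>) * (\<integral>\<^sup>+u. ennreal ((cmod (f (r *\<^sub>R u)))\<^sup>2) \<partial>cone_measure)"
            by (subst nn_integral_add) (auto simp: nn_integral_cmult emeasure_cone_UNIV \<kappa>_def)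
          also have "... \<le> ennreal \<eta> * ennreal \<kappa> + ennreal (1 / \<eta>) * ennreal (\<eta>\<^sup>2)"
            using b[of r] elim True by (intro add_left_mono mult_left_mono) auto
          also have "... = ennreal ((\<kappa> + 1) * \<eta>)"
            using e k by (simp add: ennreal_mult[symmetric] ennreal_plus[symmetric] power2_eq_square algebra_simps del: ennreal_plus)
          finally show ?thesis .
        qed simp
      qed
    qed
    also have "... = ennreal ((\<kappa> + 1) * \<eta>)" using radial_measure_prob[of "DIM('a)"] by (simp add: Suc_leI)
    finally have "ennreal (cmod (f x)) \<le> ennreal (C / (R - norm x) ^ DIM('a)) * ennreal ((\<kappa> + 1) * \<eta>)" by (simp add: mult_left_mono)
    also have "... = ennreal ((C * (\<kappa> + 1)) / (R - norm x) ^ DIM('a) * \<eta>)"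
      using C(1) x k e by (subst ennreal_mult[symmetric]) auto
    finally show ?thesis using C(1) x k e by (subst (asm) ennreal_le_iff) auto
  qed
  then show ?thesis using C(1) k by (intro exI[of _ "C * (\<kappa> + 1)"] conjI allI impI) (auto intro!: mult_pos_pos)
qed

text \<open>\<open>H\<close> consists of the homogeneous harmonic extensions whose existence is part
  of \<open>spherical_harmonic\<close>. Fixing them once permits evaluation off the sphere;
  homogeneity and harmonicity are the properties kept.\<close>

locale spherical_basis =
  fixes d :: "nat \<Rightarrow> nat" and Y H :: "nat \<Rightarrow> nat \<Rightarrow> 'a::euclidean_space \<Rightarrow> complex"
  assumes basis: "spherical_harmonic_basis d Y"
    and H_harmonic: "\<And>k j. j \<in> {1..d k} \<Longrightarrow> harmonic_on (H k j) UNIV"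
    and H_hom: "\<And>k j c x. j \<in> {1..d k} \<Longrightarrow> H k j (c *\<^sub>R x) = c ^ k *\<^sub>R H k j x"
    and H_Y: "\<And>k j x. j \<in> {1..d k} \<Longrightarrow> x \<in> sphere 0 1 \<Longrightarrow> Y k j x = H k j x"
begin

definition idx :: "(nat \<times> nat) set" where "idx = (SIGMA k:UNIV. {1..d k})"

lemma H_continuous: "j \<in> {1..d k} \<Longrightarrow> continuous_on S (H k j)"
  using harmonic_on_imp_continuous_on[OF H_harmonic] continuous_on_subset by blast

lemma H_measurable: "j \<in> {1..d k} \<Longrightarrow> H k j \<in> borel_measurable borel"
  using borel_measurable_continuous_onI[OF H_continuous] .

lemma H_orthonormal_basis: "orthonormal_basis_L2 surface_measure idx (\<lambda>(k, j). H k j)"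
proof -
  have b: "orthonormal_basis_L2 surface_measure idx (\<lambda>(k, j). Y k j)"
    using basis by (simp add: spherical_harmonic_basis_def idx_def)
  have eq: "(case i of (k, j) \<Rightarrow> H k j) x = (case i of (k, j) \<Rightarrow> Y k j) x" if "i \<in> idx" "x \<in> space surface_measure" for i x
    using that H_Y by (auto simp: idx_def space_surface_measure split: prod.splits)
  have sq: "square_integrable surface_measure (case i of (k, j) \<Rightarrow> H k j)" if i: "i \<in> idx" for i
  proof -
    have "square_integrable surface_measure (case i of (k, j) \<Rightarrow> Y k j)" using b i unfolding orthonormal_basis_L2_def by blast
    then show ?thesis unfolding square_integrable_def
      using eq[OF i] by (simp cong: measurable_cong Bochner_Integration.integrable_cong)
  qed
  have ip: "(LINT x|surface_measure. (case i of (k, j) \<Rightarrow> H k j) x * cnj ((case i' of (k, j) \<Rightarrow> H k j) x)) = (if i = i' then 1 else 0)"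
    if "i \<in> idx" "i' \<in> idx" for i i'
  proof -
    have "(LINT x|surface_measure. (case i of (k, j) \<Rightarrow> H k j) x * cnj ((case i' of (k, j) \<Rightarrow> H k j) x))
      = (LINT x|surface_measure. (case i of (k, j) \<Rightarrow> Y k j) x * cnj ((case i' of (k, j) \<Rightarrow> Y k j) x))"
      by (intro Bochner_Integration.integral_cong refl) (simp only: eq that)
    then show ?thesis using b that unfolding orthonormal_basis_L2_def by auto
  qed
  have dense: "\<exists>F c. finite F \<and> F \<subseteq> idx \<and> (LINT x|surface_measure. (cmod (h x - (\<Sum>i\<in>F. c i * (case i of (k, j) \<Rightarrow> H k j) x)))\<^sup>2) < \<epsilon>"
    if hs: "square_integrable surface_measure h" and eps: "\<epsilon> > 0" for h \<epsilon>
  proof -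
    obtain F c where F: "finite F" "F \<subseteq> idx" "(LINT x|surface_measure. (cmod (h x - (\<Sum>i\<in>F. c i * (case i of (k, j) \<Rightarrow> Y k j) x)))\<^sup>2) < \<epsilon>"
      by (rule orthonormal_basis_L2_dense[OF b hs eps])
    have "(LINT x|surface_measure. (cmod (h x - (\<Sum>i\<in>F. c i * (case i of (k, j) \<Rightarrow> H k j) x)))\<^sup>2)
      = (LINT x|surface_measure. (cmod (h x - (\<Sum>i\<in>F. c i * (case i of (k, j) \<Rightarrow> Y k j) x)))\<^sup>2)"
    proof (intro Bochner_Integration.integral_cong refl)
      fix x :: 'a assume x: "x \<in> space surface_measure"
      have "(\<Sum>i\<in>F. c i * (case i of (k, j) \<Rightarrow> H k j) x) = (\<Sum>i\<in>F. c i * (case i of (k, j) \<Rightarrow> Y k j) x)"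
        by (intro sum.cong refl) (use eq[OF _ x] F(2) in auto)
      then show "(cmod (h x - (\<Sum>i\<in>F. c i * (case i of (k, j) \<Rightarrow> H k j) x)))\<^sup>2 = (cmod (h x - (\<Sum>i\<in>F. c i * (case i of (k, j) \<Rightarrow> Y k j) x)))\<^sup>2" by simp
    qed
    then have "(LINT x|surface_measure. (cmod (h x - (\<Sum>i\<in>F. c i * (case i of (k, j) \<Rightarrow> H k j) x)))\<^sup>2) < \<epsilon>"
      using F(3) by (simp only:)
    then show ?thesis by (intro exI[of _ F] exI[of _ c] conjI F(1,2))
  qed
  show ?thesis unfolding orthonormal_basis_L2_def
    by (intro conjI ballI allI impI) ((rule sq ip dense; assumption)+)
qed

lemma square_integrable_surface:
  fixes f :: "'a \<Rightarrow> complex"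
  assumes fm[measurable]: "f \<in> borel_measurable borel" and f: "continuous_on (ball 0 1) f" and r: "0 \<le> r" "r < 1"
  shows "square_integrable surface_measure (\<lambda>u. f (r *\<^sub>R u))"
proof -
  have "integrable cone_measure (\<lambda>u. f (r *\<^sub>R u) * cnj (f (r *\<^sub>R u)))"
    by (rule integrable_cone[OF fm _ f _ r]) (use r in \<open>auto intro!: continuous_intros continuous_on_compose2[OF f]\<close>)
  then have "integrable cone_measure (\<lambda>u. complex_of_real ((cmod (f (r *\<^sub>R u)))\<^sup>2))"
    by (simp only: complex_norm_square)
  then have "integrable cone_measure (\<lambda>u. (cmod (f (r *\<^sub>R u)))\<^sup>2)" 
    by (drule_tac integrable_Re) (simp only: Re_complex_of_real)
  then have "integrable surface_measure (\<lambda>u. (cmod (f (r *\<^sub>R u)))\<^sup>2)" by (subst integrable_surface_iff) auto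
  moreover have "(\<lambda>u. f (r *\<^sub>R u)) \<in> borel_measurable surface_measure"
    unfolding measurable_cong_sets[OF sets_surface_measure refl] by (rule measurable_restrict_space1) simp
  ultimately show ?thesis by (simp add: square_integrable_def)
qed

lemma nn_integral_cone_square:
  fixes g :: "'a \<Rightarrow> complex"
  assumes gm[measurable]: "g \<in> borel_measurable borel" and g: "square_integrable surface_measure g"
  shows "(\<integral>\<^sup>+u. ennreal ((cmod (g u))\<^sup>2) \<partial>cone_measure) \<le> ennreal (LINT u|surface_measure. (cmod (g u))\<^sup>2)"
proof -
  have "integrable cone_measure (\<lambda>u. (cmod (g u))\<^sup>2)"
    using g by (subst integrable_surface_iff[symmetric]) (auto simp: square_integrable_def)
  then have "(\<integral>\<^sup>+u. ennreal ((cmod (g u))\<^sup>2) \<partial>cone_measure) = ennreal (LINT u|cone_measure. (cmod (g u))\<^sup>2)"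
    by (rule nn_integral_eq_integral) auto
  also have "... \<le> ennreal (LINT u|surface_measure. (cmod (g u))\<^sup>2)"
  proof (rule ennreal_leI)
    have "(LINT u|cone_measure. (cmod (g u))\<^sup>2) \<ge> 0" by (rule integral_nonneg_AE) auto
    then have "1 * (LINT u|cone_measure. (cmod (g u))\<^sup>2) \<le> real DIM('a) * (LINT u|cone_measure. (cmod (g u))\<^sup>2)"
      by (intro mult_right_mono) (auto simp: Suc_leI)
    then show "(LINT u|cone_measure. (cmod (g u))\<^sup>2) \<le> (LINT u|surface_measure. (cmod (g u))\<^sup>2)"
      by (subst integral_surface) auto
  qed
  finally show ?thesis .
qed

lemma finite_idx_harmonic:
  assumes "F \<subseteq> idx"
  shows "harmonic_on (\<lambda>x. \<Sum>(k, j)\<in>F. c k j * H k j x) UNIV"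
  by (rule harmonic_on_sum) (use assms in \<open>auto simp: idx_def intro!: harmonic_on_cmult H_harmonic\<close>)

text \<open>By Bessel's identity the remainder after a finite set F has, on the sphere of radius r,
  the Parseval tail as its mean square. The tail increases with r, so the one at a single radius R >
  |x| controls all smaller spheres, and \<open>pointwise_L2_bound\<close> makes the remainder small
  at x.\<close>

theorem harmonic_expansion:
  assumes fm[measurable]: "f \<in> borel_measurable borel" and f: "harmonic_on f (ball 0 1)"
    and coeff: "\<And>k j r. j \<in> {1..d k} \<Longrightarrow> r \<in> {0<..<1} \<Longrightarrow>
      (LINT u|surface_measure. f (r *\<^sub>R u) * cnj (H k j u)) = of_real r ^ k * c k j"
    and x: "x \<in> ball 0 1"
  shows "((\<lambda>(k, j). c k j * H k j x) has_sum f x) idx"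
proof -
  have cf: "continuous_on (ball 0 1) f" using f by (rule harmonic_on_imp_continuous_on)
  obtain C where C: "C > 0" "\<And>(f :: 'a \<Rightarrow> complex) x R \<eta>. f \<in> borel_measurable borel \<Longrightarrow> harmonic_on f (ball 0 1) \<Longrightarrow> 0 < \<eta> \<Longrightarrow>
     norm x < R \<Longrightarrow> R \<le> 1 \<Longrightarrow> (\<And>r. 0 < r \<Longrightarrow> r < R \<Longrightarrow> (\<integral>\<^sup>+u. ennreal ((cmod (f (r *\<^sub>R u)))\<^sup>2) \<partial>cone_measure) \<le> ennreal (\<eta>\<^sup>2)) \<Longrightarrow>
     cmod (f x) \<le> C / (R - norm x) ^ DIM('a) * \<eta>"
    using pointwise_L2_bound by blast
  define R where "R = (1 + norm x) / 2"
  have R: "norm x < R" "0 < R" "R < 1" using x by (auto simp: R_def field_simps intro: add_pos_nonneg)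
  define N where "N r = (LINT u|surface_measure. (cmod (f (r *\<^sub>R u)))\<^sup>2)" for r
  define a where "a r i = (case i of (k, j) \<Rightarrow> r ^ (2 * k) * (cmod (c k j))\<^sup>2)" for r :: real and i
  have pars: "((\<lambda>i. a r i) has_sum N r) idx" if r: "r \<in> {0<..<1}" for r
  proof -
    have "((\<lambda>i. (cmod (LINT u|surface_measure. f (r *\<^sub>R u) * cnj ((case i of (k, j) \<Rightarrow> H k j) u)))\<^sup>2) has_sum N r) idx"
      unfolding N_def by (rule parseval_has_sum[OF H_orthonormal_basis square_integrable_surface[OF fm cf]]) (use r in auto)
    moreover have "(cmod (LINT u|surface_measure. f (r *\<^sub>R u) * cnj ((case i of (k, j) \<Rightarrow> H k j) u)))\<^sup>2 = a r i" if "i \<in> idx" for i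
      using that coeff[OF _ r] r by (auto simp: idx_def a_def norm_mult norm_power power_mult_distrib power_mult[symmetric] mult.commute)
    ultimately show ?thesis by (simp cong: has_sum_cong)
  qed
  define fF where "fF F y = f y - (\<Sum>(k, j)\<in>F. c k j * H k j y)" for F y
  have fF_L2: "(LINT u|surface_measure. (cmod (fF F (r *\<^sub>R u)))\<^sup>2) = N r - (\<Sum>i\<in>F. a r i)"
    if r: "r \<in> {0<..<1}" and F: "finite F" "F \<subseteq> idx" for r F
  proof -
    have cr: "(LINT u|surface_measure. f (r *\<^sub>R u) * cnj ((case i of (k, j) \<Rightarrow> H k j) u)) = (case i of (k, j) \<Rightarrow> of_real r ^ k * c k j)" if "i \<in> F" for i
      using that F(2) coeff[OF _ r] by (auto simp: idx_def)
    have "fF F (r *\<^sub>R u) = f (r *\<^sub>R u) - (\<Sum>i\<in>F. (case i of (k, j) \<Rightarrow> of_real r ^ k * c k j) * (case i of (k, j) \<Rightarrow> H k j) u)" for u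
      unfolding fF_def
      by (intro arg_cong2[where f = minus] refl sum.cong) (use F(2) in \<open>auto simp: idx_def H_hom scaleR_conv_of_real\<close>)
    note eqf = this
    have sq: "square_integrable surface_measure (\<lambda>u. f (r *\<^sub>R u))"
      by (rule square_integrable_surface[OF fm cf]) (use r in auto)
    have "(LINT u|surface_measure. (cmod (fF F (r *\<^sub>R u)))\<^sup>2)
      = N r + (\<Sum>i\<in>F. (cmod ((case i of (k, j) \<Rightarrow> of_real r ^ k * c k j) - (LINT u|surface_measure. f (r *\<^sub>R u) * cnj ((case i of (k, j) \<Rightarrow> H k j) u))))\<^sup>2)
        - (\<Sum>i\<in>F. (cmod (LINT u|surface_measure. f (r *\<^sub>R u) * cnj ((case i of (k, j) \<Rightarrow> H k j) u)))\<^sup>2)"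
      using bessel_identity[OF H_orthonormal_basis sq F, of "\<lambda>i. case i of (k, j) \<Rightarrow> of_real r ^ k * c k j"]
      unfolding eqf N_def .
    also have "... = N r - (\<Sum>i\<in>F. a r i)"
    proof -
      have "(\<Sum>i\<in>F. (cmod (LINT u|surface_measure. f (r *\<^sub>R u) * cnj ((case i of (k, j) \<Rightarrow> H k j) u)))\<^sup>2) = (\<Sum>i\<in>F. a r i)"
        by (intro sum.cong refl) (use r in \<open>auto simp: cr a_def norm_mult norm_power power_mult_distrib power_mult[symmetric] mult.commute\<close>)
      moreover have "(\<Sum>i\<in>F. (cmod ((case i of (k, j) \<Rightarrow> of_real r ^ k * c k j) - (LINT u|surface_measure. f (r *\<^sub>R u) * cnj ((case i of (k, j) \<Rightarrow> H k j) u))))\<^sup>2) = 0"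
        by (intro sum.neutral ballI) (simp add: cr)
      ultimately show ?thesis by simp
    qed
    finally show ?thesis .
  qed
  \<comment> \<open>Both sides are sums over the complement of F, and each term r^(2k) |c|^2 grows
    with r.\<close>
  have mono: "N r - (\<Sum>i\<in>F. a r i) \<le> N R - (\<Sum>i\<in>F. a R i)" if r: "0 < r" "r < R" and F: "finite F" "F \<subseteq> idx" for r F
  proof -
    have s: "((\<lambda>i. a r i) has_sum (N r - (\<Sum>i\<in>F. a r i))) (idx - F)" "((\<lambda>i. a R i) has_sum (N R - (\<Sum>i\<in>F. a R i))) (idx - F)"
      using r R F by (auto intro!: has_sum_Diff pars has_sum_finite)
    show ?thesis
      by (rule has_sum_mono[OF s]) (use r in \<open>auto simp: a_def intro!: mult_right_mono power_mono\<close>)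
  qed
  show ?thesis unfolding has_sum_def
  proof (rule tendstoI)
    fix \<epsilon> :: real assume e: "\<epsilon> > 0"
    define K where "K = C / (R - norm x) ^ DIM('a)"
    have K: "K > 0" using C(1) R by (simp add: K_def)
    define \<eta> where "\<eta> = \<epsilon> / (2 * K)"
    have eta: "\<eta> > 0" using e K by (simp add: \<eta>_def)
    have "\<forall>\<^sub>F F in finite_subsets_at_top idx. dist (\<Sum>i\<in>F. a R i) (N R) < \<eta>\<^sup>2"
      using pars[of R] R eta unfolding has_sum_def by (auto dest!: tendstoD[where e = "\<eta>\<^sup>2"])
    then show "\<forall>\<^sub>F F in finite_subsets_at_top idx. dist (\<Sum>i\<in>F. case i of (k, j) \<Rightarrow> c k j * H k j x) (f x) < \<epsilon>"
    proof (rule eventually_mp[rotated], intro eventually_finite_subsets_at_top_weakI impI)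
      fix F assume F: "finite F" "F \<subseteq> idx" and dst: "dist (\<Sum>i\<in>F. a R i) (N R) < \<eta>\<^sup>2"
      have hm: "harmonic_on (fF F) (ball 0 1)" unfolding fF_def
        by (rule harmonic_on_diff[OF f harmonic_on_subset[OF finite_idx_harmonic[OF F(2)]]]) auto
      have fFm[measurable]: "fF F \<in> borel_measurable borel" unfolding fF_def
        by (intro borel_measurable_diff fm borel_measurable_continuous_onI harmonic_on_imp_continuous_on[OF finite_idx_harmonic[OF F(2)]])
      have "cmod (fF F x) \<le> C / (R - norm x) ^ DIM('a) * \<eta>"
      proof (rule C(2)[OF fFm hm eta R(1)])
        fix r assume r: "0 < r" "r < R"
        have "(\<integral>\<^sup>+u. ennreal ((cmod (fF F (r *\<^sub>R u)))\<^sup>2) \<partial>cone_measure) \<le> ennreal (LINT u|surface_measure. (cmod (fF F (r *\<^sub>R u)))\<^sup>2)"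
          by (rule nn_integral_cone_square[OF _ square_integrable_surface[OF fFm harmonic_on_imp_continuous_on[OF hm]]]) (use r R in auto)
        also have "... \<le> ennreal (\<eta>\<^sup>2)"
        proof (rule ennreal_leI)
          have "(LINT u|surface_measure. (cmod (fF F (r *\<^sub>R u)))\<^sup>2) = N r - (\<Sum>i\<in>F. a r i)" by (rule fF_L2[OF _ F]) (use r R in auto)
          also have "... \<le> N R - (\<Sum>i\<in>F. a R i)" by (rule mono[OF r F])
          also have "... \<le> \<eta>\<^sup>2" using dst by (simp add: dist_real_def)
          finally show "(LINT u|surface_measure. (cmod (fF F (r *\<^sub>R u)))\<^sup>2) \<le> \<eta>\<^sup>2" .
        qed
        finally show "(\<integral>\<^sup>+u. ennreal ((cmod (fF F (r *\<^sub>R u)))\<^sup>2) \<partial>cone_measure) \<le> ennreal (\<eta>\<^sup>2)" .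
      qed (use R in auto)
      also have "... < \<epsilon>" unfolding K_def[symmetric] using K e by (simp add: \<eta>_def)
      finally show "dist (\<Sum>i\<in>F. case i of (k, j) \<Rightarrow> c k j * H k j x) (f x) < \<epsilon>"
        by (simp add: fF_def dist_norm norm_minus_commute)
    qed
  qed
qed

end

section \<open>The Bergman kernel\<close>

definition poisson :: "'a::euclidean_space \<Rightarrow> 'a \<Rightarrow> complex" where
  "poisson \<zeta> y = of_real ((1 - (norm y)\<^sup>2) / norm (y - \<zeta>) ^ DIM('a))"

lemma harmonic_on_of_real:
  fixes f :: "'a::euclidean_space \<Rightarrow> real"
  assumes "harmonic_on f S"
  shows "harmonic_on (\<lambda>x. complex_of_real (f x)) S"
proof -
  obtain D1 D2 where D: "open S" "\<And>x. x \<in> S \<Longrightarrow> (f has_derivative D1 x) (at x)"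
    "\<And>i x. i \<in> Basis \<Longrightarrow> x \<in> S \<Longrightarrow> ((\<lambda>y. D1 y i) has_derivative D2 x i) (at x)"
    "\<And>i j. i \<in> Basis \<Longrightarrow> j \<in> Basis \<Longrightarrow> continuous_on S (\<lambda>x. D2 x i j)"
    "\<And>x. x \<in> S \<Longrightarrow> (\<Sum>i\<in>Basis. D2 x i i) = 0" by (rule harmonic_onE[OF assms]) (rule that)
  show ?thesis
    by (rule harmonic_onI[where ?D1.0 = "\<lambda>x v. complex_of_real (D1 x v)" and ?D2.0 = "\<lambda>x i v. complex_of_real (D2 x i v)"])
      (auto intro!: D has_derivative_of_real continuous_intros simp: of_real_sum[symmetric] simp del: of_real_sum)
qed

lemma harmonic_on_cong:
  assumes f: "harmonic_on f S" and eq: "\<And>x. x \<in> S \<Longrightarrow> f x = g x"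
  shows "harmonic_on g S"
proof -
  obtain D1 D2 where D: "open S" "\<And>x. x \<in> S \<Longrightarrow> (f has_derivative D1 x) (at x)"
    "\<And>i x. i \<in> Basis \<Longrightarrow> x \<in> S \<Longrightarrow> ((\<lambda>y. D1 y i) has_derivative D2 x i) (at x)"
    "\<And>i j. i \<in> Basis \<Longrightarrow> j \<in> Basis \<Longrightarrow> continuous_on S (\<lambda>x. D2 x i j)"
    "\<And>x. x \<in> S \<Longrightarrow> (\<Sum>i\<in>Basis. D2 x i i) = 0" by (rule harmonic_onE[OF f]) (rule that)
  have "(g has_derivative D1 x) (at x)" if "x \<in> S" for x
    by (rule has_derivative_transform_within_open[OF D(2) D(1)]) (use that eq in auto)
  then show ?thesis by (rule harmonic_onI[OF D(1) _ D(3-5)])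
qed

text \<open>With w = y - \<zeta>, a = -n/2 and hence n = -2a, the Laplacian collects to 4 a
  |w|^(2a-2) (|w|^2 - 2 y.w - (1 - |y|^2)). The bracket vanishes because |\<zeta>| = 1.\<close>

lemma harmonic_poisson_powr:
  fixes \<zeta> :: "'a::euclidean_space"
  assumes z: "norm \<zeta> = 1"
  shows "harmonic_on (\<lambda>y. (1 - y \<bullet> y) * ((y - \<zeta>) \<bullet> (y - \<zeta>)) powr (- (real DIM('a) / 2))) (- {\<zeta>})"
proof -
  define a where "a = - (real DIM('a) / 2)"
  define q where "q y = (y - \<zeta>) \<bullet> (y - \<zeta>)" for y
  have q: "q y > 0" if "y \<in> - {\<zeta>}" for y using that by (simp add: q_def)
  have qd: "(q has_derivative (\<lambda>v. 2 * ((y - \<zeta>) \<bullet> v))) (at y)" for y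
    unfolding q_def by (auto intro!: derivative_eq_intros simp: inner_commute)
  have qp: "((\<lambda>y. q y powr b) has_derivative (\<lambda>v. b * q y powr (b - 1) * (2 * ((y - \<zeta>) \<bullet> v)))) (at y)" if "y \<in> - {\<zeta>}" for y b
  proof -
    have "((\<lambda>t. t powr b) has_real_derivative b * q y powr (b - 1)) (at (q y))"
      by (rule has_real_derivative_powr) (rule q[OF that])
    from has_derivative_compose[OF qd this[unfolded has_field_derivative_def]]
    show ?thesis by simp
  qed
  have cq: "continuous_on (- {\<zeta>}) (\<lambda>y. q y powr b)" for b
    by (rule continuous_at_imp_continuous_on) (use qp has_derivative_continuous in blast)
  define E where "E b y = q y powr b" for b y
  have qE: "(E b has_derivative (\<lambda>v. b * E (b - 1) y * (2 * ((y - \<zeta>) \<bullet> v)))) (at y)" if "y \<in> - {\<zeta>}" for y b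
    using qp[OF that] unfolding E_def[abs_def] .
  have cE: "continuous_on (- {\<zeta>}) (\<lambda>y. E b y)" for b using cq unfolding E_def .
  define D1 where "D1 y v = - (2 * (y \<bullet> v)) * E a y + (1 - y \<bullet> y) * (a * E (a - 1) y * (2 * ((y - \<zeta>) \<bullet> v)))" for y v
  define D2 where "D2 y i v = - (2 * (v \<bullet> i)) * E a y - (2 * (y \<bullet> i)) * (a * E (a - 1) y * (2 * ((y - \<zeta>) \<bullet> v)))
     - 2 * (y \<bullet> v) * (a * E (a - 1) y * (2 * ((y - \<zeta>) \<bullet> i)))
     + (1 - y \<bullet> y) * (a * ((a - 1) * E (a - 1 - 1) y * (2 * ((y - \<zeta>) \<bullet> v))) * (2 * ((y - \<zeta>) \<bullet> i)) + a * E (a - 1) y * (2 * (v \<bullet> i)))" for y i v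
  have "harmonic_on (\<lambda>y. (1 - y \<bullet> y) * E a y) (- {\<zeta>})"
  proof (rule harmonic_onI[where ?D1.0 = D1 and ?D2.0 = D2])
    fix y assume y: "y \<in> - {\<zeta>}"
    show "((\<lambda>y. (1 - y \<bullet> y) * E a y) has_derivative D1 y) (at y)"
      unfolding D1_def using y by (auto intro!: derivative_eq_intros qE simp: fun_eq_iff inner_commute algebra_simps)
    show "((\<lambda>y. D1 y i) has_derivative D2 y i) (at y)" for i
      unfolding D1_def D2_def using y by (auto intro!: derivative_eq_intros qE simp: fun_eq_iff inner_commute algebra_simps)
    show "(\<Sum>i\<in>Basis. D2 y i i) = 0"
    proof -
      define w where "w = y - \<zeta>"
      have s1: "(\<Sum>i\<in>Basis. (u \<bullet> i) * (v \<bullet> i)) = u \<bullet> v" for u v :: 'a by (rule euclidean_inner[symmetric])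
      have s2: "(\<Sum>i\<in>(Basis::'a set). i \<bullet> i) = real DIM('a)" by (simp add: inner_Basis)
      have "(\<Sum>i\<in>Basis. D2 y i i) = (\<Sum>i\<in>Basis. (- 2 * q y powr a + (1 - y \<bullet> y) * a * q y powr (a - 1) * 2) * (i \<bullet> i)
         + (- 8 * a * q y powr (a - 1)) * ((y \<bullet> i) * (w \<bullet> i))
         + (1 - y \<bullet> y) * a * (a - 1) * q y powr (a - 1 - 1) * 4 * ((w \<bullet> i) * (w \<bullet> i)))"
        by (intro sum.cong refl) (simp add: D2_def E_def w_def[symmetric] algebra_simps)
      also have "... = (- 2 * q y powr a + (1 - y \<bullet> y) * a * q y powr (a - 1) * 2) * real DIM('a)
         + (- 8 * a * q y powr (a - 1)) * (y \<bullet> w) + (1 - y \<bullet> y) * a * (a - 1) * q y powr (a - 1 - 1) * 4 * (w \<bullet> w)"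
        by (simp only: sum.distrib sum_distrib_left[symmetric] s1 s2)
      also have "real DIM('a) = - 2 * a" by (simp add: a_def)
      also have "q y powr a = q y powr (a - 1) * q y" using q[OF y] powr_add[of "q y" "a - 1" 1] by simp
      also have "w \<bullet> w = q y" by (simp add: q_def w_def)
      also have "(1 - y \<bullet> y) * a * (a - 1) * q y powr (a - 1 - 1) * 4 * q y = (1 - y \<bullet> y) * a * (a - 1) * q y powr (a - 1) * 4"
        using q[OF y] powr_add[of "q y" "a - 1 - 1" 1] by simp
      also have "(- 2 * (q y powr (a - 1) * q y) + (1 - y \<bullet> y) * a * q y powr (a - 1) * 2) * (- 2 * a)
         + (- 8 * a * q y powr (a - 1)) * (y \<bullet> w) + (1 - y \<bullet> y) * a * (a - 1) * q y powr (a - 1) * 4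
         = 4 * a * q y powr (a - 1) * (q y - 2 * (y \<bullet> w) - (1 - y \<bullet> y))" by (simp add: algebra_simps)
      also have "q y - 2 * (y \<bullet> w) - (1 - y \<bullet> y) = 0"
      proof -
        have "\<zeta> \<bullet> \<zeta> = 1" using z by (simp add: norm_eq_1)
        then show ?thesis by (simp add: q_def w_def inner_diff_left inner_diff_right inner_commute[of \<zeta> y])
      qed
      finally show ?thesis by simp
    qed
  next
    show "continuous_on (- {\<zeta>}) (\<lambda>y. D2 y i j)" for i j
      unfolding D2_def by (intro continuous_intros cE)
  qed auto
  then show ?thesis unfolding E_def q_def a_def .
qed

lemma harmonic_poisson:
  fixes \<zeta> :: "'a::euclidean_space"
  assumes z: "norm \<zeta> = 1"
  shows "harmonic_on (poisson \<zeta>) (ball 0 1)"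
proof (rule harmonic_on_cong)
  show "harmonic_on (\<lambda>y. complex_of_real ((1 - y \<bullet> y) * ((y - \<zeta>) \<bullet> (y - \<zeta>)) powr (- (real DIM('a) / 2)))) (ball 0 1)"
    by (rule harmonic_on_of_real, rule harmonic_on_subset[OF harmonic_poisson_powr[OF z]]) (use z in auto)
  fix y assume "y \<in> ball (0::'a) 1"
  then have n: "norm (y - \<zeta>) > 0" using z by auto
  have "((y - \<zeta>) \<bullet> (y - \<zeta>)) powr (- (real DIM('a) / 2)) = ((norm (y - \<zeta>)) powr 2) powr (- (real DIM('a) / 2))"
    using n by (simp only: powr_numeral power2_norm_eq_inner)
  also have "... = norm (y - \<zeta>) powr (- real DIM('a))" using powr_powr[of "norm (y - \<zeta>)" 2 "- (real DIM('a) / 2)"] by simp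
  also have "... = 1 / norm (y - \<zeta>) ^ DIM('a)" using n by (simp add: powr_minus powr_realpow divide_inverse)
  finally show "complex_of_real ((1 - y \<bullet> y) * ((y - \<zeta>) \<bullet> (y - \<zeta>)) powr (- (real DIM('a) / 2))) = poisson \<zeta> y"
    by (simp add: poisson_def power2_norm_eq_inner)
qed

lemma poisson_measurable [measurable]: "poisson \<zeta> \<in> borel_measurable borel"
  unfolding poisson_def by measurable

section \<open>Zonal sums and the mean of the Poisson kernel\<close>

context spherical_basis
begin

definition Z :: "nat \<Rightarrow> 'a \<Rightarrow> 'a \<Rightarrow> complex" where
  "Z k u v = (\<Sum>j=1..d k. H k j u * cnj (H k j v))"

definition surf :: real where "surf = real DIM('a) * cone_mass TYPE('a)"

lemma surf_pos: "surf > 0"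
  unfolding surf_def using cone_mass_pos[where 'a = 'a] by simp

lemma zonal_eq_Z: "u \<in> sphere 0 1 \<Longrightarrow> v \<in> sphere 0 1 \<Longrightarrow> zonal d Y k u v = Z k u v"
  unfolding zonal_def Z_def by (intro sum.cong refl) (simp add: H_Y)

text \<open>Let m be the sum of squares at u. The degree-k function P formed with the coefficients
  \<open>cnj (H k j u)\<close> has P(u) = m, while its mean square on spheres inside the ball is at
  most m. The pointwise bound at r u gives r^k m \<le> K sqrt m. Thus m grows more slowly than any
  exponential in k.\<close>

lemma square_sum_growth:
  assumes r: "0 < r" "r < 1"
  shows "\<exists>C>0. \<forall>k. \<forall>u\<in>sphere 0 1. (\<Sum>j=1..d k. (cmod (H k j u))\<^sup>2) * r ^ (2 * k) \<le> C"
proof -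
  obtain C where C: "C > 0" "\<And>(f :: 'a \<Rightarrow> complex) x R \<eta>. f \<in> borel_measurable borel \<Longrightarrow> harmonic_on f (ball 0 1) \<Longrightarrow> 0 < \<eta> \<Longrightarrow>
     norm x < R \<Longrightarrow> R \<le> 1 \<Longrightarrow> (\<And>r. 0 < r \<Longrightarrow> r < R \<Longrightarrow> (\<integral>\<^sup>+u. ennreal ((cmod (f (r *\<^sub>R u)))\<^sup>2) \<partial>cone_measure) \<le> ennreal (\<eta>\<^sup>2)) \<Longrightarrow>
     cmod (f x) \<le> C / (R - norm x) ^ DIM('a) * \<eta>"
    using pointwise_L2_bound by blast
  define K where "K = C / (1 - r) ^ DIM('a)"
  have K: "K > 0" using C(1) r by (simp add: K_def)
  have "(\<Sum>j=1..d k. (cmod (H k j u))\<^sup>2) * r ^ (2 * k) \<le> K\<^sup>2" if u: "u \<in> sphere 0 1" for k u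
  proof (cases "(\<Sum>j=1..d k. (cmod (H k j u))\<^sup>2) = 0")
    case True
    then show ?thesis by (simp only: mult_zero_left zero_le_power2)
  next
    case False
    define m where "m = (\<Sum>j=1..d k. (cmod (H k j u))\<^sup>2)"
    have m: "m > 0" using False unfolding m_def by (simp add: less_le sum_nonneg)
    define P where "P x = (\<Sum>j=1..d k. cnj (H k j u) * H k j x)" for x
    have Ph: "harmonic_on P UNIV" unfolding P_def
      by (rule harmonic_on_sum) (auto intro!: harmonic_on_cmult H_harmonic)
    have Pm[measurable]: "P \<in> borel_measurable borel"
      by (intro borel_measurable_continuous_onI harmonic_on_imp_continuous_on Ph)
    have Phom: "P (c *\<^sub>R x) = c ^ k *\<^sub>R P x" for c x
      unfolding P_def scaleR_sum_right by (intro sum.cong refl) (simp add: H_hom)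
    have Pu: "P u = of_real m" unfolding P_def m_def of_real_sum
      by (intro sum.cong refl) (simp only: complex_norm_square mult.commute)
    have sqr: "square_integrable surface_measure (\<lambda>v. P (\<rho> *\<^sub>R v))" if "0 \<le> \<rho>" "\<rho> < 1" for \<rho>
      by (rule square_integrable_surface[OF Pm _ that]) (intro harmonic_on_imp_continuous_on harmonic_on_subset[OF Ph], auto)
    have PL2: "(\<integral>\<^sup>+v. ennreal ((cmod (P (\<rho> *\<^sub>R v)))\<^sup>2) \<partial>cone_measure) \<le> ennreal ((sqrt m)\<^sup>2)" if rho: "0 < \<rho>" "\<rho> < 1" for \<rho>
    proof -
      have "(\<integral>\<^sup>+v. ennreal ((cmod (P (\<rho> *\<^sub>R v)))\<^sup>2) \<partial>cone_measure) \<le> ennreal (LINT v|surface_measure. (cmod (P (\<rho> *\<^sub>R v)))\<^sup>2)"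
        by (rule nn_integral_cone_square[OF _ sqr]) (use rho in auto)
      also have "(LINT v|surface_measure. (cmod (P (\<rho> *\<^sub>R v)))\<^sup>2) = (\<Sum>i\<in>Pair k ` {1..d k}. (cmod (of_real \<rho> ^ k * cnj (H k (snd i) u)))\<^sup>2)"
      proof -
        have F: "finite (Pair k ` {1..d k})" "Pair k ` {1..d k} \<subseteq> idx" by (auto simp: idx_def)
        \<comment> \<open>Bessel's identity for h = 0 evaluates the mean square of a finite
          combination.\<close>
        have s0: "square_integrable surface_measure (\<lambda>_. 0)" by (simp add: square_integrable_def)
        have e: "cmod (P (\<rho> *\<^sub>R v)) = cmod (0 - (\<Sum>i\<in>Pair k ` {1..d k}. (of_real \<rho> ^ k * cnj (H k (snd i) u)) * (case i of (k, j) \<Rightarrow> H k j) v))" for v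
        proof -
          have "(\<Sum>i\<in>Pair k ` {1..d k}. (of_real \<rho> ^ k * cnj (H k (snd i) u)) * (case i of (k, j) \<Rightarrow> H k j) v) = P (\<rho> *\<^sub>R v)"
            unfolding Phom unfolding P_def scaleR_sum_right
            by (subst sum.reindex) (auto intro!: inj_onI sum.cong simp: scaleR_conv_of_real)
          then show ?thesis by simp
        qed
        show ?thesis unfolding e
          using bessel_identity[OF H_orthonormal_basis s0 F, of "\<lambda>i. of_real \<rho> ^ k * cnj (H k (snd i) u)"] by simp
      qed
      also have "... = \<rho> ^ (2 * k) * m"
        unfolding m_def sum_distrib_left
        by (subst sum.reindex) (use rho in \<open>auto intro!: inj_onI sum.cong simp: norm_mult norm_power power_mult_distrib power_mult[symmetric] mult.commute\<close>)
      also have "ennreal (\<rho> ^ (2 * k) * m) \<le> ennreal ((sqrt m)\<^sup>2)"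
        using m rho by (intro ennreal_leI) (auto intro!: mult_left_le_one_le power_le_one)
      finally show ?thesis .
    qed
    have nr: "norm (r *\<^sub>R u) = r" using u r by simp
    have "cmod (P (r *\<^sub>R u)) \<le> C / (1 - norm (r *\<^sub>R u)) ^ DIM('a) * sqrt m"
      by (rule C(2)[OF Pm harmonic_on_subset[OF Ph]]) (use m PL2 r nr in auto)
    then have "r ^ k * m \<le> K * sqrt m"
      unfolding nr K_def[symmetric] Phom Pu using r m by (simp add: abs_mult)
    then have "r ^ k * sqrt m * sqrt m \<le> K * sqrt m" using m by (simp add: mult.assoc)
    then have "r ^ k * sqrt m \<le> K" using m by simp
    then have "(r ^ k * sqrt m)\<^sup>2 \<le> K\<^sup>2" using r m by (intro power_mono) auto
    then show ?thesis using m by (simp add: power_mult_distrib power_mult[symmetric] mult.commute m_def)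
  qed
  then show ?thesis using K by (intro exI[of _ "K\<^sup>2"]) auto
qed

lemma Z_bound_aux:
  "cmod (Z k u v) \<le> (\<Sum>j=1..d k. (cmod (H k j u))\<^sup>2) + (\<Sum>j=1..d k. (cmod (H k j v))\<^sup>2)"
proof -
  have "cmod (Z k u v) \<le> (\<Sum>j=1..d k. cmod (H k j u) * cmod (H k j v))"
    unfolding Z_def by (rule order_trans[OF norm_sum]) (simp add: norm_mult)
  also have "... \<le> (\<Sum>j=1..d k. (cmod (H k j u))\<^sup>2 + (cmod (H k j v))\<^sup>2)"
  proof (rule sum_mono)
    fix j
    have "a * b \<le> a\<^sup>2 + b\<^sup>2" if "a \<ge> 0" "b \<ge> 0" for a b :: real
      using sum_squares_bound[of a b] that mult_nonneg_nonneg[OF that] by linarith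
    then show "cmod (H k j u) * cmod (H k j v) \<le> (cmod (H k j u))\<^sup>2 + (cmod (H k j v))\<^sup>2" by simp
  qed
  finally show ?thesis by (simp add: sum.distrib)
qed

lemma Z_growth:
  assumes r: "0 < r" "r < 1"
  shows "\<exists>C>0. \<forall>k. \<forall>u\<in>sphere 0 1. \<forall>v\<in>sphere 0 1. cmod (Z k u v) * r ^ k \<le> C"
proof -
  \<comment> \<open>Taken at radius sqrt r, whose power 2 k is r^k.\<close>
  obtain C where C: "C > 0" "\<And>k u. u \<in> sphere 0 1 \<Longrightarrow> (\<Sum>j=1..d k. (cmod (H k j u))\<^sup>2) * (sqrt r) ^ (2 * k) \<le> C"
    using square_sum_growth[of "sqrt r"] r by (metis real_sqrt_gt_zero real_sqrt_lt_1_iff)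
  have "cmod (Z k u v) * r ^ k \<le> 2 * C" if "u \<in> sphere 0 1" "v \<in> sphere 0 1" for k u v
  proof -
    have e: "(sqrt r) ^ (2 * k) = r ^ k" using r by (simp add: power_mult)
    have "cmod (Z k u v) * r ^ k \<le> ((\<Sum>j=1..d k. (cmod (H k j u))\<^sup>2) + (\<Sum>j=1..d k. (cmod (H k j v))\<^sup>2)) * r ^ k"
      by (rule mult_right_mono[OF Z_bound_aux]) (use r in simp)
    also have "... \<le> C + C" unfolding distrib_right using C(2)[of _ k] that unfolding e by (intro add_mono) auto
    finally show ?thesis by simp
  qed
  then show ?thesis using C(1) by (intro exI[of _ "2 * C"]) auto
qed

text \<open>The coefficient of degree 0 is constant in the radius, and at the centre the Poisson
  kernel equals 1.\<close>

lemma poisson_mean: "r \<in> {0<..<1} \<Longrightarrow> norm \<zeta> = 1 \<Longrightarrow> (LINT u|cone_measure. poisson \<zeta> (r *\<^sub>R u)) = of_real (cone_mass TYPE('a))" for \<zeta> :: 'a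
proof -
  fix \<zeta> :: 'a and r :: real assume r: "r \<in> {0<..<1}" and z: "norm \<zeta> = 1"
  define g where "g r = (LINT u|cone_measure. poisson \<zeta> (r *\<^sub>R u) * 1)" for r
  obtain c where c: "\<And>r. r \<in> {0<..<1} \<Longrightarrow> g r = of_real r ^ 0 * c"
    using cone_coefficient_homogeneous[OF poisson_measurable harmonic_poisson[OF z] harmonic_on_const, of 1 0] unfolding g_def by auto
  have cg: "continuous_on {0..<1} g" unfolding g_def
    by (rule continuous_on_cone_integral) (auto intro: harmonic_on_imp_continuous_on[OF harmonic_poisson[OF z]])
  have "(\<lambda>n. g (inverse (real (Suc (Suc n))))) \<longlonglongrightarrow> g 0"
    by (rule continuous_on_tendsto_compose[OF cg])
      (auto intro!: LIMSEQ_Suc LIMSEQ_inverse_real_of_nat always_eventually simp del: of_nat_Suc simp: inverse_less_1_iff)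
  moreover have "g (inverse (real (Suc (Suc n)))) = c" for n
    using c[of "inverse (real (Suc (Suc n)))"] by (simp add: inverse_less_1_iff)
  ultimately have "c = g 0" by (simp add: LIMSEQ_const_iff)
  also have "g 0 = of_real (cone_mass TYPE('a))" using z by (simp add: g_def poisson_def cone_mass_def scaleR_conv_of_real)
  finally show "(LINT u|cone_measure. poisson \<zeta> (r *\<^sub>R u)) = of_real (cone_mass TYPE('a))" using c[OF r] by (simp add: g_def)
qed

end

lemma direction_props:
  fixes x :: "'a::euclidean_space"
  shows "direction x \<in> sphere 0 1" "norm (direction x) = 1" "x = norm x *\<^sub>R direction x"
proof -
  have "\<exists>u. u \<in> sphere 0 1 \<and> x = norm x *\<^sub>R u" using exists_unit_direction[of x] by auto
  from someI_ex[OF this] show "direction x \<in> sphere 0 1" "norm (direction x) = 1" "x = norm x *\<^sub>R direction x"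
    unfolding direction_def by auto
qed

context spherical_basis
begin

text \<open>The Poisson kernel acts as an approximate identity on the sphere.\<close>

lemma poisson_coefficient:
  assumes z: "norm \<zeta> = 1" and j: "j \<in> {1..d k}" and r: "r \<in> {0<..<1}"
  shows "(LINT u|surface_measure. poisson \<zeta> (r *\<^sub>R u) * cnj (H k j u)) = of_real r ^ k * (of_real surf * cnj (H k j \<zeta>))"
proof -
  define \<kappa> where "\<kappa> = cone_mass TYPE('a)"
  have k: "\<kappa> > 0" unfolding \<kappa>_def by (rule cone_mass_pos)
  define h where "h u = cnj (H k j u)" for u
  have hh: "harmonic_on h UNIV" unfolding h_def by (rule harmonic_on_cnj[OF H_harmonic[OF j]])
  have hhom: "h (c *\<^sub>R x) = c ^ k *\<^sub>R h x" for c x unfolding h_def by (simp add: H_hom[OF j])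
  have ch: "continuous_on T h" for T
    using harmonic_on_imp_continuous_on[OF hh] continuous_on_subset by blast
  have hm[measurable]: "h \<in> borel_measurable borel" using borel_measurable_continuous_onI[OF ch] .
  have pm: "poisson \<zeta> \<in> borel_measurable borel" by simp
  have cp: "continuous_on (ball 0 1) (poisson \<zeta>)" by (rule harmonic_on_imp_continuous_on[OF harmonic_poisson[OF z]])
  define g where "g r = (LINT u|cone_measure. poisson \<zeta> (r *\<^sub>R u) * h u)" for r
  obtain c where c: "\<And>r. r \<in> {0<..<1} \<Longrightarrow> g r = of_real r ^ k * c"
    using cone_coefficient_homogeneous[OF pm harmonic_poisson[OF z] hh hhom] unfolding g_def by blast
  obtain B where B: "B \<ge> 0" "\<And>u. u \<in> sphere 0 1 \<Longrightarrow> norm (h u) \<le> B"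
    using continuous_on_compact_bound[OF compact_sphere ch] by blast
  \<comment> \<open>Homogeneity has reduced the claim to the value of the constant c, which is found
    by letting r tend to 1 in the coefficient r^k c.\<close>
  have "cmod (c - h \<zeta> * of_real \<kappa>) \<le> \<epsilon> * \<kappa>" if e: "\<epsilon> > 0" for \<epsilon>
  proof -
    have "continuous (at \<zeta>) h" using ch[of UNIV] by (simp add: continuous_on_eq_continuous_at)
    then obtain \<delta> where dl: "\<delta> > 0" "\<And>u. dist u \<zeta> < \<delta> \<Longrightarrow> dist (h u) (h \<zeta>) < \<epsilon>"
      using e unfolding continuous_at_eps_delta by blast
    \<comment> \<open>The first summand covers |u - \<zeta>| < \<delta>, where h varies by less than
      \<epsilon> and the kernel has mass \<kappa>. For the other u the condition r > 1 - \<delta>/2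
      gives |r u - \<zeta>| \<ge> \<delta>/2, and the second summand tends to 0 with 1 -
      r^2.\<close>
    define D where "D r = \<epsilon> * \<kappa> + 2 * B * \<kappa> * ((1 - r\<^sup>2) / (\<delta> / 2) ^ DIM('a))" for r
    have main: "cmod (of_real r ^ k * c - h \<zeta> * of_real \<kappa>) \<le> D r" if r: "r \<in> {0<..<1}" "r > 1 - \<delta> / 2" for r
    proof -
      have i1: "integrable cone_measure (\<lambda>u. poisson \<zeta> (r *\<^sub>R u) * h u)"
        by (rule integrable_cone[OF pm hm cp ch]) (use r in auto)
      have i0: "integrable cone_measure (\<lambda>u. poisson \<zeta> (r *\<^sub>R u) * 1)"
        by (rule integrable_cone[OF pm _ cp]) (use r in auto)
      then have i2: "integrable cone_measure (\<lambda>u. h \<zeta> * poisson \<zeta> (r *\<^sub>R u))" by simp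
      have ip: "integrable cone_measure (\<lambda>u. Re (poisson \<zeta> (r *\<^sub>R u)))" using i0 by (simp add: integrable_Re)
      have pr: "poisson \<zeta> (r *\<^sub>R u) = of_real (Re (poisson \<zeta> (r *\<^sub>R u)))" for u by (simp add: poisson_def)
      have pnn: "Re (poisson \<zeta> (r *\<^sub>R u)) \<ge> 0" if "norm u = 1" for u
        using that r by (auto simp: poisson_def power_le_one)
      have rint: "(LINT u|cone_measure. Re (poisson \<zeta> (r *\<^sub>R u))) = \<kappa>"
      proof -
        have "complex_of_real (LINT u|cone_measure. Re (poisson \<zeta> (r *\<^sub>R u))) = (LINT u|cone_measure. poisson \<zeta> (r *\<^sub>R u))"
          by (subst integral_complex_of_real[symmetric]) (simp only: pr[symmetric])
        also have "... = of_real \<kappa>" unfolding \<kappa>_def by (rule poisson_mean[OF r(1) z])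
        finally show ?thesis by (simp only: of_real_eq_iff)
      qed
      have "of_real r ^ k * c - h \<zeta> * of_real \<kappa> = g r - h \<zeta> * (LINT u|cone_measure. poisson \<zeta> (r *\<^sub>R u))"
        using c[OF r(1)] poisson_mean[OF r(1) z] by (simp add: \<kappa>_def)
      also have "... = (LINT u|cone_measure. poisson \<zeta> (r *\<^sub>R u) * h u - h \<zeta> * poisson \<zeta> (r *\<^sub>R u))"
        unfolding g_def Bochner_Integration.integral_diff[OF i1 i2] by (simp only: integral_mult_right_zero)
      also have "cmod ... \<le> (LINT u|cone_measure. cmod (poisson \<zeta> (r *\<^sub>R u) * h u - h \<zeta> * poisson \<zeta> (r *\<^sub>R u)))"
        by (rule integral_norm_bound)
      also have "... \<le> (LINT u|cone_measure. \<epsilon> * Re (poisson \<zeta> (r *\<^sub>R u)) + 2 * B * ((1 - r\<^sup>2) / (\<delta> / 2) ^ DIM('a)))"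
      proof (rule integral_mono_AE)
        show "integrable cone_measure (\<lambda>u. cmod (poisson \<zeta> (r *\<^sub>R u) * h u - h \<zeta> * poisson \<zeta> (r *\<^sub>R u)))"
          by (intro integrable_norm Bochner_Integration.integrable_diff i1 i2)
        show "integrable cone_measure (\<lambda>u. \<epsilon> * Re (poisson \<zeta> (r *\<^sub>R u)) + 2 * B * ((1 - r\<^sup>2) / (\<delta> / 2) ^ DIM('a)))"
          by (intro Bochner_Integration.integrable_add integrable_mult_right ip finite_measure.integrable_const[OF finite_measure_cone])
        show "AE u in cone_measure. cmod (poisson \<zeta> (r *\<^sub>R u) * h u - h \<zeta> * poisson \<zeta> (r *\<^sub>R u))
            \<le> \<epsilon> * Re (poisson \<zeta> (r *\<^sub>R u)) + 2 * B * ((1 - r\<^sup>2) / (\<delta> / 2) ^ DIM('a))"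
          using AE_cone
        proof eventually_elim
          case (elim u)
          have "poisson \<zeta> (r *\<^sub>R u) * h u - h \<zeta> * poisson \<zeta> (r *\<^sub>R u) = poisson \<zeta> (r *\<^sub>R u) * (h u - h \<zeta>)" by (simp add: algebra_simps)
          moreover have "cmod (poisson \<zeta> (r *\<^sub>R u)) = Re (poisson \<zeta> (r *\<^sub>R u))"
            using pnn[OF elim] pr[of u] by (metis abs_of_nonneg norm_of_real)
          ultimately have eq: "cmod (poisson \<zeta> (r *\<^sub>R u) * h u - h \<zeta> * poisson \<zeta> (r *\<^sub>R u)) = Re (poisson \<zeta> (r *\<^sub>R u)) * cmod (h u - h \<zeta>)"
            by (simp add: norm_mult)
          have nn: "0 \<le> 2 * B * ((1 - r\<^sup>2) / (\<delta> / 2) ^ DIM('a))"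
            using B(1) r dl(1) by (intro mult_nonneg_nonneg divide_nonneg_nonneg) (auto simp: power_le_one)
          show ?case
          proof (cases "dist u \<zeta> < \<delta>")
            case True
            then have "cmod (h u - h \<zeta>) \<le> \<epsilon>" using dl(2) by (simp add: dist_norm less_imp_le)
            then have "Re (poisson \<zeta> (r *\<^sub>R u)) * cmod (h u - h \<zeta>) \<le> Re (poisson \<zeta> (r *\<^sub>R u)) * \<epsilon>"
              by (rule mult_left_mono) (rule pnn[OF elim])
            then show ?thesis unfolding eq using nn by (simp add: mult.commute)
          next
            case False
            have "\<delta> \<le> norm (u - \<zeta>)" using False by (simp add: dist_norm)
            also have "... \<le> norm (u - r *\<^sub>R u) + norm (r *\<^sub>R u - \<zeta>)" using norm_triangle_ineq[of "u - r *\<^sub>R u" "r *\<^sub>R u - \<zeta>"] by simp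
            also have "norm (u - r *\<^sub>R u) = 1 - r"
            proof -
              have "u - r *\<^sub>R u = (1 - r) *\<^sub>R u" by (simp add: algebra_simps)
              then show ?thesis using elim r by simp
            qed
            finally have ge: "\<delta> / 2 \<le> norm (r *\<^sub>R u - \<zeta>)" using r(2) by simp
            have "Re (poisson \<zeta> (r *\<^sub>R u)) = (1 - r\<^sup>2) / norm (r *\<^sub>R u - \<zeta>) ^ DIM('a)"
              using elim by (simp add: poisson_def power_mult_distrib)
            also have "... \<le> (1 - r\<^sup>2) / (\<delta> / 2) ^ DIM('a)"
              using ge dl(1) r by (intro divide_left_mono power_mono mult_pos_pos zero_less_power) (auto simp: power_le_one)
            finally have "Re (poisson \<zeta> (r *\<^sub>R u)) \<le> (1 - r\<^sup>2) / (\<delta> / 2) ^ DIM('a)" .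
            moreover have "cmod (h u - h \<zeta>) \<le> 2 * B"
              using norm_triangle_ineq4[of "h u" "h \<zeta>"] B(2)[of u] B(2)[of \<zeta>] elim z by simp
            ultimately have "Re (poisson \<zeta> (r *\<^sub>R u)) * cmod (h u - h \<zeta>) \<le> (1 - r\<^sup>2) / (\<delta> / 2) ^ DIM('a) * (2 * B)"
              using pnn[OF elim] by (intro mult_mono) auto
            moreover have "0 \<le> \<epsilon> * Re (poisson \<zeta> (r *\<^sub>R u))" using e pnn[OF elim] by (intro mult_nonneg_nonneg) auto
            ultimately show ?thesis unfolding eq by (simp add: mult.commute)
          qed
        qed
      qed
      also have "... = D r"
      proof -
        have "(LINT u|cone_measure. \<epsilon> * Re (poisson \<zeta> (r *\<^sub>R u)) + 2 * B * ((1 - r\<^sup>2) / (\<delta> / 2) ^ DIM('a)))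
          = \<epsilon> * (LINT u|cone_measure. Re (poisson \<zeta> (r *\<^sub>R u))) + (LINT u|(cone_measure::'a measure). 2 * B * ((1 - r\<^sup>2) / (\<delta> / 2) ^ DIM('a)))"
          by (subst Bochner_Integration.integral_add) (auto intro!: integrable_mult_right ip finite_measure.integrable_const[OF finite_measure_cone])
        then show ?thesis unfolding rint D_def \<kappa>_def by (simp add: cone_mass_def mult_ac)
      qed
      finally show ?thesis .
    qed
    define rr where "rr i = 1 - inverse (real (Suc (Suc i)))" for i
    have rr: "rr i \<in> {0<..<1}" for i by (auto simp: rr_def inverse_less_1_iff)
    have lim: "rr \<longlonglongrightarrow> 1" unfolding rr_def
      using tendsto_diff[OF tendsto_const LIMSEQ_Suc[OF LIMSEQ_inverse_real_of_nat], of 1] by simp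
    have l1: "(\<lambda>i. cmod (of_real (rr i) ^ k * c - h \<zeta> * of_real \<kappa>)) \<longlonglongrightarrow> cmod (of_real 1 ^ k * c - h \<zeta> * of_real \<kappa>)"
      by (intro tendsto_intros lim)
    have l2: "(\<lambda>i. D (rr i)) \<longlonglongrightarrow> D 1" unfolding D_def using dl(1) by (intro tendsto_intros lim) auto
    have "\<forall>\<^sub>F i in sequentially. rr i > 1 - \<delta> / 2" by (rule order_tendstoD(1)[OF lim]) (use dl(1) in simp)
    then have "\<forall>\<^sub>F i in sequentially. cmod (of_real (rr i) ^ k * c - h \<zeta> * of_real \<kappa>) \<le> D (rr i)"
      by eventually_elim (rule main[OF rr])
    then have "cmod (of_real 1 ^ k * c - h \<zeta> * of_real \<kappa>) \<le> D 1"
      by (rule tendsto_le[OF sequentially_bot l2 l1])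
    then show ?thesis by (simp add: D_def)
  qed
  then have "cmod (c - h \<zeta> * of_real \<kappa>) \<le> 0 + \<epsilon>" if "\<epsilon> > 0" for \<epsilon>
    using that k \<open>\<And>\<epsilon>. \<epsilon> > 0 \<Longrightarrow> cmod (c - h \<zeta> * of_real \<kappa>) \<le> \<epsilon> * \<kappa>\<close>[of "\<epsilon> / \<kappa>"] by simp
  then have "cmod (c - h \<zeta> * of_real \<kappa>) \<le> 0" by (rule field_le_epsilon)
  then have cc: "c = h \<zeta> * of_real \<kappa>" by simp
  have "(LINT u|surface_measure. poisson \<zeta> (r *\<^sub>R u) * cnj (H k j u)) = real DIM('a) *\<^sub>R g r"
    unfolding g_def h_def[symmetric] by (rule integral_surface) measurable
  also have "... = of_real r ^ k * (of_real surf * cnj (H k j \<zeta>))"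
    unfolding c[OF r] cc surf_def \<kappa>_def[symmetric] by (simp add: h_def scaleR_conv_of_real)
  finally show ?thesis .
qed

text \<open>The expansion of the Poisson kernel with the coefficients of
  \<open>poisson_coefficient\<close>, its unordered sum regrouped by degree. The factor
  \<open>surf\<close>, the total mass of the sphere, appears because surface measure is not
  normalized.\<close>

lemma zonal_poisson_sums:
  assumes u: "u \<in> sphere 0 1" and z: "\<zeta> \<in> sphere 0 1" and r: "0 \<le> r" "r < 1"
  shows "(\<lambda>k. of_real surf * Z k u \<zeta> * of_real r ^ k) sums of_real ((1 - r\<^sup>2) / norm (r *\<^sub>R u - \<zeta>) ^ DIM('a))"
proof -
  have z1: "norm \<zeta> = 1" using z by simp
  have "((\<lambda>(k, j). (of_real surf * cnj (H k j \<zeta>)) * H k j (r *\<^sub>R u)) has_sum poisson \<zeta> (r *\<^sub>R u)) idx"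
    by (rule harmonic_expansion[OF _ harmonic_poisson[OF z1]]) (use u r poisson_coefficient[OF z1] in auto)
  then have "((\<lambda>k. \<Sum>j\<in>{1..d k}. (of_real surf * cnj (H k j \<zeta>)) * H k j (r *\<^sub>R u)) has_sum poisson \<zeta> (r *\<^sub>R u)) UNIV"
    unfolding idx_def by (rule has_sum_Sigma') (auto intro!: has_sum_finite)
  moreover have "(\<Sum>j\<in>{1..d k}. (of_real surf * cnj (H k j \<zeta>)) * H k j (r *\<^sub>R u)) = of_real surf * Z k u \<zeta> * of_real r ^ k" for k
    unfolding Z_def sum_distrib_left sum_distrib_right
    by (intro sum.cong refl) (simp add: H_hom scaleR_conv_of_real)
  ultimately have "(\<lambda>k. of_real surf * Z k u \<zeta> * of_real r ^ k) sums poisson \<zeta> (r *\<^sub>R u)"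
    by (simp add: has_sum_imp_sums)
  then show ?thesis using u r by (simp add: poisson_def power_mult_distrib)
qed

text \<open>z = exp(i \<theta>), with \<theta> the angle between u and v. It moves the geometry into
  the complex plane, where the extension of the Poisson kernel lives.\<close>

lemma unit_vectors_complex:
  assumes u: "u \<in> sphere 0 1" and v: "v \<in> sphere (0::'a) 1"
  shows "\<exists>z::complex. norm z = 1 \<and> (\<forall>t. norm (1 - of_real t * z) = norm (t *\<^sub>R u - v))"
proof -
  define c where "c = u \<bullet> v"
  have "\<bar>c\<bar> \<le> 1" using Cauchy_Schwarz_ineq2[of u v] u v by (simp add: c_def)
  then have c2: "c\<^sup>2 \<le> 1" by (simp add: abs_square_le_1)
  define z where "z = Complex c (sqrt (1 - c\<^sup>2))"
  have z1: "(norm z)\<^sup>2 = 1" using c2 by (simp add: z_def cmod_power2)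
  then have "norm z = 1" by (simp add: power2_eq_1_iff) (smt (verit) norm_ge_zero)
  moreover have "norm (1 - of_real t * z) = norm (t *\<^sub>R u - v)" for t
  proof -
    have "(norm (1 - of_real t * z))\<^sup>2 = (1 - t * c)\<^sup>2 + (t * sqrt (1 - c\<^sup>2))\<^sup>2" by (simp add: cmod_power2 z_def)
    also have "... = 1 - 2 * t * c + t\<^sup>2" using c2 by (simp add: power_mult_distrib power2_diff algebra_simps)
    also have "... = (norm (t *\<^sub>R u - v))\<^sup>2"
    proof -
      have "u \<bullet> u = 1" "v \<bullet> v = 1" using u v by (auto simp: norm_eq_1)
      then show ?thesis unfolding power2_norm_eq_inner
        by (simp add: inner_diff_left inner_diff_right c_def inner_commute[of v u] power2_eq_square algebra_simps)
    qed
    finally show ?thesis by simp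
  qed
  ultimately show ?thesis by blast
qed

text \<open>For real radii in (0, 1) both sides are the Poisson kernel. They are holomorphic in the
  unit disc and (0, 1) accumulates at 1/2, so the identity theorem applies.\<close>

lemma zonal_poisson_ext_sums:
  fixes z :: complex
  assumes u: "u \<in> sphere 0 1" and v: "v \<in> sphere 0 1"
    and z: "norm z = 1" "\<And>t. norm (1 - of_real t * z) = norm (t *\<^sub>R u - v)" and w: "w \<in> ball 0 1"
  shows "(\<lambda>k. (of_real surf * Z k u v) * w ^ k) sums poisson_ext DIM('a) z w"
proof -
  define q where "q k = of_real surf * Z k u v" for k
  have sm: "summable (\<lambda>k. q k * w ^ k)" if "w \<in> ball 0 1" for w
  proof -
    have "summable (\<lambda>k. q k * of_real ((1 + norm w) / 2) ^ k)" unfolding q_def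
      by (rule sums_summable, rule zonal_poisson_sums[OF u v]) (use that in \<open>auto intro: add_nonneg_nonneg\<close>)
    moreover have "norm w < norm (of_real ((1 + norm w) / 2) :: complex)"
      using that unfolding norm_of_real by auto
    ultimately show ?thesis using powser_inside by blast
  qed
  define S where "S w = (\<Sum>k. q k * w ^ k)" for w
  have sums: "(\<lambda>k. q k * w ^ k) sums S w" if "w \<in> ball 0 1" for w
    unfolding S_def by (rule summable_sums[OF sm[OF that]])
  have hS: "S holomorphic_on ball 0 1"
    by (rule power_series_holomorphic[where a = q]) (use sums in simp)
  have "S w - poisson_ext DIM('a) z w = 0"
  proof (rule analytic_continuation[where U = "of_real ` {0<..<1}" and \<xi> = "1 / 2" and S = "ball 0 1" and f = "\<lambda>w. S w - poisson_ext DIM('a) z w"])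
    show "(\<lambda>w. S w - poisson_ext DIM('a) z w) holomorphic_on ball 0 1"
      by (intro holomorphic_intros hS holomorphic_poisson_ext_disc[OF z(1)])
    show "(1 / 2 :: complex) islimpt of_real ` {0<..<1}"
      unfolding islimpt_approachable
    proof (intro allI impI)
      fix e :: real assume e: "e > 0"
      define t where "t = 1 / 2 + min (e / 2) (1 / 4)"
      have "of_real t \<in> complex_of_real ` {0<..<1}" using e by (intro imageI) (auto simp: t_def min_def)
      moreover have d: "complex_of_real t - 1 / 2 = of_real (min (e / 2) (1 / 4))" by (simp add: t_def)
      moreover have "norm (complex_of_real (min (e / 2) (1 / 4))) = min (e / 2) (1 / 4)" using e by (simp only: norm_of_real)
      ultimately show "\<exists>x'\<in>complex_of_real ` {0<..<1}. x' \<noteq> 1 / 2 \<and> dist x' (1 / 2) < e"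
        using e by (intro bexI[of _ "of_real t"]) (auto simp: dist_norm t_def min_def split: if_splits)
    qed
    fix x assume "x \<in> complex_of_real ` {0<..<1}"
    then obtain t where t: "x = of_real t" "0 < t" "t < 1" by auto
    have "S x = of_real ((1 - t\<^sup>2) / norm (t *\<^sub>R u - v) ^ DIM('a))"
      unfolding S_def q_def t by (rule sums_unique[symmetric], rule zonal_poisson_sums[OF u v]) (use t in auto)
    also have "... = poisson_ext DIM('a) z x" unfolding t using poisson_ext_of_real[OF z(1), of t "DIM('a)"] t z(2) by simp
    finally show "S x - poisson_ext DIM('a) z x = 0" by simp
  qed (use w in auto)
  then show ?thesis using sums[OF w] by (simp add: q_def)
qed

section \<open>The pointwise bound for the Bergman kernel\<close>

definition bcoef :: "real \<Rightarrow> nat \<Rightarrow> real" where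
  "bcoef \<beta> k = Gamma (\<beta> + 1 + real k + real DIM('a) / 2) / (Gamma (\<beta> + 1) * Gamma (real k + real DIM('a) / 2))"

lemma bergman_kernel_Z:
  "bergman_kernel d Y \<beta> x y = 2 * (\<Sum>k. of_real (bcoef \<beta> k * norm x ^ k * norm y ^ k) * Z k (direction x) (direction y))"
  unfolding bergman_kernel_def bcoef_def by (simp add: zonal_eq_Z[OF direction_props(1) direction_props(1)])

text \<open>Let D be the norm on the right and t = |x| |y|. Then 1 - |x| and 1 - |y| are at most 1 -
  t \<le> D, and passing through t u gives |u - v| \<le> 2 D. In \<open>kap\<close> the two boundary
  distances are counted twice, which makes 4 D + 2 D.\<close>

lemma kap_direction:
  fixes x y :: 'a
  assumes x: "norm x < 1" and y: "norm y < 1"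
  shows "kap x y / 6 \<le> norm ((norm x * norm y) *\<^sub>R direction x - direction y)"
proof -
  define u v t where "u = direction x" and "v = direction y" and "t = norm x * norm y"
  define D where "D = norm (t *\<^sub>R u - v)"
  have uv: "norm u = 1" "norm v = 1" "x = norm x *\<^sub>R u" "y = norm y *\<^sub>R v" using direction_props unfolding u_def v_def by blast+
  have t: "0 \<le> t" "t \<le> norm x" "t \<le> norm y" using x y by (auto simp: t_def mult_left_le mult_left_le_one_le)
  have D: "1 - t \<le> D" unfolding D_def using norm_triangle_ineq2[of v "t *\<^sub>R u"] uv t by (simp add: norm_minus_commute)
  have xu: "norm (x - u) = 1 - norm x"
  proof -
    have "x - u = (norm x - 1) *\<^sub>R u" using uv(3) by (simp add: algebra_simps)
    then have "norm (x - u) = \<bar>norm x - 1\<bar> * norm u" by (simp only: norm_scaleR)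
    then show ?thesis using uv x by simp
  qed
  have yv: "norm (v - y) = 1 - norm y"
  proof -
    have "v - y = (1 - norm y) *\<^sub>R v" using uv(4) by (simp add: algebra_simps)
    then have "norm (v - y) = \<bar>1 - norm y\<bar> * norm v" by (simp only: norm_scaleR)
    then show ?thesis using uv y by simp
  qed
  have utu: "norm (u - t *\<^sub>R u) = 1 - t"
  proof -
    have "u - t *\<^sub>R u = (1 - t) *\<^sub>R u" by (simp add: algebra_simps)
    then have "norm (u - t *\<^sub>R u) = \<bar>1 - t\<bar> * norm u" by (simp only: norm_scaleR)
    then show ?thesis using uv t x by simp
  qed
  have "norm (u - v) \<le> norm (u - t *\<^sub>R u) + D"
    unfolding D_def using norm_triangle_ineq[of "u - t *\<^sub>R u" "t *\<^sub>R u - v"] by simp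
  moreover have "norm (x - y) \<le> norm (x - u) + norm (u - v) + norm (v - y)"
  proof -
    have eq: "(x - u) + (u - v) + (v - y) = x - y" by simp
    show ?thesis using norm_triangle3[of "x - u" "u - v" "v - y"] unfolding eq .
  qed
  ultimately have "kap x y \<le> 6 * D" unfolding kap_def using xu yv utu D t by linarith
  then show ?thesis by (simp add: D_def u_def v_def t_def)
qed

text \<open>\<open>fractional_kernel_bound\<close> with b = \<beta> + 1, so that 1 - n - b = -(n +
  \<beta>). It is applied to the coefficients \<open>surf\<close> Z, whose generating function is
  the extended Poisson kernel; \<open>kap_direction\<close> translates the result.\<close>

lemma bergman_kernel_bound:
  assumes b: "\<beta> \<ge> 0"
  shows "\<exists>C>0. \<forall>x\<in>ball 0 1. \<forall>y\<in>ball 0 1. cmod (bergman_kernel d Y \<beta> x y) \<le> C * kap x y powr (- (real DIM('a) + \<beta>))"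
    and "x \<in> ball 0 1 \<Longrightarrow> y \<in> ball 0 1 \<Longrightarrow> summable (\<lambda>k. norm (of_real (bcoef \<beta> k * norm x ^ k * norm y ^ k) * Z k (direction x) (direction y)))"
proof -
  have G: "Gamma (\<beta> + 1) > 0" by (rule Gamma_real_pos) (use b in simp)
  obtain C where C: "C > 0" "\<And>z q t. norm z = 1 \<Longrightarrow> (\<forall>w\<in>ball 0 1. (\<lambda>k. q k * w ^ k) sums poisson_ext DIM('a) z w) \<Longrightarrow> 0 \<le> t \<Longrightarrow> t < 1 \<Longrightarrow>
     summable (\<lambda>k. norm (of_real (Gamma (\<beta> + 1 + real k + real DIM('a) / 2) / Gamma (real k + real DIM('a) / 2)) * q k * of_real t ^ k)) \<and>
     norm (\<Sum>k. of_real (Gamma (\<beta> + 1 + real k + real DIM('a) / 2) / Gamma (real k + real DIM('a) / 2)) * q k * of_real t ^ k)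
        \<le> C * norm (1 - of_real t * z) powr (1 - real DIM('a) - (\<beta> + 1))"
    using fractional_kernel_bound[of "\<beta> + 1" "DIM('a)"] b by (auto simp: Suc_leI)
  define K where "K = 2 / (Gamma (\<beta> + 1) * surf) * C * 6 powr (real DIM('a) + \<beta>)"
  have K: "K > 0" unfolding K_def using C(1) G surf_pos by simp
  have main: "cmod (bergman_kernel d Y \<beta> x y) \<le> K * kap x y powr (- (real DIM('a) + \<beta>)) \<and>
      summable (\<lambda>k. norm (of_real (bcoef \<beta> k * norm x ^ k * norm y ^ k) * Z k (direction x) (direction y)))"
    if x: "x \<in> ball 0 1" and y: "y \<in> ball 0 1" for x y
  proof -
    define u v t where "u = direction x" and "v = direction y" and "t = norm x * norm y"
    have uv: "u \<in> sphere 0 1" "v \<in> sphere 0 1" unfolding u_def v_def by (rule direction_props)+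
    have t: "0 \<le> t" "t < 1"
    proof -
      show "0 \<le> t" by (simp add: t_def)
      have "t \<le> norm x" using y by (simp add: t_def mult_left_le)
      then show "t < 1" using x by simp
    qed
    obtain z :: complex where z: "norm z = 1" "\<And>t. norm (1 - of_real t * z) = norm (t *\<^sub>R u - v)" using unit_vectors_complex[OF uv] by blast
    define q where "q k = of_real surf * Z k u v" for k
    have q: "\<forall>w\<in>ball 0 1. (\<lambda>k. q k * w ^ k) sums poisson_ext DIM('a) z w"
      unfolding q_def using zonal_poisson_ext_sums[OF uv z] by blast
    define T where "T k = of_real (Gamma (\<beta> + 1 + real k + real DIM('a) / 2) / Gamma (real k + real DIM('a) / 2)) * q k * of_real t ^ k" for k
    have T: "summable (\<lambda>k. norm (T k))" "norm (\<Sum>k. T k) \<le> C * norm (1 - of_real t * z) powr (1 - real DIM('a) - (\<beta> + 1))"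
      unfolding T_def using C(2)[OF z(1) q t] by blast+
    have eq: "of_real (bcoef \<beta> k * norm x ^ k * norm y ^ k) * Z k u v = T k / of_real (Gamma (\<beta> + 1) * surf)" for k
      using surf_pos G unfolding T_def q_def bcoef_def t_def by (simp add: power_mult_distrib field_simps)
    have "bergman_kernel d Y \<beta> x y = 2 * (\<Sum>k. T k / of_real (Gamma (\<beta> + 1) * surf))"
      unfolding bergman_kernel_Z u_def[symmetric] v_def[symmetric] eq ..
    also have "... = 2 * ((\<Sum>k. T k) / of_real (Gamma (\<beta> + 1) * surf))"
      by (subst suminf_divide[OF summable_norm_cancel[OF T(1)]]) simp
    finally have "cmod (bergman_kernel d Y \<beta> x y) = 2 / (Gamma (\<beta> + 1) * surf) * norm (\<Sum>k. T k)"
      using G surf_pos by (simp add: norm_mult norm_divide)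
    also have "... \<le> 2 / (Gamma (\<beta> + 1) * surf) * (C * norm (1 - of_real t * z) powr (1 - real DIM('a) - (\<beta> + 1)))"
      using G surf_pos by (intro mult_left_mono T(2)) auto
    also have "norm (1 - of_real t * z) powr (1 - real DIM('a) - (\<beta> + 1)) \<le> (kap x y / 6) powr (1 - real DIM('a) - (\<beta> + 1))"
    proof (rule powr_mono2')
      show "kap x y / 6 > 0" using kap_pos[of x y] x y by simp
      show "kap x y / 6 \<le> norm (1 - of_real t * z)"
        unfolding z(2) u_def v_def t_def by (rule kap_direction) (use x y in auto)
    qed (use b DIM_positive[where 'a = 'a] in simp)
    also have "(kap x y / 6) powr (1 - real DIM('a) - (\<beta> + 1)) = 6 powr (real DIM('a) + \<beta>) * kap x y powr (- (real DIM('a) + \<beta>))"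
    proof -
      have e: "1 - real DIM('a) - (\<beta> + 1) = - (real DIM('a) + \<beta>)" by simp
      have "(kap x y / 6) powr (- (real DIM('a) + \<beta>)) = kap x y powr (- (real DIM('a) + \<beta>)) / 6 powr (- (real DIM('a) + \<beta>))"
        by (rule powr_divide)
      also have "6 powr (- (real DIM('a) + \<beta>)) = inverse (6 powr (real DIM('a) + \<beta>) :: real)" by (rule powr_minus)
      finally show ?thesis unfolding e by (simp only: divide_inverse inverse_inverse_eq mult.commute)
    qed
    finally have "cmod (bergman_kernel d Y \<beta> x y) \<le> K * kap x y powr (- (real DIM('a) + \<beta>))"
      using C(1) G surf_pos by (simp add: K_def mult_ac mult_left_mono divide_right_mono)
    moreover have "summable (\<lambda>k. norm (of_real (bcoef \<beta> k * norm x ^ k * norm y ^ k) * Z k u v))"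
      unfolding eq norm_divide by (rule summable_divide[OF T(1)])
    ultimately show ?thesis unfolding u_def v_def by blast
  qed
  show "\<exists>C>0. \<forall>x\<in>ball 0 1. \<forall>y\<in>ball 0 1. cmod (bergman_kernel d Y \<beta> x y) \<le> C * kap x y powr (- (real DIM('a) + \<beta>))"
    using K main by blast
  show "x \<in> ball 0 1 \<Longrightarrow> y \<in> ball 0 1 \<Longrightarrow> summable (\<lambda>k. norm (of_real (bcoef \<beta> k * norm x ^ k * norm y ^ k) * Z k (direction x) (direction y)))"
    using main by blast
qed

end

section \<open>Harmonicity from mean values\<close>

text \<open>The witnesses of \<open>harmonic_on\<close> may differ from one neighbourhood to the
  next. \<open>frechet_derivative\<close> is one global choice that agrees with all of them by
  uniqueness of derivatives.\<close>

lemma harmonic_on_local: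
  fixes f :: "'a::euclidean_space \<Rightarrow> complex"
  assumes S: "open S" and loc: "\<And>x. x \<in> S \<Longrightarrow> \<exists>T. x \<in> T \<and> T \<subseteq> S \<and> harmonic_on f T"
  shows "harmonic_on f S"
proof -
  define D1 where "D1 x = frechet_derivative f (at x)" for x
  define D2 where "D2 x i = frechet_derivative (\<lambda>y. D1 y i) (at x)" for x i
  have *: "(f has_derivative D1 x) (at x) \<and> (\<forall>i\<in>Basis. ((\<lambda>y. D1 y i) has_derivative D2 x i) (at x) \<and>
      (\<forall>j\<in>Basis. continuous (at x) (\<lambda>x. D2 x i j))) \<and> (\<Sum>i\<in>Basis. D2 x i i) = 0" if x: "x \<in> S" for x
  proof -
    obtain T where T: "x \<in> T" "T \<subseteq> S" "harmonic_on f T" using loc[OF x] by blast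
    obtain E1 E2 where E: "open T" "\<And>x. x \<in> T \<Longrightarrow> (f has_derivative E1 x) (at x)"
      "\<And>i x. i \<in> Basis \<Longrightarrow> x \<in> T \<Longrightarrow> ((\<lambda>y. E1 y i) has_derivative E2 x i) (at x)"
      "\<And>i j. i \<in> Basis \<Longrightarrow> j \<in> Basis \<Longrightarrow> continuous_on T (\<lambda>x. E2 x i j)"
      "\<And>x. x \<in> T \<Longrightarrow> (\<Sum>i\<in>Basis. E2 x i i) = 0" by (rule harmonic_onE[OF T(3)]) (rule that)
    have e1: "D1 y = E1 y" if "y \<in> T" for y unfolding D1_def using frechet_derivative_at[OF E(2)[OF that]] by simp
    have d: "((\<lambda>y. D1 y i) has_derivative E2 y i) (at y)" if "y \<in> T" "i \<in> Basis" for y i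
      by (rule has_derivative_transform_within_open[OF E(3)[OF that(2,1)] E(1) that(1)]) (simp add: e1)
    have e2: "D2 y i = E2 y i" if "y \<in> T" "i \<in> Basis" for y i
      unfolding D2_def using frechet_derivative_at[OF d[OF that]] by simp
    have "continuous (at x) (\<lambda>x. D2 x i j)" if "i \<in> Basis" "j \<in> Basis" for i j
    proof -
      have "continuous_on T (\<lambda>x. D2 x i j) \<longleftrightarrow> continuous_on T (\<lambda>x. E2 x i j)"
        by (rule continuous_on_cong) (simp_all add: e2 that)
      then have "continuous_on T (\<lambda>x. D2 x i j)" using E(4)[OF that] by simp
      then show ?thesis using E(1) T(1) by (simp add: continuous_on_eq_continuous_at)
    qed
    moreover have "(\<Sum>i\<in>Basis. D2 x i i) = 0" using E(5)[OF T(1)] e2[OF T(1)] by simp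
    ultimately show ?thesis using E(2)[OF T(1)] e1[OF T(1)] d[OF T(1)] e2[OF T(1)] by simp
  qed
  show ?thesis
  proof (rule harmonic_onI[OF S, where ?D1.0 = D1 and ?D2.0 = D2])
    fix i j :: 'a assume ij: "i \<in> Basis" "j \<in> Basis"
    show "continuous_on S (\<lambda>x. D2 x i j)"
      by (rule continuous_at_imp_continuous_on) (use * ij in blast)
  qed (use * in blast)+
qed

lemma integral_lborel_affine:
  fixes f :: "'a::euclidean_space \<Rightarrow> 'b::{banach, second_countable_topology}" and t :: 'a
  assumes [measurable]: "f \<in> borel_measurable borel" and c: "c \<noteq> 0"
  shows "(\<integral>x. f x \<partial>lborel) = (\<bar>c\<bar> ^ DIM('a)) *\<^sub>R (\<integral>x. f (t + c *\<^sub>R x) \<partial>lborel)"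
proof -
  have "(\<integral>x. f x \<partial>lborel) = (\<integral>x. f x \<partial>density (distr lborel borel (\<lambda>x. t + c *\<^sub>R x)) (\<lambda>_. ennreal (\<bar>c\<bar>^DIM('a))))"
    using lborel_affine[OF c, of t] by (simp add: ennreal_power)
  also have "... = (\<bar>c\<bar> ^ DIM('a)) *\<^sub>R (\<integral>x. f (t + c *\<^sub>R x) \<partial>lborel)"
    by (subst integral_density) (auto simp: integral_distr)
  finally show ?thesis .
qed

lemma mean_value_bump_ball:
  fixes f :: "'a::euclidean_space \<Rightarrow> complex"
  assumes R: "0 < R" "R < s" and N: "N \<ge> 1" and f: "harmonic_on f (ball x s)"
  shows "(\<integral>y. bump R N (y - x) *\<^sub>R f y \<partial>lborel) = (\<integral>y. bump R N (y::'a) \<partial>lborel) *\<^sub>R f x"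
proof -
  have s: "s > 0" using R by simp
  define g where "g y = f (x + s *\<^sub>R y)" for y
  have g: "harmonic_on g (ball 0 1)" unfolding g_def
    by (rule harmonic_on_affine[OF f open_ball]) (use s in \<open>auto simp: dist_norm\<close>)
  have scale: "bump R N (s *\<^sub>R y) = (s\<^sup>2) ^ N * bump (R / s) N y" for y :: 'a
  proof -
    have "R\<^sup>2 - (norm (s *\<^sub>R y))\<^sup>2 = s\<^sup>2 * ((R / s)\<^sup>2 - (norm y)\<^sup>2)" using s by (simp add: power_mult_distrib power_divide algebra_simps)
    moreover have "max 0 (s\<^sup>2 * t) = s\<^sup>2 * max 0 t" for t :: real
      using s by (simp add: max_def zero_le_mult_iff mult_le_0_iff)
    ultimately show ?thesis unfolding bump_def by (simp add: power_mult_distrib)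
  qed
  have mv: "(\<integral>y. bump (R / s) N y *\<^sub>R g y \<partial>lborel) = (\<integral>y. bump (R / s) N (y::'a) \<partial>lborel) *\<^sub>R g 0"
    by (rule mean_value_bump) (use R s N g in auto)
  have bm[measurable]: "bump r N \<in> borel_measurable (borel :: 'a measure)" for r
    by (intro borel_measurable_continuous_onI continuous_on_bump)
  have fm: "(\<lambda>y. bump R N (y - x) *\<^sub>R f y) \<in> borel_measurable borel"
  proof -
    have "(\<lambda>y. bump R N (y - x) *\<^sub>R f y) = (\<lambda>y. bump R N (y - x) *\<^sub>R (indicator (ball x s) y *\<^sub>R f y))"
    proof
      fix y show "bump R N (y - x) *\<^sub>R f y = bump R N (y - x) *\<^sub>R (indicator (ball x s) y *\<^sub>R f y)"
        by (cases "y \<in> ball x s") (use R N bump_eq_0[of R "y - x" N] in \<open>auto simp: dist_norm norm_minus_commute\<close>)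
    qed
    moreover have "... \<in> borel_measurable borel"
      using borel_measurable_indicator_ball[OF harmonic_on_imp_continuous_on[OF f]] by measurable
    ultimately show ?thesis by simp
  qed
  have "(\<integral>y. bump R N (y - x) *\<^sub>R f y \<partial>lborel) = s ^ DIM('a) *\<^sub>R (\<integral>y. bump R N (s *\<^sub>R y) *\<^sub>R g y \<partial>lborel)"
    using integral_lborel_affine[OF fm, of s x] s by (simp add: g_def)
  also have "... = s ^ DIM('a) *\<^sub>R (s\<^sup>2) ^ N *\<^sub>R (\<integral>y. bump (R / s) N (y::'a) \<partial>lborel) *\<^sub>R g 0"
  proof -
    have "(\<integral>y. bump R N (s *\<^sub>R y) *\<^sub>R g y \<partial>lborel) = (\<integral>y. (s\<^sup>2) ^ N *\<^sub>R (bump (R / s) N y *\<^sub>R g y) \<partial>lborel)"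
      by (simp only: scale scaleR_scaleR)
    then show ?thesis by (simp only: Bochner_Integration.integral_scaleR_right mv)
  qed
  also have "... = (\<integral>y. bump R N (y::'a) \<partial>lborel) *\<^sub>R f x"
  proof -
    have "(\<integral>y. bump R N (y::'a) \<partial>lborel) = s ^ DIM('a) * ((s\<^sup>2) ^ N * (\<integral>y. bump (R / s) N (y::'a) \<partial>lborel))"
      using integral_lborel_affine[OF bm, of s R 0] s by (simp add: scale)
    then show ?thesis by (simp add: g_def)
  qed
  finally show ?thesis .
qed

text \<open>The functions y_i bump_2 have compact support, so their i-th derivatives integrate to
  zero. Summed over i these are (4 + n) bump_2 - 4 R^2 bump_1, which is the Laplacian of bump_3
  divided by -6.\<close>

lemma bump_laplacian_mean_zero:
  assumes R: "0 < R"
  shows "4 * R\<^sup>2 * (\<integral>y. bump R 1 (y::'a::euclidean_space) \<partial>lborel) = (4 + real DIM('a)) * (\<integral>y. bump R 2 (y::'a) \<partial>lborel)"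
proof -
  have r: "bump R 1 y * (norm y)\<^sup>2 = R\<^sup>2 * bump R 1 y - bump R 2 y" for y :: 'a
    unfolding bump_def by (simp add: max_def power2_eq_square algebra_simps)
  have I: "integrable lborel (bump R N :: 'a \<Rightarrow> real)" if "N \<ge> 1" for N by (rule integral_bump_pos(2)[OF R that])
  have comp: "integrable lborel (\<lambda>y::'a. - (4 * bump R 1 y * (y \<bullet> i) * (y \<bullet> i)) + bump R 2 y)"
      "(\<integral>y. - (4 * bump R 1 (y::'a) * (y \<bullet> i) * (y \<bullet> i)) + bump R 2 y \<partial>lborel) = 0" if i: "i \<in> Basis" for i
  proof -
    let ?h = "\<lambda>y::'a. - (4 * bump R 1 y * (y \<bullet> i) * (y \<bullet> i)) + bump R 2 y"
    have "integrable lborel (\<lambda>y. indicator (cball 0 R) y *\<^sub>R ?h y)"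
      by (rule borel_integrable_compact) (auto intro!: continuous_intros)
    moreover have "(\<lambda>y. indicator (cball 0 R) y *\<^sub>R ?h y) = ?h"
    proof
      fix y :: 'a show "indicator (cball 0 R) y *\<^sub>R ?h y = ?h y"
        by (cases "norm y \<le> R") (use R in \<open>simp_all add: bump_eq_0\<close>)
    qed
    ultimately show "integrable lborel ?h" by simp
    define g' where "g' y v = - (4 * bump R 1 y * (y \<bullet> v)) * (y \<bullet> i) + bump R 2 y * (v \<bullet> i)" for y v :: 'a
    have d: "((\<lambda>y. bump R 2 y * (y \<bullet> i)) has_derivative g' y) (at y)" for y :: 'a
      using has_derivative_bump[of 1 R y] unfolding g'_def
      by (auto intro!: derivative_eq_intros simp: numeral_2_eq_2 fun_eq_iff)
    have "(\<integral>y. g' y i \<partial>lborel) = 0"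
      by (rule integral_directional_derivative_zero[OF d, of i R]) (use R in \<open>auto simp: g'_def bump_eq_0 intro!: continuous_intros\<close>)
    then show "(\<integral>y. ?h y \<partial>lborel) = 0" using i by (simp add: g'_def)
  qed
  have s: "(\<Sum>i\<in>Basis. - (4 * bump R 1 y * (y \<bullet> i) * (y \<bullet> i)) + bump R 2 y) = (4 + real DIM('a)) * bump R 2 y - 4 * R\<^sup>2 * bump R 1 y" for y :: 'a
  proof -
    have "(\<Sum>i\<in>Basis. - (4 * bump R 1 y * (y \<bullet> i) * (y \<bullet> i)) + bump R 2 y) = (\<Sum>i\<in>Basis. (- 4 * bump R 1 y) * ((y \<bullet> i) * (y \<bullet> i)) + bump R 2 y)"
      by (intro sum.cong refl) simp
    also have "... = (- 4 * bump R 1 y) * (y \<bullet> y) + real DIM('a) * bump R 2 y"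
      by (simp only: sum.distrib sum_distrib_left[symmetric] euclidean_inner[symmetric]) simp
    also have "... = - 4 * (bump R 1 y * (norm y)\<^sup>2) + real DIM('a) * bump R 2 y" by (simp add: power2_norm_eq_inner)
    finally show ?thesis unfolding r by (simp add: algebra_simps)
  qed
  have "0 = (\<Sum>i\<in>Basis. (\<integral>y. - (4 * bump R 1 (y::'a) * (y \<bullet> i) * (y \<bullet> i)) + bump R 2 y \<partial>lborel))" using comp(2) by simp
  also have "... = (\<integral>y. (\<Sum>i\<in>Basis. - (4 * bump R 1 (y::'a) * (y \<bullet> i) * (y \<bullet> i)) + bump R 2 y) \<partial>lborel)"
    by (rule Bochner_Integration.integral_sum[symmetric]) (rule comp(1))
  also have "... = (\<integral>y. (4 + real DIM('a)) * bump R 2 (y::'a) - 4 * R\<^sup>2 * bump R 1 y \<partial>lborel)" by (simp only: s)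
  also have "... = (4 + real DIM('a)) * (\<integral>y. bump R 2 (y::'a) \<partial>lborel) - 4 * R\<^sup>2 * (\<integral>y. bump R 1 (y::'a) \<partial>lborel)"
    using I by (subst Bochner_Integration.integral_diff) auto
  finally show ?thesis by simp
qed

text \<open>The Laplacian of the third bump is a combination of the first two with mean zero.\<close>

lemma harmonic_of_mean_value_bump:
  fixes f G :: "'a::euclidean_space \<Rightarrow> complex"
  assumes \<delta>: "0 < \<delta>" "\<delta> \<le> 1" and R: "R \<le> 1"
    and Gm[measurable]: "G \<in> borel_measurable borel" and B: "\<And>y. cmod (G y) \<le> B * indicator (ball 0 1) y"
    and mv: "\<And>N x. N \<in> {1, 2, 3} \<Longrightarrow> x \<in> ball 0 R \<Longrightarrow> (\<integral>y. bump \<delta> N (y - x) *\<^sub>R G y \<partial>lborel) = (\<integral>y. bump \<delta> N (y::'a) \<partial>lborel) *\<^sub>R f x"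
  shows "harmonic_on f (ball 0 R)"
proof -
  have bm[measurable]: "bump \<delta> N \<in> borel_measurable (borel :: 'a measure)" for N
    by (intro borel_measurable_continuous_onI continuous_on_bump)
  have b1: "bump \<delta> N y \<le> 1" for N and y :: 'a
  proof -
    have "\<delta>\<^sup>2 - (norm y)\<^sup>2 \<le> 1" using \<delta> power_le_one[of \<delta> 2] zero_le_power2[of "norm y"] by linarith
    then show ?thesis unfolding bump_def by (intro power_le_one) auto
  qed
  have iB: "integrable lborel (\<lambda>y::'a. c * (B * indicator (ball 0 1) y))" for c :: real
    by (intro integrable_mult_right integrable_real_indicator) (auto simp: emeasure_ball)
  have iK: "integrable lborel (\<lambda>y. K y *\<^sub>R G y)"
    if Km: "K \<in> borel_measurable borel" and Kb: "\<And>y. y \<in> ball 0 1 \<Longrightarrow> \<bar>K y\<bar> \<le> c" for K :: "'a \<Rightarrow> real" and c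
  proof (rule Bochner_Integration.integrable_bound[OF iB[of c]])
    show "(\<lambda>y. K y *\<^sub>R G y) \<in> borel_measurable lborel" using Km by measurable
    show "AE y in lborel. norm (K y *\<^sub>R G y) \<le> norm (c * (B * indicator (ball 0 1) y))"
    proof (rule AE_I2)
      fix y :: 'a
      show "norm (K y *\<^sub>R G y) \<le> norm (c * (B * indicator (ball 0 1) y))"
      proof (cases "y \<in> ball 0 1")
        case True
        have "\<bar>K y\<bar> * cmod (G y) \<le> c * B" using Kb[OF True] B[of y] True by (intro mult_mono) auto
        then show ?thesis using True by (simp add: order_trans[OF _ abs_ge_self])
      next
        case False
        then show ?thesis using B[of y] by simp
      qed
    qed
  qed
  have w2: "\<bar>(y - x) \<bullet> v\<bar> \<le> 2 * norm v" if "x \<in> ball 0 R" "y \<in> ball 0 1" for x y v :: 'a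
  proof -
    have "norm (y - x) \<le> 2" using norm_triangle_ineq4[of y x] that R by simp
    then have "norm (y - x) * norm v \<le> 2 * norm v" by (intro mult_right_mono) auto
    then show ?thesis using Cauchy_Schwarz_ineq2[of "y - x" v] by linarith
  qed
  have near: "\<exists>e>0. ball x e \<subseteq> ball 0 R" if "x \<in> ball 0 R" for x :: 'a
    using that open_contains_ball open_ball by blast
  have db: "((\<lambda>x. bump \<delta> (Suc N) (y - x)) has_derivative (\<lambda>v. 2 * of_nat (Suc N) * bump \<delta> N (y - x) * ((y - x) \<bullet> v))) (at x)"
    if "N \<ge> 1" for N and x y :: 'a
  proof -
    have "((\<lambda>x. y - x) has_derivative (\<lambda>v. - v)) (at x)" by (auto intro!: derivative_eq_intros)
    from has_derivative_compose[OF this has_derivative_bump[OF that, of \<delta> "y - x"]]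
    show ?thesis by simp
  qed
  \<comment> \<open>First and second derivatives in x of \<open>bump \<delta> 3 (y - x)\<close>. The
    exponent 3 is the least in this scheme for which the second derivatives are still
    continuous.\<close>
  define K1 where "K1 x v y = 6 * bump \<delta> 2 (y - x) * ((y - x) \<bullet> v)" for x v y :: 'a
  define K2 where "K2 x i v y = 6 * (4 * bump \<delta> 1 (y - x) * ((y - x) \<bullet> v) * ((y - x) \<bullet> i) - bump \<delta> 2 (y - x) * (v \<bullet> i))" for x i v y :: 'a
  have K1m[measurable]: "K1 x v \<in> borel_measurable borel" for x v unfolding K1_def by measurable
  have K2m[measurable]: "K2 x i v \<in> borel_measurable borel" for x i v unfolding K2_def by measurable
  have K1b: "\<bar>K1 x v y\<bar> \<le> 12 * norm v" if "x \<in> ball 0 R" "y \<in> ball 0 1" for x v y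
  proof -
    have "\<bar>K1 x v y\<bar> = 6 * (bump \<delta> 2 (y - x) * \<bar>(y - x) \<bullet> v\<bar>)" by (simp add: K1_def abs_mult)
    also have "bump \<delta> 2 (y - x) * \<bar>(y - x) \<bullet> v\<bar> \<le> 1 * (2 * norm v)" by (intro mult_mono b1 w2 that) auto
    finally show ?thesis by simp
  qed
  \<comment> \<open>102 = 6 (4 times 2 times 2 + 1), with |y - x| \<le> 2 and all weights at most
    1.\<close>
  have K2b: "\<bar>K2 x i v y\<bar> \<le> 102 * norm v" if "x \<in> ball 0 R" "y \<in> ball 0 1" "i \<in> Basis" for x i v y
  proof -
    have "bump \<delta> 1 (y - x) * \<bar>(y - x) \<bullet> v\<bar> * \<bar>(y - x) \<bullet> i\<bar> \<le> 1 * (2 * norm v) * (2 * norm i)"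
      by (intro mult_mono b1 w2 that mult_nonneg_nonneg) auto
    moreover have "bump \<delta> 2 (y - x) * \<bar>v \<bullet> i\<bar> \<le> 1 * norm v"
      by (intro mult_mono b1) (use that Basis_le_norm in auto)
    moreover have "\<bar>K2 x i v y\<bar> \<le> 6 * (4 * (bump \<delta> 1 (y - x) * \<bar>(y - x) \<bullet> v\<bar> * \<bar>(y - x) \<bullet> i\<bar>) + bump \<delta> 2 (y - x) * \<bar>v \<bullet> i\<bar>)"
      unfolding K2_def abs_mult[of 6] by (intro mult_mono order_trans[OF abs_triangle_ineq4]) (auto simp: abs_mult)
    ultimately show ?thesis using that norm_Basis by simp
  qed
  define \<Phi> where "\<Phi> x = (\<integral>y. bump \<delta> 3 (y - x) *\<^sub>R G y \<partial>lborel)" for x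
  define D1 where "D1 x v = (\<integral>y. K1 x v y *\<^sub>R G y \<partial>lborel)" for x v
  define D2 where "D2 x i v = (\<integral>y. K2 x i v y *\<^sub>R G y \<partial>lborel)" for x i v
  have "harmonic_on \<Phi> (ball 0 R)"
  proof (rule harmonic_onI[where ?D1.0 = D1 and ?D2.0 = D2])
    fix x :: 'a assume x: "x \<in> ball 0 R"
    obtain e where e: "e > 0" "ball x e \<subseteq> ball 0 R" using near[OF x] by blast
    show "(\<Phi> has_derivative D1 x) (at x)" unfolding \<Phi>_def[abs_def] D1_def[abs_def]
    proof (rule has_derivative_integral_dominated[OF e(1), where k' = "\<lambda>x y v. K1 x v y *\<^sub>R G y" and B = "\<lambda>y. 12 * (B * indicator (ball 0 1) y)"])
      fix x' assume x': "x' \<in> ball x e"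
      show "integrable lborel (\<lambda>y. bump \<delta> 3 (y - x') *\<^sub>R G y)"
        by (rule iK[of _ 1]) (use b1 in auto)
      fix y :: 'a
      have "((\<lambda>x. bump \<delta> 3 (y - x)) has_derivative (\<lambda>v. K1 x' v y)) (at x')"
        using db[of 2 y x'] by (simp add: K1_def eval_nat_numeral)
      then show "((\<lambda>x. bump \<delta> 3 (y - x) *\<^sub>R G y) has_derivative (\<lambda>v. K1 x' v y *\<^sub>R G y)) (at x')"
        by (rule has_derivative_scaleR_left)
      show "norm (K1 x' v y *\<^sub>R G y) \<le> 12 * (B * indicator (ball 0 1) y) * norm v" for v
      proof (cases "y \<in> ball 0 1")
        case True
        have "\<bar>K1 x' v y\<bar> * cmod (G y) \<le> (12 * norm v) * B"
          using K1b[of x' y v] True e x' B[of y] by (intro mult_mono) auto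
        then show ?thesis using True by (simp add: mult_ac)
      qed (use B[of y] in simp)
    next
      show "integrable lborel (\<lambda>y::'a. 12 * (B * indicator (ball 0 1) y))" by (rule iB)
    qed measurable
    show "((\<lambda>y. D1 y i) has_derivative D2 x i) (at x)" if i: "i \<in> Basis" for i
      unfolding D1_def[abs_def] D2_def[abs_def]
    proof (rule has_derivative_integral_dominated[OF e(1), where k' = "\<lambda>x y v. K2 x i v y *\<^sub>R G y" and B = "\<lambda>y. 102 * (B * indicator (ball 0 1) y)"])
      fix x' assume x': "x' \<in> ball x e"
      show "integrable lborel (\<lambda>y. K1 x' i y *\<^sub>R G y)"
        by (rule iK[of _ "12 * norm i"]) (use K1b x' e in auto)
      fix y :: 'a
      have d0: "((\<lambda>x. (y - x) \<bullet> i) has_derivative (\<lambda>v. - (v \<bullet> i))) (at x')"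
        by (auto intro!: derivative_eq_intros)
      have d2: "((\<lambda>x. bump \<delta> 2 (y - x)) has_derivative (\<lambda>v. 4 * bump \<delta> 1 (y - x') * ((y - x') \<bullet> v))) (at x')"
        using db[of 1 y x'] by (simp add: numeral_2_eq_2)
      have "((\<lambda>x. 6 * (bump \<delta> 2 (y - x) * ((y - x) \<bullet> i))) has_derivative (\<lambda>v. K2 x' i v y)) (at x')"
        by (rule has_derivative_eq_rhs[OF has_derivative_mult_right[OF has_derivative_mult[OF d2 d0]]])
          (auto simp: K2_def fun_eq_iff algebra_simps)
      then have "((\<lambda>x. K1 x i y) has_derivative (\<lambda>v. K2 x' i v y)) (at x')" by (simp only: K1_def mult.assoc)
      then show "((\<lambda>x. K1 x i y *\<^sub>R G y) has_derivative (\<lambda>v. K2 x' i v y *\<^sub>R G y)) (at x')"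
        by (rule has_derivative_scaleR_left)
      show "norm (K2 x' i v y *\<^sub>R G y) \<le> 102 * (B * indicator (ball 0 1) y) * norm v" for v
      proof (cases "y \<in> ball 0 1")
        case True
        have "\<bar>K2 x' i v y\<bar> * cmod (G y) \<le> (102 * norm v) * B"
          using K2b[of x' y i v] True e x' B[of y] i by (intro mult_mono) auto
        then show ?thesis using True by (simp add: mult_ac)
      qed (use B[of y] in simp)
    next
      show "integrable lborel (\<lambda>y::'a. 102 * (B * indicator (ball 0 1) y))" by (rule iB)
    qed measurable
    show "(\<Sum>i\<in>Basis. D2 x i i) = 0"
    proof -
      have iK2: "integrable lborel (\<lambda>y. K2 x i i y *\<^sub>R G y)" if "i \<in> Basis" for i
        by (rule iK[OF K2m K2b[OF x _ that]])
      have ib: "integrable lborel (\<lambda>y. bump \<delta> N (y - x) *\<^sub>R G y)" for N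
        by (rule iK[of _ 1]) (use b1 in auto)
      have tr: "(\<Sum>i\<in>Basis. K2 x i i y) = 24 * \<delta>\<^sup>2 * bump \<delta> 1 (y - x) - 6 * (4 + real DIM('a)) * bump \<delta> 2 (y - x)" for y
      proof -
        define w where "w = y - x"
        have r: "bump \<delta> 1 w * (w \<bullet> w) = \<delta>\<^sup>2 * bump \<delta> 1 w - bump \<delta> 2 w"
          unfolding bump_def power2_norm_eq_inner[symmetric] by (simp add: max_def power2_eq_square algebra_simps)
        have "(\<Sum>i\<in>Basis. K2 x i i y) = (\<Sum>i\<in>Basis. (24 * bump \<delta> 1 w) * ((w \<bullet> i) * (w \<bullet> i)) - 6 * bump \<delta> 2 w)"
          by (intro sum.cong refl) (simp add: K2_def w_def inner_Basis)
        also have "... = (24 * bump \<delta> 1 w) * (w \<bullet> w) - real DIM('a) * (6 * bump \<delta> 2 w)"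
          by (simp only: sum_subtractf sum_distrib_left[symmetric] euclidean_inner[symmetric]) simp
        also have "... = 24 * (bump \<delta> 1 w * (w \<bullet> w)) - real DIM('a) * (6 * bump \<delta> 2 w)" by simp
        finally show ?thesis unfolding r by (simp add: w_def algebra_simps)
      qed
      have "(\<Sum>i\<in>Basis. D2 x i i) = (\<integral>y. (\<Sum>i\<in>Basis. K2 x i i y *\<^sub>R G y) \<partial>lborel)"
        unfolding D2_def by (rule Bochner_Integration.integral_sum[symmetric]) (rule iK2)
      also have "... = (\<integral>y. (24 * \<delta>\<^sup>2) *\<^sub>R (bump \<delta> 1 (y - x) *\<^sub>R G y) - (6 * (4 + real DIM('a))) *\<^sub>R (bump \<delta> 2 (y - x) *\<^sub>R G y) \<partial>lborel)"
        unfolding scaleR_sum_left[symmetric] tr by (simp only: scaleR_diff_left scaleR_scaleR)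
      also have "... = (24 * \<delta>\<^sup>2) *\<^sub>R (\<integral>y. bump \<delta> 1 (y - x) *\<^sub>R G y \<partial>lborel) - (6 * (4 + real DIM('a))) *\<^sub>R (\<integral>y. bump \<delta> 2 (y - x) *\<^sub>R G y \<partial>lborel)"
        by (subst Bochner_Integration.integral_diff[OF integrable_scaleR_right integrable_scaleR_right])
          (use ib in \<open>simp_all only: Bochner_Integration.integral_scaleR_right\<close>)
      \<comment> \<open>The Laplacian is averaged by the mean value property for N = 1, 2; its total
        mass is zero.\<close>
      also have "... = (6 * (4 * \<delta>\<^sup>2 * (\<integral>y. bump \<delta> 1 (y::'a) \<partial>lborel) - (4 + real DIM('a)) * (\<integral>y. bump \<delta> 2 (y::'a) \<partial>lborel))) *\<^sub>R f x"
        using mv[of 1 x] mv[of 2 x] x by (simp add: scaleR_diff_left algebra_simps)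
      also have "... = 0" unfolding bump_laplacian_mean_zero[OF \<delta>(1), where 'a = 'a] by simp
      finally show ?thesis .
    qed
  next
    fix i j :: 'a assume ij: "i \<in> Basis" "j \<in> Basis"
    show "continuous_on (ball 0 R) (\<lambda>x. D2 x i j)"
    proof (rule continuous_on_sequentiallyI)
      fix w a assume w: "\<forall>n. w n \<in> ball (0::'a) R" and a: "a \<in> ball 0 R" and lim: "w \<longlonglongrightarrow> a"
      show "(\<lambda>n. D2 (w n) i j) \<longlonglongrightarrow> D2 a i j" unfolding D2_def
      proof (rule integral_dominated_convergence[where w = "\<lambda>y. 102 * (B * indicator (ball 0 1) y)"])
        show "integrable lborel (\<lambda>y::'a. 102 * (B * indicator (ball 0 1) y))" by (rule iB)
        show "AE y in lborel. (\<lambda>n. K2 (w n) i j y *\<^sub>R G y) \<longlonglongrightarrow> K2 a i j y *\<^sub>R G y"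
          unfolding K2_def bump_def by (intro AE_I2 tendsto_intros lim)
        show "AE y in lborel. norm (K2 (w n) i j y *\<^sub>R G y) \<le> 102 * (B * indicator (ball 0 1) y)" for n
        proof (rule AE_I2)
          fix y :: 'a
          show "norm (K2 (w n) i j y *\<^sub>R G y) \<le> 102 * (B * indicator (ball 0 1) y)"
          proof (cases "y \<in> ball 0 1")
            case True
            have "\<bar>K2 (w n) i j y\<bar> * cmod (G y) \<le> (102 * norm j) * B"
              using K2b[of "w n" y i j] True w B[of y] ij by (intro mult_mono) auto
            then show ?thesis using True ij by simp
          qed (use B[of y] in simp)
        qed
      qed measurable
    qed
  qed (rule open_ball)
  \<comment> \<open>The mean value property for N = 3 identifies f with the normalized convolution
    \<open>\<Phi>\<close>.\<close>
  then have "harmonic_on (\<lambda>x. of_real (inverse (\<integral>y. bump \<delta> 3 (y::'a) \<partial>lborel)) * \<Phi> x) (ball 0 R)" by (rule harmonic_on_cmult)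
  then show ?thesis
  proof (rule harmonic_on_cong)
    fix x :: 'a assume x: "x \<in> ball 0 R"
    have "(\<integral>y. bump \<delta> 3 (y::'a) \<partial>lborel) \<noteq> 0" using integral_bump_pos(1)[OF \<delta>(1), of 3, where 'a = 'a] by simp
    then show "of_real (inverse (\<integral>y. bump \<delta> 3 (y::'a) \<partial>lborel)) * \<Phi> x = f x"
      unfolding \<Phi>_def using mv[of 3 x] x by (simp add: scaleR_conv_of_real)
  qed
qed

text \<open>The weighted mean value formulas survive a locally bounded pointwise limit by dominated
  convergence, and they characterize harmonicity. Neither uniform convergence nor bounds on
  derivatives enter.\<close>

lemma harmonic_on_bounded_limit:
  fixes f :: "'a::euclidean_space \<Rightarrow> complex"
  assumes h: "\<And>n. harmonic_on (F n) (ball 0 1)"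
    and lim: "\<And>x. x \<in> ball 0 1 \<Longrightarrow> (\<lambda>n. F n x) \<longlonglongrightarrow> f x"
    and bdd: "\<And>R. R < 1 \<Longrightarrow> \<exists>B. \<forall>n. \<forall>x\<in>cball 0 R. cmod (F n x) \<le> B"
  shows "harmonic_on f (ball 0 1)"
proof (rule harmonic_on_local)
  fix x :: 'a assume x: "x \<in> ball 0 1"
  define R where "R = (1 + norm x) / 2"
  have R: "norm x < R" "0 < R" "R < 1" using x by (auto simp: R_def field_simps intro: add_pos_nonneg)
  \<comment> \<open>Averages over radius \<delta> around points of \<open>ball 0 R\<close> stay in
    \<open>ball 0 (R + \<delta>)\<close>, still compactly inside the unit ball.\<close>
  define \<delta> where "\<delta> = (1 - R) / 2"
  have d: "0 < \<delta>" "\<delta> \<le> 1" "\<delta> < 1 - R" using R by (auto simp: \<delta>_def)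
  obtain B where B: "\<And>n x. x \<in> cball 0 (R + \<delta>) \<Longrightarrow> cmod (F n x) \<le> B"
  proof -
    have "R + \<delta> < 1" using d by simp
    then obtain B where "\<forall>n. \<forall>x\<in>cball 0 (R + \<delta>). cmod (F n x) \<le> B" using bdd by blast
    then show ?thesis using that by blast
  qed
  define Gn where "Gn n y = indicator (ball 0 (R + \<delta>)) y *\<^sub>R F n y" for n y
  define G where "G y = indicator (ball 0 (R + \<delta>)) y *\<^sub>R f y" for y
  have sub: "ball 0 (R + \<delta>) \<subseteq> ball (0::'a) 1" using d by auto
  have Gnm[measurable]: "Gn n \<in> borel_measurable borel" for n
    unfolding Gn_def using harmonic_on_imp_continuous_on[OF h] sub
    by (intro borel_measurable_indicator_ball) (rule continuous_on_subset)
  have Glim: "(\<lambda>n. Gn n y) \<longlonglongrightarrow> G y" for y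
    unfolding Gn_def G_def using lim[of y] sub by (cases "y \<in> ball 0 (R + \<delta>)") auto
  have Gm[measurable]: "G \<in> borel_measurable borel"
    by (rule borel_measurable_LIMSEQ_metric[OF Gnm Glim])
  have B0: "0 \<le> B" using order_trans[OF norm_ge_zero B[of 0 0]] R d by simp
  have Gnb: "cmod (Gn n y) \<le> B * indicator (ball 0 1) y" for n y
    using B[of y n] B0 sub by (auto simp: Gn_def indicator_def)
  have Gb: "cmod (G y) \<le> B * indicator (ball 0 1) y" for y
    by (rule Lim_bounded[OF tendsto_norm[OF Glim]]) (use Gnb in auto)
  have "harmonic_on f (ball 0 R)"
  proof (rule harmonic_of_mean_value_bump[OF d(1,2) _ Gm Gb])
    show "R \<le> 1" using R by simp
    fix N :: nat and x :: 'a assume N: "N \<in> {1, 2, 3}" and x: "x \<in> ball 0 R"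
    then have N1: "N \<ge> 1" by auto
    have bm[measurable]: "bump \<delta> N \<in> borel_measurable (borel :: 'a measure)" for N
      by (intro borel_measurable_continuous_onI continuous_on_bump)
    have eq: "(\<integral>y. bump \<delta> N (y - x) *\<^sub>R Gn n y \<partial>lborel) = (\<integral>y. bump \<delta> N (y::'a) \<partial>lborel) *\<^sub>R F n x" for n
    proof -
      have "bump \<delta> N (y - x) *\<^sub>R Gn n y = bump \<delta> N (y - x) *\<^sub>R F n y" for y
      proof (cases "norm (y - x) < \<delta>")
        case True
        then have "norm y < R + \<delta>" using x norm_triangle_ineq2[of y x] by simp
        then show ?thesis by (simp add: Gn_def)
      qed (use d N1 in \<open>simp add: bump_eq_0\<close>)
      moreover have "(\<integral>y. bump \<delta> N (y - x) *\<^sub>R F n y \<partial>lborel) = (\<integral>y. bump \<delta> N (y::'a) \<partial>lborel) *\<^sub>R F n x"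
        by (rule mean_value_bump_ball[OF d(1,3) N1 harmonic_on_subset[OF h]]) (use x in \<open>auto simp: ball_subset_ball_iff\<close>)
      ultimately show ?thesis by (simp only:)
    qed
    have "(\<lambda>n. \<integral>y. bump \<delta> N (y - x) *\<^sub>R Gn n y \<partial>lborel) \<longlonglongrightarrow> (\<integral>y. bump \<delta> N (y - x) *\<^sub>R G y \<partial>lborel)"
    proof (rule integral_dominated_convergence[where w = "\<lambda>y. B * indicator (ball 0 1) y"])
      show "integrable lborel (\<lambda>y::'a. B * indicator (ball 0 1) y)"
        by (intro integrable_mult_right integrable_real_indicator) (auto simp: emeasure_ball)
      show "AE y in lborel. (\<lambda>n. bump \<delta> N (y - x) *\<^sub>R Gn n y) \<longlonglongrightarrow> bump \<delta> N (y - x) *\<^sub>R G y"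
        by (intro AE_I2 tendsto_intros Glim)
      show "AE y in lborel. norm (bump \<delta> N (y - x) *\<^sub>R Gn n y) \<le> B * indicator (ball 0 1) y" for n
      proof (rule AE_I2)
        fix y :: 'a
        have "\<delta>\<^sup>2 - (norm (y - x))\<^sup>2 \<le> 1" using d power_le_one[of \<delta> 2] zero_le_power2[of "norm (y - x)"] by linarith
        then have "bump \<delta> N (y - x) \<le> 1" unfolding bump_def by (intro power_le_one) auto
        then have "bump \<delta> N (y - x) * cmod (Gn n y) \<le> 1 * cmod (Gn n y)" by (intro mult_right_mono) auto
        then show "norm (bump \<delta> N (y - x) *\<^sub>R Gn n y) \<le> B * indicator (ball 0 1) y" using Gnb[of n y] by simp
      qed
    qed measurable
    moreover have "(\<lambda>n. (\<integral>y. bump \<delta> N (y::'a) \<partial>lborel) *\<^sub>R F n x) \<longlonglongrightarrow> (\<integral>y. bump \<delta> N (y::'a) \<partial>lborel) *\<^sub>R f x"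
      by (intro tendsto_intros lim) (use x R in auto)
    ultimately show "(\<integral>y. bump \<delta> N (y - x) *\<^sub>R G y \<partial>lborel) = (\<integral>y. bump \<delta> N (y::'a) \<partial>lborel) *\<^sub>R f x"
      unfolding eq by (rule LIMSEQ_unique)
  qed
  then show "\<exists>T. x \<in> T \<and> T \<subseteq> ball 0 1 \<and> harmonic_on f T"
    using R by (intro exI[of _ "ball 0 R"]) auto
qed simp

section \<open>The Bergman projection\<close>

lemma pred_mem_ball [measurable]: "Measurable.pred borel (\<lambda>x. x \<in> ball (a::'a::metric_space) r)"
  using borel_open[OF open_ball[of a r]] by (simp add: pred_def ball_def)

lemma nn_integral_beta_square:
  fixes z b :: real
  assumes z: "z > 0" and b: "b \<ge> 0"
  shows "(\<integral>\<^sup>+r. ennreal ((r\<^sup>2) powr (z - 1) * (1 - r\<^sup>2) powr b * (2 * r) * indicator {0..1} r) \<partial>lborel) = ennreal (Beta z (b + 1))"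
proof -
  have "((\<lambda>t. t powr (z - 1) * (1 - t) powr (b + 1 - 1)) has_integral Beta z (b + 1)) {0..1}"
    by (rule has_integral_Beta_real) (use z b in auto)
  from nn_integral_has_integral_lebesgue[OF _ this] have
     "ennreal (Beta z (b + 1)) = nn_integral lborel (\<lambda>t. ennreal (t powr (z - 1) * (1 - t) powr b * indicator {0^2..1^2} t))"
    by (simp add: mult_ac ennreal_mult' ennreal_indicator)
  also have "\<dots> = (\<integral>\<^sup>+ x. ennreal ((x\<^sup>2) powr (z - 1) * (1 - x\<^sup>2) powr b * (2 * x) * indicator {0..1} x) \<partial>lborel)"
    by (subst nn_integral_substitution[where g = "\<lambda>x. x ^ 2" and g' = "\<lambda>x. 2 * x"])
       (auto intro!: derivative_eq_intros continuous_intros simp: set_borel_measurable_def)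
  finally show ?thesis ..
qed

text \<open>The substitution t = r^2 produces a Beta integral. Its value is n/2 divided by
  \<open>bcoef\<close>, which is why integration against the weight undoes the coefficients of the
  kernel.\<close>

lemma integral_radial_beta:
  assumes n: "n \<ge> 1" and b: "b \<ge> 0"
  shows "integrable (radial_measure n) (\<lambda>r. r ^ (2 * k) * (1 - r\<^sup>2) powr b)"
    and "(LINT r|radial_measure n. r ^ (2 * k) * (1 - r\<^sup>2) powr b) = real n / 2 * Beta (real k + real n / 2) (b + 1)"
proof -
  define z where "z = real k + real n / 2"
  have z: "z > 0" using n by (auto simp: z_def intro: add_nonneg_pos)
  have Bpos: "Beta z (b + 1) > 0" unfolding Beta_def using z b by (intro divide_pos_pos mult_pos_pos Gamma_real_pos) auto
  have "(\<integral>\<^sup>+r. ennreal (r ^ (2 * k) * (1 - r\<^sup>2) powr b) \<partial>radial_measure n)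
     = (\<integral>\<^sup>+r. ennreal (real n * r ^ (n - 1)) * indicator {0<..<1} r * ennreal (r ^ (2 * k) * (1 - r\<^sup>2) powr b) \<partial>lborel)"
    by (rule nn_integral_radial) measurable
  also have "... = (\<integral>\<^sup>+r. ennreal (real n / 2) * ennreal ((r\<^sup>2) powr (z - 1) * (1 - r\<^sup>2) powr b * (2 * r) * indicator {0..1} r) \<partial>lborel)"
  proof (rule nn_integral_cong_AE)
    have "AE r::real in lborel. r \<noteq> 0" "AE r::real in lborel. r \<noteq> 1" by (rule AE_lborel_singleton)+
    then show "AE r in lborel. ennreal (real n * r ^ (n - 1)) * indicator {0<..<1} r * ennreal (r ^ (2 * k) * (1 - r\<^sup>2) powr b)
      = ennreal (real n / 2) * ennreal ((r\<^sup>2) powr (z - 1) * (1 - r\<^sup>2) powr b * (2 * r) * indicator {0..1} r)"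
    proof eventually_elim
      case (elim r)
      show ?case
      proof (cases "0 < r \<and> r < 1")
        case True
        have "(r\<^sup>2) powr (z - 1) * r = r powr (2 * (z - 1)) * r powr 1"
          using True powr_powr[of r 2 "z - 1"] by simp
        also have "... = r powr (2 * (z - 1) + 1)" by (rule powr_add[symmetric])
        also have "2 * (z - 1) + 1 = real (n - 1) + real (2 * k)"
          using n by (simp add: z_def of_nat_diff algebra_simps)
        also have "r powr (real (n - 1) + real (2 * k)) = r powr real (n - 1) * r powr real (2 * k)" by (rule powr_add)
        also have "... = r ^ (n - 1) * r ^ (2 * k)" using True by (simp only: powr_realpow)
        finally have e: "(r\<^sup>2) powr (z - 1) * r = r ^ (n - 1) * r ^ (2 * k)" .
        have "real n * r ^ (n - 1) * (r ^ (2 * k) * (1 - r\<^sup>2) powr b) = real n * (r ^ (n - 1) * r ^ (2 * k)) * (1 - r\<^sup>2) powr b" by simp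
        also have "... = real n / 2 * ((r\<^sup>2) powr (z - 1) * (1 - r\<^sup>2) powr b * (2 * r))"
          unfolding e[symmetric] by simp
        finally have "real n * r ^ (n - 1) * (r ^ (2 * k) * (1 - r\<^sup>2) powr b) = real n / 2 * ((r\<^sup>2) powr (z - 1) * (1 - r\<^sup>2) powr b * (2 * r))" .
        then show ?thesis using True
          by (simp add: ennreal_mult[symmetric])
      qed (use elim in auto)
    qed
  qed
  also have "... = ennreal (real n / 2) * ennreal (Beta z (b + 1))"
    by (subst nn_integral_cmult) (auto simp: nn_integral_beta_square[OF z b])
  also have "... = ennreal (real n / 2 * Beta z (b + 1))" by (rule ennreal_mult[symmetric]) (use Bpos in auto)
  finally have nn: "(\<integral>\<^sup>+r. ennreal (r ^ (2 * k) * (1 - r\<^sup>2) powr b) \<partial>radial_measure n) = ennreal (real n / 2 * Beta z (b + 1))" .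
  have "integrable (radial_measure n) (\<lambda>r. r ^ (2 * k) * (1 - r\<^sup>2) powr b) \<and> (LINT r|radial_measure n. r ^ (2 * k) * (1 - r\<^sup>2) powr b) = real n / 2 * Beta z (b + 1)"
    by (subst nn_integral_eq_integrable[symmetric]) (use nn Bpos in \<open>auto simp: zero_le_mult_iff\<close>)
  then show "integrable (radial_measure n) (\<lambda>r. r ^ (2 * k) * (1 - r\<^sup>2) powr b)"
    "(LINT r|radial_measure n. r ^ (2 * k) * (1 - r\<^sup>2) powr b) = real n / 2 * Beta (real k + real n / 2) (b + 1)"
    by (auto simp: z_def)
qed

context spherical_basis
begin

section \<open>The kernel as a series of solid harmonics\<close>

lemma Z_homogeneous: "Z k (a *\<^sub>R u) (b *\<^sub>R v) = of_real (a ^ k * b ^ k) * Z k u v"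
  unfolding Z_def sum_distrib_left
  by (intro sum.cong refl) (simp add: H_hom scaleR_conv_of_real)

text \<open>Homogeneity absorbs the radii and eliminates the chosen vectors
  \<open>direction\<close>. Measurability of the kernel becomes visible in this form.\<close>

lemma bergman_kernel_series: "bergman_kernel d Y \<beta> x y = 2 * (\<Sum>k. of_real (bcoef \<beta> k) * Z k x y)"
proof -
  have "of_real (bcoef \<beta> k * norm x ^ k * norm y ^ k) * Z k (direction x) (direction y) = of_real (bcoef \<beta> k) * Z k x y" for k
    using Z_homogeneous[of k "norm x" "direction x" "norm y" "direction y"]
    by (simp add: direction_props(3)[symmetric])
  then show ?thesis unfolding bergman_kernel_Z by (simp only:)
qed

lemma Z_measurable [measurable]: "Z k x \<in> borel_measurable borel"
  unfolding Z_def by (intro borel_measurable_sum borel_measurable_times borel_measurable_cnj H_measurable borel_measurable_const) auto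

lemma bergman_kernel_measurable [measurable]: "bergman_kernel d Y \<beta> x \<in> borel_measurable borel"
  unfolding bergman_kernel_series[abs_def] by measurable

lemma bcoef_pos: "\<beta> \<ge> 0 \<Longrightarrow> bcoef \<beta> k > 0"
  unfolding bcoef_def using DIM_positive[where 'a = 'a]
  by (intro divide_pos_pos mult_pos_pos Gamma_real_pos) (auto intro: add_nonneg_pos)

lemma bcoef_Suc:
  assumes b: "\<beta> \<ge> 0"
  shows "bcoef \<beta> (Suc k) = bcoef \<beta> k * ((\<beta> + 1 + real k + real DIM('a) / 2) / (real k + real DIM('a) / 2))"
proof -
  have p: "real k + real DIM('a) / 2 > 0" "\<beta> + 1 + real k + real DIM('a) / 2 > 0"
    using b DIM_positive[where 'a = 'a] by (auto intro: add_nonneg_pos)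
  have nn: "real k + real DIM('a) / 2 \<notin> \<int>\<^sub>\<le>\<^sub>0" "\<beta> + 1 + real k + real DIM('a) / 2 \<notin> \<int>\<^sub>\<le>\<^sub>0"
    using p by (auto dest: nonpos_Ints_nonpos)
  have "Gamma (real (Suc k) + real DIM('a) / 2) = (real k + real DIM('a) / 2) * Gamma (real k + real DIM('a) / 2)"
    using Gamma_plus1[OF nn(1)] by (simp add: algebra_simps)
  moreover have "Gamma (\<beta> + 1 + real (Suc k) + real DIM('a) / 2) = (\<beta> + 1 + real k + real DIM('a) / 2) * Gamma (\<beta> + 1 + real k + real DIM('a) / 2)"
    using Gamma_plus1[OF nn(2)] by (simp add: algebra_simps)
  ultimately show ?thesis unfolding bcoef_def by (simp add: mult_ac)
qed

lemma bcoef_summable: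
  assumes b: "\<beta> \<ge> 0" and s: "0 \<le> s" "s < 1"
  shows "summable (\<lambda>k. bcoef \<beta> k * s ^ k)"
proof -
  define c where "c = (1 + s) / 2"
  have c: "c < 1" "s < c" using s by (auto simp: c_def)
  \<comment> \<open>From this index on the ratio s (\<beta> + 1 + z) / z of consecutive terms, with
    z = k + n/2, is at most c.\<close>
  obtain N :: nat where N: "real N \<ge> s * (\<beta> + 1) / (c - s)" using real_arch_simple by blast
  show ?thesis
  proof (rule summable_ratio_test[OF c(1), of "max N 1"])
    fix k assume k: "max N 1 \<le> k"
    define z where "z = real k + real DIM('a) / 2"
    have z: "z > 0" "z \<ge> real N" using k by (auto simp: z_def intro: add_nonneg_pos)
    have "s * (\<beta> + 1) \<le> real N * (c - s)" using N c by (simp add: pos_divide_le_eq)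
    also have "... \<le> z * (c - s)" using z c by (intro mult_right_mono) auto
    finally have "s * (\<beta> + 1 + z) \<le> c * z" by (simp add: algebra_simps)
    then have r: "s * ((\<beta> + 1 + z) / z) \<le> c" using z(1) by (simp add: divide_le_eq)
    have "norm (bcoef \<beta> (Suc k) * s ^ Suc k) = bcoef \<beta> k * s ^ k * (s * ((\<beta> + 1 + z) / z))"
      using bcoef_pos[OF b, of k] s b z unfolding bcoef_Suc[OF b] by (simp add: z_def add.assoc abs_mult)
    also have "... \<le> bcoef \<beta> k * s ^ k * c"
      by (rule mult_left_mono[OF r]) (use bcoef_pos[OF b, of k] s in simp)
    finally show "norm (bcoef \<beta> (Suc k) * s ^ Suc k) \<le> c * norm (bcoef \<beta> k * s ^ k)"
      using bcoef_pos[OF b, of k] s by (simp add: mult.commute)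
  qed
qed

text \<open>For r strictly between R and 1 the zonal sums grow at most like r^(-k), while |x|^k
  \<le> R^k; the geometric ratio R/r beats the polynomial growth of \<open>bcoef\<close>. The
  majorant is uniform up to the boundary in y.\<close>

lemma kernel_terms_dominated:
  assumes b: "\<beta> \<ge> 0" and R: "R < 1"
  shows "\<exists>A. summable A \<and> (\<forall>k. \<forall>x\<in>cball 0 R. \<forall>y\<in>ball 0 1. norm (of_real (bcoef \<beta> k) * Z k x y) \<le> A k)"
proof (cases "R \<ge> 0")
  case False
  then show ?thesis by (intro exI[of _ "\<lambda>_. 0"]) auto
next
  case R0: True
  define r where "r = (1 + R) / 2"
  have r: "0 < r" "r < 1" "R < r" using R R0 by (auto simp: r_def)
  obtain C where C: "C > 0" "\<And>k u v. u \<in> sphere 0 1 \<Longrightarrow> v \<in> sphere 0 1 \<Longrightarrow> cmod (Z k u v) * r ^ k \<le> C"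
    using Z_growth[OF r(1,2)] by blast
  define A where "A k = C * (bcoef \<beta> k * (R / r) ^ k)" for k
  have "summable A" unfolding A_def by (intro summable_mult bcoef_summable b) (use r R0 in auto)
  moreover have "norm (of_real (bcoef \<beta> k) * Z k x y) \<le> A k" if x: "x \<in> cball 0 R" and y: "y \<in> ball 0 1" for k x y
  proof -
    have "Z k x y = of_real (norm x ^ k * norm y ^ k) * Z k (direction x) (direction y)"
      using Z_homogeneous[of k "norm x" "direction x" "norm y" "direction y"] by (simp add: direction_props(3)[symmetric])
    then have "cmod (Z k x y) = norm x ^ k * norm y ^ k * cmod (Z k (direction x) (direction y))"
      by (simp add: norm_mult norm_power)
    also have "... \<le> R ^ k * 1 * (C / r ^ k)"
    proof (intro mult_mono)
      show "norm x ^ k \<le> R ^ k" using x by (intro power_mono) auto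
      show "norm y ^ k \<le> 1" using y by (intro power_le_one) auto
      show "cmod (Z k (direction x) (direction y)) \<le> C / r ^ k"
        using C(2)[OF direction_props(1) direction_props(1), of k x y] r by (simp add: pos_le_divide_eq)
    qed (use R0 in auto)
    finally have "cmod (Z k x y) \<le> C * (R / r) ^ k" by (simp add: power_divide mult.commute)
    then have "bcoef \<beta> k * cmod (Z k x y) \<le> bcoef \<beta> k * (C * (R / r) ^ k)"
      by (rule mult_left_mono) (use bcoef_pos[OF b] in \<open>simp add: less_imp_le\<close>)
    then show ?thesis using bcoef_pos[OF b, of k] by (simp add: A_def norm_mult mult_ac)
  qed
  ultimately show ?thesis by blast
qed

text \<open>The weight (1 - |y|^2)^\<beta> belongs to the argument, not to the operator; the same
  operator thus acts on weighted functions cut off to arbitrary sets. Integration is against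
  unnormalized Lebesgue measure, matching the unnormalized surface measure behind the
  kernel.\<close>

definition bergman_projection :: "real \<Rightarrow> ('a \<Rightarrow> complex) \<Rightarrow> 'a \<Rightarrow> complex" where
  "bergman_projection \<beta> g x = (LINT y:ball 0 1|lborel. bergman_kernel d Y \<beta> x y * g y)"

definition solid_coeff :: "('a \<Rightarrow> complex) \<Rightarrow> nat \<Rightarrow> nat \<Rightarrow> complex" where
  "solid_coeff g k j = (LINT y:ball 0 1|lborel. cnj (H k j y) * g y)"

lemma H_cnj_integrable:
  assumes gm[measurable]: "g \<in> borel_measurable borel" and g: "set_integrable lborel (ball 0 1) g" and j: "j \<in> {1..d k}"
  shows "integrable lborel (\<lambda>y. indicator (ball 0 1) y *\<^sub>R (cnj (H k j y) * g y))"
proof -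
  obtain B where B: "B \<ge> 0" "\<And>y. y \<in> cball 0 1 \<Longrightarrow> norm (H k j y) \<le> B"
    using continuous_on_compact_bound[OF compact_cball H_continuous[OF j]] by blast
  note [measurable] = H_measurable[OF j]
  show ?thesis
  proof (rule Bochner_Integration.integrable_bound)
    show "integrable lborel (\<lambda>y. B *\<^sub>R (indicator (ball 0 1) y *\<^sub>R g y))"
      using g unfolding set_integrable_def by (rule integrable_scaleR_right)
    show "AE y in lborel. norm (indicator (ball 0 1) y *\<^sub>R (cnj (H k j y) * g y)) \<le> norm (B *\<^sub>R (indicator (ball 0 1) y *\<^sub>R g y))"
      using B by (intro AE_I2) (auto simp: indicator_def norm_mult intro!: mult_right_mono)
  qed measurable
qed

text \<open>The kernel series is integrated termwise under a summable majorant. The second part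
  leaves the majorant as a parameter, so that a single one serves all x in
  \<open>cball 0 R\<close>.\<close>

lemma bergman_projection_sums:
  assumes b: "\<beta> \<ge> 0" and gm[measurable]: "g \<in> borel_measurable borel" and g: "set_integrable lborel (ball 0 1) g" and x: "x \<in> ball 0 1"
  shows "(\<lambda>k. 2 * of_real (bcoef \<beta> k) * (\<Sum>j=1..d k. H k j x * solid_coeff g k j)) sums bergman_projection \<beta> g x"
    and "summable A \<Longrightarrow> (\<forall>k. \<forall>x\<in>cball 0 R. \<forall>y\<in>ball 0 1. norm (of_real (bcoef \<beta> k) * Z k x y) \<le> A k) \<Longrightarrow> x \<in> cball 0 R \<Longrightarrow>
      norm (2 * of_real (bcoef \<beta> k) * (\<Sum>j=1..d k. H k j x * solid_coeff g k j)) \<le> 2 * A k * (LINT y:ball 0 1|lborel. norm (g y))"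
proof -
  have gi: "integrable lborel (\<lambda>y. indicator (ball 0 1) y *\<^sub>R g y)" using g by (simp add: set_integrable_def)
  have gn: "integrable lborel (\<lambda>y. indicator (ball 0 1) y *\<^sub>R norm (g y))" using integrable_norm[OF gi] by simp
  define t where "t k y = indicator (ball 0 1) y *\<^sub>R (of_real (bcoef \<beta> k) * Z k x y * g y)" for k y
  have dom: "integrable lborel (t k) \<and> (LINT y|lborel. norm (t k y)) \<le> A k * (LINT y:ball 0 1|lborel. norm (g y))"
    if A: "\<And>y. y \<in> ball 0 1 \<Longrightarrow> norm (of_real (bcoef \<beta> k) * Z k x y) \<le> A k" for A k
  proof -
    have A0: "0 \<le> A k" using order_trans[OF norm_ge_zero A[of 0]] by simp
    have le: "norm (t k y) \<le> A k * (indicator (ball 0 1) y *\<^sub>R norm (g y))" for y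
    proof (cases "y \<in> ball 0 1")
      case True
      have "norm (of_real (bcoef \<beta> k) * Z k x y) * norm (g y) \<le> A k * norm (g y)" by (rule mult_right_mono[OF A[OF True]]) simp
      then show ?thesis using True by (simp add: t_def norm_mult)
    qed (simp add: t_def)
    have i: "integrable lborel (t k)"
    proof (rule Bochner_Integration.integrable_bound[OF integrable_mult_right[OF gn]])
      show "AE y in lborel. norm (t k y) \<le> norm (A k * (indicator (ball 0 1) y *\<^sub>R norm (g y)))"
        using le A0 by (intro AE_I2) (simp add: abs_mult order_trans[OF le])
      show "t k \<in> borel_measurable lborel" unfolding t_def by measurable
    qed
    have "(LINT y|lborel. norm (t k y)) \<le> (LINT y|lborel. A k * (indicator (ball 0 1) y *\<^sub>R norm (g y)))"
      by (rule Bochner_Integration.integral_mono) (use i gn le in auto)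
    also have "... = A k * (LINT y:ball 0 1|lborel. norm (g y))"
      unfolding set_lebesgue_integral_def by (rule integral_mult_right_zero)
    finally show ?thesis using i by blast
  qed
  have coeff: "2 * (LINT y|lborel. t k y) = 2 * of_real (bcoef \<beta> k) * (\<Sum>j=1..d k. H k j x * solid_coeff g k j)" for k
  proof -
    have "t k y = (\<Sum>j=1..d k. (of_real (bcoef \<beta> k) * H k j x) * (indicator (ball 0 1) y *\<^sub>R (cnj (H k j y) * g y)))" for y
      unfolding t_def Z_def sum_distrib_left sum_distrib_right scaleR_sum_right
      by (intro sum.cong refl) (simp add: scaleR_conv_of_real)
    then have "(LINT y|lborel. t k y) = (LINT y|lborel. (\<Sum>j=1..d k. (of_real (bcoef \<beta> k) * H k j x) * (indicator (ball 0 1) y *\<^sub>R (cnj (H k j y) * g y))))" by simp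
    also have "... = (\<Sum>j=1..d k. (LINT y|lborel. (of_real (bcoef \<beta> k) * H k j x) * (indicator (ball 0 1) y *\<^sub>R (cnj (H k j y) * g y))))"
      by (rule Bochner_Integration.integral_sum) (intro integrable_mult_right H_cnj_integrable[OF gm g])
    also have "... = (\<Sum>j=1..d k. (of_real (bcoef \<beta> k) * H k j x) * solid_coeff g k j)"
      unfolding solid_coeff_def set_lebesgue_integral_def by (simp only: integral_mult_right_zero)
    finally show ?thesis by (simp add: sum_distrib_left mult_ac)
  qed
  obtain A where A: "summable A" "\<And>k y. y \<in> ball 0 1 \<Longrightarrow> norm (of_real (bcoef \<beta> k) * Z k x y) \<le> A k"
    using kernel_terms_dominated[OF b, of "norm x"] x by auto
  have domA: "integrable lborel (t k)" "(LINT y|lborel. norm (t k y)) \<le> A k * (LINT y:ball 0 1|lborel. norm (g y))" for k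
    using dom[where A = A and k = k, OF A(2)] by simp_all
  have tA: "norm (t k y) \<le> A k * norm (g y)" for k y
  proof (cases "y \<in> ball 0 1")
    case True
    have "norm (of_real (bcoef \<beta> k) * Z k x y) * norm (g y) \<le> A k * norm (g y)" by (rule mult_right_mono[OF A(2)[OF True]]) simp
    then show ?thesis using True by (simp add: t_def norm_mult)
  next
    case False
    then show ?thesis using order_trans[OF norm_ge_zero A(2)[of 0 k]] by (simp add: t_def)
  qed
  have "(\<lambda>k. integral\<^sup>L lborel (t k)) sums (LINT y|lborel. (\<Sum>k. t k y))"
  proof (rule sums_integral)
    show "integrable lborel (t k)" for k by (rule domA(1))
    show "AE y in lborel. summable (\<lambda>k. norm (t k y))"
      by (intro AE_I2 summable_comparison_test'[OF summable_mult2[OF A(1)]]) (use tA in auto)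
    show "summable (\<lambda>k. LINT y|lborel. norm (t k y))"
      by (rule summable_comparison_test'[OF summable_mult2[OF A(1), of "LINT y:ball 0 1|lborel. norm (g y)"]])
        (use domA(2) in auto)
  qed
  then have "(\<lambda>k. 2 * integral\<^sup>L lborel (t k)) sums (2 * (LINT y|lborel. (\<Sum>k. t k y)))" by (rule sums_mult)
  moreover have "2 * (LINT y|lborel. (\<Sum>k. t k y)) = bergman_projection \<beta> g x"
  proof -
    have "2 * (\<Sum>k. t k y) = indicator (ball 0 1) y *\<^sub>R (bergman_kernel d Y \<beta> x y * g y)" for y
    proof (cases "y \<in> ball 0 1")
      case True
      have "summable (\<lambda>k. of_real (bcoef \<beta> k) * Z k x y)"
        by (rule summable_comparison_test'[OF A(1)]) (use A(2)[OF True] in auto)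
      then show ?thesis using True by (simp add: t_def bergman_kernel_series suminf_mult2[symmetric])
    qed (simp add: t_def)
    then show ?thesis unfolding bergman_projection_def set_lebesgue_integral_def
      by (simp only: integral_mult_right_zero[symmetric])
  qed
  ultimately show "(\<lambda>k. 2 * of_real (bcoef \<beta> k) * (\<Sum>j=1..d k. H k j x * solid_coeff g k j)) sums bergman_projection \<beta> g x"
    unfolding coeff by simp
  show "norm (2 * of_real (bcoef \<beta> k) * (\<Sum>j=1..d k. H k j x * solid_coeff g k j)) \<le> 2 * A k * (LINT y:ball 0 1|lborel. norm (g y))"
    if "summable A" "\<forall>k. \<forall>x\<in>cball 0 R. \<forall>y\<in>ball 0 1. norm (of_real (bcoef \<beta> k) * Z k x y) \<le> A k" "x \<in> cball 0 R" for A k R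
  proof -
    have "(LINT y|lborel. norm (t k y)) \<le> A k * (LINT y:ball 0 1|lborel. norm (g y))"
      using dom[of k A] that by blast
    then have "norm (2 * (LINT y|lborel. t k y)) \<le> 2 * (A k * (LINT y:ball 0 1|lborel. norm (g y)))"
      using order_trans[OF integral_norm_bound, of lborel "t k"] by (simp add: norm_mult)
    then show ?thesis unfolding coeff by (simp add: mult.assoc)
  qed
qed

text \<open>The partial sums are finite combinations of solid harmonics, bounded uniformly on each
  smaller closed ball, so \<open>harmonic_on_bounded_limit\<close> applies.\<close>

lemma bergman_projection_harmonic:
  assumes b: "\<beta> \<ge> 0" and gm: "g \<in> borel_measurable borel" and g: "set_integrable lborel (ball 0 1) g"
  shows "harmonic_on (bergman_projection \<beta> g) (ball 0 1)"
proof (rule harmonic_on_bounded_limit)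
  define T where "T k x = 2 * of_real (bcoef \<beta> k) * (\<Sum>j=1..d k. H k j x * solid_coeff g k j)" for k x
  show "harmonic_on (\<lambda>x. \<Sum>k<n. T k x) (ball 0 1)" for n
  proof (rule harmonic_on_subset[where S = UNIV])
    have "harmonic_on (\<lambda>x. \<Sum>k<n. 2 * of_real (bcoef \<beta> k) * (\<Sum>j=1..d k. solid_coeff g k j * H k j x)) UNIV"
      by (intro harmonic_on_sum harmonic_on_cmult H_harmonic) auto
    then show "harmonic_on (\<lambda>x. \<Sum>k<n. T k x) UNIV" unfolding T_def by (simp add: mult.commute)
  qed auto
  show "(\<lambda>n. \<Sum>k<n. T k x) \<longlonglongrightarrow> bergman_projection \<beta> g x" if "x \<in> ball 0 1" for x
    using bergman_projection_sums(1)[OF b gm g that] unfolding T_def sums_def .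
  show "\<exists>B. \<forall>n. \<forall>x\<in>cball 0 R. cmod (\<Sum>k<n. T k x) \<le> B" if R: "R < 1" for R
  proof -
    obtain A where A: "summable A" "\<forall>k. \<forall>x\<in>cball 0 R. \<forall>y\<in>ball 0 1. norm (of_real (bcoef \<beta> k) * Z k x y) \<le> A k"
      using kernel_terms_dominated[OF b R] by blast
    define I where "I = (LINT y:ball 0 1|lborel. norm (g y))"
    have "cmod (\<Sum>k<n. T k x) \<le> (\<Sum>k. 2 * A k * I)" if x: "x \<in> cball 0 R" for n x
    proof -
      have x1: "x \<in> ball 0 1" using x R by simp
      have le: "norm (T k x) \<le> 2 * A k * I" for k
        unfolding T_def I_def by (rule bergman_projection_sums(2)[OF b gm g x1 A x])
      have "cmod (\<Sum>k<n. T k x) \<le> (\<Sum>k<n. norm (T k x))" by (rule norm_sum)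
      also have "... \<le> (\<Sum>k<n. 2 * A k * I)" by (intro sum_mono le)
      also have "... \<le> (\<Sum>k. 2 * A k * I)"
        by (rule sum_le_suminf[OF summable_mult2[OF summable_mult[OF A(1)]] finite_lessThan]) (rule order_trans[OF norm_ge_zero le])
      finally show ?thesis .
    qed
    then show ?thesis by blast
  qed
qed

text \<open>Both sides have the same expansion in the \<open>H k j\<close>: the weighted integral
  multiplies each coefficient by a Beta value, and the kernel divides by it. The hypothesis on M
  makes the weighted function integrable.\<close>

theorem bergman_reproducing:
  assumes b: "\<beta> \<ge> 0" and fm[measurable]: "f \<in> borel_measurable borel" and f: "harmonic_on f (ball 0 1)"
    and bnd: "\<And>y. y \<in> ball 0 1 \<Longrightarrow> cmod (f y) * (1 - (norm y)\<^sup>2) powr \<beta> \<le> M"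
    and x: "x \<in> ball 0 1"
  shows "bergman_projection \<beta> (\<lambda>y. f y * of_real ((1 - (norm y)\<^sup>2) powr \<beta>)) x = f x"
proof -
  define g where "g y = f y * of_real ((1 - (norm y)\<^sup>2) powr \<beta>)" for y
  have gm[measurable]: "g \<in> borel_measurable borel" unfolding g_def by measurable
  have gi: "set_integrable lborel (ball 0 1) g" unfolding set_integrable_def
  proof (rule Bochner_Integration.integrable_bound)
    show "integrable lborel (\<lambda>y::'a. M * indicator (ball 0 1) y)"
      by (intro integrable_mult_right integrable_real_indicator) (auto simp: emeasure_ball)
    show "AE y in lborel. norm (indicator (ball 0 1) y *\<^sub>R g y) \<le> norm (M * indicator (ball 0 1) y)"
    proof (rule AE_I2)
      fix y :: 'a
      show "norm (indicator (ball 0 1) y *\<^sub>R g y) \<le> norm (M * indicator (ball 0 1) y)"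
        using bnd[of y] by (cases "y \<in> ball 0 1") (auto simp: g_def norm_mult)
    qed
  qed measurable
  have ex: "\<exists>c. \<forall>r\<in>{0<..<1}. (LINT u|cone_measure. f (r *\<^sub>R u) * cnj (H k j u)) = of_real r ^ k * c" if "j \<in> {1..d k}" for k j
    by (rule cone_coefficient_homogeneous[OF fm f harmonic_on_cnj[OF H_harmonic[OF that]]]) (simp add: H_hom[OF that])
  define c where "c k j = (SOME c. \<forall>r\<in>{0<..<1}. (LINT u|cone_measure. f (r *\<^sub>R u) * cnj (H k j u)) = of_real r ^ k * c)" for k j
  have c: "(LINT u|cone_measure. f (r *\<^sub>R u) * cnj (H k j u)) = of_real r ^ k * c k j" if "j \<in> {1..d k}" "r \<in> {0<..<1}" for k j r
    using someI_ex[OF ex[OF that(1)]] that(2) unfolding c_def by (rule bspec)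
  have surf: "(LINT u|surface_measure. f (r *\<^sub>R u) * cnj (H k j u)) = of_real r ^ k * (of_nat DIM('a) * c k j)"
    if j: "j \<in> {1..d k}" and r: "r \<in> {0<..<1}" for k j r
  proof -
    note [measurable] = H_measurable[OF j]
    have "(LINT u|surface_measure. f (r *\<^sub>R u) * cnj (H k j u)) = real DIM('a) *\<^sub>R (LINT u|cone_measure. f (r *\<^sub>R u) * cnj (H k j u))"
      by (rule integral_surface) measurable
    then show ?thesis unfolding c[OF j r] by (simp add: scaleR_conv_of_real)
  qed
  have "((\<lambda>(k, j). of_nat DIM('a) * c k j * H k j x) has_sum f x) idx"
    by (rule harmonic_expansion[OF fm f surf x])
  then have "((\<lambda>k. \<Sum>j\<in>{1..d k}. of_nat DIM('a) * c k j * H k j x) has_sum f x) UNIV"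
    unfolding idx_def by (rule has_sum_Sigma') (auto intro!: has_sum_finite)
  then have s1: "(\<lambda>k. \<Sum>j\<in>{1..d k}. of_nat DIM('a) * c k j * H k j x) sums f x" by (rule has_sum_imp_sums)
  \<comment> \<open>The angular integral yields r^k c and the solid harmonic a further r^k, which
    leaves the moment of \<open>integral_radial_beta\<close>.\<close>
  have sc: "solid_coeff g k j = of_nat DIM('a) * c k j / (2 * of_real (bcoef \<beta> k))" if j: "j \<in> {1..d k}" for k j
  proof -
    note [measurable] = H_measurable[OF j]
    define F where "F r u = of_real (r ^ k * (1 - r\<^sup>2) powr \<beta>) * (f (r *\<^sub>R u) * cnj (H k j u))" for r u
    have Fm: "(\<lambda>(r, u). F r u) \<in> borel_measurable (borel \<Otimes>\<^sub>M borel)" unfolding F_def by measurable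
    have F: "F (norm y) (sgn y) = cnj (H k j y) * g y" for y
    proof -
      have y: "norm y *\<^sub>R sgn y = y" by (cases "y = 0") (simp_all add: sgn_div_norm)
      show ?thesis unfolding F_def y g_def homogeneous_polar[of "H k j" k y, OF H_hom[OF j]]
        by (simp add: scaleR_conv_of_real)
    qed
    have eqb: "(LINT r|radial_measure DIM('a). r ^ (2 * k) * (1 - r\<^sup>2) powr \<beta>) = real DIM('a) / 2 * Beta (real k + real DIM('a) / 2) (\<beta> + 1)"
      by (rule integral_radial_beta(2)[OF _ b]) (simp add: Suc_leI)
    have "solid_coeff g k j = (LINT y:ball 0 1|lborel. F (norm y) (sgn y))" unfolding solid_coeff_def F ..
    also have "... = (LINT r|radial_measure DIM('a). LINT u|cone_measure. F r u)"
      by (rule integral_polar[OF Fm]) (use H_cnj_integrable[OF gm gi j] in \<open>simp add: set_integrable_def F\<close>)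
    also have "... = (LINT r|radial_measure DIM('a). of_real (r ^ (2 * k) * (1 - r\<^sup>2) powr \<beta>) * c k j)"
    proof (rule integral_cong_AE)
      interpret C: finite_measure "cone_measure :: 'a measure" by (rule finite_measure_cone)
      show "(\<lambda>r. LINT u|cone_measure. F r u) \<in> borel_measurable (radial_measure DIM('a))" using Fm by measurable
      show "AE r in radial_measure DIM('a). (LINT u|cone_measure. F r u) = of_real (r ^ (2 * k) * (1 - r\<^sup>2) powr \<beta>) * c k j"
        using AE_radial
      proof eventually_elim
        case (elim r)
        have "(LINT u|cone_measure. F r u) = of_real (r ^ k * (1 - r\<^sup>2) powr \<beta>) * (of_real r ^ k * c k j)"
          unfolding F_def using c[OF j, of r] elim by (simp only: integral_mult_right_zero) simp
        moreover have "r ^ (2 * k) = r ^ k * r ^ k" by (simp add: mult_2 power_add)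
        ultimately show ?case by (simp add: mult_ac)
      qed
    qed measurable
    also have "... = of_real (real DIM('a) / 2 * Beta (real k + real DIM('a) / 2) (\<beta> + 1)) * c k j"
      by (simp only: integral_mult_left_zero integral_complex_of_real eqb)
    also have "Beta (real k + real DIM('a) / 2) (\<beta> + 1) = 1 / bcoef \<beta> k"
      unfolding Beta_def bcoef_def by (simp add: algebra_simps)
    finally show ?thesis by (simp add: field_simps)
  qed
  have "(\<lambda>k. 2 * of_real (bcoef \<beta> k) * (\<Sum>j=1..d k. H k j x * solid_coeff g k j)) sums bergman_projection \<beta> g x"
    by (rule bergman_projection_sums(1)[OF b gm gi x])
  moreover have "2 * of_real (bcoef \<beta> k) * (\<Sum>j=1..d k. H k j x * solid_coeff g k j) = (\<Sum>j\<in>{1..d k}. of_nat DIM('a) * c k j * H k j x)" for k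
    unfolding sum_distrib_left
    by (intro sum.cong refl) (use sc bcoef_pos[OF b, of k] in simp)
  ultimately have "(\<lambda>k. \<Sum>j\<in>{1..d k}. of_nat DIM('a) * c k j * H k j x) sums bergman_projection \<beta> g x" by simp
  then show ?thesis using s1 sums_unique2 unfolding g_def by blast
qed

end

section \<open>The two distances\<close>

lemma ennreal_powr_mono: "x \<le> y \<Longrightarrow> 0 < p \<Longrightarrow> ennreal_powr x p \<le> ennreal_powr y p"
  unfolding ennreal_powr_def
  by (auto simp: top_unique less_top intro!: ennreal_leI powr_mono2 enn2real_mono)

lemma ennreal_powr_ennreal: "0 \<le> a \<Longrightarrow> ennreal_powr (ennreal a) p = ennreal (a powr p)"
  by (simp add: ennreal_powr_def)

lemma ennreal_powr_cmult:
  assumes "0 < a" "0 < p"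
  shows "ennreal_powr (ennreal a * X) p = ennreal (a powr p) * ennreal_powr X p"
proof (cases X)
  case (real r)
  then show ?thesis using assms by (simp add: ennreal_mult[symmetric] ennreal_powr_ennreal powr_mult)
next
  case top
  then show ?thesis using assms by (simp add: ennreal_powr_def ennreal_mult_top)
qed

lemma ennreal_powr_measurable [measurable]: "f \<in> borel_measurable M \<Longrightarrow> (\<lambda>x. ennreal_powr (f x) p) \<in> borel_measurable M"
proof -
  assume [measurable]: "f \<in> borel_measurable M"
  have "{x \<in> space M. f x = \<infinity>} = f -` {\<infinity>} \<inter> space M" by auto
  then have "Measurable.pred M (\<lambda>x. f x = \<infinity>)" unfolding pred_def by simp
  moreover have "(\<lambda>x. enn2real (f x) powr p) \<in> borel_measurable M"
    by (intro powr_real_measurable borel_measurable_enn2real) auto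
  ultimately show ?thesis unfolding ennreal_powr_def
    by (intro measurable_If measurable_compose[OF _ measurable_ennreal]) (auto simp: pred_def)
qed

lemma nn_integral_ball_measure:
  fixes h :: "'a::euclidean_space \<Rightarrow> ennreal"
  assumes [measurable]: "h \<in> borel_measurable borel"
  shows "(\<integral>\<^sup>+x. h x \<partial>ball_measure) = ennreal (1 / measure lborel (ball (0::'a) 1)) * (\<integral>\<^sup>+x\<in>ball 0 1. h x \<partial>lborel)"
proof -
  define V where "V = measure lborel (ball (0::'a) 1)"
  have V: "V > 0" unfolding V_def using content_ball_pos[of 1 "0::'a"] by simp
  have eV: "emeasure lborel (ball (0::'a) 1) = ennreal V"
    unfolding V_def by (rule emeasure_eq_ennreal_measure) (simp add: emeasure_ball)
  have "(\<integral>\<^sup>+x. h x \<partial>ball_measure) = (\<integral>\<^sup>+x\<in>ball 0 1. h x \<partial>lborel) / emeasure lborel (ball (0::'a) 1)"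
    unfolding ball_measure_def by (rule nn_integral_uniform_measure) auto
  then show ?thesis unfolding eV V_def[symmetric] using V
    by (simp add: divide_ennreal_def inverse_ennreal mult.commute divide_inverse)
qed

lemma AE_ball_measure: "AE x in (ball_measure :: 'a::euclidean_space measure). x \<in> ball 0 1"
  unfolding ball_measure_def by (rule AE_uniform_measureI) auto

text \<open>The quotient of 1 - |y|^2 and 1 - |y| is 1 + |y|, which lies in [1, 2). The absolute
  value of the exponent covers negative a, as happens for \<alpha> < 0.\<close>

lemma weight_comparison:
  fixes y :: "'a::real_normed_vector"
  assumes "norm y < 1"
  shows "(1 - norm y) powr a \<le> 2 powr \<bar>a\<bar> * (1 - (norm y)\<^sup>2) powr a"
    and "(1 - (norm y)\<^sup>2) powr a \<le> 2 powr \<bar>a\<bar> * (1 - norm y) powr a"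
proof -
  have e: "1 - (norm y)\<^sup>2 = (1 - norm y) * (1 + norm y)" by (simp add: power2_eq_square algebra_simps)
  have f: "(1 - (norm y)\<^sup>2) powr a = (1 - norm y) powr a * (1 + norm y) powr a"
    unfolding e by (rule powr_mult)
  have up: "(1 + norm y) powr b \<le> 2 powr \<bar>b\<bar>" for b
  proof (cases "b \<ge> 0")
    case True
    then show ?thesis using assms by (auto intro!: powr_mono2)
  next
    case False
    then have "(1 + norm y) powr b \<le> 1 powr b" by (intro powr_mono2') auto
    also have "... \<le> 2 powr \<bar>b\<bar>" using ge_one_powr_ge_zero[of 2 "\<bar>b\<bar>"] by simp
    finally show ?thesis .
  qed
  show "(1 - (norm y)\<^sup>2) powr a \<le> 2 powr \<bar>a\<bar> * (1 - norm y) powr a"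
    unfolding f using mult_left_mono[OF up[of a], of "(1 - norm y) powr a"] by (simp add: mult.commute)
  have "1 = (1 + norm y) powr a * (1 + norm y) powr (- a)"
    using norm_ge_zero[of y] by (simp add: powr_add[symmetric] del: norm_ge_zero)
  also have "... \<le> (1 + norm y) powr a * 2 powr \<bar>a\<bar>" using up[of "- a"] by (intro mult_left_mono) auto
  finally have "(1 - norm y) powr a * 1 \<le> (1 - norm y) powr a * ((1 + norm y) powr a * 2 powr \<bar>a\<bar>)"
    by (rule mult_left_mono) simp
  then show "(1 - norm y) powr a \<le> 2 powr \<bar>a\<bar> * (1 - (norm y)\<^sup>2) powr a" unfolding f by (simp add: mult_ac)
qed

text \<open>On the ball around y of half its distance to the boundary, the boundary distance and
  \<open>kap x\<close> change by at most a factor 2. This lets weights pass through the sub-mean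
  value inequality.\<close>

lemma kap_local:
  fixes x y z :: "'a::real_normed_vector"
  assumes y: "norm y < 1" and z: "norm (y - z) < (1 - norm y) / 2" and x: "norm x < 1"
  shows "norm z < 1" "1 - norm y \<le> 2 * (1 - norm z)" "1 - norm z \<le> 2 * (1 - norm y)" "kap x z \<le> 2 * kap x y"
proof -
  have d: "\<bar>norm y - norm z\<bar> \<le> norm (y - z)" by (rule norm_triangle_ineq3)
  show "norm z < 1" using d z y by argo
  show "1 - norm y \<le> 2 * (1 - norm z)" using d z y by argo
  show "1 - norm z \<le> 2 * (1 - norm y)" using d z y by argo
  have "norm (x - z) \<le> norm (x - y) + norm (y - z)" using norm_triangle_ineq[of "x - y" "y - z"] by simp
  then show "kap x z \<le> 2 * kap x y" unfolding kap_def using d z y x norm_ge_zero[of "x - y"] by argo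
qed

lemma powr_doubling:
  fixes a b e :: real
  assumes "0 < a" "0 < b" "a \<le> 2 * b" "b \<le> 2 * a"
  shows "a powr e \<le> 2 powr \<bar>e\<bar> * b powr e"
proof (cases "e \<ge> 0")
  case True
  have "a powr e \<le> (2 * b) powr e" using assms True by (intro powr_mono2) auto
  then show ?thesis using True by (simp add: powr_mult)
next
  case False
  have "a powr e \<le> (b / 2) powr e" using assms False by (intro powr_mono2') auto
  also have "... = b powr e / 2 powr e" by (rule powr_divide)
  also have "... = 2 powr \<bar>e\<bar> * b powr e" using False by (simp add: powr_minus divide_inverse mult.commute)
  finally show ?thesis .
qed

text \<open>For \<open>p \<le> 1\<close> the integral of \<open>|f| K\<close> is dominated by that of \<open>(|f| K)\<^bsup>p\<^esup>\<close>: the sub-mean value property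
  bounds \<open>|f| K (1 - |y|)\<^bsup>\<beta>+n\<^esup>\<close> pointwise, and its power \<open>1 - p\<close> is pulled out of the integral.\<close>

lemma kernel_integral_powr_le:
  fixes p \<beta> :: real
  assumes p: "0 < p" "p \<le> 1" and b: "\<beta> \<ge> 0"
  shows "\<exists>C>0. \<forall>(f :: 'a::euclidean_space \<Rightarrow> complex) x. f \<in> borel_measurable borel \<longrightarrow> harmonic_on f (ball 0 1) \<longrightarrow> x \<in> ball 0 1 \<longrightarrow>
    ennreal_powr (\<integral>\<^sup>+y\<in>ball 0 1. ennreal (cmod (f y) * kap x y powr (- (real DIM('a) + \<beta>)) * (1 - norm y) powr \<beta>) \<partial>lborel) p
    \<le> ennreal C * (\<integral>\<^sup>+y\<in>ball 0 1. ennreal (cmod (f y) powr p * kap x y powr (- (p * (real DIM('a) + \<beta>))) * (1 - norm y) powr (p * \<beta> + p * real DIM('a) - real DIM('a))) \<partial>lborel)"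
proof -
  let ?n = "real DIM('a)"
  obtain C1 where C1: "C1 > 0" "\<And>(f :: 'a \<Rightarrow> complex) x \<delta>. \<delta> > 0 \<Longrightarrow> harmonic_on f (ball x \<delta>) \<Longrightarrow>
    ennreal (cmod (f x) powr p) \<le> ennreal (C1 / \<delta> ^ DIM('a)) * (\<integral>\<^sup>+y\<in>ball x \<delta>. ennreal (cmod (f y) powr p) \<partial>lborel)"
    using submean_value_powr[OF p] by blast
  \<comment> \<open>e + n = p (\<beta> + n): the missing n is the price of averaging over a ball of
    radius comparable with 1 - |y|.\<close>
  define e where "e = p * \<beta> + p * ?n - ?n"
  define q where "q = p * (?n + \<beta>)"
  have q: "q > 0" using p b DIM_positive[where 'a = 'a] by (simp add: q_def add_pos_nonneg)
  define C2 where "C2 = 2 powr q * 2 powr \<bar>e\<bar>"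
  define C3 where "C3 = C1 * 2 ^ DIM('a) * C2"
  have C3: "C3 > 0" using C1(1) by (simp add: C3_def C2_def)
  have "ennreal_powr (\<integral>\<^sup>+y\<in>ball 0 1. ennreal (cmod (f y) * kap x y powr (- (?n + \<beta>)) * (1 - norm y) powr \<beta>) \<partial>lborel) p
    \<le> ennreal (C3 powr (1 - p)) * (\<integral>\<^sup>+y\<in>ball 0 1. ennreal (cmod (f y) powr p * kap x y powr (- q) * (1 - norm y) powr e) \<partial>lborel)"
    if fm[measurable]: "f \<in> borel_measurable borel" and f: "harmonic_on f (ball 0 1)" and x: "x \<in> ball 0 1" for f :: "'a \<Rightarrow> complex" and x
  proof (cases "(\<integral>\<^sup>+y\<in>ball 0 1. ennreal (cmod (f y) powr p * kap x y powr (- q) * (1 - norm y) powr e) \<partial>lborel)")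
    case top
    then show ?thesis using C3 by (simp add: ennreal_mult_top)
  next
    case (real \<nu>)
    have km[measurable]: "kap x \<in> borel_measurable borel" unfolding kap_def by measurable
    \<comment> \<open>Sub-mean value inequality for |f|^p on the ball of radius (1 - |y|)/2, where
      the weights are nearly constant; the local integral is enlarged to the full integral
      \<nu>.\<close>
    have pw: "cmod (f y) powr p * kap x y powr (- q) * (1 - norm y) powr (e + ?n) \<le> C3 * \<nu>" if y: "y \<in> ball 0 1" for y
    proof -
      define \<delta> where "\<delta> = (1 - norm y) / 2"
      have d: "\<delta> > 0" using y by (simp add: \<delta>_def)
      define w where "w = kap x y powr (- q) * (1 - norm y) powr e"
      have w0: "w \<ge> 0" by (simp add: w_def)
      have sub: "ball y \<delta> \<subseteq> ball 0 1" using y by (auto simp: ball_subset_ball_iff \<delta>_def field_simps)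
      have wz: "w \<le> C2 * (kap x z powr (- q) * (1 - norm z) powr e)" if z: "z \<in> ball y \<delta>" for z
      proof -
        have z': "norm (y - z) < (1 - norm y) / 2" "norm y < 1" "norm x < 1" using z y x by (auto simp: \<delta>_def dist_norm)
        note L = kap_local[OF z'(2,1,3)]
        have kz: "kap x z > 0" using kap_pos[OF z'(3) L(1)] .
        have "kap x y powr (- q) \<le> (kap x z / 2) powr (- q)" using L(4) kz q by (intro powr_mono2') auto
        also have "... = kap x z powr (- q) / 2 powr (- q)" by (rule powr_divide)
        also have "... = 2 powr q * kap x z powr (- q)" by (simp add: powr_minus divide_inverse mult.commute)
        finally have 1: "kap x y powr (- q) \<le> 2 powr q * kap x z powr (- q)" .
        have 2: "(1 - norm y) powr e \<le> 2 powr \<bar>e\<bar> * (1 - norm z) powr e"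
          by (rule powr_doubling) (use L z' in auto)
        have "w \<le> (2 powr q * kap x z powr (- q)) * (2 powr \<bar>e\<bar> * (1 - norm z) powr e)"
          unfolding w_def by (intro mult_mono 1 2) auto
        then show ?thesis by (simp add: C2_def mult_ac)
      qed
      have m: "(\<lambda>z. ennreal (cmod (f z) powr p) * indicator (ball y \<delta>) z) \<in> borel_measurable lborel" by measurable
      have "ennreal w * ennreal (cmod (f y) powr p) \<le> ennreal w * (ennreal (C1 / \<delta> ^ DIM('a)) * (\<integral>\<^sup>+z\<in>ball y \<delta>. ennreal (cmod (f z) powr p) \<partial>lborel))"
        by (intro mult_left_mono C1(2)[OF d harmonic_on_subset[OF f]]) (use sub in auto)
      also have "... = ennreal (C1 / \<delta> ^ DIM('a)) * (\<integral>\<^sup>+z. ennreal w * (ennreal (cmod (f z) powr p) * indicator (ball y \<delta>) z) \<partial>lborel)"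
        by (subst nn_integral_cmult[OF m]) (simp add: mult_ac)
      also have "... \<le> ennreal (C1 / \<delta> ^ DIM('a)) * (\<integral>\<^sup>+z. ennreal C2 * (ennreal (cmod (f z) powr p * kap x z powr (- q) * (1 - norm z) powr e) * indicator (ball 0 1) z) \<partial>lborel)"
      proof (intro mult_left_mono nn_integral_mono)
        fix z
        show "ennreal w * (ennreal (cmod (f z) powr p) * indicator (ball y \<delta>) z) \<le> ennreal C2 * (ennreal (cmod (f z) powr p * kap x z powr (- q) * (1 - norm z) powr e) * indicator (ball 0 1) z)"
        proof (cases "z \<in> ball y \<delta>")
          case True
          have "w * cmod (f z) powr p \<le> C2 * (kap x z powr (- q) * (1 - norm z) powr e) * cmod (f z) powr p"
            by (rule mult_right_mono[OF wz[OF True]]) simp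
          then have "w * cmod (f z) powr p \<le> C2 * (cmod (f z) powr p * kap x z powr (- q) * (1 - norm z) powr e)" by (simp add: mult_ac)
          moreover have "z \<in> ball 0 1" using True sub by blast
          ultimately show ?thesis using True w0 by (simp add: ennreal_mult[symmetric] C2_def ennreal_leI)
        qed simp
      qed simp
      also have "... = ennreal (C1 / \<delta> ^ DIM('a)) * (ennreal C2 * ennreal \<nu>)"
        by (subst nn_integral_cmult) (auto simp: real)
      also have "... = ennreal (C1 / \<delta> ^ DIM('a) * (C2 * \<nu>))"
        using C1(1) d real by (simp add: ennreal_mult[symmetric] C2_def)
      finally have "ennreal (w * cmod (f y) powr p) \<le> ennreal (C1 / \<delta> ^ DIM('a) * (C2 * \<nu>))"
        using w0 by (simp add: ennreal_mult)
      then have le: "w * cmod (f y) powr p \<le> C1 / \<delta> ^ DIM('a) * (C2 * \<nu>)"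
        using C1(1) d real by (subst (asm) ennreal_le_iff) (auto simp: C2_def)
      have "cmod (f y) powr p * kap x y powr (- q) * (1 - norm y) powr (e + ?n) = (w * cmod (f y) powr p) * (2 * \<delta>) ^ DIM('a)"
      proof -
        have "2 * \<delta> = 1 - norm y" by (simp add: \<delta>_def)
        then show ?thesis using y by (simp add: w_def powr_add powr_realpow mult_ac)
      qed
      also have "... \<le> C1 / \<delta> ^ DIM('a) * (C2 * \<nu>) * (2 * \<delta>) ^ DIM('a)"
        by (rule mult_right_mono[OF le]) (use d in simp)
      also have "... = C3 * \<nu>" using d by (simp add: C3_def power_mult_distrib)
      finally show ?thesis .
    qed
    \<comment> \<open>The bound on a^(1-p) that results from a^p \<le> \<open>C3\<close> \<nu>,
      where a = |f| kap^(-(n+\<beta>)) (1 - |y|)^(\<beta>+n).\<close>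
    define D where "D = (C3 * \<nu>) powr ((1 - p) / p)"
    have pt: "cmod (f y) * kap x y powr (- (?n + \<beta>)) * (1 - norm y) powr \<beta> \<le> D * (cmod (f y) powr p * kap x y powr (- q) * (1 - norm y) powr e)"
      if y: "y \<in> ball 0 1" for y
    proof -
      define a where "a = cmod (f y) * kap x y powr (- (?n + \<beta>)) * (1 - norm y) powr (\<beta> + ?n)"
      have a0: "a \<ge> 0" by (simp add: a_def)
      have e1: "(\<beta> + ?n) * p = e + ?n" and e2: "- (?n + \<beta>) * p = - q" by (simp_all add: e_def q_def algebra_simps)
      have ap: "a powr p = cmod (f y) powr p * kap x y powr (- q) * (1 - norm y) powr (e + ?n)"
        unfolding a_def by (simp only: powr_mult powr_powr e1 e2)
      have "(a powr p) powr (1 / p) \<le> (C3 * \<nu>) powr (1 / p)"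
        using pw[OF y] p unfolding ap by (intro powr_mono2) auto
      then have "a \<le> (C3 * \<nu>) powr (1 / p)" using a0 p by (simp add: powr_powr)
      then have "a powr (1 - p) \<le> ((C3 * \<nu>) powr (1 / p)) powr (1 - p)" using a0 p by (intro powr_mono2) auto
      then have ad: "a powr (1 - p) \<le> D" by (simp add: D_def powr_powr)
      have "a = a powr p * a powr (1 - p)" using a0 by (simp add: powr_add[symmetric])
      also have "... \<le> a powr p * D" by (rule mult_left_mono[OF ad]) simp
      finally have "a * (1 - norm y) powr (- ?n) \<le> a powr p * D * (1 - norm y) powr (- ?n)" by (rule mult_right_mono) simp
      moreover have "a * (1 - norm y) powr (- ?n) = cmod (f y) * kap x y powr (- (?n + \<beta>)) * (1 - norm y) powr \<beta>"
      proof -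
        have "(1 - norm y) powr (\<beta> + ?n) * (1 - norm y) powr (- ?n) = (1 - norm y) powr \<beta>" by (simp add: powr_add[symmetric])
        then show ?thesis unfolding a_def by (simp only: mult.assoc)
      qed
      moreover have "a powr p * D * (1 - norm y) powr (- ?n) = D * (cmod (f y) powr p * kap x y powr (- q) * (1 - norm y) powr e)"
      proof -
        have "(1 - norm y) powr (e + ?n) * (1 - norm y) powr (- ?n) = (1 - norm y) powr e" by (simp add: powr_add[symmetric])
        then show ?thesis unfolding ap by (simp add: mult_ac)
      qed
      ultimately show ?thesis by simp
    qed
    have "(\<integral>\<^sup>+y\<in>ball 0 1. ennreal (cmod (f y) * kap x y powr (- (?n + \<beta>)) * (1 - norm y) powr \<beta>) \<partial>lborel)
      \<le> (\<integral>\<^sup>+y. ennreal D * (ennreal (cmod (f y) powr p * kap x y powr (- q) * (1 - norm y) powr e) * indicator (ball 0 1) y) \<partial>lborel)"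
    proof (rule nn_integral_mono)
      fix y :: 'a
      show "ennreal (cmod (f y) * kap x y powr (- (?n + \<beta>)) * (1 - norm y) powr \<beta>) * indicator (ball 0 1) y
        \<le> ennreal D * (ennreal (cmod (f y) powr p * kap x y powr (- q) * (1 - norm y) powr e) * indicator (ball 0 1) y)"
        by (cases "y \<in> ball 0 1") (use pt[of y] in \<open>auto simp: D_def ennreal_mult[symmetric] intro!: ennreal_leI\<close>)
    qed
    also have "... = ennreal D * ennreal \<nu>" by (subst nn_integral_cmult) (auto simp: real)
    also have "... = ennreal (D * \<nu>)" using real by (simp add: D_def ennreal_mult)
    finally have "ennreal_powr (\<integral>\<^sup>+y\<in>ball 0 1. ennreal (cmod (f y) * kap x y powr (- (?n + \<beta>)) * (1 - norm y) powr \<beta>) \<partial>lborel) p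
        \<le> ennreal_powr (ennreal (D * \<nu>)) p" by (rule ennreal_powr_mono[OF _ p(1)])
    also have "... = ennreal ((D * \<nu>) powr p)" using real by (intro ennreal_powr_ennreal) (simp add: D_def)
    \<comment> \<open>The exponents 1 - p and p add up, so the final bound is linear in \<nu>, which
      is what allows Fubini's theorem afterwards.\<close>
    also have "(D * \<nu>) powr p = C3 powr (1 - p) * \<nu>"
    proof -
      have "(D * \<nu>) powr p = (C3 * \<nu>) powr (1 - p) * \<nu> powr p" using p by (simp add: D_def powr_mult powr_powr)
      also have "... = C3 powr (1 - p) * (\<nu> powr (1 - p) * \<nu> powr p)" by (simp add: powr_mult)
      also have "\<nu> powr (1 - p) * \<nu> powr p = \<nu>" using real by (simp add: powr_add[symmetric])
      finally show ?thesis .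
    qed
    finally show ?thesis using real by (simp add: ennreal_mult)
  qed
  then show ?thesis using C3 unfolding e_def q_def by (intro exI[of _ "C3 powr (1 - p)"]) auto
qed

text \<open>After \<open>kernel_integral_powr_le\<close> the order of integration is exchanged, and
  the x-integral falls under \<open>kap_integral_estimate\<close> with s = \<alpha> and t = p (n +
  \<beta>) - n - \<alpha>. The hypothesis \<open>big\<close> is t > 0, and the remaining exponent of
  1 - |y| is exactly \<alpha>.\<close>

lemma kernel_A_p_bound:
  fixes p \<alpha> \<beta> :: real
  assumes p: "0 < p" "p \<le> 1" and a: "\<alpha> > -1" and b: "\<beta> \<ge> 0" and big: "p * (real DIM('a) + \<beta>) > real DIM('a::euclidean_space) + \<alpha>"
  shows "\<exists>C>0. \<forall>(f :: 'a \<Rightarrow> complex). f \<in> borel_measurable borel \<longrightarrow> harmonic_on f (ball 0 1) \<longrightarrow>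
    (\<integral>\<^sup>+x\<in>ball 0 1. ennreal_powr (\<integral>\<^sup>+y\<in>ball 0 1. ennreal (cmod (f y) * kap x y powr (- (real DIM('a) + \<beta>)) * (1 - norm y) powr \<beta>) \<partial>lborel) p
       * ennreal ((1 - norm x) powr \<alpha>) \<partial>lborel)
    \<le> ennreal C * (\<integral>\<^sup>+y\<in>ball 0 1. ennreal (cmod (f y) powr p * (1 - norm y) powr \<alpha>) \<partial>lborel)"
proof -
  let ?n = "real DIM('a)"
  define e where "e = p * \<beta> + p * ?n - ?n"
  define q where "q = p * (?n + \<beta>)"
  define t where "t = q - ?n - \<alpha>"
  have t: "t > 0" using big by (simp add: t_def q_def)
  have q: "q = ?n + \<alpha> + t" by (simp add: t_def)
  obtain C1 where C1: "C1 > 0" "\<And>(f :: 'a \<Rightarrow> complex) x. f \<in> borel_measurable borel \<Longrightarrow> harmonic_on f (ball 0 1) \<Longrightarrow> x \<in> ball 0 1 \<Longrightarrow>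
    ennreal_powr (\<integral>\<^sup>+y\<in>ball 0 1. ennreal (cmod (f y) * kap x y powr (- (?n + \<beta>)) * (1 - norm y) powr \<beta>) \<partial>lborel) p
    \<le> ennreal C1 * (\<integral>\<^sup>+y\<in>ball 0 1. ennreal (cmod (f y) powr p * kap x y powr (- q) * (1 - norm y) powr e) \<partial>lborel)"
    using kernel_integral_powr_le[OF p b, where 'a = 'a] unfolding e_def q_def by blast
  obtain C2 where C2: "C2 > 0" "\<And>y. y \<in> ball (0::'a) 1 \<Longrightarrow>
    (\<integral>\<^sup>+x\<in>ball 0 1. ennreal ((1 - norm x) powr \<alpha> * kap x y powr (- q)) \<partial>lborel) \<le> ennreal (C2 * (1 - norm y) powr (- t))"
    using kap_integral_estimate[OF a t, where 'a = 'a] unfolding q by blast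
  have "(\<integral>\<^sup>+x\<in>ball 0 1. ennreal_powr (\<integral>\<^sup>+y\<in>ball 0 1. ennreal (cmod (f y) * kap x y powr (- (?n + \<beta>)) * (1 - norm y) powr \<beta>) \<partial>lborel) p
       * ennreal ((1 - norm x) powr \<alpha>) \<partial>lborel)
    \<le> ennreal (C1 * C2) * (\<integral>\<^sup>+y\<in>ball 0 1. ennreal (cmod (f y) powr p * (1 - norm y) powr \<alpha>) \<partial>lborel)"
    if fm[measurable]: "f \<in> borel_measurable borel" and f: "harmonic_on f (ball 0 1)" for f :: "'a \<Rightarrow> complex"
  proof -
    define G where "G x y = ennreal (cmod (f y) powr p * kap x y powr (- q) * (1 - norm y) powr e) * indicator (ball 0 1) y * (ennreal ((1 - norm x) powr \<alpha>) * indicator (ball 0 1) x)" for x y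
    have Gm[measurable]: "(\<lambda>(x, y). G x y) \<in> borel_measurable (borel \<Otimes>\<^sub>M borel)" unfolding G_def kap_def by measurable
    have Gm': "(\<lambda>(x, y). G x y) \<in> borel_measurable (lborel \<Otimes>\<^sub>M lborel)" using Gm by (simp cong: measurable_cong_sets sets_pair_measure_cong)
    have km: "(\<lambda>y. ennreal (cmod (f y) powr p * kap x y powr (- q) * (1 - norm y) powr e) * indicator (ball 0 1) y) \<in> borel_measurable lborel" for x
      unfolding kap_def by measurable
    have "(\<integral>\<^sup>+x\<in>ball 0 1. ennreal_powr (\<integral>\<^sup>+y\<in>ball 0 1. ennreal (cmod (f y) * kap x y powr (- (?n + \<beta>)) * (1 - norm y) powr \<beta>) \<partial>lborel) p
       * ennreal ((1 - norm x) powr \<alpha>) \<partial>lborel) \<le> (\<integral>\<^sup>+x. ennreal C1 * (\<integral>\<^sup>+y. G x y \<partial>lborel) \<partial>lborel)"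
    proof (rule nn_integral_mono)
      fix x :: 'a
      have "(\<integral>\<^sup>+y. G x y \<partial>lborel) = (\<integral>\<^sup>+y\<in>ball 0 1. ennreal (cmod (f y) powr p * kap x y powr (- q) * (1 - norm y) powr e) \<partial>lborel) * (ennreal ((1 - norm x) powr \<alpha>) * indicator (ball 0 1) x)"
        unfolding G_def by (rule nn_integral_multc[OF km])
      moreover have "ennreal_powr (\<integral>\<^sup>+y\<in>ball 0 1. ennreal (cmod (f y) * kap x y powr (- (?n + \<beta>)) * (1 - norm y) powr \<beta>) \<partial>lborel) p * (ennreal ((1 - norm x) powr \<alpha>) * indicator (ball 0 1) x)
         \<le> (ennreal C1 * (\<integral>\<^sup>+y\<in>ball 0 1. ennreal (cmod (f y) powr p * kap x y powr (- q) * (1 - norm y) powr e) \<partial>lborel)) * (ennreal ((1 - norm x) powr \<alpha>) * indicator (ball 0 1) x)"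
      proof (cases "x \<in> ball 0 1")
        case True
        show ?thesis by (rule mult_right_mono[OF C1(2)[OF fm f True]]) simp
      qed simp
      ultimately show "ennreal_powr (\<integral>\<^sup>+y\<in>ball 0 1. ennreal (cmod (f y) * kap x y powr (- (?n + \<beta>)) * (1 - norm y) powr \<beta>) \<partial>lborel) p * ennreal ((1 - norm x) powr \<alpha>) * indicator (ball 0 1) x \<le> ennreal C1 * (\<integral>\<^sup>+y. G x y \<partial>lborel)"
        by (simp add: mult.assoc)
    qed
    also have "... = ennreal C1 * (\<integral>\<^sup>+x. (\<integral>\<^sup>+y. G x y \<partial>lborel) \<partial>lborel)"
      by (rule nn_integral_cmult) measurable
    also have "(\<integral>\<^sup>+x. (\<integral>\<^sup>+y. G x y \<partial>lborel) \<partial>lborel) = (\<integral>\<^sup>+y. (\<integral>\<^sup>+x. G x y \<partial>lborel) \<partial>lborel)"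
      using lborel_pair.Fubini'[OF Gm'] by simp
    also have "... \<le> (\<integral>\<^sup>+y. ennreal C2 * (ennreal (cmod (f y) powr p * (1 - norm y) powr \<alpha>) * indicator (ball 0 1) y) \<partial>lborel)"
    proof (rule nn_integral_mono)
      fix y :: 'a
      show "(\<integral>\<^sup>+x. G x y \<partial>lborel) \<le> ennreal C2 * (ennreal (cmod (f y) powr p * (1 - norm y) powr \<alpha>) * indicator (ball 0 1) y)"
      proof (cases "y \<in> ball 0 1")
        case True
        have km2: "(\<lambda>x. ennreal ((1 - norm x) powr \<alpha> * kap x y powr (- q)) * indicator (ball 0 1) x) \<in> borel_measurable lborel"
          unfolding kap_def by measurable
        have "(\<integral>\<^sup>+x. G x y \<partial>lborel) = (\<integral>\<^sup>+x. ennreal (cmod (f y) powr p * (1 - norm y) powr e) * (ennreal ((1 - norm x) powr \<alpha> * kap x y powr (- q)) * indicator (ball 0 1) x) \<partial>lborel)"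
          by (intro nn_integral_cong) (use True in \<open>auto simp: G_def indicator_def ennreal_mult[symmetric] mult_ac\<close>)
        also have "... = ennreal (cmod (f y) powr p * (1 - norm y) powr e) * (\<integral>\<^sup>+x\<in>ball 0 1. ennreal ((1 - norm x) powr \<alpha> * kap x y powr (- q)) \<partial>lborel)"
          by (rule nn_integral_cmult[OF km2])
        also have "... \<le> ennreal (cmod (f y) powr p * (1 - norm y) powr e) * ennreal (C2 * (1 - norm y) powr (- t))"
          by (rule mult_left_mono[OF C2(2)[OF True]]) simp
        also have "... = ennreal (C2 * (cmod (f y) powr p * ((1 - norm y) powr e * (1 - norm y) powr (- t))))"
          using C2(1) by (subst ennreal_mult[symmetric]) (auto simp: mult_ac)
        also have "(1 - norm y) powr e * (1 - norm y) powr (- t) = (1 - norm y) powr \<alpha>"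
        proof -
          have "e + - t = \<alpha>" by (simp add: e_def t_def q_def algebra_simps)
          then show ?thesis by (simp only: powr_add[symmetric])
        qed
        finally show ?thesis using True C2(1) by (simp add: ennreal_mult)
      qed (simp add: G_def)
    qed
    also have "... = ennreal C2 * (\<integral>\<^sup>+y\<in>ball 0 1. ennreal (cmod (f y) powr p * (1 - norm y) powr \<alpha>) \<partial>lborel)"
      by (rule nn_integral_cmult) measurable
    finally show ?thesis using C1(1) C2(1) by (simp add: ennreal_mult mult.assoc mult_left_mono)
  qed
  then show ?thesis using C1(1) C2(1) by (intro exI[of _ "C1 * C2"]) auto
qed

text \<open>Moves a constant to the other side of an inequality, so that bounds for individual
  admissible \<epsilon> or g pass to the infimum even when values are infinite.\<close>

lemma ennreal_inverse_mult_le_iff: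
  assumes "0 < c"
  shows "ennreal (1 / c) * a \<le> b \<longleftrightarrow> a \<le> ennreal c * b"
proof
  assume "ennreal (1 / c) * a \<le> b"
  then have "ennreal c * (ennreal (1 / c) * a) \<le> ennreal c * b" by (rule mult_left_mono) simp
  moreover have "ennreal c * (ennreal (1 / c) * a) = a"
    using assms by (simp add: mult.assoc[symmetric] ennreal_mult[symmetric])
  ultimately show "a \<le> ennreal c * b" by simp
next
  assume "a \<le> ennreal c * b"
  then have "ennreal (1 / c) * a \<le> ennreal (1 / c) * (ennreal c * b)" by (rule mult_left_mono) simp
  moreover have "ennreal (1 / c) * (ennreal c * b) = b"
    using assms by (simp add: mult.assoc[symmetric] ennreal_mult[symmetric])
  ultimately show "ennreal (1 / c) * a \<le> b" by simp
qed

section \<open>Norms, level sets and measurability\<close>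

lemma A_infty_norm_cong: "(\<And>x. x \<in> ball 0 1 \<Longrightarrow> f x = g x) \<Longrightarrow> A_infty_norm t f = A_infty_norm t g"
  unfolding A_infty_norm_def by (intro SUP_cong) auto

lemma A_infty_norm_bound: "x \<in> ball 0 1 \<Longrightarrow> ennreal (cmod (f x) * (1 - (norm x)\<^sup>2) powr t) \<le> A_infty_norm t f"
  unfolding A_infty_norm_def by (rule SUP_upper)

lemma U_set_measurable:
  fixes f :: "'a::euclidean_space \<Rightarrow> complex"
  assumes [measurable]: "f \<in> borel_measurable borel"
  shows "U_set \<epsilon> t f \<in> sets borel"
proof -
  have [measurable]: "(\<lambda>x::'a. (1 - norm x) powr t) \<in> borel_measurable borel"
    by (intro powr_real_measurable) measurable
  have "{x \<in> space borel. x \<in> ball 0 1 \<and> \<epsilon> \<le> cmod (f x) * (1 - norm x) powr t} \<in> sets borel" by measurable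
  then show ?thesis by (simp add: U_set_def)
qed

text \<open>A function harmonic on the ball is arbitrary elsewhere and need not be Borel measurable.
  Cutting it off makes it so, without changing any quantity that depends on values in the
  ball.\<close>

lemma harmonic_extension_by_zero:
  fixes f :: "'a::euclidean_space \<Rightarrow> complex"
  assumes f: "harmonic_on f (ball 0 1)"
  shows "(\<lambda>y. indicator (ball 0 1) y *\<^sub>R f y) \<in> borel_measurable borel"
    and "harmonic_on (\<lambda>y. indicator (ball 0 1) y *\<^sub>R f y) (ball 0 1)"
  using borel_measurable_indicator_ball[OF harmonic_on_imp_continuous_on[OF f]] by (auto intro: harmonic_on_cong[OF f])

context spherical_basis
begin

lemma bergman_kernel_measurable_pair:
  "(\<lambda>z. bergman_kernel d Y \<beta> (fst z) (snd z)) \<in> borel_measurable (borel \<Otimes>\<^sub>M borel)"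
proof -
  have h1: "(\<lambda>z. H k j (fst z)) \<in> borel_measurable (borel \<Otimes>\<^sub>M borel)" if "j \<in> {1..d k}" for k j
    by (rule measurable_compose[OF measurable_fst H_measurable[OF that]])
  have h2: "(\<lambda>z. H k j (snd z)) \<in> borel_measurable (borel \<Otimes>\<^sub>M borel)" if "j \<in> {1..d k}" for k j
    by (rule measurable_compose[OF measurable_snd H_measurable[OF that]])
  have [measurable]: "(\<lambda>z. Z k (fst z) (snd z)) \<in> borel_measurable (borel \<Otimes>\<^sub>M borel)" for k
    unfolding Z_def by (intro borel_measurable_sum borel_measurable_times borel_measurable_cnj h1 h2)
  show ?thesis unfolding bergman_kernel_series by measurable
qed

lemma level_integral:
  fixes f :: "'a \<Rightarrow> complex"
  assumes fm[measurable]: "f \<in> borel_measurable borel"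
  shows "(\<integral>\<^sup>+y\<in>U_set \<epsilon> t f. ennreal (cmod (bergman_kernel d Y \<beta> x y) * (1 - norm y) powr e) \<partial>ball_measure)
      = ennreal (1 / measure lborel (ball (0::'a) 1)) *
        (\<integral>\<^sup>+y. ennreal (cmod (bergman_kernel d Y \<beta> x y) * (1 - norm y) powr e) * indicator (U_set \<epsilon> t f) y \<partial>lborel)"
    and "(\<lambda>x. \<integral>\<^sup>+y\<in>U_set \<epsilon> t f. ennreal (cmod (bergman_kernel d Y \<beta> x y) * (1 - norm y) powr e) \<partial>ball_measure) \<in> borel_measurable borel"
proof -
  have [measurable]: "U_set \<epsilon> t f \<in> sets borel" by (rule U_set_measurable[OF fm])
  let ?F = "\<lambda>x y. ennreal (cmod (bergman_kernel d Y \<beta> x y) * (1 - norm y) powr e) * indicator (U_set \<epsilon> t f) y"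
  have eq: "(\<integral>\<^sup>+y. ?F x y \<partial>ball_measure) = ennreal (1 / measure lborel (ball (0::'a) 1)) * (\<integral>\<^sup>+y. ?F x y \<partial>lborel)" for x
  proof -
    have "?F x \<in> borel_measurable borel" by measurable
    then have "(\<integral>\<^sup>+y. ?F x y \<partial>ball_measure) = ennreal (1 / measure lborel (ball (0::'a) 1)) * (\<integral>\<^sup>+y\<in>ball 0 1. ?F x y \<partial>lborel)"
      by (rule nn_integral_ball_measure)
    also have "(\<integral>\<^sup>+y\<in>ball 0 1. ?F x y \<partial>lborel) = (\<integral>\<^sup>+y. ?F x y \<partial>lborel)"
      by (intro nn_integral_cong) (auto simp: indicator_def U_set_def)
    finally show ?thesis .
  qed
  show "(\<integral>\<^sup>+y. ?F x y \<partial>ball_measure) = ennreal (1 / measure lborel (ball (0::'a) 1)) * (\<integral>\<^sup>+y. ?F x y \<partial>lborel)" by (rule eq)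
  have [measurable]: "(\<lambda>z. bergman_kernel d Y \<beta> (fst z) (snd z)) \<in> borel_measurable (borel \<Otimes>\<^sub>M borel)"
    by (rule bergman_kernel_measurable_pair)
  have "(\<lambda>z. ?F (fst z) (snd z)) \<in> borel_measurable (borel \<Otimes>\<^sub>M borel)" by measurable
  then have "(\<lambda>(x, y). ?F x y) \<in> borel_measurable (borel \<Otimes>\<^sub>M lborel)"
    by (simp add: case_prod_beta' cong: measurable_cong_sets sets_pair_measure_cong)
  then have "(\<lambda>x. \<integral>\<^sup>+y. ?F x y \<partial>lborel) \<in> borel_measurable borel" by (rule lborel.borel_measurable_nn_integral)
  then show "(\<lambda>x. \<integral>\<^sup>+y. ?F x y \<partial>ball_measure) \<in> borel_measurable borel" unfolding eq by measurable
qed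

text \<open>A nonintegrable integrand has Bochner integral 0, so the inequality holds for every g
  and x.\<close>

lemma bergman_projection_norm_le:
  "ennreal (cmod (bergman_projection \<beta> g x)) \<le> (\<integral>\<^sup>+y\<in>ball 0 1. ennreal (cmod (bergman_kernel d Y \<beta> x y) * cmod (g y)) \<partial>lborel)"
proof -
  let ?G = "\<lambda>y. indicator (ball 0 1) y *\<^sub>R (bergman_kernel d Y \<beta> x y * g y)"
  have "ennreal (cmod (\<integral>y. ?G y \<partial>lborel)) \<le> (\<integral>\<^sup>+y. ennreal (norm (?G y)) \<partial>lborel)"
    by (cases "integrable lborel ?G") (auto intro: integral_norm_bound_ennreal simp: not_integrable_integral_eq simp del: norm_scaleR)
  also have "... = (\<integral>\<^sup>+y\<in>ball 0 1. ennreal (cmod (bergman_kernel d Y \<beta> x y) * cmod (g y)) \<partial>lborel)"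
    by (intro nn_integral_cong) (auto simp: indicator_def norm_mult)
  finally show ?thesis unfolding bergman_projection_def set_lebesgue_integral_def .
qed

lemma set_integrable_bounded_ball:
  fixes g :: "'a \<Rightarrow> complex"
  assumes [measurable]: "g \<in> borel_measurable borel" and "\<And>y. y \<in> ball 0 1 \<Longrightarrow> cmod (g y) \<le> B"
  shows "set_integrable lborel (ball 0 1) g"
  unfolding set_integrable_def
proof (rule integrableI_bounded_set_indicator)
  show "AE y in lborel. y \<in> ball 0 1 \<longrightarrow> norm (g y) \<le> B" using assms(2) by auto
  show "emeasure lborel (ball (0::'a) 1) < \<infinity>" using finite_cone[of "UNIV::'a set"] by simp
qed auto

text \<open>For fixed x the kernel is bounded in y, since \<open>kap x y\<close> is at least 1 -
  |x|.\<close>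

lemma set_integrable_kernel:
  fixes g :: "'a \<Rightarrow> complex"
  assumes b: "\<beta> \<ge> 0" and x: "x \<in> ball 0 1"
    and gm[measurable]: "g \<in> borel_measurable borel" and g: "\<And>y. y \<in> ball 0 1 \<Longrightarrow> cmod (g y) \<le> B"
  shows "set_integrable lborel (ball 0 1) (\<lambda>y. bergman_kernel d Y \<beta> x y * g y)"
proof -
  obtain C where C: "C > 0" "\<And>x y. x \<in> ball 0 1 \<Longrightarrow> y \<in> ball 0 1 \<Longrightarrow> cmod (bergman_kernel d Y \<beta> x y) \<le> C * kap x y powr (- (real DIM('a) + \<beta>))"
    using bergman_kernel_bound(1)[OF b] by blast
  show ?thesis
  proof (rule set_integrable_bounded_ball)
    fix y :: 'a assume y: "y \<in> ball 0 1"
    have "1 - norm x \<le> kap x y" using y norm_ge_zero[of "x - y"] unfolding kap_def mem_ball dist_0_norm by argo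
    then have "kap x y powr (- (real DIM('a) + \<beta>)) \<le> (1 - norm x) powr (- (real DIM('a) + \<beta>))"
      using x b by (intro powr_mono2') auto
    then have "cmod (bergman_kernel d Y \<beta> x y) \<le> C * (1 - norm x) powr (- (real DIM('a) + \<beta>))"
      using C(2)[OF x y] C(1) by (meson mult_left_mono less_imp_le order_trans)
    then show "cmod (bergman_kernel d Y \<beta> x y * g y) \<le> C * (1 - norm x) powr (- (real DIM('a) + \<beta>)) * B"
      unfolding norm_mult using g[OF y] C(1) by (intro mult_mono) auto
  qed measurable
qed

text \<open>The approximant is the projection of \<open>f\<close> cut off to the level set.\<close>

lemma s1_le:
  fixes p \<alpha> lam \<beta> :: real
  assumes p: "0 < p" and lam: "lam > 0" and b: "\<beta> > lam"
  shows "\<exists>C>0. \<forall>f. f \<in> borel_measurable borel \<longrightarrow> f \<in> A_infty lam \<longrightarrow> s1 lam p \<alpha> f \<le> ennreal C * s2 d Y \<beta> lam p \<alpha> f"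
proof -
  let ?n = "real DIM('a)"
  have b0: "\<beta> \<ge> 0" using b lam by simp
  obtain CQ where CQ: "CQ > 0" "\<And>x y. x \<in> ball 0 1 \<Longrightarrow> y \<in> ball 0 1 \<Longrightarrow> cmod (bergman_kernel d Y \<beta> x y) \<le> CQ * kap x y powr (- (?n + \<beta>))"
    using bergman_kernel_bound(1)[OF b0] by blast
  \<comment> \<open>With weight exponent \<beta> - \<lambda> and decay exponent \<lambda>, the
    estimate for \<open>kap\<close> involves exactly n + \<beta>, the exponent of the kernel
    bound.\<close>
  have s: "\<beta> - lam > -1" and nb: "?n + (\<beta> - lam) + lam = ?n + \<beta>" using b by simp_all
  obtain CE where CE: "CE > 0" "\<And>y. y \<in> ball (0::'a) 1 \<Longrightarrow>
    (\<integral>\<^sup>+x\<in>ball 0 1. ennreal ((1 - norm x) powr (\<beta> - lam) * kap x y powr (- (?n + \<beta>))) \<partial>lborel) \<le> ennreal (CE * (1 - norm y) powr (- lam))"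
    using kap_integral_estimate[OF s lam, where 'a = 'a] unfolding nb by blast
  define V where "V = measure lborel (ball (0::'a) 1)"
  have V: "V > 0" unfolding V_def using content_ball_pos[of 1 "0::'a"] by simp
  \<comment> \<open>The two powers of 2 come from comparing 1 - |y|^2 with 1 - |y|: once in the
    weight of the projection, once in the norm.\<close>
  define C where "C = 2 powr \<beta> * CQ * CE * 2 powr lam"
  have C: "C > 0" using CQ CE by (simp add: C_def)
  have main: "s1 lam p \<alpha> f \<le> ennreal C * ennreal \<epsilon>"
    if fm[measurable]: "f \<in> borel_measurable borel" and f: "f \<in> A_infty lam" and e: "\<epsilon> > 0"
      and fin: "(\<integral>\<^sup>+x. ennreal_powr
        (\<integral>\<^sup>+y\<in>U_set \<epsilon> lam f. ennreal (cmod (bergman_kernel d Y \<beta> x y) * (1 - norm y) powr (\<beta> - lam)) \<partial>ball_measure) p *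
        ennreal ((1 - norm x) powr \<alpha>) \<partial>ball_measure) < \<infinity>" for f \<epsilon>
  proof -
    define I where "I x = (\<integral>\<^sup>+y\<in>U_set \<epsilon> lam f. ennreal (cmod (bergman_kernel d Y \<beta> x y) * (1 - norm y) powr (\<beta> - lam)) \<partial>ball_measure)" for x
    have Im[measurable]: "I \<in> borel_measurable borel" unfolding I_def[abs_def] by (rule level_integral(2)[OF fm])
    have Um[measurable]: "U_set \<epsilon> lam f \<in> sets borel" by (rule U_set_measurable[OF fm])
    have fh: "harmonic_on f (ball 0 1)" and ffin: "A_infty_norm lam f < \<infinity>" using f by (auto simp: A_infty_def)
    define M where "M = enn2real (A_infty_norm lam f) + 1"
    have M: "M > 0" by (simp add: M_def add_nonneg_pos)
    have fM: "cmod (f y) * (1 - (norm y)\<^sup>2) powr lam \<le> M" if "y \<in> ball 0 1" for y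
    proof -
      have "ennreal (cmod (f y) * (1 - (norm y)\<^sup>2) powr lam) \<le> ennreal (enn2real (A_infty_norm lam f))"
        using A_infty_norm_bound[OF that, of f lam] ffin by (simp add: less_top)
      then show ?thesis by (simp add: M_def)
    qed
    have sq: "0 \<le> 1 - (norm y)\<^sup>2" "1 - (norm y)\<^sup>2 \<le> 1" if "y \<in> ball 0 1" for y :: 'a
      using that by (auto simp: power_le_one)
    have split: "(1 - (norm y)\<^sup>2) powr \<beta> = (1 - (norm y)\<^sup>2) powr lam * (1 - (norm y)\<^sup>2) powr (\<beta> - lam)" for y :: 'a
      by (simp add: powr_add[symmetric])
    have fb: "cmod (f y) * (1 - (norm y)\<^sup>2) powr \<beta> \<le> M * (1 - (norm y)\<^sup>2) powr (\<beta> - lam)" if "y \<in> ball 0 1" for y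
      unfolding split using mult_right_mono[OF fM[OF that], of "(1 - (norm y)\<^sup>2) powr (\<beta> - lam)"] by (simp add: mult.assoc)
    have fM': "cmod (f y) * (1 - (norm y)\<^sup>2) powr \<beta> \<le> M" if "y \<in> ball 0 1" for y
    proof -
      have "(1 - (norm y)\<^sup>2) powr (\<beta> - lam) \<le> 1" using sq[OF that] b by (intro powr_le1) auto
      then show ?thesis using fb[OF that] M mult_left_mono[of "(1 - (norm y)\<^sup>2) powr (\<beta> - lam)" 1 M] by linarith
    qed
    define w where "w y = f y * of_real ((1 - (norm y)\<^sup>2) powr \<beta>)" for y
    have wm[measurable]: "w \<in> borel_measurable borel" unfolding w_def by measurable
    have nw: "cmod (w y) = cmod (f y) * (1 - (norm y)\<^sup>2) powr \<beta>" for y by (simp add: w_def norm_mult)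
    \<comment> \<open>The weighted function is split at the level set; the projection of
      \<open>g\<close> is the approximant, that of \<open>h\<close> the error.\<close>
    define g where "g y = indicator (U_set \<epsilon> lam f) y *\<^sub>R w y" for y
    define h where "h y = indicator (- U_set \<epsilon> lam f) y *\<^sub>R w y" for y
    have gm[measurable]: "g \<in> borel_measurable borel" unfolding g_def by measurable
    have hm[measurable]: "h \<in> borel_measurable borel" unfolding h_def by measurable
    have gM: "cmod (g y) \<le> M" and hM: "cmod (h y) \<le> M" if "y \<in> ball 0 1" for y
      using fM'[OF that] M by (auto simp: g_def h_def nw indicator_def)
    define f1 where "f1 = bergman_projection \<beta> g"
    have f1h: "harmonic_on f1 (ball 0 1)" unfolding f1_def
      by (rule bergman_projection_harmonic[OF b0 gm set_integrable_bounded_ball[OF gm gM]])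
    have diff: "f x - f1 x = bergman_projection \<beta> h x" if x: "x \<in> ball 0 1" for x
    proof -
      have "f x = bergman_projection \<beta> w x"
        using bergman_reproducing[OF b0 fm fh fM' x] unfolding w_def by simp
      also have "... = (LINT y:ball 0 1|lborel. bergman_kernel d Y \<beta> x y * g y + bergman_kernel d Y \<beta> x y * h y)"
        unfolding bergman_projection_def by (intro arg_cong2[where f = "\<lambda>A B. set_lebesgue_integral lborel A B"] ext refl) (auto simp: g_def h_def indicator_def)
      also have "... = f1 x + bergman_projection \<beta> h x"
        unfolding f1_def bergman_projection_def
        by (intro set_integral_add(2) set_integrable_kernel[OF b0 x gm gM] set_integrable_kernel[OF b0 x hm hM])
      finally show ?thesis by simp
    qed
    define M' where "M' = M * 2 powr \<bar>\<beta> - lam\<bar> * V"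
    have M': "M' > 0" using M V by (simp add: M'_def)
    \<comment> \<open>On the level set the weighted function is at most a multiple of (1 -
      |y|)^(\<beta>-\<lambda>), as f has finite norm. Hence \<open>f1\<close> is controlled by the
      very integral whose finiteness makes \<epsilon> admissible.\<close>
    have f1I: "ennreal (cmod (f1 x)) \<le> ennreal M' * I x" for x
    proof -
      have "ennreal (cmod (f1 x)) \<le> (\<integral>\<^sup>+y\<in>ball 0 1. ennreal (cmod (bergman_kernel d Y \<beta> x y) * cmod (g y)) \<partial>lborel)"
        unfolding f1_def by (rule bergman_projection_norm_le)
      also have "... \<le> (\<integral>\<^sup>+y. ennreal (M * 2 powr \<bar>\<beta> - lam\<bar>) * (ennreal (cmod (bergman_kernel d Y \<beta> x y) * (1 - norm y) powr (\<beta> - lam)) * indicator (U_set \<epsilon> lam f) y) \<partial>lborel)"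
      proof (rule nn_integral_mono)
        fix y :: 'a
        show "ennreal (cmod (bergman_kernel d Y \<beta> x y) * cmod (g y)) * indicator (ball 0 1) y
          \<le> ennreal (M * 2 powr \<bar>\<beta> - lam\<bar>) * (ennreal (cmod (bergman_kernel d Y \<beta> x y) * (1 - norm y) powr (\<beta> - lam)) * indicator (U_set \<epsilon> lam f) y)"
        proof (cases "y \<in> U_set \<epsilon> lam f")
          case True
          then have y: "y \<in> ball 0 1" by (simp add: U_set_def)
          have "cmod (g y) \<le> M * (1 - (norm y)\<^sup>2) powr (\<beta> - lam)" using fb[OF y] True by (simp add: g_def nw)
          also have "... \<le> M * (2 powr \<bar>\<beta> - lam\<bar> * (1 - norm y) powr (\<beta> - lam))"
            using weight_comparison(2)[of y "\<beta> - lam"] y M by (intro mult_left_mono) auto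
          finally have "cmod (bergman_kernel d Y \<beta> x y) * cmod (g y) \<le> cmod (bergman_kernel d Y \<beta> x y) * (M * (2 powr \<bar>\<beta> - lam\<bar> * (1 - norm y) powr (\<beta> - lam)))"
            by (rule mult_left_mono) simp
          then show ?thesis using True y M by (simp add: ennreal_mult[symmetric] mult_ac ennreal_leI)
        qed (simp add: g_def)
      qed
      also have "... = ennreal (M * 2 powr \<bar>\<beta> - lam\<bar>) * (\<integral>\<^sup>+y. ennreal (cmod (bergman_kernel d Y \<beta> x y) * (1 - norm y) powr (\<beta> - lam)) * indicator (U_set \<epsilon> lam f) y \<partial>lborel)"
        by (rule nn_integral_cmult) measurable
      also have "... = ennreal M' * I x"
      proof -
        have "ennreal M' * ennreal (1 / V) = ennreal (M * 2 powr \<bar>\<beta> - lam\<bar>)"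
          using V M by (simp add: M'_def ennreal_mult[symmetric])
        then show ?thesis unfolding I_def level_integral(1)[OF fm] V_def[symmetric] mult.assoc[symmetric] by simp
      qed
      finally show ?thesis .
    qed
    have "f1 \<in> A_p p \<alpha>"
    proof -
      define a where "a = M' powr p * 2 powr \<bar>\<alpha>\<bar>"
      have "(\<integral>\<^sup>+x. ennreal (cmod (f1 x) powr p * (1 - (norm x)\<^sup>2) powr \<alpha>) \<partial>ball_measure)
        \<le> (\<integral>\<^sup>+x. ennreal a * (ennreal_powr (I x) p * ennreal ((1 - norm x) powr \<alpha>)) \<partial>ball_measure)"
      proof (rule nn_integral_mono_AE, use AE_ball_measure in eventually_elim)
        fix x :: 'a assume x: "x \<in> ball 0 1"
        have "ennreal (cmod (f1 x) powr p) \<le> ennreal_powr (ennreal M' * I x) p"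
          using ennreal_powr_mono[OF f1I p] by (simp add: ennreal_powr_ennreal)
        then have 1: "ennreal (cmod (f1 x) powr p) \<le> ennreal (M' powr p) * ennreal_powr (I x) p"
          using M' p by (simp add: ennreal_powr_cmult)
        have 2: "ennreal ((1 - (norm x)\<^sup>2) powr \<alpha>) \<le> ennreal (2 powr \<bar>\<alpha>\<bar>) * ennreal ((1 - norm x) powr \<alpha>)"
          using weight_comparison(2)[of x \<alpha>] x by (simp add: ennreal_mult[symmetric] ennreal_leI)
        show "ennreal (cmod (f1 x) powr p * (1 - (norm x)\<^sup>2) powr \<alpha>) \<le> ennreal a * (ennreal_powr (I x) p * ennreal ((1 - norm x) powr \<alpha>))"
          using mult_mono[OF 1 2] by (simp add: ennreal_mult a_def mult_ac)
      qed
      also have "... = ennreal a * (\<integral>\<^sup>+x. ennreal_powr (I x) p * ennreal ((1 - norm x) powr \<alpha>) \<partial>ball_measure)"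
        by (rule nn_integral_cmult) (simp add: ball_measure_def)
      also have "... < \<infinity>" using fin unfolding I_def[symmetric] by (simp add: ennreal_mult_less_top)
      finally show ?thesis using f1h by (simp add: A_p_def)
    qed
    then have "s1 lam p \<alpha> f \<le> A_infty_norm lam (\<lambda>x. f x - f1 x)" unfolding s1_def by (rule INF_lower)
    also have "... \<le> ennreal (C * \<epsilon>)" unfolding A_infty_norm_def
    proof (rule SUP_least)
      fix x :: 'a assume x: "x \<in> ball 0 1"
      have x1: "1 - norm x > 0" using x by simp
      have "ennreal (cmod (f x - f1 x)) \<le> (\<integral>\<^sup>+y\<in>ball 0 1. ennreal (cmod (bergman_kernel d Y \<beta> x y) * cmod (h y)) \<partial>lborel)"
        unfolding diff[OF x] by (rule bergman_projection_norm_le)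
      also have "... \<le> (\<integral>\<^sup>+y. ennreal (2 powr \<beta> * \<epsilon> * CQ) * (ennreal ((1 - norm y) powr (\<beta> - lam) * kap y x powr (- (?n + \<beta>))) * indicator (ball 0 1) y) \<partial>lborel)"
      proof (rule nn_integral_mono)
        fix y :: 'a
        show "ennreal (cmod (bergman_kernel d Y \<beta> x y) * cmod (h y)) * indicator (ball 0 1) y
          \<le> ennreal (2 powr \<beta> * \<epsilon> * CQ) * (ennreal ((1 - norm y) powr (\<beta> - lam) * kap y x powr (- (?n + \<beta>))) * indicator (ball 0 1) y)"
        proof (cases "y \<in> ball 0 1")
          case y: True
          have hy: "cmod (h y) \<le> 2 powr \<beta> * \<epsilon> * (1 - norm y) powr (\<beta> - lam)"
          proof (cases "y \<in> U_set \<epsilon> lam f")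
            case True
            then show ?thesis using e by (simp add: h_def)
          next
            case False
            then have "cmod (f y) * (1 - norm y) powr lam \<le> \<epsilon>" using y by (auto simp: U_set_def)
            then have "cmod (f y) * (1 - norm y) powr lam * (1 - norm y) powr (\<beta> - lam) \<le> \<epsilon> * (1 - norm y) powr (\<beta> - lam)"
              by (rule mult_right_mono) simp
            then have le: "cmod (f y) * (1 - norm y) powr \<beta> \<le> \<epsilon> * (1 - norm y) powr (\<beta> - lam)"
              by (simp add: mult.assoc powr_add[symmetric])
            have "cmod (h y) = cmod (f y) * (1 - (norm y)\<^sup>2) powr \<beta>" using False by (simp add: h_def nw)
            also have "... \<le> cmod (f y) * (2 powr \<beta> * (1 - norm y) powr \<beta>)"
              using weight_comparison(2)[of y \<beta>] y b0 by (intro mult_left_mono) auto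
            also have "... = 2 powr \<beta> * (cmod (f y) * (1 - norm y) powr \<beta>)" by simp
            also have "... \<le> 2 powr \<beta> * (\<epsilon> * (1 - norm y) powr (\<beta> - lam))" by (rule mult_left_mono[OF le]) simp
            finally show ?thesis by (simp add: mult.assoc)
          qed
          have "cmod (bergman_kernel d Y \<beta> x y) * cmod (h y) \<le> (CQ * kap x y powr (- (?n + \<beta>))) * (2 powr \<beta> * \<epsilon> * (1 - norm y) powr (\<beta> - lam))"
            using CQ(1) by (intro mult_mono CQ(2)[OF x y] hy) auto
          also have "... = 2 powr \<beta> * \<epsilon> * CQ * ((1 - norm y) powr (\<beta> - lam) * kap y x powr (- (?n + \<beta>)))"
            by (simp add: kap_commute[of x y] mult_ac)
          finally show ?thesis using y e CQ(1) by (simp add: ennreal_mult[symmetric] ennreal_leI)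
        qed simp
      qed
      also have "... = ennreal (2 powr \<beta> * \<epsilon> * CQ) * (\<integral>\<^sup>+y\<in>ball 0 1. ennreal ((1 - norm y) powr (\<beta> - lam) * kap y x powr (- (?n + \<beta>))) \<partial>lborel)"
        unfolding kap_def by (rule nn_integral_cmult) measurable
      also have "... \<le> ennreal (2 powr \<beta> * \<epsilon> * CQ) * ennreal (CE * (1 - norm x) powr (- lam))"
        by (rule mult_left_mono[OF CE(2)[OF x]]) simp
      also have "... = ennreal (2 powr \<beta> * \<epsilon> * CQ * (CE * (1 - norm x) powr (- lam)))"
        using e CQ(1) CE(1) by (simp add: ennreal_mult[symmetric])
      finally have le: "cmod (f x - f1 x) \<le> 2 powr \<beta> * \<epsilon> * CQ * (CE * (1 - norm x) powr (- lam))"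
        using e CQ(1) CE(1) by (subst (asm) ennreal_le_iff) auto
      have "cmod (f x - f1 x) * (1 - (norm x)\<^sup>2) powr lam
        \<le> 2 powr \<beta> * \<epsilon> * CQ * (CE * (1 - norm x) powr (- lam)) * (2 powr lam * (1 - norm x) powr lam)"
        using weight_comparison(2)[of x lam] x lam e CQ(1) CE(1) by (intro mult_mono le) auto
      also have "... = C * \<epsilon> * ((1 - norm x) powr (- lam) * (1 - norm x) powr lam)"
        by (simp add: C_def mult_ac)
      also have "... = C * \<epsilon>" using x1 by (simp add: powr_add[symmetric])
      finally show "ennreal (cmod (f x - f1 x) * (1 - (norm x)\<^sup>2) powr lam) \<le> ennreal (C * \<epsilon>)" by (rule ennreal_leI)
    qed
    also have "... = ennreal C * ennreal \<epsilon>" using C e by (simp add: ennreal_mult)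
    finally show ?thesis .
  qed
  have "s1 lam p \<alpha> f \<le> ennreal C * s2 d Y \<beta> lam p \<alpha> f" if "f \<in> borel_measurable borel" "f \<in> A_infty lam" for f
    unfolding s2_def ennreal_inverse_mult_le_iff[OF C, symmetric]
    by (rule Inf_greatest) (use main[OF that] in \<open>auto simp: ennreal_inverse_mult_le_iff[OF C]\<close>)
  then show ?thesis using C by blast
qed

text \<open>Each g in the Bergman space with finite distance c from f makes every \<epsilon> > 2 c
  admissible, so the constant is 2 for all parameters. The kernel constants affect only the value of
  a finite integral.\<close>

lemma s2_le:
  fixes p \<alpha> lam \<beta> :: real
  assumes p: "0 < p" "p \<le> 1" and a: "\<alpha> > -1" and lam: "lam > 0" and b: "\<beta> > lam"
    and big: "p * (real DIM('a) + \<beta>) > real DIM('a) + \<alpha>"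
    and fm[measurable]: "f \<in> borel_measurable borel"
  shows "s2 d Y \<beta> lam p \<alpha> f \<le> ennreal 2 * s1 lam p \<alpha> f"
proof -
  let ?n = "real DIM('a)"
  have b0: "\<beta> \<ge> 0" using b lam by simp
  obtain CQ where CQ: "CQ > 0" "\<And>x y. x \<in> ball 0 1 \<Longrightarrow> y \<in> ball 0 1 \<Longrightarrow> cmod (bergman_kernel d Y \<beta> x y) \<le> CQ * kap x y powr (- (?n + \<beta>))"
    using bergman_kernel_bound(1)[OF b0] by blast
  obtain CA where CA: "CA > 0" "\<And>f :: 'a \<Rightarrow> complex. f \<in> borel_measurable borel \<Longrightarrow> harmonic_on f (ball 0 1) \<Longrightarrow>
    (\<integral>\<^sup>+x\<in>ball 0 1. ennreal_powr (\<integral>\<^sup>+y\<in>ball 0 1. ennreal (cmod (f y) * kap x y powr (- (?n + \<beta>)) * (1 - norm y) powr \<beta>) \<partial>lborel) p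
       * ennreal ((1 - norm x) powr \<alpha>) \<partial>lborel)
    \<le> ennreal CA * (\<integral>\<^sup>+y\<in>ball 0 1. ennreal (cmod (f y) powr p * (1 - norm y) powr \<alpha>) \<partial>lborel)"
    using kernel_A_p_bound[OF p a b0 big] by blast
  define V where "V = measure lborel (ball (0::'a) 1)"
  have V: "V > 0" unfolding V_def using content_ball_pos[of 1 "0::'a"] by simp
  have bm: "(\<integral>\<^sup>+x. F x \<partial>ball_measure) = ennreal (1 / V) * (\<integral>\<^sup>+x\<in>ball 0 1. F x \<partial>lborel)"
    if "F \<in> borel_measurable borel" for F :: "'a \<Rightarrow> ennreal"
    unfolding V_def by (rule nn_integral_ball_measure[OF that])
  have main: "s2 d Y \<beta> lam p \<alpha> f \<le> ennreal 2 * A_infty_norm lam (\<lambda>x. f x - g x)" if g: "g \<in> A_p p \<alpha>" for g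
  proof (rule ennreal_le_epsilon)
    fix \<eta> :: real assume fin: "ennreal 2 * A_infty_norm lam (\<lambda>x. f x - g x) < top" and \<eta>: "\<eta> > 0"
    define c where "c = enn2real (A_infty_norm lam (\<lambda>x. f x - g x))"
    have nfin: "A_infty_norm lam (\<lambda>x. f x - g x) < top" using fin by (auto simp: ennreal_mult_less_top)
    then have c: "A_infty_norm lam (\<lambda>x. f x - g x) = ennreal c" unfolding c_def by simp
    have c0: "c \<ge> 0" by (simp add: c_def)
    \<comment> \<open>With \<epsilon> > 2 c, the bound |g| (1 - |y|)^\<lambda> \<ge> \<epsilon> - c
      on the level set is at least \<epsilon>/2; the summand \<eta> also keeps \<epsilon> positive
      when c = 0.\<close>
    define \<epsilon> where "\<epsilon> = 2 * c + \<eta>"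
    have e: "\<epsilon> > 0" using c0 \<eta> by (simp add: \<epsilon>_def)
    have gh: "harmonic_on g (ball 0 1)"
      and gfin: "(\<integral>\<^sup>+x. ennreal (cmod (g x) powr p * (1 - (norm x)\<^sup>2) powr \<alpha>) \<partial>ball_measure) < \<infinity>"
      using g by (auto simp: A_p_def)
    define g0 where "g0 y = indicator (ball 0 1) y *\<^sub>R g y" for y
    have g0m[measurable]: "g0 \<in> borel_measurable borel" and g0h: "harmonic_on g0 (ball 0 1)"
      unfolding g0_def[abs_def] using harmonic_extension_by_zero[OF gh] by auto
    define I where "I x = (\<integral>\<^sup>+y\<in>U_set \<epsilon> lam f. ennreal (cmod (bergman_kernel d Y \<beta> x y) * (1 - norm y) powr (\<beta> - lam)) \<partial>ball_measure)" for x
    have Im[measurable]: "I \<in> borel_measurable borel" unfolding I_def[abs_def] by (rule level_integral(2)[OF fm])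
    define J where "J x = (\<integral>\<^sup>+y\<in>ball 0 1. ennreal (cmod (g0 y) * kap x y powr (- (?n + \<beta>)) * (1 - norm y) powr \<beta>) \<partial>lborel)" for x
    have Jm[measurable]: "J \<in> borel_measurable borel" unfolding J_def[abs_def] kap_def by measurable
    define A where "A = 1 / V * (2 * CQ / \<epsilon>)"
    have A: "A > 0" using V CQ(1) e by (simp add: A_def)
    have IJ: "I x \<le> ennreal A * J x" if x: "x \<in> ball 0 1" for x
    proof -
      have km: "(\<lambda>y. ennreal (cmod (g0 y) * kap x y powr (- (?n + \<beta>)) * (1 - norm y) powr \<beta>) * indicator (ball 0 1) y) \<in> borel_measurable lborel"
        unfolding kap_def by measurable
      have "(\<integral>\<^sup>+y. ennreal (cmod (bergman_kernel d Y \<beta> x y) * (1 - norm y) powr (\<beta> - lam)) * indicator (U_set \<epsilon> lam f) y \<partial>lborel)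
        \<le> (\<integral>\<^sup>+y. ennreal (2 * CQ / \<epsilon>) * (ennreal (cmod (g0 y) * kap x y powr (- (?n + \<beta>)) * (1 - norm y) powr \<beta>) * indicator (ball 0 1) y) \<partial>lborel)"
      proof (rule nn_integral_mono)
        fix y :: 'a
        show "ennreal (cmod (bergman_kernel d Y \<beta> x y) * (1 - norm y) powr (\<beta> - lam)) * indicator (U_set \<epsilon> lam f) y
          \<le> ennreal (2 * CQ / \<epsilon>) * (ennreal (cmod (g0 y) * kap x y powr (- (?n + \<beta>)) * (1 - norm y) powr \<beta>) * indicator (ball 0 1) y)"
        proof (cases "y \<in> U_set \<epsilon> lam f")
          case True
          then have y: "y \<in> ball 0 1" and fy: "\<epsilon> \<le> cmod (f y) * (1 - norm y) powr lam" by (auto simp: U_set_def)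
          have y1: "1 - norm y > 0" "norm y < 1" using y by auto
          have "(norm y)\<^sup>2 \<le> norm y" using y1 by (simp add: power2_eq_square mult_left_le)
          \<comment> \<open>The level set is defined with the weight 1 - |y|, the norm with 1 -
            |y|^2, which is larger; this direction costs no constant.\<close>
          then have "(1 - norm y) powr lam \<le> (1 - (norm y)\<^sup>2) powr lam" using y1 lam by (intro powr_mono2) auto
          then have "cmod (f y - g y) * (1 - norm y) powr lam \<le> cmod (f y - g y) * (1 - (norm y)\<^sup>2) powr lam"
            by (rule mult_left_mono) simp
          also have "... \<le> c" using A_infty_norm_bound[OF y, of "\<lambda>x. f x - g x" lam] c0 unfolding c by simp
          finally have fg: "cmod (f y - g y) * (1 - norm y) powr lam \<le> c" .
          have "cmod (f y) * (1 - norm y) powr lam \<le> (cmod (f y - g y) + cmod (g y)) * (1 - norm y) powr lam"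
            by (intro mult_right_mono) (use norm_triangle_ineq[of "f y - g y" "g y"] in auto)
          then have "\<epsilon> \<le> c + cmod (g y) * (1 - norm y) powr lam" using fg fy by (simp add: distrib_right)
          then have "\<epsilon> / 2 \<le> cmod (g y) * (1 - norm y) powr lam" using \<eta> unfolding \<epsilon>_def by simp
          then have "1 \<le> 2 / \<epsilon> * (cmod (g0 y) * (1 - norm y) powr lam)" using e y by (simp add: g0_def field_simps)
          then have "1 * (1 - norm y) powr (\<beta> - lam) \<le> 2 / \<epsilon> * (cmod (g0 y) * (1 - norm y) powr lam) * (1 - norm y) powr (\<beta> - lam)"
            by (rule mult_right_mono) simp
          also have "... = 2 / \<epsilon> * (cmod (g0 y) * ((1 - norm y) powr lam * (1 - norm y) powr (\<beta> - lam)))" by (simp only: mult.assoc)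
          also have "(1 - norm y) powr lam * (1 - norm y) powr (\<beta> - lam) = (1 - norm y) powr \<beta>" by (simp add: powr_add[symmetric])
          finally have le: "(1 - norm y) powr (\<beta> - lam) \<le> 2 / \<epsilon> * (cmod (g0 y) * (1 - norm y) powr \<beta>)" by simp
          have "cmod (bergman_kernel d Y \<beta> x y) * (1 - norm y) powr (\<beta> - lam)
            \<le> (CQ * kap x y powr (- (?n + \<beta>))) * (2 / \<epsilon> * (cmod (g0 y) * (1 - norm y) powr \<beta>))"
            using CQ(1) by (intro mult_mono CQ(2)[OF x y] le) auto
          also have "... = 2 * CQ / \<epsilon> * (cmod (g0 y) * kap x y powr (- (?n + \<beta>)) * (1 - norm y) powr \<beta>)" by (simp add: mult_ac)
          finally show ?thesis using True y e CQ(1) by (simp add: ennreal_mult[symmetric] ennreal_leI)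
        qed simp
      qed
      also have "... = ennreal (2 * CQ / \<epsilon>) * J x" unfolding J_def by (rule nn_integral_cmult[OF km])
      finally have "ennreal (1 / V) * (\<integral>\<^sup>+y. ennreal (cmod (bergman_kernel d Y \<beta> x y) * (1 - norm y) powr (\<beta> - lam)) * indicator (U_set \<epsilon> lam f) y \<partial>lborel)
        \<le> ennreal (1 / V) * (ennreal (2 * CQ / \<epsilon>) * J x)" by (rule mult_left_mono) simp
      also have "... = ennreal A * J x"
        unfolding A_def mult.assoc[symmetric] using V CQ(1) e by (subst ennreal_mult[symmetric]) auto
      finally show ?thesis unfolding I_def level_integral(1)[OF fm] V_def[symmetric] .
    qed
    have wfin: "(\<integral>\<^sup>+y\<in>ball 0 1. ennreal (cmod (g0 y) powr p * (1 - norm y) powr \<alpha>) \<partial>lborel) < \<infinity>"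
    proof -
      have "(\<integral>\<^sup>+y. ennreal (cmod (g0 y) powr p * (1 - norm y) powr \<alpha>) \<partial>ball_measure)
        \<le> (\<integral>\<^sup>+y. ennreal (2 powr \<bar>\<alpha>\<bar>) * ennreal (cmod (g0 y) powr p * (1 - (norm y)\<^sup>2) powr \<alpha>) \<partial>ball_measure)"
      proof (rule nn_integral_mono_AE, use AE_ball_measure in eventually_elim)
        fix y :: 'a assume "y \<in> ball 0 1"
        then have "cmod (g0 y) powr p * (1 - norm y) powr \<alpha> \<le> cmod (g0 y) powr p * (2 powr \<bar>\<alpha>\<bar> * (1 - (norm y)\<^sup>2) powr \<alpha>)"
          using weight_comparison(1)[of y \<alpha>] by (intro mult_left_mono) auto
        then show "ennreal (cmod (g0 y) powr p * (1 - norm y) powr \<alpha>) \<le> ennreal (2 powr \<bar>\<alpha>\<bar>) * ennreal (cmod (g0 y) powr p * (1 - (norm y)\<^sup>2) powr \<alpha>)"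
          by (simp add: ennreal_mult[symmetric] mult_ac ennreal_leI)
      qed
      also have "... = ennreal (2 powr \<bar>\<alpha>\<bar>) * (\<integral>\<^sup>+y. ennreal (cmod (g0 y) powr p * (1 - (norm y)\<^sup>2) powr \<alpha>) \<partial>ball_measure)"
        by (rule nn_integral_cmult) (simp add: ball_measure_def)
      also have "(\<integral>\<^sup>+y. ennreal (cmod (g0 y) powr p * (1 - (norm y)\<^sup>2) powr \<alpha>) \<partial>ball_measure)
        = (\<integral>\<^sup>+y. ennreal (cmod (g y) powr p * (1 - (norm y)\<^sup>2) powr \<alpha>) \<partial>ball_measure)"
        by (rule nn_integral_cong_AE, use AE_ball_measure in eventually_elim) (simp add: g0_def)
      also have "ennreal (2 powr \<bar>\<alpha>\<bar>) * ... < \<infinity>" using gfin by (simp add: ennreal_mult_less_top)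
      finally have "ennreal (1 / V) * (\<integral>\<^sup>+y\<in>ball 0 1. ennreal (cmod (g0 y) powr p * (1 - norm y) powr \<alpha>) \<partial>lborel) < \<infinity>"
        by (subst (asm) bm) simp_all
      then show ?thesis using V by (auto simp: ennreal_mult_less_top)
    qed
    have "(\<integral>\<^sup>+x. ennreal_powr (I x) p * ennreal ((1 - norm x) powr \<alpha>) \<partial>ball_measure)
      \<le> (\<integral>\<^sup>+x. ennreal (A powr p) * (ennreal_powr (J x) p * ennreal ((1 - norm x) powr \<alpha>)) \<partial>ball_measure)"
    proof (rule nn_integral_mono_AE, use AE_ball_measure in eventually_elim)
      fix x :: 'a assume x: "x \<in> ball 0 1"
      have "ennreal_powr (I x) p \<le> ennreal (A powr p) * ennreal_powr (J x) p"
        using ennreal_powr_mono[OF IJ[OF x] p(1)] A p by (simp add: ennreal_powr_cmult)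
      then show "ennreal_powr (I x) p * ennreal ((1 - norm x) powr \<alpha>) \<le> ennreal (A powr p) * (ennreal_powr (J x) p * ennreal ((1 - norm x) powr \<alpha>))"
        unfolding mult.assoc[symmetric] by (rule mult_right_mono) simp
    qed
    also have "... = ennreal (A powr p) * (\<integral>\<^sup>+x. ennreal_powr (J x) p * ennreal ((1 - norm x) powr \<alpha>) \<partial>ball_measure)"
      by (rule nn_integral_cmult) (simp add: ball_measure_def)
    also have "(\<integral>\<^sup>+x. ennreal_powr (J x) p * ennreal ((1 - norm x) powr \<alpha>) \<partial>ball_measure)
      = ennreal (1 / V) * (\<integral>\<^sup>+x\<in>ball 0 1. ennreal_powr (J x) p * ennreal ((1 - norm x) powr \<alpha>) \<partial>lborel)"
      by (rule bm) measurable
    also have "ennreal (A powr p) * ... < \<infinity>"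
    proof -
      have "(\<integral>\<^sup>+x\<in>ball 0 1. ennreal_powr (J x) p * ennreal ((1 - norm x) powr \<alpha>) \<partial>lborel)
        \<le> ennreal CA * (\<integral>\<^sup>+y\<in>ball 0 1. ennreal (cmod (g0 y) powr p * (1 - norm y) powr \<alpha>) \<partial>lborel)"
        unfolding J_def by (rule CA(2)[OF g0m g0h])
      also have "... < \<infinity>" using wfin by (simp add: ennreal_mult_less_top)
      finally show ?thesis by (simp add: ennreal_mult_less_top)
    qed
    finally have "s2 d Y \<beta> lam p \<alpha> f \<le> ennreal \<epsilon>"
      unfolding s2_def I_def using e by (intro Inf_lower) auto
    also have "ennreal \<epsilon> = ennreal 2 * A_infty_norm lam (\<lambda>x. f x - g x) + ennreal \<eta>"
      unfolding c \<epsilon>_def using c0 \<eta> by (simp add: ennreal_mult del: ennreal_numeral)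
    finally show "s2 d Y \<beta> lam p \<alpha> f \<le> ennreal 2 * A_infty_norm lam (\<lambda>x. f x - g x) + ennreal \<eta>" .
  qed
  have two: "(0::real) < 2" by simp
  show ?thesis unfolding s1_def ennreal_inverse_mult_le_iff[OF two, symmetric]
    by (rule INF_greatest) (use main in \<open>simp only: ennreal_inverse_mult_le_iff[OF two]\<close>)
qed

end

section \<open>The two inequalities combined\<close>

theorem theorem4:
  fixes p \<alpha> lam :: real
  assumes "0 < p" and "p \<le> 1" and "\<alpha> > -1"
    and "lam = (\<alpha> + real DIM('a::euclidean_space)) / p"
  shows "\<exists>m\<^sub>0::real. \<forall>d (Y :: nat \<Rightarrow> nat \<Rightarrow> 'a \<Rightarrow> complex). spherical_harmonic_basis d Y \<longrightarrow>
    (\<forall>\<beta>>m\<^sub>0. \<exists>C::real. C \<ge> 1 \<and>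
      (\<forall>f \<in> (A_infty lam :: ('a \<Rightarrow> complex) set).
         ennreal (1 / C) * s1 lam p \<alpha> f \<le> s2 d Y \<beta> lam p \<alpha> f \<and>
         s2 d Y \<beta> lam p \<alpha> f \<le> ennreal C * s1 lam p \<alpha> f))"
proof (rule exI[of _ lam], intro allI impI)
  fix d and Y :: "nat \<Rightarrow> nat \<Rightarrow> 'a \<Rightarrow> complex" and \<beta> :: real
  assume basis: "spherical_harmonic_basis d Y" and b: "\<beta> > lam"
  have n: "real DIM('a) \<ge> 1" using DIM_positive[where 'a = 'a] by linarith
  have plam: "p * lam = \<alpha> + real DIM('a)" using assms(1,4) by simp
  have lam: "lam > 0" unfolding assms(4) by (rule divide_pos_pos) (use assms(1,3) n in linarith)+
  have "p * \<beta> > p * lam" using b assms(1) by simp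
  moreover have "p * real DIM('a) \<ge> 0" using assms(1) by simp
  ultimately have big: "p * (real DIM('a) + \<beta>) > real DIM('a) + \<alpha>"
    using plam unfolding distrib_left by linarith
  \<comment> \<open>The implication stands inside the existential so that \<open>H\<close> can be
    chosen for all k and j at once.\<close>
  have "\<forall>k j. \<exists>P. j \<in> {1..d k} \<longrightarrow> (\<forall>c x. P (c *\<^sub>R x) = c ^ k *\<^sub>R P x) \<and> harmonic_on P UNIV \<and> (\<forall>x\<in>sphere 0 1. Y k j x = P x)"
    using basis unfolding spherical_harmonic_basis_def spherical_harmonic_def by meson
  then obtain H where H: "\<And>k j. j \<in> {1..d k} \<longrightarrow> (\<forall>c x. H k j (c *\<^sub>R x) = c ^ k *\<^sub>R H k j x) \<and> harmonic_on (H k j) UNIV \<and> (\<forall>x\<in>sphere 0 1. Y k j x = H k j x)"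
    by metis
  interpret spherical_basis d Y H
    by unfold_locales (use basis H in blast)+
  obtain C where C: "C > 0" "\<And>f. f \<in> borel_measurable borel \<Longrightarrow> f \<in> A_infty lam \<Longrightarrow> s1 lam p \<alpha> f \<le> ennreal C * s2 d Y \<beta> lam p \<alpha> f"
    using s1_le[OF assms(1) lam b] by blast
  show "\<exists>C::real. C \<ge> 1 \<and> (\<forall>f \<in> (A_infty lam :: ('a \<Rightarrow> complex) set).
         ennreal (1 / C) * s1 lam p \<alpha> f \<le> s2 d Y \<beta> lam p \<alpha> f \<and> s2 d Y \<beta> lam p \<alpha> f \<le> ennreal C * s1 lam p \<alpha> f)"
  \<comment> \<open>2 is the constant of \<open>s2_le\<close>, and it also secures the requirement C
    \<ge> 1.\<close>
  proof (intro exI[of _ "max 2 C"] conjI ballI)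
    fix f :: "'a \<Rightarrow> complex" assume f: "f \<in> A_infty lam"
    \<comment> \<open>Both distances depend on f through its values in the ball alone, so f may be
      replaced by its measurable cut-off.\<close>
    define f0 where "f0 y = indicator (ball 0 1) y *\<^sub>R f y" for y
    have eq: "f x = f0 x" if "x \<in> ball 0 1" for x using that by (simp add: f0_def)
    have f0m: "f0 \<in> borel_measurable borel" and f0h: "harmonic_on f0 (ball 0 1)"
      using harmonic_extension_by_zero f unfolding f0_def[abs_def] A_infty_def by blast+
    have "A_infty_norm lam f = A_infty_norm lam f0" by (rule A_infty_norm_cong[OF eq])
    then have f0: "f0 \<in> A_infty lam" using f f0h by (simp add: A_infty_def)
    have s1: "s1 lam p \<alpha> f = s1 lam p \<alpha> f0"
      unfolding s1_def by (intro INF_cong refl A_infty_norm_cong) (simp add: eq)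
    have "U_set \<epsilon> lam f = U_set \<epsilon> lam f0" for \<epsilon> unfolding U_set_def using eq by auto
    then have s2: "s2 d Y \<beta> lam p \<alpha> f = s2 d Y \<beta> lam p \<alpha> f0" unfolding s2_def by simp
    have m: "max 2 C > 0" by simp
    have "s1 lam p \<alpha> f0 \<le> ennreal (max 2 C) * s2 d Y \<beta> lam p \<alpha> f0"
      by (rule order_trans[OF C(2)[OF f0m f0] mult_right_mono]) (auto intro: ennreal_leI)
    then show "ennreal (1 / max 2 C) * s1 lam p \<alpha> f \<le> s2 d Y \<beta> lam p \<alpha> f"
      unfolding s1 s2 ennreal_inverse_mult_le_iff[OF m] .
    show "s2 d Y \<beta> lam p \<alpha> f \<le> ennreal (max 2 C) * s1 lam p \<alpha> f" unfolding s1 s2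
      by (rule order_trans[OF s2_le[OF assms(1-3) lam b big f0m] mult_right_mono]) (auto intro: ennreal_leI)
  qed simp
qed

end
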